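(* For any prime power $q$, any positive integer $d\mid q-1$, and any character polynomial $P$ for $\mathrm{FI}_{\mathbb{Z}/d\mathbb{Z}}$, $$\lim_{n\to\infty}q^{-n}\sum_{f\in\mathrm{Poly}_n(\mathbb{F}_q^* )}P(f)=\sum_{i=0}^\infty(-1)^i\,\frac{\langle P^*,H^i(\mathrm{Conf}^{\mathbb{Z}/d\mathbb{Z}}(\mathbb{C}^* );\mathbb{C})\rangle}{q^i}.$$ In particular both the limit on the left and the series on the right converge, and they converge to the same limit.
   Context: Let $G=\mathbb{Z}/d\mathbb{Z}$ and $W_n=G^n\rtimes S_n$. **Topological side.** $G$ acts on $\mathbb{C}^*$ by multiplication by $d$-th roots of unity, and $\mathrm{Conf}^{\mathbb{Z}/d\mathbb{Z}}_n(\mathbb{C}^* )=\{(x_1,\dots,x_n)\in(\mathbb{C}^* )^n: x_i\neq\zeta x_j\ \text{for all } i\ne j \text{ and all } \zeta \text{ with } \zeta^d=1\}$. $W_n$ acts on it ($G^n$ coordinatewise, $S_n$ permuting coordinates), hence on its cohomology. **Character polynomials.** For $w=((g_1,\dots,g_n),\sigma)\in W_n$, each cycle of $\sigma$ is decorated by the element of $G$ which is the sum of the $g_j$ over $j$ in the cycle. For $i\ge1$, $g\in G$, $X_i^g(w)$ is the number of $i$-cycles of $\sigma$ decorated by $g$. A character polynomial for $\mathrm{FI}_{\mathbb{Z}/d\mathbb{Z}}$ is a polynomial $P$ with complex coefficients in the $X_i^g$; it defines a class function $P_n$ on $W_n$ for every $n$. $P^*$ denotes the dual (complex conjugate) class function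 $P^*(w)=\overline{P(w)}$. For a $W_n$-representation $V_n$, $\langle Q,V_n\rangle_{W_n}=\frac1{|W_n|}\sum_{w\in W_n}\overline{Q(w)}\chi_{V_n}(w)$, and $\langle P^*,H^i(\mathrm{Conf}^{\mathbb{Z}/d\mathbb{Z}}(\mathbb{C}^* );\mathbb{C})\rangle:=\lim_{n\to\infty}\langle P^*_n,H^i(\mathrm{Conf}_n^{\mathbb{Z}/d\mathbb{Z}}(\mathbb{C}^* );\mathbb{C})\rangle_{W_n}$ (the sequence is eventually constant). **Arithmetic side.** $\mathrm{Poly}_n(\mathbb{F}_q^* )$ is the set of monic square-free polynomials of degree $n$ in $\mathbb{F}_q[T]$ that do not have $0$ as a root. For $f\in\mathrm{Poly}_n(\mathbb{F}_q^* )$ with roots $\alpha_1,\dots,\alpha_n\in\overline{\mathbb{F}}_q^*$, consider the $nd$ elements of $\overline{\mathbb{F}}_q^*$ that are $d$-th roots of the $\alpha_j$. Fix a primitive $d$-th root of unity in $\mathbb{F}_q$ (one exists since $d\mid q-1$) to identify $G$ with the $d$-th roots of unity in $\mathbb{F}_q$. The map $x\mapsto x^q$ permutes these $nd$ elements, commuting with multiplication by $d$-th roots of unity; after choosing one $d$-th root of each $\alpha_j$ it is an element $\sigma_f\in W_n$, well defined up to conjugacy. $P(f):=P_n(\sigma_f)$. *)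

theory Defs
  imports
    "HOL-Homology.Homology"
    "HOL-Algebra.Algebraic_Closure_Type"
    "HOL-Combinatorics.Orbits"
    "HOL-Library.Poly_Mapping"
    "HOL-Computational_Algebra.Squarefree"
begin

section \<open>The group $W_n = (\mathbb{Z}/d)^n \rtimes S_n$\<close>

text \<open>
  The pair \<open>(g, \<sigma>)\<close> stands for the product \<open>g \<cdot> \<sigma>\<close>, with \<open>\<sigma>\<close> acting on \<open>(\<int>/d)\<^sup>n\<close> by
  \<open>(\<sigma> h) i = h (\<sigma>\<inverse> i)\<close>. Indices run over \<open>{..<n}\<close> and residues are represented in \<open>{0..<d}\<close>.
\<close>

definition wreath :: "nat \<Rightarrow> nat \<Rightarrow> ((nat \<Rightarrow> int) \<times> (nat \<Rightarrow> nat)) monoid" where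
  "wreath d n =
    \<lparr>carrier = carrier (product_group {..<n} (\<lambda>_. integer_mod_group d)) \<times> {\<sigma>. \<sigma> permutes {..<n}},
     monoid.mult = (\<lambda>(g, \<sigma>) (h, \<tau>).
       ((\<lambda>i\<in>{..<n}. (g i + h (inv_into UNIV \<sigma> i)) mod int d), \<sigma> \<circ> \<tau>)),
     one = ((\<lambda>i\<in>{..<n}. 0), id)\<rparr>"

section \<open>Character polynomials\<close>

definition cycle_count ::
    "nat \<Rightarrow> nat \<Rightarrow> nat \<times> int \<Rightarrow> (nat \<Rightarrow> int) \<times> (nat \<Rightarrow> nat) \<Rightarrow> nat" where
  "cycle_count d n = (\<lambda>(i, a) (g, \<sigma>).
     card {C \<in> orbit \<sigma> ` {..<n}. card C = i \<and> (\<Sum>j\<in>C. g j) mod int d = a})"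

text \<open>
  A polynomial in the variables \<open>X\<^sub>i\<^sup>a\<close> is a finitely supported map from monomials to coefficients,
  a monomial being a finitely supported map from index pairs \<open>(i, a)\<close> to exponents.
\<close>

type_synonym char_poly = "((nat \<times> int) \<Rightarrow>\<^sub>0 nat) \<Rightarrow>\<^sub>0 complex"

definition is_char_poly :: "nat \<Rightarrow> char_poly \<Rightarrow> bool" where
  "is_char_poly d P \<longleftrightarrow>
    (\<forall>m \<in> Poly_Mapping.keys P. Poly_Mapping.keys m \<subseteq> {1..} \<times> carrier (integer_mod_group d))"

definition char_poly_fun ::
    "nat \<Rightarrow> char_poly \<Rightarrow> nat \<Rightarrow> (nat \<Rightarrow> int) \<times> (nat \<Rightarrow> nat) \<Rightarrow> complex" where
  "char_poly_fun d P n w =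
    (\<Sum>m\<in>Poly_Mapping.keys P. Poly_Mapping.lookup P m *
       (\<Prod>v\<in>Poly_Mapping.keys m. of_nat (cycle_count d n v w) ^ Poly_Mapping.lookup m v))"

definition class_inner ::
    "nat \<Rightarrow> nat \<Rightarrow> ((nat \<Rightarrow> int) \<times> (nat \<Rightarrow> nat) \<Rightarrow> complex)
      \<Rightarrow> ((nat \<Rightarrow> int) \<times> (nat \<Rightarrow> nat) \<Rightarrow> complex) \<Rightarrow> complex" where
  "class_inner d n Q ch =
    (\<Sum>w\<in>carrier (wreath d n). cnj (Q w) * ch w) / of_nat (card (carrier (wreath d n)))"

section \<open>Singular cohomology with complex coefficients\<close>

text \<open>Cochains are functions on singular simplices, made total by the value 0 elsewhere.\<close>

type_synonym 'a cochain = "((nat \<Rightarrow> real) \<Rightarrow> 'a) \<Rightarrow> complex"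

definition cochains :: "nat \<Rightarrow> 'a topology \<Rightarrow> 'a cochain set" where
  "cochains p S = {u. \<forall>s. \<not> singular_simplex p S s \<longrightarrow> u s = 0}"

definition coboundary :: "nat \<Rightarrow> 'a topology \<Rightarrow> 'a cochain \<Rightarrow> 'a cochain" where
  "coboundary p S u = (\<lambda>s. if singular_simplex (Suc p) S s
     then \<Sum>k\<le>Suc p. (-1) ^ k * u (singular_face (Suc p) k s) else 0)"

definition cocycles :: "nat \<Rightarrow> 'a topology \<Rightarrow> 'a cochain set" where
  "cocycles p S = {u \<in> cochains p S. coboundary p S u = (\<lambda>_. 0)}"

definition coboundaries :: "nat \<Rightarrow> 'a topology \<Rightarrow> 'a cochain set" where
  "coboundaries p S =
    (case p of 0 \<Rightarrow> {\<lambda>_. 0} | Suc k \<Rightarrow> coboundary k S ` cochains k S)"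

definition cochain_pullback ::
    "nat \<Rightarrow> 'a topology \<Rightarrow> ('a \<Rightarrow> 'b) \<Rightarrow> 'b cochain \<Rightarrow> 'a cochain" where
  "cochain_pullback p S h u =
    (\<lambda>s. if singular_simplex p S s then u (simplex_map p h s) else 0)"

text \<open>
  For subspaces \<open>B \<subseteq> Z\<close> of a space of complex functions, \<open>quotient_basis Z B m c\<close> says that the
  classes of \<open>c 0, \<dots>, c (m - 1)\<close> form a basis of \<open>Z / B\<close>, and \<open>quotient_trace Z B T\<close> is the trace
  of the endomorphism of \<open>Z / B\<close> induced by \<open>T\<close>, computed from its matrix \<open>M\<close> in any such basis.
  It is unspecified if \<open>Z / B\<close> has infinite dimension.
\<close>

definition quotient_basis ::
    "('s \<Rightarrow> complex) set \<Rightarrow> ('s \<Rightarrow> complex) set \<Rightarrow> nat \<Rightarrow> (nat \<Rightarrow> 's \<Rightarrow> complex) \<Rightarrow> bool" where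
  "quotient_basis Z B m c \<longleftrightarrow> (\<forall>j<m. c j \<in> Z) \<and>
    (\<forall>z\<in>Z. \<exists>!a. a \<in> ({..<m} \<rightarrow>\<^sub>E UNIV) \<and> (\<lambda>s. z s - (\<Sum>j<m. a j * c j s)) \<in> B)"

definition quotient_trace ::
    "('s \<Rightarrow> complex) set \<Rightarrow> ('s \<Rightarrow> complex) set
      \<Rightarrow> (('s \<Rightarrow> complex) \<Rightarrow> ('s \<Rightarrow> complex)) \<Rightarrow> complex" where
  "quotient_trace Z B T = (THE t. \<exists>m c M. quotient_basis Z B m c \<and>
    (\<forall>j<m. (\<lambda>s. T (c j) s - (\<Sum>i<m. M i j * c i s)) \<in> B) \<and> t = (\<Sum>j<m. M j j))"

section \<open>The orbit configuration space\<close>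

definition orbit_conf :: "nat \<Rightarrow> nat \<Rightarrow> (nat \<Rightarrow> complex) topology" where
  "orbit_conf d n = subtopology (product_topology (\<lambda>_. euclidean) {..<n})
    {x. (\<forall>i<n. x i \<noteq> 0) \<and>
        (\<forall>i<n. \<forall>j<n. i \<noteq> j \<longrightarrow> (\<forall>\<zeta>. \<zeta> ^ d = 1 \<longrightarrow> x i \<noteq> \<zeta> * x j))}"

definition conf_act ::
    "nat \<Rightarrow> nat \<Rightarrow> (nat \<Rightarrow> int) \<times> (nat \<Rightarrow> nat) \<Rightarrow> (nat \<Rightarrow> complex) \<Rightarrow> (nat \<Rightarrow> complex)" where
  "conf_act d n = (\<lambda>(g, \<sigma>) x.
     \<lambda>i\<in>{..<n}. cis (2 * pi * of_int (g i) / of_nat d) * x (inv_into UNIV \<sigma> i))"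

text \<open>
  The character of $H^p(\mathrm{Conf}_n;\mathbb{C})$. The left action of \<open>w\<close> on cohomology is
  pullback along the inverse of \<open>w\<close>.
\<close>

definition conf_cohomology_char ::
    "nat \<Rightarrow> nat \<Rightarrow> nat \<Rightarrow> (nat \<Rightarrow> int) \<times> (nat \<Rightarrow> nat) \<Rightarrow> complex" where
  "conf_cohomology_char d p n w =
    quotient_trace (cocycles p (orbit_conf d n)) (coboundaries p (orbit_conf d n))
      (cochain_pullback p (orbit_conf d n) (conf_act d n (inv\<^bsub>wreath d n\<^esub> w)))"

definition conf_inner :: "nat \<Rightarrow> char_poly \<Rightarrow> nat \<Rightarrow> nat \<Rightarrow> complex" where
  "conf_inner d P p n =
    class_inner d n (\<lambda>w. cnj (char_poly_fun d P n w)) (conf_cohomology_char d p n)"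

section \<open>Square-free polynomials over a finite field\<close>

definition sqfree_polys :: "nat \<Rightarrow> 'k::field poly set" where
  "sqfree_polys n = {f. Polynomial.degree f = n \<and> Polynomial.lead_coeff f = 1 \<and>
     squarefree f \<and> poly f 0 \<noteq> 0}"

text \<open>
  \<open>w = (g, \<sigma>)\<close> is the element of \<open>W\<^sub>n\<close> by which Frobenius acts on the \<open>d\<close>-th roots of the roots of
  \<open>f\<close>, for some numbering of the roots of \<open>f\<close> and some choice \<open>y j\<close> of a \<open>d\<close>-th root of the \<open>j\<close>-th
  root. The index \<open>g (\<sigma> j)\<close> (not \<open>g j\<close>) matches the convention \<open>(g, \<sigma>) = g \<cdot> \<sigma>\<close>.
\<close>

definition frobenius_elem ::
    "nat \<Rightarrow> 'k::{field,finite} \<Rightarrow> 'k poly \<Rightarrow> (nat \<Rightarrow> int) \<times> (nat \<Rightarrow> nat) \<Rightarrow> bool" where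
  "frobenius_elem d \<zeta> f = (\<lambda>(g, \<sigma>). (g, \<sigma>) \<in> carrier (wreath d (Polynomial.degree f)) \<and>
    (\<exists>y :: nat \<Rightarrow> 'k alg_closure.
      bij_betw (\<lambda>j. y j ^ d) {..<Polynomial.degree f} {\<alpha>. poly (map_poly to_ac f) \<alpha> = 0} \<and>
      (\<forall>j<Polynomial.degree f.
         y j ^ CARD('k) = to_ac \<zeta> ^ nat (g (\<sigma> j)) * y (\<sigma> j))))"

text \<open>
  The value \<open>P(f)\<close>: the Frobenius element is determined up to conjugacy, so that the choice made
  by \<open>SOME\<close> is immaterial.
\<close>

definition char_poly_at ::
    "nat \<Rightarrow> 'k::{field,finite} \<Rightarrow> char_poly \<Rightarrow> 'k poly \<Rightarrow> complex" where
  "char_poly_at d \<zeta> P f =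
    char_poly_fun d P (Polynomial.degree f) (SOME w. frobenius_elem d \<zeta> f w)"

end

theory Submission
  imports Defs "HOL-Analysis.Analysis" "HOL-Number_Theory.Number_Theory" "HOL-Algebra.Sylow"
begin

text \<open>
The cohomology of the configuration space is spanned by products of logarithmic classes, one for each hyperplane
of the arrangement \<open>x\<^sub>i = 0\<close>, \<open>x\<^sub>i = \<zeta> x\<^sub>j\<close>: projecting to one point fewer is a trivial bundle up to homotopy, with
fibre a punctured plane. The classes supported on the hyperplanes through a point \<open>y\<close> span an algebra on which
contraction with the Euler field is exact, so that \<open>\<Sum>\<^sub>p (-1)\<^sup>p Q\<^sup>n\<^sup>-\<^sup>p tr(w, H\<^sup>p)\<close> is the sum, over the points \<open>y\<close> of
affine space on which Frobenius acts as \<open>w\<close>, of an alternating sum that vanishes unless \<open>y\<close> avoids all hyperplanes.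
Averaging over \<open>W\<^sub>n\<close> turns \<open>\<Sum>\<^sub>p (-1)\<^sup>p Q\<^sup>n\<^sup>-\<^sup>p \<langle>P\<^sup>*, H\<^sup>p\<rangle>\<close> into a sum over Frobenius-stable sets, whose generating function
is computed from the closed points. For \<open>Q\<close> ranging over the powers of \<open>q\<close> it is, up to the factor \<open>1 / (1 - Q x)\<close>,
a sum of terms \<open>(Q x)\<^sup>t \<gamma>(x)\<close> with coefficients of polynomial growth; comparing the coefficients of the powers of \<open>Q\<close>
gives the stable values of the inner products, with bounds that justify the passage to the limit.
\<close>


text \<open>Cohomology classes are only tested on singular cycles: a cocycle whose functional on
  cycles vanishes is a coboundary, and an identity between logarithmic classes becomes an equality
  of functionals on generating cycles. Two worlds have to be matched: the arrangement over the
  complex numbers, which carries the topology, and the same equations over the closure of a finite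
  field, which carry the counting. The equations only compare 0 and the multiples z^a x_j, so the
  incidence pattern of a finite-field point is realised by a complex point, and the codimension of a
  flat can be read off from the number of its rational points. The weight Q^(n-p) appears because a
  basis class of degree p lives on a flat of codimension p, on which Frobenius twisted by a group
  element preserving the flat has Q^(n-p) fixed points. A single q could not separate the inner
  products of different degrees in the alternating sum; infinitely many powers of q turn it into a
  polynomial identity. Stability and the bounds for the limit come from the generating
  function.\<close>

abbreviation (input) "wcar d n \<equiv> carrier (wreath d n)"
abbreviation (input) "pkeys \<equiv> Poly_Mapping.keys"
abbreviation (input) "plook \<equiv> Poly_Mapping.lookup"
abbreviation (input) "xD f \<equiv> fps_X * fps_deriv f"

section \<open>Chains and the prism operator\<close>

text \<open>The pairing of a complex cochain with an integral chain. Every later argument about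
  cohomology is an argument about \<open>ev u\<close> on cycles.\<close>

definition ev :: "('s => complex) => ('s \<Rightarrow>\<^sub>0 int) => complex" where
 "ev u c = (\<Sum>s\<in>pkeys c. of_int (plook c s) * u s)"

lemma ev_superset:
 assumes "finite A" "pkeys c <= A" shows "ev u c = (\<Sum>s\<in>A. of_int (plook c s) * u s)"
 unfolding ev_def by (rule sum.mono_neutral_left) (use assms in "auto simp: in_keys_iff")

lemma ev_0 [simp]: "ev u 0 = 0" by (simp add: ev_def)

lemma ev_of [simp]: "ev u (frag_of s) = u s" by (simp add: ev_def keys_frag_of)

lemma ev_add: "ev u (a + b) = ev u a + ev u b"
proof -
 let ?A = "pkeys a \<union> pkeys b"
 have "pkeys (a + b) <= ?A" by (rule Poly_Mapping.keys_add)
 thus ?thesis by (simp add: ev_superset[of ?A] lookup_add distrib_right sum.distrib)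
qed

lemma ev_cmul: "ev u (frag_cmul k c) = of_int k * ev u c"
proof -
 have "ev u (frag_cmul k c) = (\<Sum>s\<in>pkeys c. of_int (plook (frag_cmul k c) s) * u s)"
  by (rule ev_superset) (auto simp: keys_cmul)
 thus ?thesis by (simp add: ev_def sum_distrib_left mult.assoc)
qed

lemma ev_minus: "ev u (- c) = - ev u c" using ev_cmul[of u "-1" c] by simp

lemma ev_diff: "ev u (a - b) = ev u a - ev u b" using ev_add[of u a "-b"] by (simp add: ev_minus)

lemma ev_sum: "ev u (sum f A) = (\<Sum>a\<in>A. ev u (f a))"
 by (induction A rule: infinite_finite_induct) (auto simp: ev_add)

lemma frag_extend_frag_extend: "frag_extend f (frag_extend g c) = frag_extend (frag_extend f \<circ> g) c"
proof -
 have "pkeys c <= UNIV" by simp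
 thus ?thesis by (induction rule: frag_induction) (auto simp: frag_extend_diff)
qed

lemma ev_frag_extend: "ev u (frag_extend f c) = ev (%s. ev u (f s)) c"
proof -
 have "pkeys c <= UNIV" by simp
 thus ?thesis by (induction rule: frag_induction) (auto simp: frag_extend_diff ev_diff)
qed

lemma ev_cong: "(!!s. s \<in> pkeys c ==> u s = v s) ==> ev u c = ev v c" by (simp add: ev_def)

lemma ev_fun_sum: "ev (%s. \<Sum>i\<in>I. a i * f i s) c = (\<Sum>i\<in>I. a i * ev (f i) c)"
 unfolding ev_def by (simp add: sum_distrib_left sum.swap[of _ I] mult_ac)

lemma ev_fun_diff: "ev (%s. f s - g s) c = ev f c - ev g c"
 by (simp add: ev_def right_diff_distrib sum_subtractf)

subsection \<open>Formal chains of vertex lists\<close>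

text \<open>Deletion of entry \<open>k\<close>. It is used both for faces of vertex lists and for
  leaving out one factor of a product of logarithmic classes, so the two alternating sums have the
  same shape.\<close>

definition drp :: "nat => 'a list => 'a list" where
 "drp k L = take k L @ drop (Suc k) L"

lemma drp_0 [simp]: "drp 0 (x # L) = L" and drp_Suc [simp]: "drp (Suc k) (x # L) = x # drp k L"
 by (auto simp: drp_def)

lemma length_drp [simp]: "k < length L ==> length (drp k L) = length L - 1" by (simp add: drp_def)

lemma nth_drp:
 "k < length L ==> j < length L - 1 ==> drp k L ! j = L ! (if j < k then j else Suc j)"
 by (auto simp: drp_def nth_append min_def)

lemma map_drp: "map f (drp k L) = drp k (map f L)" by (simp add: drp_def take_map drop_map)

lemma set_drp: "set (drp k L) <= set L" by (auto simp: drp_def dest: in_set_takeD in_set_dropD)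

text \<open>The augmented boundary: a one-element list is sent to the empty list. The augmentation
  makes the cone formula \<open>bd_Cons\<close> hold without an exceptional case.\<close>

definition bd :: "'v list => 'v list \<Rightarrow>\<^sub>0 int" where
 "bd L = (\<Sum>k<length L. frag_cmul ((-1) ^ k) (frag_of (drp k L)))"

definition consf :: "'v => ('v list \<Rightarrow>\<^sub>0 int) => 'v list \<Rightarrow>\<^sub>0 int" where
 "consf x = frag_extend (frag_of \<circ> Cons x)"

lemma consf_of [simp]: "consf x (frag_of L) = frag_of (x # L)" by (simp add: consf_def)

lemma consf_diff: "consf x (a - b) = consf x a - consf x b" by (simp add: consf_def frag_extend_diff)

lemma consf_add: "consf x (a + b) = consf x a + consf x b" by (simp add: consf_def frag_extend_add)

lemma bd_Nil [simp]: "bd [] = 0" by (simp add: bd_def)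

lemma bd_Cons: "bd (x # L) = frag_of L - consf x (bd L)"
proof -
 have "bd (x # L) = frag_of L + (\<Sum>k<length L. frag_cmul ((-1) ^ Suc k) (frag_of (x # drp k L)))"
  by (simp add: bd_def sum.lessThan_Suc_shift del: sum.lessThan_Suc)
 also have "(\<Sum>k<length L. frag_cmul ((-1) ^ Suc k) (frag_of (x # drp k L))) = - consf x (bd L)"
  by (simp add: bd_def consf_def frag_extend_sum frag_extend_cmul flip: sum_negf)
 finally show ?thesis by simp
qed

lemma frag_extend_bd_consf: "frag_extend bd (consf x c) = c - consf x (frag_extend bd c)"
proof -
 have "pkeys c <= UNIV" by simp
 thus ?thesis by (induction rule: frag_induction)
   (auto simp: bd_Cons frag_extend_diff consf_diff consf_def[of x, THEN fun_cong, of 0])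
qed

text \<open>Triangulation of simplex times interval by recursion on the first vertex: either the
  climb from level 0 to level 1 happens at \<open>v\<close>, or \<open>v\<close> stays at the bottom
  as a cone point over the prism of the rest. The closed form is \<open>pr_explicit\<close>.\<close>

fun pr :: "nat list => (nat \<times> real) list \<Rightarrow>\<^sub>0 int" where
 "pr [] = 0"
| "pr (v # vs) = frag_of ((v,0) # map (%u. (u,1)) (v # vs)) - consf (v,0) (pr vs)"

lemma frag_extend_pr_consf:
 "frag_extend pr (consf v c) =
   consf (v,0) (consf (v,1) (frag_extend (frag_of \<circ> map (%u. (u,1))) c)) - consf (v,0) (frag_extend pr c)"
proof -
 have "pkeys c <= UNIV" by simp
 thus ?thesis by (induction rule: frag_induction) (auto simp: frag_extend_diff consf_diff consf_def)
qed

lemma frag_extend_map_bd: "frag_extend (frag_of \<circ> map f) (bd L) = bd (map f L)"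
 by (simp add: bd_def frag_extend_sum frag_extend_cmul map_drp)

text \<open>Induction with the cone formula: the terms \<open>pr vs\<close> and the doubly coned
  boundary cancel between the two summands, and the induction hypothesis is coned with
  \<open>(v,0)\<close>.\<close>

lemma bd_pr:
 "frag_extend bd (pr vs) + frag_extend pr (bd vs) = frag_of (map (%u. (u,1)) vs) - frag_of (map (%u. (u,0)) vs)"
proof (induction vs)
 case Nil
 thus ?case by simp
next
 case (Cons v vs)
 let ?w = "map (%u. (u,1::real)) vs"
 let ?P = "frag_extend bd (pr vs)" and ?Q = "frag_extend pr (bd vs)"
 have 1: "frag_extend bd (pr (v # vs)) =
   frag_of ((v,1) # ?w) - frag_of ((v,0) # ?w) + consf (v,0) (consf (v,1) (bd ?w)) - pr vs + consf (v,0) ?P"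
  by (simp add: frag_extend_diff bd_Cons frag_extend_bd_consf consf_diff)
 have 2: "frag_extend pr (bd (v # vs)) =
   pr vs - consf (v,0) (consf (v,1) (bd ?w)) + consf (v,0) ?Q"
  by (simp add: bd_Cons frag_extend_diff frag_extend_pr_consf frag_extend_map_bd)
 have 3: "consf (v,0) ?P + consf (v,0) ?Q = frag_of ((v,0) # ?w) - frag_of ((v,0) # map (%u. (u,0)) vs)"
  using Cons by (simp flip: consf_add add: consf_diff)
 show ?case unfolding 1 2 using 3 by (simp add: algebra_simps)
qed

lemma keys_consf: "L \<in> pkeys (consf x c) ==> EX L':pkeys c. L = x # L'"
 using keys_frag_extend[of "frag_of \<circ> Cons x" c] by (auto simp: consf_def keys_frag_of)

lemma keys_pr:
 assumes "L \<in> pkeys (pr vs)"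
 shows "length L = Suc (length vs)" "fst ` set L <= set vs" "snd ` set L <= {0,1}"
proof -
 have "length L = Suc (length vs) & fst ` set L <= set vs & snd ` set L <= {0,1}" using assms
 proof (induction vs arbitrary: L)
  case (Cons v vs)
  from Cons.prems consider "L = (v,0) # map (%u. (u,1)) (v # vs)" | "L \<in> pkeys (consf (v,0) (pr vs))"
   using keys_diff[of "frag_of ((v,0) # map (%u. (u,1)) (v # vs))" "consf (v,0) (pr vs)"]
   by (auto simp: keys_frag_of)
  thus ?case proof cases
   case 2
   then obtain L' where L': "L' \<in> pkeys (pr vs)" and L: "L = (v,0) # L'" using keys_consf[OF 2] by blast
   have a: "length L' = Suc (length vs)" and b: "fst ` set L' <= set vs" and c: "snd ` set L' <= {0,1}"
    using Cons.IH[OF L'] by blast+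
   thus ?thesis unfolding L by auto
  qed (auto simp: image_image)
 qed auto
 thus "length L = Suc (length vs)" "fst ` set L <= set vs" "snd ` set L <= {0,1}" by blast+
qed

lemma pr_map: "pr (map f vs) = frag_extend (frag_of \<circ> map (apfst f)) (pr vs)"
proof (induction vs)
 case (Cons v vs)
 have "consf (f v, 0) (frag_extend (frag_of \<circ> map (apfst f)) c) = frag_extend (frag_of \<circ> map (apfst f)) (consf (v,0) c)" for c
  proof -
  have "pkeys c <= UNIV" by simp
  thus ?thesis by (induction rule: frag_induction) (auto simp: consf_def frag_extend_diff)
 qed
 with Cons show ?case by (simp add: frag_extend_diff o_def)
qed simp

subsection \<open>Affine simplices in a prism\<close>

text \<open>A list of vertices \<open>(i, t)\<close> spans an affine simplex in the product of a
  standard simplex with the line; \<open>bpt\<close> and \<open>tpt\<close> are the two components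
  of its parametrisation. A vertex may be repeated, hence the sum over positions.\<close>

definition bpt :: "(nat \<times> real) list => (nat => real) => nat => real" where
 "bpt L x = (%i. \<Sum>k<length L. if fst (L ! k) = i then x k else 0)"

definition tpt :: "(nat \<times> real) list => (nat => real) => real" where
 "tpt L x = (\<Sum>k<length L. x k * snd (L ! k))"

definition psimp :: "((nat => real) => 'a) => (nat \<times> real) list => (nat => real) => 'a \<times> real" where
 "psimp s L = (\<lambda>x\<in>standard_simplex (length L - 1). (s (bpt L x), tpt L x))"

lemma bpt_in_simplex:
 assumes "L ~= []" "fst ` set L <= {..q}" "x \<in> standard_simplex (length L - 1)"
 shows "bpt L x \<in> standard_simplex q"
proof -
 have x: "!!i. 0 <= x i" and sx: "(\<Sum>k<length L. x k) = 1"
  using assms(1,3) by (auto simp: standard_simplex_def lessThan_Suc_atMost[symmetric])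
 have L: "fst (L!k) <= q" if "k < length L" for k using that assms(2) by (force simp: set_conv_nth)
 have le: "bpt L x i <= 1" for i unfolding bpt_def sx[symmetric] by (rule sum_mono) (use x in auto)
 have "(\<Sum>i\<le>q. bpt L x i) = (\<Sum>k<length L. \<Sum>i\<le>q. if fst (L!k) = i then x k else 0)"
  unfolding bpt_def by (rule sum.swap)
 also have "... = (\<Sum>k<length L. x k)" by (rule sum.cong) (use L in auto)
 finally have "(\<Sum>i\<le>q. bpt L x i) = 1" using sx by simp
 moreover have "bpt L x i = 0" if "i > q" for i
  unfolding bpt_def by (rule sum.neutral) (use L that in fastforce)
 moreover have "0 <= bpt L x i" for i unfolding bpt_def by (rule sum_nonneg) (use x in auto)
 ultimately show ?thesis using le by (simp add: standard_simplex_def)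
qed

lemma tpt_in_01:
 assumes "L ~= []" "snd ` set L <= {0..1}" "x \<in> standard_simplex (length L - 1)"
 shows "tpt L x \<in> {0..1}"
proof -
 have x: "!!i. 0 <= x i" and sx: "(\<Sum>k<length L. x k) = 1"
  using assms(1,3) by (auto simp: standard_simplex_def lessThan_Suc_atMost[symmetric])
 have L: "snd (L!k) \<in> {0..1}" if "k < length L" for k using that assms(2) by (force simp: set_conv_nth)
 have "tpt L x <= 1" unfolding tpt_def sx[symmetric] by (rule sum_mono) (use x L in "auto simp: mult_left_le")
 moreover have "0 <= tpt L x" unfolding tpt_def by (rule sum_nonneg) (use x L in auto)
 ultimately show ?thesis by simp
qed

lemma continuous_map_bpt:
 "continuous_map (powertop_real UNIV) (powertop_real UNIV) (bpt L)"
 unfolding bpt_def continuous_map_componentwise_UNIV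
 by (intro allI continuous_map_sum) (auto intro: continuous_map_product_projection)

lemma continuous_map_tpt: "continuous_map (powertop_real UNIV) euclideanreal (tpt L)"
 unfolding tpt_def by (intro continuous_map_sum continuous_map_real_mult)
  (auto intro: continuous_map_product_projection)

abbreviation "I01 \<equiv> top_of_set {0..1::real}"

lemma singular_simplex_psimp:
 assumes s: "singular_simplex q S s" and L: "L ~= []" "fst ` set L <= {..q}" "snd ` set L <= {0..1}"
 shows "singular_simplex (length L - 1) (prod_topology S I01) (psimp s L)"
proof -
 let ?D = "subtopology (powertop_real UNIV) (standard_simplex (length L - 1))"
 have "continuous_map ?D (subtopology (powertop_real UNIV) (standard_simplex q)) (bpt L)"
  using bpt_in_simplex[OF L(1,2)] continuous_map_bpt
  by (auto simp: continuous_map_in_subtopology intro: continuous_map_from_subtopology)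
 moreover have "continuous_map (subtopology (powertop_real UNIV) (standard_simplex q)) S s"
  using s by (simp add: singular_simplex_def)
 ultimately have 1: "continuous_map ?D S (s \<circ> bpt L)" by (rule continuous_map_compose)
 have 2: "continuous_map ?D I01 (tpt L)" using tpt_in_01[OF L(1,3)] continuous_map_tpt
  by (auto simp: continuous_map_in_subtopology intro: continuous_map_from_subtopology)
 have "continuous_map ?D (prod_topology S I01) (%x. (s (bpt L x), tpt L x))"
  using 1 2 by (simp add: continuous_map_pairwise o_def)
 hence "continuous_map ?D (prod_topology S I01) (psimp s L)" by (rule continuous_map_eq) (auto simp: psimp_def)
 thus ?thesis by (auto simp: singular_simplex_def psimp_def)
qed

text \<open>The face map inserts a zero at coordinate \<open>k\<close>; a summand that vanishes
  there drops out and the later ones are shifted.\<close>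

lemma sum_simplical_face:
 fixes x :: "nat => real" and f :: "nat => real => real"
 assumes "k < n" "!!j. f j 0 = 0"
 shows "(\<Sum>j<n. f j (simplical_face k x j)) = (\<Sum>j<n-1. f (if j < k then j else Suc j) (x j))"
proof -
 have eq: "{..<n} = {..<k} \<union> insert k (Suc ` {k..<n-1})" proof (intro equalityI subsetI)
  fix i assume "i \<in> {..<n}"
  thus "i \<in> {..<k} \<union> insert k (Suc ` {k..<n-1})"
   using assms(1) by (cases "i <= k") (auto intro!: image_eqI[of _ _ "i-1"])
 qed (use assms in auto)
 have eq2: "{..<n-1} = {..<k} \<union> {k..<n-1}" using assms(1) by auto
 have "(\<Sum>j<n. f j (simplical_face k x j)) = (\<Sum>j<k. f j (x j)) + (\<Sum>j\<in>Suc ` {k..<n-1}. f j (simplical_face k x j))"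
  unfolding eq by (subst sum.union_disjoint) (auto simp: simplical_face_def assms)
 also have "(\<Sum>j\<in>Suc ` {k..<n-1}. f j (simplical_face k x j)) = (\<Sum>j\<in>{k..<n-1}. f (Suc j) (x j))"
  by (subst sum.reindex) (auto simp: simplical_face_def intro!: sum.cong)
 also have "(\<Sum>j<k. f j (x j)) + ... = (\<Sum>j<n-1. f (if j < k then j else Suc j) (x j))"
  unfolding eq2 by (subst sum.union_disjoint) (auto intro!: arg_cong2[of _ _ _ _ "(+)"] sum.cong)
 finally show ?thesis .
qed

lemma singular_face_psimp:
 assumes "length L = Suc (Suc m)" "k < length L" shows "singular_face (Suc m) k (psimp s L) = psimp s (drp k L)"
proof -
 have len: "length (drp k L) = Suc m" using assms by simp
 have "bpt L (simplical_face k x) = bpt (drp k L) x" for x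
  using sum_simplical_face[of k "length L" "%j y. if fst (L!j) = _ then y else 0" x] assms
  by (auto simp: bpt_def len nth_drp fun_eq_iff intro!: sum.cong)
 moreover have "tpt L (simplical_face k x) = tpt (drp k L) x" for x
  using sum_simplical_face[of k "length L" "%j y. y * snd (L!j)" x] assms
  by (auto simp: tpt_def len nth_drp fun_eq_iff intro!: sum.cong)
 ultimately show ?thesis
  using assms len by (auto simp: singular_face_def psimp_def simplical_face_in_standard_simplex)
qed

definition shift_at :: "nat => nat => nat" where
 "shift_at i j = (if j < i then j else Suc j)"

lemma psimp_singular_face:
 assumes "L ~= []" "fst ` set L <= {..q}" "i <= Suc q"
 shows "psimp (singular_face (Suc q) i s) L = psimp s (map (apfst (shift_at i)) L)"
proof -
 have "simplical_face i (bpt L x) = bpt (map (apfst (shift_at i)) L) x" for x proof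
  fix m
  have A: "fst (map (apfst (shift_at i)) L ! k) = m \<longleftrightarrow>
    (if m < i then fst (L ! k) = m else if m = i then False else fst (L ! k) = m - 1)" if "k < length L" for k
   using that by (auto simp: shift_at_def)
  show "simplical_face i (bpt L x) m = bpt (map (apfst (shift_at i)) L) x m"
   unfolding simplical_face_def bpt_def by (auto simp: A shift_at_def intro!: sum.cong sum.neutral)
 qed
 moreover have "tpt (map (apfst (shift_at i)) L) x = tpt L x" for x by (simp add: tpt_def)
 ultimately show ?thesis using bpt_in_simplex[OF assms(1,2)] by (auto simp: psimp_def singular_face_def)
qed

lemma psimp_const:
 assumes "singular_simplex q S s" shows "psimp s (map (%u. (u, c)) [0..<Suc q]) = simplex_map q (%b. (b, c)) s"
proof -
 have "bpt (map (%u. (u, c)) [0..<Suc q]) x = x" if "x \<in> standard_simplex q" for x proof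
  fix i
  have "(\<Sum>k<Suc q. if fst (map (%u. (u, c)) [0..<Suc q] ! k) = i then x k else 0) = (\<Sum>k<Suc q. if k = i then x k else 0)"
   by (rule sum.cong) (auto simp del: upt_Suc)
  also have "... = x i" using that by (auto simp: standard_simplex_def)
  finally show "bpt (map (%u. (u, c)) [0..<Suc q]) x i = x i" by (simp add: bpt_def)
 qed
 moreover have "tpt (map (%u. (u, c)) [0..<Suc q]) x = c" if "x \<in> standard_simplex q" for x proof -
  have "tpt (map (%u. (u, c)) [0..<Suc q]) x = (\<Sum>k<Suc q. x k * c)"
   unfolding tpt_def by (rule sum.cong) (auto simp del: upt_Suc)
  also have "... = c" using that by (simp add: standard_simplex_def lessThan_Suc_atMost flip: sum_distrib_right)
  finally show ?thesis .
 qed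
 ultimately show ?thesis by (auto simp: psimp_def simplex_map_def simp del: upt_Suc)
qed

definition prism :: "nat => 'a chain => ('a \<times> real) chain" where
 "prism q = frag_extend (%s. frag_extend (frag_of \<circ> psimp s) (pr [0..<Suc q]))"

lemma prism_0 [simp]: "prism q 0 = 0" by (simp add: prism_def)
lemma prism_diff: "prism q (a - b) = prism q a - prism q b" by (simp add: prism_def frag_extend_diff)
lemma singular_chain_prism:
 assumes "singular_chain q S c" shows "singular_chain (Suc q) (prod_topology S I01) (prism q c)"
 unfolding prism_def
proof (rule singular_chain_extend)
 fix s assume "s \<in> pkeys c"
 hence s: "singular_simplex q S s" using assms by (auto simp: singular_chain_def)
 show "singular_chain (Suc q) (prod_topology S I01) (frag_extend (frag_of \<circ> psimp s) (pr [0..<Suc q]))"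
 proof (rule singular_chain_extend)
  fix L assume L: "L \<in> pkeys (pr [0..<Suc q])"
  note k = keys_pr[OF L]
  have "singular_simplex (length L - 1) (prod_topology S I01) (psimp s L)"
   by (rule singular_simplex_psimp[OF s]) (use k in auto)
  thus "singular_chain (Suc q) (prod_topology S I01) ((frag_of \<circ> psimp s) L)"
   using k(1) by (simp add: singular_chain_of)
 qed
qed

lemma chain_boundary_psimp_list:
 assumes "pkeys c <= {L. length L = Suc (Suc q)}"
 shows "chain_boundary (Suc q) (frag_extend (frag_of \<circ> psimp s) c) = frag_extend (frag_of \<circ> psimp s) (frag_extend bd c)"
 using assms
proof (induction rule: frag_induction)
 case (one L)
 hence "length L = Suc (Suc q)" by simp
 thus ?case
  by (simp add: chain_boundary_of bd_def frag_extend_sum frag_extend_cmul singular_face_psimp lessThan_Suc_atMost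
    del: sum.lessThan_Suc sum.atMost_Suc)
qed (auto simp: frag_extend_diff chain_boundary_diff)

lemma drp_upt: "k <= q ==> drp k [0..<Suc q] = map (shift_at k) [0..<q]"
 by (rule nth_equalityI) (auto simp: nth_drp shift_at_def simp del: upt_Suc)

text \<open>The formal identity \<open>bd_pr\<close>, realised by \<open>psimp\<close>. What is not
  formal is that deleting vertex \<open>k\<close> from the vertex list and passing to face
  \<open>k\<close> of the simplex give the same prism.\<close>

theorem chain_boundary_prism:
 assumes "singular_chain q S c" shows "chain_boundary (Suc q) (prism q c) =
  chain_map q (%b. (b,1)) c - chain_map q (%b. (b,0)) c - prism (q - 1) (chain_boundary q c)"
 using assms unfolding singular_chain_def
proof (induction rule: frag_induction)
 case (one s)
 hence s: "singular_simplex q S s" by simp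
 let ?F = "%s. frag_extend (frag_of \<circ> psimp s)" and ?v = "[0..<Suc q]"
 have "chain_boundary (Suc q) (prism q (frag_of s)) = ?F s (frag_extend bd (pr ?v))"
  unfolding prism_def frag_extend_of by (rule chain_boundary_psimp_list) (use keys_pr(1)[of _ ?v] in auto)
 also have "frag_extend bd (pr ?v) = frag_of (map (%u. (u,1)) ?v) - frag_of (map (%u. (u,0)) ?v) - frag_extend pr (bd ?v)"
  using bd_pr[of ?v] by (simp add: algebra_simps del: upt_Suc)
 also have "?F s ... = frag_of (simplex_map q (%b. (b,1)) s) - frag_of (simplex_map q (%b. (b,0)) s) - ?F s (frag_extend pr (bd ?v))"
  by (simp add: frag_extend_diff psimp_const[OF s] del: upt_Suc)
 also have "?F s (frag_extend pr (bd ?v)) = prism (q - 1) (chain_boundary q (frag_of s))" proof (cases q)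
  case 0
  thus ?thesis by (simp add: bd_def chain_boundary_of)
 next
  case (Suc r)
  \<comment> \<open>Naturality of \<open>pr\<close> under relabelling moves the coface map from the
    vertex list to the simplex \<open>s\<close>.\<close>
  have 1: "?F s (pr (map (shift_at k) [0..<q])) = ?F (singular_face q k s) (pr [0..<q])" if "k <= q" for k
  proof -
   have "?F s (pr (map (shift_at k) [0..<q])) = frag_extend (?F s \<circ> (frag_of \<circ> map (apfst (shift_at k)))) (pr [0..<q])"
    by (simp add: pr_map frag_extend_frag_extend)
   also have "... = ?F (singular_face q k s) (pr [0..<q])" proof (rule frag_extend_eq)
    fix L assume "L \<in> pkeys (pr [0..<q])"
    from keys_pr[OF this] have "L ~= []" "fst ` set L <= {..r}" using Suc by auto
    from psimp_singular_face[OF this, of k s] show "(?F s \<circ> (frag_of \<circ> map (apfst (shift_at k)))) L = (frag_of \<circ> psimp (singular_face q k s)) L"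
     using that Suc by simp
   qed
   finally show ?thesis .
  qed
  have "?F s (frag_extend pr (bd ?v)) = (\<Sum>k<Suc q. frag_cmul ((-1)^k) (?F s (pr (drp k ?v))))"
   by (simp add: bd_def frag_extend_sum frag_extend_cmul del: upt_Suc sum.lessThan_Suc)
  also have "... = (\<Sum>k<Suc q. frag_cmul ((-1)^k) (?F (singular_face q k s) (pr [0..<q])))"
   by (rule sum.cong) (auto simp: drp_upt 1 simp del: upt_Suc)
  finally show ?thesis
   using Suc by (simp add: chain_boundary_of prism_def frag_extend_sum frag_extend_cmul lessThan_Suc_atMost
     del: upt_Suc sum.lessThan_Suc sum.atMost_Suc)
 qed
 finally show ?case by simp
qed (auto simp: chain_boundary_diff chain_map_diff prism_diff)

subsection \<open>Cochains vanishing on cycles\<close>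

lemma ev_coboundary:
 assumes "singular_chain (Suc p) S c" shows "ev (coboundary p S u) c = ev u (chain_boundary (Suc p) c)"
 using assms unfolding singular_chain_def
proof (induction rule: frag_induction)
 case (one s)
 thus ?case by (simp add: coboundary_def chain_boundary_of ev_sum ev_cmul del: sum.atMost_Suc)
qed (auto simp: ev_diff chain_boundary_diff)

lemma ev_pullback:
 assumes "singular_chain p S c" shows "ev (cochain_pullback p S h u) c = ev u (chain_map p h c)"
 using assms unfolding singular_chain_def
 by (induction rule: frag_induction) (auto simp: ev_diff chain_map_diff cochain_pullback_def)

lemma coboundaries_vanish:
 assumes "u \<in> coboundaries p S" "singular_relcycle p S {} c" shows "ev u c = 0"
proof (cases p)
 case 0
 with assms show ?thesis by (simp add: coboundaries_def ev_def)
next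
 case (Suc k)
 with assms show ?thesis by (auto simp: coboundaries_def singular_cycle ev_coboundary)
qed

text \<open>Turns a rational relation between boundaries of simplices into an integral one, so that
  it defines a cycle with integer coefficients.\<close>

lemma common_denominator:
 fixes r :: "'b => rat"
 assumes "finite T" shows "EX N>0. EX m. ALL b:T. of_int N * r b = of_int (m b)" using assms
proof induction
 case empty
 show ?case by (rule exI[of _ 1]) auto
next
 case (insert x T)
 then obtain N m where N: "N > 0" and m: "ALL b:T. of_int N * r b = of_int (m b)" by blast
 obtain a d where q: "quotient_of (r x) = (a, d)" by fastforce
 hence d: "d > 0" and rx: "r x = of_int a / of_int d" using quotient_of_denom_pos quotient_of_div by blast+
 show ?case proof (intro exI[of _ "N * d"] exI[of _ "%b. if b = x then N * a else m b * d"] conjI ballI)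
  show "N * d > 0" using N d by simp
  fix b assume "b \<in> insert x T"
  thus "of_int (N * d) * r b = of_int (if b = x then N * a else m b * d)"
   using m rx d insert(2) by (auto simp: field_simps)
 qed
qed

text \<open>Linear algebra is done over the rationals: inside rational chains the boundaries of
  simplices contain a basis of their span, from which a functional can be extended.\<close>

lift_definition rat_chain :: "('s \<Rightarrow>\<^sub>0 int) => ('s \<Rightarrow>\<^sub>0 rat)" is "%f x. of_int (f x)"
 by (rule finite_subset) auto

lift_definition rat_scale :: "rat => ('s \<Rightarrow>\<^sub>0 rat) => ('s \<Rightarrow>\<^sub>0 rat)" is "%r f x. r * f x"
 by (rule finite_subset) auto

lemma rat_chain_add: "rat_chain (a + b) = rat_chain a + rat_chain b" by transfer auto
lemma rat_chain_diff: "rat_chain (a - b) = rat_chain a - rat_chain b" by transfer auto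
lemma rat_chain_0: "rat_chain 0 = 0" by transfer auto
lemma rat_chain_cmul: "rat_chain (frag_cmul k a) = rat_scale (of_int k) (rat_chain a)"
 by (rule poly_mapping_eqI) (simp add: rat_chain.rep_eq rat_scale.rep_eq)
lemma rat_chain_sum: "rat_chain (sum f A) = (\<Sum>a\<in>A. rat_chain (f a))"
 by (induction A rule: infinite_finite_induct) (auto simp: rat_chain_add rat_chain_0)
lemma rat_chain_eq_0: "rat_chain a = 0 \<longleftrightarrow> a = 0" by transfer (auto simp: fun_eq_iff)

text \<open>Universal coefficients over a field. A cochain that vanishes on integral cycles depends
  only on the boundary of a simplex; the resulting functional on boundaries extends to all rational
  chains of one degree less, and its values on simplices form the required cochain.\<close>

theorem cochain_null_imp_coboundary:
 fixes S :: "'a topology"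
 assumes u: "u \<in> cochains p S" and null: "!!c. singular_relcycle p S {} c ==> ev u c = 0"
 shows "u \<in> coboundaries p S"
proof (cases p)
 case 0
 have "u s = 0" for s proof (cases "singular_simplex 0 S s")
  case True
  hence "singular_relcycle 0 S {} (frag_of s)" by (simp add: singular_cycle singular_chain_of chain_boundary_of)
  with null 0 show ?thesis by fastforce
 qed (use u 0 in "auto simp: cochains_def")
 with 0 show ?thesis by (auto simp: coboundaries_def)
next
 case (Suc k)
 interpret V: vector_space "rat_scale :: rat => (((nat => real) => 'a) \<Rightarrow>\<^sub>0 rat) => _"
  by standard (transfer; auto simp: algebra_simps)+
 interpret W: vector_space "%r (z::complex). of_rat r * z"
  by standard (auto simp: algebra_simps of_rat_add of_rat_mult)
 interpret P: vector_space_pair "rat_scale :: rat => (((nat => real) => 'a) \<Rightarrow>\<^sub>0 rat) => _" "%r (z::complex). of_rat r * z" ..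
 define \<beta> where "\<beta> s = rat_chain (chain_boundary p (frag_of s))" for s :: "(nat => real) => 'a"
 let ?G = "Collect (singular_simplex p S)"
 obtain B where B: "B <= \<beta> ` ?G" "V.independent B" "\<beta> ` ?G <= V.span B"
  using V.maximal_independent_subset by blast
 have "ALL b:B. EX s. s \<in> ?G & \<beta> s = b" using B(1) by (auto simp: subset_iff image_iff)
 then obtain sb where sb: "!!b. b \<in> B ==> sb b \<in> ?G & \<beta> (sb b) = b" by metis
 \<comment> \<open>The values are prescribed on the basis \<open>B\<close> of simplex boundaries
   only, through one chosen simplex \<open>sb b\<close> for each basis element.\<close>
 obtain g where g: "Vector_Spaces.linear rat_scale (%r (z::complex). of_rat r * z) g" and gB: "ALL b:B. g b = u (sb b)"
  using P.linear_independent_extend[OF B(2), of "%b. u (sb b)"] by blast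
 interpret g: Vector_Spaces.linear "rat_scale :: rat => (((nat => real) => 'a) \<Rightarrow>\<^sub>0 rat) => _" "%r (z::complex). of_rat r * z" g
  by (rule g)
 define v where "v t = (if singular_simplex k S t then g (rat_chain (frag_of t)) else 0)" for t
 have evv: "ev v c = g (rat_chain c)" if "singular_chain k S c" for c using that unfolding singular_chain_def
  by (induction rule: frag_induction) (auto simp: v_def ev_diff rat_chain_diff rat_chain_0 g.diff g.zero)
 have key: "g (\<beta> s) = u s" if s: "singular_simplex p S s" for s proof -
  have "\<beta> s \<in> V.span B" using B(3) s by auto
  then obtain T r where T: "finite T" "T <= B" and r: "\<beta> s = (\<Sum>b\<in>T. rat_scale (r b) b)"
   unfolding V.span_explicit mem_Collect_eq by (elim exE conjE) (rule that)
  obtain N m where N: "N > 0" and m: "ALL b:T. of_int N * r b = of_int (m b)"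
   using common_denominator[OF T(1), of r] by blast
  \<comment> \<open>The expansion of the boundary of \<open>s\<close> with denominators cleared:
    this chain has boundary 0, so \<open>u\<close> vanishes on it.\<close>
  define c where "c = frag_cmul N (frag_of s) - (\<Sum>b\<in>T. frag_cmul (m b) (frag_of (sb b)))"
  have ch: "singular_chain p S c" unfolding c_def using s sb T(2)
   by (intro singular_chain_diff singular_chain_cmul singular_chain_sum) (auto simp: singular_chain_of)
  have "rat_chain (chain_boundary p c) = rat_scale (of_int N) (\<beta> s) - (\<Sum>b\<in>T. rat_scale (of_int (m b)) (\<beta> (sb b)))"
   by (simp add: c_def chain_boundary_diff chain_boundary_cmul chain_boundary_sum rat_chain_diff rat_chain_cmul rat_chain_sum \<beta>_def)
  also have "... = 0" unfolding r V.scale_sum_right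
   using m sb T(2) by (auto simp: V.scale_scale subset_iff intro!: sum.cong)
  finally have "singular_relcycle p S {} c" using ch by (simp add: singular_cycle rat_chain_eq_0)
  from null[OF this] have 1: "of_int N * u s = (\<Sum>b\<in>T. of_int (m b) * u (sb b))"
   by (simp add: c_def ev_diff ev_cmul ev_sum)
  have "of_int N * g (\<beta> s) = (\<Sum>b\<in>T. of_int N * (of_rat (r b) * g b))"
   unfolding r g.sum g.scale sum_distrib_left ..
  also have "... = (\<Sum>b\<in>T. of_int (m b) * u (sb b))" proof (rule sum.cong[OF refl])
   fix b assume b: "b \<in> T"
   have "of_int N * (of_rat (r b) :: complex) = of_rat (of_int N * r b)" by (simp add: of_rat_mult)
   also have "... = of_int (m b)" using m b by simp
   finally have "of_int N * (of_rat (r b) :: complex) = of_int (m b)" .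
   thus "of_int N * (of_rat (r b) * g b) = of_int (m b) * u (sb b)"
    using gB b T(2) by (auto simp: mult.assoc[symmetric])
  qed
  finally show ?thesis using 1 N by (metis mult_left_cancel of_int_eq_0_iff less_irrefl)
 qed
 have "u = coboundary k S v" proof
  fix s
  show "u s = coboundary k S v s" proof (cases "singular_simplex p S s")
   case True
   hence "singular_chain p S (frag_of s)" by (simp add: singular_chain_of)
   hence "coboundary k S v s = ev v (chain_boundary p (frag_of s))"
    using ev_coboundary[of k S "frag_of s" v] Suc by simp
   also have "... = g (\<beta> s)"
    unfolding \<beta>_def by (rule evv) (use \<open>singular_chain p S (frag_of s)\<close> Suc singular_chain_boundary_alt in blast)
   finally show ?thesis using key[OF True] by simp
  next
   case False
   thus ?thesis using u Suc by (auto simp: cochains_def coboundary_def)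
  qed
 qed
 moreover have "v \<in> cochains k S" by (simp add: cochains_def v_def)
 ultimately show ?thesis using Suc by (auto simp: coboundaries_def)
qed

section \<open>Homology of a trivial bundle with fibre the punctured plane\<close>

lemma continuous_map_mult_complex [continuous_intros]:
 fixes f :: "'a => complex"
 shows "continuous_map T euclidean f ==> continuous_map T euclidean g ==> continuous_map T euclidean (%x. f x * g x)"
 by (simp add: continuous_map_atin tendsto_mult)

lemma continuous_map_divide_complex [continuous_intros]:
 fixes f :: "'a => complex"
 shows "continuous_map T euclidean f ==> continuous_map T euclidean g ==> (!!x. x \<in> topspace T ==> g x ~= 0)
  ==> continuous_map T euclidean (%x. f x / g x)" by (simp add: continuous_map_atin tendsto_divide)

lemma continuous_map_of_real_complex [continuous_intros]:
 "continuous_map T euclidean f ==> continuous_map T euclidean (%x. complex_of_real (f x))"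
 by (simp add: continuous_map_atin tendsto_of_real)

lemma continuous_map_exp_complex [continuous_intros]:
 fixes f :: "'a => complex" shows "continuous_map T euclidean f ==> continuous_map T euclidean (%x. exp (f x))"
 by (simp add: continuous_map_atin tendsto_exp)

lemma continuous_map_fst' [continuous_intros]:
 "continuous_map T (prod_topology A B) f ==> continuous_map T A (%x. fst (f x))"
 using continuous_map_fst_of[of T A B f] by (simp add: o_def)

lemma continuous_map_snd' [continuous_intros]:
 "continuous_map T (prod_topology A B) f ==> continuous_map T B (%x. snd (f x))"
 using continuous_map_snd_of[of T A B f] by (simp add: o_def)

lemma continuous_map_snd_into [continuous_intros]:
 "continuous_map T (prod_topology A (top_of_set B)) f ==> continuous_map T euclidean (%x. snd (f x))"
 using continuous_map_snd'[of T A "top_of_set B" f] by (simp add: continuous_map_in_subtopology)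

lemma continuous_map_top_of_setI:
 "continuous_map T euclidean f ==> (!!x. x \<in> topspace T ==> f x \<in> A) ==> continuous_map T (top_of_set A) f"
 by (auto simp: continuous_map_in_subtopology)

abbreviation (input) cycle :: "nat => 'a topology => 'a chain => bool" where
 "cycle p S \<equiv> singular_relcycle p S {}"

abbreviation (input) homol :: "nat => 'a topology => 'a chain => 'a chain => bool" where
 "homol p S \<equiv> homologous_rel p S {}"

lemma homol_iff: "homol p S a b \<longleftrightarrow> (EX d. singular_chain (Suc p) S d & chain_boundary (Suc p) d = a - b)"
 by (simp add: homologous_rel_def singular_boundary)

lemma homol_chain_map:
 "homol p S a b ==> continuous_map S T f ==> homol p T (chain_map p f a) (chain_map p f b)"
 unfolding homologous_rel_def chain_map_diff[symmetric] by (rule singular_relboundary_chain_map) auto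

lemma cycle_chain_map: "cycle p S c ==> continuous_map S T f ==> cycle p T (chain_map p f c)"
 by (rule singular_relcycle_chain_map) auto

lemma homol_homotopy:
 assumes h: "continuous_map (prod_topology S I01) T h" and c: "cycle p S c"
 shows "homol p T (chain_map p (%b. h (b,1)) c) (chain_map p (%b. h (b,0)) c)" unfolding homol_iff
proof (intro exI conjI)
 have c': "singular_chain p S c" "chain_boundary p c = 0" using c by (auto simp: singular_cycle)
 have pc: "singular_chain (Suc p) (prod_topology S I01) (prism p c)" by (rule singular_chain_prism[OF c'(1)])
 show "singular_chain (Suc p) T (chain_map (Suc p) h (prism p c))" by (rule singular_chain_chain_map[OF pc h])
 have 1: "chain_map p h (chain_map p (%b. (b, t)) c) = chain_map p (%b. h (b,t)) c" for t
  by (simp add: chain_map_compose[THEN fun_cong, symmetric, unfolded o_def])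
 show "chain_boundary (Suc p) (chain_map (Suc p) h (prism p c)) =
   chain_map p (%b. h (b,1)) c - chain_map p (%b. h (b,0)) c"
  by (simp add: chain_boundary_chain_map[OF pc] chain_boundary_prism[OF c'(1)] c'(2) chain_map_diff 1)
qed

lemma chain_map_chain_map: "chain_map p f (chain_map p g c) = chain_map p (%x. f (g x)) c"
 using chain_map_compose[of p f g] by (simp add: fun_eq_iff o_def)

abbreviation (input) PS :: "'a topology => complex set => ('a \<times> complex) topology" where
 "PS S A \<equiv> prod_topology S (top_of_set A)"

lemma subtopology_PS: "subtopology (PS S A) (UNIV \<times> B) = PS S (A \<inter> B)"
 by (simp add: subtopology_Times subtopology_subtopology)

lemma PS_mono_chain: "singular_chain p (PS S A) c ==> A <= B ==> singular_chain p (PS S B) c"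
 using subtopology_PS[of S B A] by (metis inf.absorb2 singular_chain_subtopology)

lemma PS_mono_homol: "homol p (PS S A) a b ==> A <= B ==> homol p (PS S B) a b"
 using PS_mono_chain unfolding homol_iff by blast

lemma continuous_map_section: "a \<in> A ==> continuous_map S (PS S A) (%b. (b, a))"
 by (simp add: continuous_map_pairedI)

lemma star_retract:
 assumes c: "cycle p (PS S A) c" and a: "!!z t. z \<in> A ==> 0 <= t ==> t <= 1 ==> (1 - of_real t) * a + of_real t * z \<in> A"
 shows "homol p (PS S A) c (chain_map p (%b. (b, a)) (chain_map p fst c))"
proof -
 let ?h = "%x :: ('a \<times> complex) \<times> real. (fst (fst x), (1 - of_real (snd x)) * a + of_real (snd x) * snd (fst x))"
 have "continuous_map (prod_topology (PS S A) I01) (PS S A) ?h"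
 proof (intro continuous_map_pairedI continuous_map_top_of_setI)
  show "continuous_map (prod_topology (PS S A) I01) S (%x. fst (fst x))"
   by (intro continuous_map_fst'[OF continuous_map_fst])
  have 1: "continuous_map (prod_topology (PS S A) I01) euclideanreal snd"
   by (rule continuous_map_snd_into[OF continuous_map_id[unfolded id_def]])
  have 2: "continuous_map (prod_topology (PS S A) I01) euclidean (%x. snd (fst x))"
   by (rule continuous_map_snd_into[OF continuous_map_fst])
  show "continuous_map (prod_topology (PS S A) I01) euclidean
   (%x. (1 - complex_of_real (snd x)) * a + complex_of_real (snd x) * snd (fst x))"
   by (intro continuous_intros continuous_map_canonical_const 1 2)
  fix x assume "x \<in> topspace (prod_topology (PS S A) I01)"
  hence "snd (fst x) \<in> A" "0 <= snd x" "snd x <= 1" by auto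
  thus "(1 - complex_of_real (snd x)) * a + complex_of_real (snd x) * snd (fst x) \<in> A" by (rule a)
 qed
 from homol_homotopy[OF this c] show ?thesis
  using c chain_map_id_gen[of p "PS S A" c "%b. b"] by (simp add: chain_map_chain_map singular_cycle)
qed

section \<open>Cross products with half circles and the torus cycle of a base cycle\<close>

definition arc :: "real => complex" where "arc t = cis (pi / 2 - pi * t)"

lemma arc_simps [simp]: "arc 0 = \<i>" "arc 1 = - \<i>" "arc t ~= 0" "norm (arc t) = 1"
proof -
 show "arc 0 = \<i>" by (simp add: arc_def complex_eq_iff)
 show "arc t ~= 0" "norm (arc t) = 1" by (simp_all add: arc_def)
 have "pi / 2 - pi * 1 = - (pi / 2)" by simp
 hence "arc 1 = cis (- (pi/2))" unfolding arc_def by presburger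
 thus "arc 1 = - \<i>" by (simp add: complex_eq_iff)
qed

lemma Re_arc: "0 <= t ==> t <= 1 ==> Re (arc t) \<ge> 0"
proof -
 assume t: "0 <= t" "t <= 1"
 have "Re (arc t) = sin (pi * t)" by (simp add: arc_def cos_diff)
 moreover have "sin (pi * t) \<ge> 0" by (rule sin_ge_zero) (use t in "auto simp: mult_left_le")
 ultimately show ?thesis by simp
qed

lemma continuous_map_arc [continuous_intros]:
 "continuous_map T euclidean f ==> continuous_map T euclidean (%x. arc (f x))"
 unfolding arc_def by (auto simp: continuous_map_atin intro!: tendsto_intros)

text \<open>The cross product of \<open>c\<close> with the half circle \<open>s * arc\<close>. Since
  \<open>arc\<close> runs from i through 1 to -i, the cases \<open>s = 1\<close> and
  \<open>s = -1\<close> together go once around 0 clockwise, whence the sign in the residue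
  formula.\<close>

definition halfcirc :: "complex => nat => 'a chain => ('a \<times> complex) chain" where
 "halfcirc s k c = chain_map (Suc k) (%x. (fst x, s * arc (snd x))) (prism k c)"

lemma continuous_map_halfcirc:
 assumes "!!t. 0 <= t ==> t <= 1 ==> s * arc t \<in> A"
 shows "continuous_map (prod_topology S I01) (PS S A) (%x. (fst x, s * arc (snd x)))"
 by (intro continuous_map_pairedI continuous_map_top_of_setI continuous_intros continuous_map_canonical_const
   continuous_map_fst continuous_map_snd_into[OF continuous_map_id[unfolded id_def]]) (use assms in auto)

lemma singular_chain_halfcirc:
 assumes "singular_chain k S c" "!!t. 0 <= t ==> t <= 1 ==> s * arc t \<in> A"
 shows "singular_chain (Suc k) (PS S A) (halfcirc s k c)" unfolding halfcirc_def
 by (rule singular_chain_chain_map[OF singular_chain_prism[OF assms(1)] continuous_map_halfcirc[OF assms(2)]])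

lemma chain_boundary_halfcirc:
 assumes "singular_chain k S c" shows "chain_boundary (Suc k) (halfcirc s k c) =
  chain_map k (%b. (b, - s * \<i>)) c - chain_map k (%b. (b, s * \<i>)) c -
  (if k = 0 then 0 else halfcirc s (k - 1) (chain_boundary k c))"
proof -
 have 0: "chain_boundary 0 c = 0" by (simp add: chain_boundary_def)
 show ?thesis by (auto simp: halfcirc_def chain_boundary_chain_map[OF singular_chain_prism[OF assms]]
   chain_boundary_prism[OF assms] chain_map_diff chain_map_chain_map 0)
qed

lemma halfcirc_0 [simp]: "halfcirc s k 0 = 0" by (simp add: halfcirc_def)
lemma halfcirc_diff: "halfcirc s k (a - b) = halfcirc s k a - halfcirc s k b"
 by (simp add: halfcirc_def prism_diff chain_map_diff)

definition circ :: "nat => 'a chain => ('a \<times> complex) chain" where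
 "circ k c = halfcirc 1 k c + halfcirc (-1) k c"

text \<open>The correction term makes the projection of \<open>tor\<close> to the base vanish; it only involves degenerate simplices.\<close>

definition tor :: "nat => 'a chain => ('a \<times> complex) chain" where
 "tor k c = circ k c - chain_map (Suc k) (%x. (fst x, 1)) (circ k c)"

lemma circ_diff: "circ k (a - b) = circ k a - circ k b" by (simp add: circ_def halfcirc_diff)
lemma tor_diff: "tor k (a - b) = tor k a - tor k b" by (simp add: tor_def circ_diff chain_map_diff)
lemma tor_0 [simp]: "tor k 0 = 0" by (simp add: tor_def circ_def)
lemma tor_minus: "tor k (- a) = - tor k a" using tor_diff[of k 0 a] by simp
lemma tor_add: "tor k (a + b) = tor k a + tor k b" using tor_diff[of k a "- b"] by (simp add: tor_minus)

lemma singular_chain_circ: "singular_chain k S c ==> singular_chain (Suc k) (PS S (-{0})) (circ k c)"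
 unfolding circ_def by (intro singular_chain_add singular_chain_halfcirc) auto

lemma singular_chain_tor: "singular_chain k S c ==> singular_chain (Suc k) (PS S (-{0})) (tor k c)"
 unfolding tor_def by (intro singular_chain_diff singular_chain_circ singular_chain_chain_map)
  (auto intro: singular_chain_circ intro!: continuous_map_pairedI continuous_map_fst)

lemma chain_boundary_circ:
 assumes "singular_chain k S c"
 shows "chain_boundary (Suc k) (circ k c) = - (if k = 0 then 0 else circ (k - 1) (chain_boundary k c))"
 using assms by (simp add: circ_def chain_boundary_add chain_boundary_halfcirc)

lemma chain_boundary_tor:
 assumes "singular_chain k S c"
 shows "chain_boundary (Suc k) (tor k c) = - (if k = 0 then 0 else tor (k - 1) (chain_boundary k c))"
 using chain_boundary_circ[OF assms]
 by (auto simp: tor_def chain_boundary_diff chain_map_minus chain_boundary_chain_map[OF singular_chain_circ[OF assms]])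

lemma cycle_tor: "cycle k S c ==> cycle (Suc k) (PS S (-{0})) (tor k c)"
 unfolding singular_cycle using singular_chain_tor chain_boundary_tor by fastforce

lemma boundary_tor:
 assumes "singular_relboundary k S {} c" shows "singular_relboundary (Suc k) (PS S (-{0})) {} (tor k c)"
proof -
 obtain d where d: "singular_chain (Suc k) S d" "chain_boundary (Suc k) d = c"
  using assms by (auto simp: singular_boundary)
 have "chain_boundary (Suc (Suc k)) (- tor (Suc k) d) = tor k c"
  using chain_boundary_tor[OF d(1)] d(2) by (simp add: chain_boundary_minus)
 thus ?thesis using singular_chain_tor[OF d(1)] unfolding singular_boundary by (metis singular_chain_minus)
qed

section \<open>Cutting the punctured plane into two slit planes\<close>

definition upper_part :: "('a \<times> complex) chain => ('a \<times> complex) chain" where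
 "upper_part = frag_extend (%s. if Im (snd (s (%j. if j = 0 then 1 else 0))) > 0 then frag_of s else 0)"

abbreviation (input) "UH \<equiv> {z. Im z > 0}"
abbreviation (input) "LH \<equiv> {z. Im z < 0}"
abbreviation (input) "NR \<equiv> {z. Im z ~= 0}"

text \<open>The imaginary part of the second component has a connected image avoiding 0, which is
  why \<open>upper_part\<close> may test a single vertex.\<close>

lemma upper_or_lower_simplex:
 assumes s: "singular_simplex p (PS S NR) s"
 shows "singular_simplex p (PS S UH) s | singular_simplex p (PS S LH) s"
proof -
 let ?D = "subtopology (powertop_real UNIV) (standard_simplex p)"
 have cs: "continuous_map ?D (PS S NR) s" and ext: "s \<in> extensional (standard_simplex p)"
  using s by (auto simp: singular_simplex_def)
 have cm: "continuous_map ?D euclidean (%x. snd (s x))" by (rule continuous_map_snd_into[OF cs])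
 hence "continuous_map ?D euclideanreal (%x. Im (snd (s x)))" by (simp add: continuous_map_atin tendsto_Im)
 hence "connectedin euclideanreal ((%x. Im (snd (s x))) ` standard_simplex p)"
  by (rule connectedin_continuous_map_image) (simp add: connectedin_subtopology connectedin_standard_simplex)
 hence iv: "is_interval ((%x. Im (snd (s x))) ` standard_simplex p)" by (simp add: is_interval_connected_1)
 have ne: "Im (snd (s x)) ~= 0" if "x \<in> standard_simplex p" for x
  using continuous_map_image_subset_topspace[OF cs] that by fastforce
 have "(ALL x:standard_simplex p. Im (snd (s x)) > 0) | (ALL x:standard_simplex p. Im (snd (s x)) < 0)"
 proof (rule ccontr)
  assume "\<not> ?thesis"
  then obtain x y where x: "x \<in> standard_simplex p" "Im (snd (s x)) < 0" and y: "y \<in> standard_simplex p" "Im (snd (s y)) > 0"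
   using ne by (meson linorder_neqE_linordered_idom)
  hence "0 \<in> (%x. Im (snd (s x))) ` standard_simplex p"
   using iv unfolding is_interval_1 by (meson image_eqI less_imp_le)
  with ne show False by force
 qed
 moreover have "singular_simplex p (PS S A) s" if "ALL x:standard_simplex p. snd (s x) \<in> A" for A proof -
  have "continuous_map ?D S (%x. fst (s x))" by (rule continuous_map_fst'[OF cs])
  moreover have "continuous_map ?D (top_of_set A) (%x. snd (s x))"
   by (rule continuous_map_top_of_setI[OF cm]) (use that in auto)
  ultimately have "continuous_map ?D (PS S A) (%x. (fst (s x), snd (s x)))" by (rule continuous_map_pairedI)
  thus ?thesis using ext by (simp add: singular_simplex_def)
 qed
 ultimately show ?thesis by auto
qed

lemma upper_part_simplex: shows "singular_simplex p (PS S UH) s ==> upper_part (frag_of s) = frag_of s"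
  and "singular_simplex p (PS S LH) s ==> upper_part (frag_of s) = 0"
proof -
 have mem: "snd (s (%j. if j = 0 then 1 else 0)) \<in> A" if "singular_simplex p (PS S A) s" for A proof -
  have "s (%j. if j = 0 then 1 else 0) \<in> topspace (PS S A)"
   by (rule continuous_map_image_subset_topspace[THEN subsetD, of "subtopology (powertop_real UNIV) (standard_simplex p)"])
    (use that in "auto simp: singular_simplex_def intro!: imageI")
  thus ?thesis by auto
 qed
 show "singular_simplex p (PS S UH) s ==> upper_part (frag_of s) = frag_of s" using mem[of UH] by (simp add: upper_part_def)
 show "singular_simplex p (PS S LH) s ==> upper_part (frag_of s) = 0" using mem[of LH] by (simp add: upper_part_def)
qed

lemma upper_part_diff: "upper_part (a - b) = upper_part a - upper_part b"
 by (simp add: upper_part_def frag_extend_diff)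
lemma upper_part_0 [simp]: "upper_part 0 = 0" by (simp add: upper_part_def)
lemma upper_part_cmul: "upper_part (frag_cmul k a) = frag_cmul k (upper_part a)"
 by (simp add: upper_part_def frag_extend_cmul)
lemma upper_part_sum: "finite A ==> upper_part (sum f A) = (\<Sum>a\<in>A. upper_part (f a))"
 by (simp add: upper_part_def frag_extend_sum o_def)

lemma upper_part:
 assumes "singular_chain p (PS S NR) c" shows "singular_chain p (PS S UH) (upper_part c)"
  and "singular_chain p (PS S LH) (c - upper_part c)"
  and "chain_boundary p (upper_part c) = upper_part (chain_boundary p c)"
proof -
 have "singular_chain p (PS S UH) (upper_part c) & singular_chain p (PS S LH) (c - upper_part c) &
  chain_boundary p (upper_part c) = upper_part (chain_boundary p c)"
  using assms unfolding singular_chain_def[of p "PS S NR"] proof (induction rule: frag_induction)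
  case (one s)
  have sf: "singular_simplex (p - 1) (PS S A) (singular_face p k s)"
   if "singular_simplex p (PS S A) s" "k <= p" "p ~= 0" for A k
   using singular_simplex_singular_face[OF that(1), of k] that by auto
  from one upper_or_lower_simplex[of p S s] consider
   "singular_simplex p (PS S UH) s" | "singular_simplex p (PS S LH) s" by auto
  thus ?case proof cases
   case 1
   have "upper_part (frag_of (singular_face p k s)) = frag_of (singular_face p k s)" if "k <= p" "p ~= 0" for k
    by (rule upper_part_simplex(1)[OF sf[OF 1 that]])
   thus ?thesis
    using 1 by (auto simp: upper_part_simplex(1)[OF 1] singular_chain_of chain_boundary_of upper_part_sum upper_part_cmul
      simp del: sum.atMost_Suc)
  next
   case 2
   have "upper_part (frag_of (singular_face p k s)) = 0" if "k <= p" "p ~= 0" for k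
    by (rule upper_part_simplex(2)[OF sf[OF 2 that]])
   thus ?thesis
    using 2 by (auto simp: upper_part_simplex(2)[OF 2] singular_chain_of chain_boundary_of upper_part_sum upper_part_cmul
      simp del: sum.atMost_Suc)
  qed
 next
  case (diff a b)
  have "a - b - upper_part (a - b) = (a - upper_part a) - (b - upper_part b)" by (simp add: upper_part_diff)
  with diff singular_chain_diff[of p "PS S LH" "a - upper_part a" "b - upper_part b"]
   singular_chain_diff[of p "PS S UH" "upper_part a" "upper_part b"]
  show ?case by (simp only: upper_part_diff chain_boundary_diff)
 qed auto
 thus "singular_chain p (PS S UH) (upper_part c)"
  "singular_chain p (PS S LH) (c - upper_part c)"
  "chain_boundary p (upper_part c) = upper_part (chain_boundary p c)" by auto
qed

abbreviation (input) "Uslit \<equiv> {z::complex. Im z ~= 0 | Re z > 0}"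
abbreviation (input) "Vslit \<equiv> {z::complex. Im z ~= 0 | Re z < 0}"

lemma star_UH: "z \<in> UH ==> 0 <= t ==> t <= 1 ==> (1 - complex_of_real t) * \<i> + complex_of_real t * z \<in> UH"
 by (cases "t = 0") (auto intro: add_nonneg_pos)

lemma star_LH: "z \<in> LH ==> 0 <= t ==> t <= 1 ==> (1 - complex_of_real t) * (-\<i>) + complex_of_real t * z \<in> LH"
proof -
 assume z: "z \<in> LH" and t: "0 <= t" "t <= 1"
 show ?thesis proof (cases "t = 0")
  case False
  hence "t * Im z < 0" using z t by (simp add: mult_pos_neg)
  thus ?thesis using t by simp
 qed auto
qed

lemma star_Uslit: "z \<in> Uslit ==> 0 <= t ==> t <= 1 ==> (1 - complex_of_real t) * 1 + complex_of_real t * z \<in> Uslit"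
 by (cases "t = 0") (auto intro: add_nonneg_pos)

lemma star_Vslit: "z \<in> Vslit ==> 0 <= t ==> t <= 1 ==> (1 - complex_of_real t) * (-1) + complex_of_real t * z \<in> Vslit"
 by (cases "t = 0") (auto simp: mult_pos_neg intro!: add_nonpos_neg)

text \<open>Excision of the negative real half axis, which is closed and lies in the open set
  \<open>Vslit\<close>, from the punctured plane relative to \<open>Vslit\<close>: what remains is
  \<open>Uslit\<close> relative to the two open half planes.\<close>

lemma chain_split_slit:
 assumes c: "cycle p (PS S (-{0})) c"
 obtains a e g where "singular_chain p (PS S Uslit) a" "singular_chain p (PS S Vslit) e"
  "singular_chain (Suc p) (PS S (-{0})) g" "c = a + e + chain_boundary (Suc p) g"
  "singular_chain (p - 1) (PS S NR) (chain_boundary p a)"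
proof -
 let ?T = "PS S (-{0})" and ?N = "{z::complex. Im z = 0 & Re z < 0}"
 have N1: "closedin (top_of_set (-{0})) ?N" proof -
  have N: "?N = (-{0}) \<inter> {z. Im z = 0 & Re z <= 0}" by (auto simp: complex_eq_iff less_le)
  have "closed {z. Im z = 0 & Re z <= 0}"
   by (intro closed_Collect_conj closed_Collect_eq closed_Collect_le continuous_intros)
  thus ?thesis unfolding N by (rule closedin_closed_Int)
 qed
 have V1: "openin (top_of_set (-{0})) Vslit" proof -
  have "open {z::complex. Im z ~= 0}" "open {z. Re z < 0}"
   by (intro open_Collect_neq open_Collect_less continuous_intros)+
  moreover have "Vslit = {z. Im z ~= 0} \<union> {z. Re z < 0}" by auto
  ultimately have "open Vslit" by (simp add: open_Un)
  thus ?thesis by (rule open_subset[rotated]) auto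
 qed
 have cl: "?T closure_of (topspace S \<times> ?N) = topspace S \<times> ?N"
  by (rule closure_of_closedin) (simp add: closedin_prod_Times_iff N1)
 have int: "?T interior_of (topspace S \<times> Vslit) = topspace S \<times> Vslit"
  by (rule interior_of_openin) (unfold openin_prod_Times_iff, use V1 in blast)
 have sub: "subtopology ?T (topspace S \<times> A) = PS S A" if "A <= -{0}" for A
  using that by (simp add: subtopology_Times subtopology_subtopology inf.absorb2)
 have c': "singular_relcycle p (subtopology ?T (topspace ?T)) (topspace S \<times> Vslit) c" proof -
  have "singular_chain p ?T c" "chain_boundary p c = 0" using c by (simp_all add: singular_cycle)
  thus ?thesis unfolding singular_relcycle subtopology_topspace by (simp only: singular_chain_0 simp_thms)
 qed
 obtain a where a: "singular_relcycle p (subtopology ?T (topspace ?T - topspace S \<times> ?N)) (topspace S \<times> Vslit - topspace S \<times> ?N) a"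
  and h: "homologous_rel p (subtopology ?T (topspace ?T)) (topspace S \<times> Vslit) c a"
 proof (rule excised_relcycle_exists[OF _ _ c', of "topspace S \<times> ?N"])
  show "?T closure_of (topspace S \<times> ?N) <= ?T interior_of (topspace S \<times> Vslit)" unfolding cl int by blast
  show "topspace S \<times> Vslit <= topspace ?T" by auto
 qed (rule that)
 have e1: "subtopology ?T (topspace ?T - topspace S \<times> ?N) = PS S Uslit" proof -
  have "topspace ?T - topspace S \<times> ?N = topspace S \<times> Uslit" by (auto simp: complex_eq_iff)
  thus ?thesis using sub[of Uslit] by auto
 qed
 have e2: "subtopology (PS S Uslit) (topspace S \<times> Vslit - topspace S \<times> ?N) = PS S NR" proof -
  have "Uslit \<inter> (Vslit - ?N) = NR" by auto
  thus ?thesis unfolding Times_Diff_distrib1[symmetric] Sigma_Diff_distrib2[symmetric]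
   by (simp add: subtopology_Times subtopology_subtopology)
 qed
 have a1: "singular_chain p (PS S Uslit) a" and a2: "singular_chain (p - 1) (PS S NR) (chain_boundary p a)"
  using a unfolding singular_relcycle e1 e2 by auto
 obtain g e where g: "singular_chain (Suc p) ?T g" and e: "singular_chain p (subtopology ?T (topspace S \<times> Vslit)) e"
  and "chain_boundary (Suc p) g + e = c - a"
  using h unfolding homologous_rel_def singular_relboundary subtopology_topspace by blast
 hence eq: "c = a + e + chain_boundary (Suc p) g" by (simp add: algebra_simps)
 have e3: "subtopology ?T (topspace S \<times> Vslit) = PS S Vslit" by (rule sub) auto
 show thesis by (rule that[OF a1 e[unfolded e3] g eq a2])
qed

lemma homol_section_path:
 fixes g :: "real => complex"
 assumes c: "cycle p S c" and g: "continuous_on {0..1} g" "g ` {0..1} <= A"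
 shows "homol p (PS S A) (chain_map p (%b. (b, g 1)) c) (chain_map p (%b. (b, g 0)) c)"
proof -
 have "continuous_map (prod_topology S I01) (top_of_set A) (%x. g (snd x))" proof -
  have "continuous_map I01 (top_of_set A) g" using g by auto
  hence "continuous_map (prod_topology S I01) (top_of_set A) (g \<circ> snd)"
   by (rule continuous_map_compose[OF continuous_map_snd])
  thus ?thesis by (simp add: o_def)
 qed
 hence "continuous_map (prod_topology S I01) (PS S A) (%x. (fst x, g (snd x)))"
  by (intro continuous_map_pairedI continuous_map_fst)
 from homol_homotopy[OF this c] show ?thesis by simp
qed

text \<open>Mayer-Vietoris for the two slit planes, made explicit. The boundary of the part in
  \<open>Uslit\<close> lives over the two half planes; its upper half projects to the base cycle
  that is needed, up to sign. Cylinders over the half circles close both parts to cycles with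
  star-shaped fibres, which are homologous to sections. In degree 0 nothing has to be
  closed.\<close>

theorem homol_punctured_plane:
 fixes S :: "'a topology"
 assumes c: "cycle p (PS S (-{0})) c"
 shows "(p = 0 & homol p (PS S (-{0})) c (chain_map p (%b. (b,1)) (chain_map p fst c))) |
  (EX k \<gamma>. p = Suc k & cycle k S \<gamma> &
   homol p (PS S (-{0})) c (chain_map p (%b. (b,1)) (chain_map p fst c) + tor k \<gamma>))"
proof -
 let ?T = "PS S (-{0})"
 obtain a e g where a: "singular_chain p (PS S Uslit) a" and e: "singular_chain p (PS S Vslit) e"
  and g: "singular_chain (Suc p) ?T g" and ceq: "c = a + e + chain_boundary (Suc p) g"
  and ba: "singular_chain (p - 1) (PS S NR) (chain_boundary p a)" by (rule chain_split_slit[OF c])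
 have to1: "homol p ?T (chain_map p (%b. (b,-1)) \<beta>) (chain_map p (%b. (b,1)) \<beta>)" if "cycle p S \<beta>" for \<beta>
 proof -
  have "continuous_on {0..1} (%t. cis (pi * t))" by (intro continuous_intros)
  from homol_section_path[OF that this, of "-{0}"] show ?thesis by (auto simp: image_iff)
 qed
 have U: "homol p ?T x (chain_map p (%b. (b,1)) (chain_map p fst x))" if "cycle p (PS S Uslit) x" for x
  by (rule PS_mono_homol[OF star_retract[OF that star_Uslit]]) auto
 have V: "homol p ?T x (chain_map p (%b. (b,1)) (chain_map p fst x))" if x: "cycle p (PS S Vslit) x" for x
 proof -
  have "homol p ?T x (chain_map p (%b. (b,-1)) (chain_map p fst x))"
   by (rule PS_mono_homol[OF star_retract[OF x star_Vslit]]) auto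
  moreover have "cycle p S (chain_map p fst x)" by (rule cycle_chain_map[OF x continuous_map_fst])
  ultimately show ?thesis using to1 homologous_rel_trans by blast
 qed
 have g': "homol p ?T (chain_boundary (Suc p) g) 0" unfolding homol_iff using g by auto
 show ?thesis proof (cases p)
  case 0
  have "cycle p (PS S Uslit) a" "cycle p (PS S Vslit) e"
   using a e 0 by (auto simp: singular_cycle chain_boundary_def)
  hence h: "homol p ?T c (chain_map p (%b. (b,1)) (chain_map p fst (a + e)))"
   unfolding ceq chain_map_add using homologous_rel_add[OF homologous_rel_add[OF U V] g'] by simp
  from homol_chain_map[OF homol_chain_map[OF this continuous_map_fst] continuous_map_section[of 1 "-{0}" S]]
  have "homol p ?T (chain_map p (%b. (b,1)) (chain_map p fst c)) (chain_map p (%b. (b,1)) (chain_map p fst (a + e)))"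
   by (simp add: chain_map_chain_map)
  with h have "homol p ?T c (chain_map p (%b. (b,1)) (chain_map p fst c))"
   using homologous_rel_trans homologous_rel_sym by blast
  with 0 show ?thesis by blast
 next
  case (Suc k)
  define z where "z = chain_boundary p a"
  have z: "singular_chain k (PS S NR) z" using ba Suc by (simp add: z_def)
  have "singular_chain p (PS S Uslit) a" by (rule a)
  hence bz: "chain_boundary k z = 0" using chain_boundary_boundary[OF a] Suc by (simp add: z_def)
  define zp where "zp = upper_part z"
  define zm where "zm = z - zp"
  have zp: "cycle k (PS S UH) zp" using upper_part[OF z] bz by (simp add: zp_def singular_cycle)
  have zm: "cycle k (PS S LH) zm"
   using upper_part[OF z] bz by (simp add: zm_def zp_def singular_cycle chain_boundary_diff)
  define \<gamma> where "\<gamma> = chain_map k fst zp"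
  define \<gamma>' where "\<gamma>' = chain_map k fst zm"
  have \<gamma>: "cycle k S \<gamma>" unfolding \<gamma>_def by (rule cycle_chain_map[OF zp continuous_map_fst])
  have gc: "singular_chain k S \<gamma>" "chain_boundary k \<gamma> = 0" using \<gamma> by (auto simp: singular_cycle)
  obtain dp where dp: "singular_chain p (PS S UH) dp" "chain_boundary p dp = zp - chain_map k (%b. (b,\<i>)) \<gamma>"
   using star_retract[OF zp star_UH] Suc unfolding homol_iff \<gamma>_def by auto
  obtain dm where dm: "singular_chain p (PS S LH) dm" "chain_boundary p dm = zm - chain_map k (%b. (b,-\<i>)) \<gamma>'"
   using star_retract[OF zm star_LH] Suc unfolding homol_iff \<gamma>'_def by auto
  \<comment> \<open>The projection of \<open>a\<close>, placed over -i. Its boundary cancels the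
    contribution of \<open>\<gamma>'\<close> and leaves \<open>\<gamma>\<close> over i and -i, which
    is what the half circles can absorb.\<close>
  define m where "m = chain_map p (%b. (b,-\<i>)) (chain_map p fst a)"
  have pa: "singular_chain p S (chain_map p fst a)" by (rule singular_chain_chain_map[OF a continuous_map_fst])
  have m: "singular_chain p (PS S {-\<i>}) m"
   unfolding m_def by (rule singular_chain_chain_map[OF pa continuous_map_section]) simp
  have bm: "chain_boundary p m = chain_map k (%b. (b,-\<i>)) \<gamma> + chain_map k (%b. (b,-\<i>)) \<gamma>'"
  proof -
   have "chain_boundary p m = chain_map (p - Suc 0) (%b. (b,-\<i>)) (chain_map (p - Suc 0) fst z)"
    by (simp only: m_def chain_boundary_chain_map[OF pa] chain_boundary_chain_map[OF a] z_def)
   also have "z = zp + zm" by (simp add: zm_def)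
   finally show ?thesis by (simp add: Suc chain_map_add \<gamma>_def \<gamma>'_def)
  qed
  define PU where "PU = halfcirc 1 k \<gamma>"
  define PV where "PV = halfcirc (-1) k \<gamma>"
  have PU: "singular_chain p (PS S Uslit) PU" unfolding PU_def Suc
  proof (rule singular_chain_halfcirc[OF gc(1)])
   fix t :: real assume "0 <= t" "t <= 1"
   thus "1 * arc t \<in> Uslit" using Re_arc[of t] arc_simps(3)[of t] by (auto simp: complex_eq_iff)
  qed
  have PV: "singular_chain p (PS S Vslit) PV" unfolding PV_def Suc
  proof (rule singular_chain_halfcirc[OF gc(1)])
   fix t :: real assume "0 <= t" "t <= 1"
   thus "-1 * arc t \<in> Vslit" using Re_arc[of t] arc_simps(3)[of t] by (auto simp: complex_eq_iff)
  qed
  have bPU: "chain_boundary p PU = chain_map k (%b. (b,-\<i>)) \<gamma> - chain_map k (%b. (b,\<i>)) \<gamma>"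
   and bPV: "chain_boundary p PV = chain_map k (%b. (b,\<i>)) \<gamma> - chain_map k (%b. (b,-\<i>)) \<gamma>"
   using chain_boundary_halfcirc[OF gc(1)] gc(2) by (auto simp: PU_def PV_def Suc)
  \<comment> \<open>Both parts are corrected by the same retraction chains with opposite signs, so
    their sum changes only by the two half circles.\<close>
  define CU where "CU = a - dp - dm - m + PU"
  define CV where "CV = e + dp + dm + m + PV"
  have be: "chain_boundary p e = - z" proof -
   have "0 = chain_boundary p c" using c by (simp add: singular_cycle)
   also have "... = z + chain_boundary p e"
    using chain_boundary_boundary_alt[OF g] by (simp add: ceq chain_boundary_add z_def)
   finally show ?thesis by (simp add: eq_neg_iff_add_eq_0 add.commute)
  qed
  have CU: "cycle p (PS S Uslit) CU" unfolding singular_cycle proof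
   show "singular_chain p (PS S Uslit) CU" unfolding CU_def
    by (intro singular_chain_add singular_chain_diff a PU PS_mono_chain[OF dp(1)] PS_mono_chain[OF dm(1)] PS_mono_chain[OF m]) auto
   show "chain_boundary p CU = 0"
    by (simp add: CU_def chain_boundary_add chain_boundary_diff dp(2) dm(2) bm bPU flip: z_def) (simp add: zm_def)
  qed
  have CV: "cycle p (PS S Vslit) CV" unfolding singular_cycle proof
   show "singular_chain p (PS S Vslit) CV" unfolding CV_def
    by (intro singular_chain_add singular_chain_diff e PV PS_mono_chain[OF dp(1)] PS_mono_chain[OF dm(1)] PS_mono_chain[OF m]) auto
   show "chain_boundary p CV = 0"
    by (simp add: CV_def chain_boundary_add chain_boundary_diff dp(2) dm(2) bm bPV be) (simp add: zm_def)
  qed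
  have circ_eq: "circ k \<gamma> = PU + PV" by (simp add: circ_def PU_def PV_def)
  have ceq2: "c = CU + CV + chain_boundary (Suc p) g - circ k \<gamma>"
   unfolding ceq circ_eq CU_def CV_def by simp
  define \<beta> where "\<beta> = chain_map p fst CU + chain_map p fst CV"
  have h: "homol p ?T c (chain_map p (%b. (b,1)) \<beta> - circ k \<gamma>)"
   unfolding ceq2 \<beta>_def chain_map_add
   using homologous_rel_diff[OF homologous_rel_add[OF homologous_rel_add[OF U[OF CU] V[OF CV]] g'] homologous_rel_refl] by simp
  \<comment> \<open>Projecting the relation and reinserting it over 1 eliminates the unknown
    \<open>\<beta>\<close> in favour of the projection of \<open>c\<close>; the subtraction produces
    \<open>tor\<close> instead of \<open>circ\<close>.\<close>
  from homol_chain_map[OF homol_chain_map[OF this continuous_map_fst] continuous_map_section[of 1 "-{0}" S]]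
  have "homol p ?T (chain_map p (%b. (b,1)) (chain_map p fst c))
   (chain_map p (%b. (b,1)) \<beta> - chain_map p (%x. (fst x,1)) (circ k \<gamma>))"
   by (simp add: chain_map_chain_map chain_map_diff)
  from homologous_rel_diff[OF h this]
  have "homol p ?T (c - chain_map p (%b. (b,1)) (chain_map p fst c)) (tor k (- \<gamma>))"
   by (simp add: tor_minus) (simp add: tor_def Suc)
  from homologous_rel_add[OF this homologous_rel_refl[of p ?T "{}" "chain_map p (%b. (b,1)) (chain_map p fst c)"]]
  have "homol p ?T c (chain_map p (%b. (b,1)) (chain_map p fst c) + tor k (- \<gamma>))" by (simp add: add.commute)
  moreover have "cycle k S (- \<gamma>)" using \<gamma> by (simp add: singular_relcycle_minus)
  ultimately show ?thesis using Suc by blast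
 qed
qed

section \<open>Complements of disjoint sections\<close>

text \<open>Complex functionals on homology, expressed on cycles: additivity is demanded there only,
  and boundaries are killed. The quotient itself is never formed.\<close>

definition hom_fun :: "nat => 'a topology => ('a chain => complex) => bool" where
 "hom_fun p S \<phi> \<longleftrightarrow> (ALL a b. singular_relcycle p S {} a --> singular_relcycle p S {} b --> \<phi> (a + b) = \<phi> a + \<phi> b) &
   (ALL c. singular_relboundary p S {} c --> \<phi> c = 0)"

lemma hom_fun_add: "hom_fun p S \<phi> ==> cycle p S a ==> cycle p S b ==> \<phi> (a + b) = \<phi> a + \<phi> b"
 by (simp add: hom_fun_def)

lemma hom_fun_0: "hom_fun p S \<phi> ==> \<phi> 0 = 0" by (simp add: hom_fun_def)

lemma hom_fun_homol:
 assumes "hom_fun p S \<phi>" "homol p S a b" "cycle p S b" shows "\<phi> a = \<phi> b"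
proof -
 have "singular_relboundary p S {} (a - b)" using assms(2) by (simp add: homologous_rel_def)
 hence "\<phi> (a - b) = 0" "cycle p S (a - b)"
  using assms(1) singular_relboundary_imp_relcycle by (auto simp: hom_fun_def)
 thus ?thesis using hom_fun_add[OF assms(1) _ assms(3), of "a - b"] by simp
qed

lemma hom_fun_sum:
 assumes "hom_fun p S \<phi>" "finite I" "!!i. i \<in> I ==> cycle p S (f i)"
 shows "\<phi> (\<Sum>i\<in>I. f i) = (\<Sum>i\<in>I. \<phi> (f i))" using assms(2,3)
 by (induction I rule: finite_induct) (auto simp: hom_fun_0[OF assms(1)] hom_fun_add[OF assms(1)] singular_relcycle_sum)

lemma hom_fun_chain_map:
 assumes "hom_fun p T \<phi>" "continuous_map S T f" shows "hom_fun p S (%c. \<phi> (chain_map p f c))"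
 using assms cycle_chain_map[OF _ assms(2)] singular_relboundary_chain_map[OF _ assms(2), of p "{}" _ "{}"]
 by (auto simp: hom_fun_def chain_map_add)

lemma hom_fun_tor:
 assumes "hom_fun (Suc k) (PS S (-{0})) \<phi>" shows "hom_fun k S (%c. \<phi> (tor k c))"
 using assms cycle_tor[of k S] boundary_tor[of k S] by (auto simp: hom_fun_def tor_add)

lemma hom_fun_diff: "hom_fun p S f ==> hom_fun p S g ==> hom_fun p S (%c. f c - g c)"
 by (auto simp: hom_fun_def)

lemma hom_fun_lincomb: "finite I ==> (!!i. i \<in> I ==> hom_fun p S (f i)) ==> hom_fun p S (%c. \<Sum>i\<in>I. a i * f i c)"
 by (auto simp: hom_fun_def sum.distrib distrib_left)

text \<open>Finitely many disjoint sections of a trivial plane bundle over \<open>S\<close>; the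
  open disc of radius \<open>r k\<close> around section \<open>k\<close> contains no other
  section.\<close>

locale sections =
 fixes S :: "'b topology" and K :: "'k set" and s :: "'k => 'b => complex" and r :: "'k => 'b => real"
 assumes finK: "finite K" and cont_s: "!!k. k \<in> K ==> continuous_map S euclidean (s k)"
  and cont_r: "!!k. k \<in> K ==> continuous_map S euclideanreal (r k)"
  and r_pos: "!!k b. k \<in> K ==> b \<in> topspace S ==> r k b > 0"
  and r_le: "!!j k b. j \<in> K ==> k \<in> K ==> j ~= k ==> b \<in> topspace S ==> r k b <= norm (s j b - s k b)"
begin

definition E :: "'k set => ('b \<times> complex) topology" where
 "E J = subtopology (prod_topology S euclidean) {x. ALL k:J. snd x ~= s k (fst x)}"

text \<open>Radial compression of the punctured plane onto the punctured open disc of radius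
  \<open>r k\<close> around section \<open>k\<close>; \<open>fwd\<close> is its inverse.\<close>

definition emb :: "'k => 'b \<times> complex => 'b \<times> complex" where
 "emb k x = (fst x, s k (fst x) + of_real (r k (fst x) / (1 + norm (snd x))) * snd x)"

lemma topspace_E: "topspace (E J) = {x. fst x \<in> topspace S & (ALL k:J. snd x ~= s k (fst x))}"
 by (auto simp: E_def)

lemma E_subtopology: "J <= J' ==> subtopology (E J) {x. ALL k:J'. snd x ~= s k (fst x)} = E J'"
 unfolding E_def subtopology_subtopology by (rule arg_cong[where f = "subtopology _"]) auto

lemma E_chain_mono: "J <= J' ==> singular_chain p (E J') c ==> singular_chain p (E J) c"
 by (simp flip: E_subtopology[of J J'] add: singular_chain_subtopology[of _ "E J"])

lemma E_cycle_mono: "J <= J' ==> cycle p (E J') c ==> cycle p (E J) c"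
 using E_chain_mono unfolding singular_cycle by blast

lemma cont_fst_E: "continuous_map (E J) S fst"
 unfolding E_def by (intro continuous_map_from_subtopology continuous_map_fst)

lemma cont_snd_E: "continuous_map (E J) euclidean snd"
 unfolding E_def by (intro continuous_map_from_subtopology continuous_map_snd)

lemma cont_into_E:
 assumes "continuous_map T S f" "continuous_map T euclidean g" "!!x k. x \<in> topspace T ==> k \<in> J ==> g x ~= s k (f x)"
 shows "continuous_map T (E J) (%x. (f x, g x))"
 using assms by (auto simp: E_def continuous_map_in_subtopology continuous_map_pairedI)

lemma cont_s': "k \<in> K ==> continuous_map T S f ==> continuous_map T euclidean (%x. s k (f x))"
 using continuous_map_compose[OF _ cont_s] by (auto simp: o_def)

lemma cont_r': "k \<in> K ==> continuous_map T S f ==> continuous_map T euclidean (%x. r k (f x))"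
 using continuous_map_compose[OF _ cont_r] by (auto simp: o_def)

lemma cont_PS_fst: "continuous_map (PS S A) S fst" and cont_PS_snd: "continuous_map (PS S A) euclidean snd"
 by (rule continuous_map_fst) (rule continuous_map_snd_into[OF continuous_map_id[unfolded id_def]])

lemma one_plus_norm_nz: "1 + norm z ~= 0"
 by (metis add_nonneg_pos add.commute less_irrefl norm_ge_zero zero_less_one)

lemma cont_emb:
 assumes k: "k \<in> K" shows "continuous_map (PS S (-{0})) (E K) (emb k)"
proof -
 have "continuous_map (PS S (-{0})) (E K) (%x. (fst x, s k (fst x) + of_real (r k (fst x) / (1 + norm (snd x))) * snd x))"
 proof (intro cont_into_E)
  show "continuous_map (PS S (-{0})) S fst" by (rule cont_PS_fst)
  have "continuous_map (PS S (-{0})) euclideanreal (%x. 1 + norm (snd x))"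
   by (intro continuous_map_add continuous_map_norm cont_PS_snd continuous_map_canonical_const)
  hence "continuous_map (PS S (-{0})) euclideanreal (%x. r k (fst x) / (1 + norm (snd x)))"
   by (rule continuous_map_real_divide[OF cont_r'[OF k cont_PS_fst]]) (rule one_plus_norm_nz)
  thus "continuous_map (PS S (-{0})) euclidean (%x. s k (fst x) + of_real (r k (fst x) / (1 + norm (snd x))) * snd x)"
   by (intro continuous_map_add continuous_map_mult_complex continuous_map_of_real_complex cont_s'[OF k] cont_PS_fst cont_PS_snd)
 next
  fix x j assume x: "x \<in> topspace (PS S (-{0}))" and j: "j \<in> K"
  let ?d = "of_real (r k (fst x) / (1 + norm (snd x))) * snd x"
  have b: "fst x \<in> topspace S" "snd x ~= 0" using x by auto
  have rp: "r k (fst x) > 0" using r_pos[OF k b(1)] .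
  have "r k (fst x) / (1 + norm (snd x)) ~= 0" using rp one_plus_norm_nz[of "snd x"] by simp
  hence nz: "?d ~= 0" using b(2) by (simp only: mult_eq_0_iff of_real_eq_0_iff simp_thms)
  have "norm ?d = r k (fst x) * (norm (snd x) / (1 + norm (snd x)))" proof -
   have "r k (fst x) / (1 + norm (snd x)) > 0" using rp by (simp add: add_pos_nonneg)
   thus ?thesis by (simp only: norm_mult norm_of_real abs_of_pos times_divide_eq_left times_divide_eq_right)
  qed
  also have "... < r k (fst x)" proof -
   have "1 + norm (snd x) > 0" by (simp add: add_pos_nonneg)
   hence "norm (snd x) / (1 + norm (snd x)) < 1" by (simp add: divide_less_eq)
   from mult_strict_left_mono[OF this rp] show ?thesis by simp
  qed
  finally have lt: "norm ?d < r k (fst x)" .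
  show "s k (fst x) + ?d ~= s j (fst x)" proof
   assume eq: "s k (fst x) + ?d = s j (fst x)"
   show False proof (cases "j = k")
    case True
    thus ?thesis using eq nz by simp
   next
    case False
    have "?d = s j (fst x) - s k (fst x)" using eq by (simp add: algebra_simps)
    hence "r k (fst x) <= norm ?d" using r_le[OF j k False b(1)] by simp
    with lt show ?thesis by simp
   qed
  qed
 qed
 thus ?thesis by (simp add: emb_def[abs_def])
qed

definition fwd :: "'k => 'b \<times> complex => 'b \<times> complex" where
 "fwd k x = (fst x, (snd x - s k (fst x)) / of_real (r k (fst x) - norm (snd x - s k (fst x))))"

lemma emb_fwd:
 assumes "k \<in> K" "fst x \<in> topspace S" "norm (snd x - s k (fst x)) < r k (fst x)"
 shows "emb k (fwd k x) = x"
proof -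
 let ?v = "snd x - s k (fst x)" and ?r = "r k (fst x)"
 have p: "?r - norm ?v > 0" "?r > 0" using assms r_pos by auto
 have "1 + norm (?v / of_real (?r - norm ?v)) = ?r / (?r - norm ?v)"
  using p by (simp add: norm_divide field_simps del: of_real_diff)
 hence "of_real (?r / (1 + norm (?v / of_real (?r - norm ?v)))) * (?v / of_real (?r - norm ?v)) = ?v"
  using p by (simp del: of_real_diff)
 thus ?thesis by (simp add: emb_def fwd_def prod_eq_iff)
qed

text \<open>Induction on the sections removed. In the complement of fewer sections the cycle is
  homologous to a standard one; excision confines the bounding chain to the disc bundle around the
  new section, and its boundary, a cycle in the punctured discs, is known from
  \<open>homol_punctured_plane\<close>.\<close>

theorem generation:
 assumes sec: "continuous_map S (E K) sec" "!!b. b \<in> topspace S ==> fst (sec b) = b"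
  and J: "J <= K" and c: "cycle p (E J) c"
 shows "EX \<beta> \<gamma>. cycle p S \<beta> & (ALL k:J. cycle (p - 1) S (\<gamma> k)) &
  homol p (E J) c (chain_map p sec \<beta> + (if p = 0 then 0 else \<Sum>k\<in>J. chain_map p (emb k) (tor (p - 1) (\<gamma> k))))"
proof -
 have "finite J" using J finK finite_subset by blast
 thus ?thesis using J c proof (induction J arbitrary: c rule: finite_induct)
  case empty
  have E0: "E {} = PS S UNIV" by (simp add: E_def)
  have c: "cycle p (PS S UNIV) c" using empty E0 by simp
  have st: "homol p (PS S UNIV) x (chain_map p (%b. (b, 0)) (chain_map p fst x))" if "cycle p (PS S UNIV) x" for x
   by (rule star_retract[OF that]) auto
  let ?b = "chain_map p fst c"
  have b: "cycle p S ?b" by (rule cycle_chain_map[OF c cont_PS_fst])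
  have "continuous_map S (E {}) sec" using sec(1) unfolding E_def by (auto simp: continuous_map_in_subtopology)
  hence "cycle p (PS S UNIV) (chain_map p sec ?b)" using cycle_chain_map[OF b] E0 by metis
  from st[OF this] have "homol p (PS S UNIV) (chain_map p sec ?b) (chain_map p (%b. (b, 0)) (chain_map p fst (chain_map p sec ?b)))" .
  also have "chain_map p fst (chain_map p sec ?b) = ?b"
   unfolding chain_map_chain_map[of p fst sec] using b sec(2) by (intro chain_map_id_gen[of p S]) (auto simp: singular_cycle)
  finally have "homol p (PS S UNIV) c (chain_map p sec ?b)"
   using st[OF c] homologous_rel_trans homologous_rel_sym by blast
  thus ?case using b E0 by (auto intro!: exI[of _ ?b])
 next
  case (insert k J)
  let ?J = "insert k J"
  have k: "k \<in> K" and JK: "J <= K" using insert by auto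
  have cJ: "cycle p (E J) c" by (rule E_cycle_mono[OF _ insert.prems(2)]) auto
  obtain \<beta> \<gamma> where \<beta>: "cycle p S \<beta>" and \<gamma>: "ALL k:J. cycle (p - 1) S (\<gamma> k)" and
   h: "homol p (E J) c (chain_map p sec \<beta> + (if p = 0 then 0 else \<Sum>k\<in>J. chain_map p (emb k) (tor (p - 1) (\<gamma> k))))"
   using insert.IH[OF JK cJ] by blast
  define W where "W = chain_map p sec \<beta> + (if p = 0 then 0 else \<Sum>k\<in>J. chain_map p (emb k) (tor (p - 1) (\<gamma> k)))"
  \<comment> \<open>\<open>W\<close> avoids all sections of \<open>K\<close>, hence also the new
    one. This is the reason for letting \<open>sec\<close> and the tubes avoid all of
    \<open>K\<close> throughout the induction on \<open>J\<close>.\<close>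
  have W: "cycle p (E K) W" proof -
   have "cycle p (E K) (chain_map p (emb j) (tor (p - 1) (\<gamma> j)))" if "j \<in> J" "p ~= 0" for j
    using cycle_chain_map[OF cycle_tor cont_emb, of "p - 1" "\<gamma> j" j] that \<gamma> JK by auto
   moreover have "cycle p (E K) (chain_map p sec \<beta>)" by (rule cycle_chain_map[OF \<beta> sec(1)])
   ultimately show ?thesis unfolding W_def
    by (cases "p = 0") (auto intro!: singular_relcycle_add singular_relcycle_sum)
  qed
  obtain D where D: "singular_chain (Suc p) (E J) D" "chain_boundary (Suc p) D = c - W"
   using h unfolding W_def[symmetric] homol_iff by blast
  have cX: "cycle p (E ?J) (c - W)"
   by (rule singular_relcycle_diff[OF insert.prems(2) E_cycle_mono[OF insert.prems(1) W]])
  let ?A = "{x. ALL k:?J. snd x ~= s k (fst x)}"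
  \<comment> \<open>The complement of the open disc bundle around section \<open>k\<close>; it is
    closed and misses that section, so it may be excised.\<close>
  let ?Z = "{x \<in> topspace (E J). r k (fst x) <= norm (snd x - s k (fst x))}"
  have EA: "subtopology (E J) ?A = E ?J" by (rule E_subtopology) auto
  have Acap: "topspace (E J) \<inter> ?A = {x \<in> topspace (E J). snd x - s k (fst x) ~= 0}" by (auto simp: topspace_E)
  have cd: "continuous_map (E J) euclidean (%x. snd x - s k (fst x))"
   by (intro continuous_intros cont_snd_E cont_s'[OF k] cont_fst_E)
  have A_open: "openin (E J) (topspace (E J) \<inter> ?A)" proof -
   have "openin euclidean (-{0::complex})" by (simp add: open_Compl)
   from openin_continuous_map_preimage[OF cd this] show ?thesis unfolding Acap by simp
  qed
  have Z_closed: "closedin (E J) ?Z" proof -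
   have "continuous_map (E J) euclideanreal (%x. norm (snd x - s k (fst x)) - r k (fst x))"
    by (intro continuous_intros cd cont_r'[OF k] cont_fst_E)
   from closedin_continuous_map_preimage[OF this, of "{0..}"] show ?thesis by simp
  qed
  have ZA: "?Z <= topspace (E J) \<inter> ?A" proof
   fix x assume x: "x \<in> ?Z"
   hence "r k (fst x) > 0" using r_pos[OF k] by (auto simp: topspace_E)
   with x show "x \<in> topspace (E J) \<inter> ?A" unfolding Acap by auto
  qed
  have D2: "singular_relcycle (Suc p) (subtopology (E J) (topspace (E J))) (topspace (E J) \<inter> ?A) D"
  proof -
   have "singular_chain p (E ?J) (chain_boundary (Suc p) D)" using cX D(2) by (simp add: singular_cycle)
   thus ?thesis unfolding subtopology_topspace singular_relcycle_restrict
    using D(1) EA by (simp add: singular_relcycle)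
  qed
  obtain D' where D': "singular_relcycle (Suc p) (subtopology (E J) (topspace (E J) - ?Z)) (topspace (E J) \<inter> ?A - ?Z) D'"
   and hD: "homologous_rel (Suc p) (subtopology (E J) (topspace (E J))) (topspace (E J) \<inter> ?A) D D'"
  proof (rule excised_relcycle_exists[OF _ _ D2, of ?Z])
   show "E J closure_of ?Z <= E J interior_of (topspace (E J) \<inter> ?A)"
    unfolding closure_of_closedin[OF Z_closed] interior_of_openin[OF A_open] by (rule ZA)
  qed (use that in auto)
  obtain G e where G: "singular_chain (Suc (Suc p)) (E J) G" and e: "singular_chain (Suc p) (E ?J) e"
   and De: "chain_boundary (Suc (Suc p)) G + e = D - D'"
   using hD unfolding homologous_rel_def subtopology_topspace singular_relboundary_restrict singular_relboundary EA by blast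
  define y where "y = chain_boundary (Suc p) D'"
  have yeq: "c - W = y + chain_boundary (Suc p) e" proof -
   have "chain_boundary (Suc p) (D - D') = chain_boundary (Suc p) e"
    using chain_boundary_boundary_alt[OF G] De by (metis add.left_neutral chain_boundary_add)
   thus ?thesis using D(2) by (simp add: chain_boundary_diff y_def algebra_simps)
  qed
  let ?N = "subtopology (E J) (topspace (E J) - ?Z)"
  let ?N' = "subtopology ?N (topspace (E J) \<inter> ?A - ?Z)"
  have D'c: "singular_chain (Suc p) ?N D'" and yc: "singular_chain p ?N' y"
   using D' by (auto simp: singular_relcycle y_def)
  have by0: "chain_boundary p y = 0" unfolding y_def using chain_boundary_boundary[OF D'c] by simp
  have tN: "fst x \<in> topspace S & norm (snd x - s k (fst x)) < r k (fst x)" if "x \<in> topspace ?N" for x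
   using that by (auto simp: topspace_E)
  have cN1: "continuous_map ?N S fst" and cN2: "continuous_map ?N euclidean snd"
   by (intro continuous_map_from_subtopology cont_fst_E cont_snd_E)+
  have cfwd: "continuous_map ?N euclidean (%x. (snd x - s k (fst x)) / of_real (r k (fst x) - norm (snd x - s k (fst x))))"
  proof (intro continuous_map_divide_complex continuous_map_diff continuous_map_of_real_complex continuous_map_norm cN1 cN2 cont_s'[OF k] cont_r'[OF k])
   fix x assume "x \<in> topspace ?N"
   from tN[OF this] show "complex_of_real (r k (fst x) - norm (snd x - s k (fst x))) ~= 0"
    by (metis less_irrefl of_real_eq_0_iff right_minus_eq)
  qed
  have cfwd': "continuous_map ?N' (PS S (-{0})) (fwd k)" proof -
   have "continuous_map ?N' (PS S (-{0})) (%x. (fst x, (snd x - s k (fst x)) / of_real (r k (fst x) - norm (snd x - s k (fst x)))))"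
   proof (intro continuous_map_pairedI continuous_map_top_of_setI continuous_map_from_subtopology[OF cfwd] continuous_map_from_subtopology[OF cN1])
    fix x assume x: "x \<in> topspace ?N'"
    hence "x \<in> topspace ?N" "snd x - s k (fst x) ~= 0" by auto
    with tN[OF this(1)] show "(snd x - s k (fst x)) / of_real (r k (fst x) - norm (snd x - s k (fst x))) \<in> -{0}"
     by (simp del: of_real_diff)
   qed
   thus ?thesis by (simp add: fwd_def[abs_def])
  qed
  have ycyc: "cycle p ?N' y" using yc by0 by (simp add: singular_cycle)
  have fy: "cycle p (PS S (-{0})) (chain_map p (fwd k) y)" by (rule cycle_chain_map[OF ycyc cfwd'])
  have bf: "chain_map p (emb k) (chain_map p (fwd k) y) = y" proof -
   have "emb k (fwd k x) = x" if "x \<in> topspace ?N'" for x using tN[of x] that by (intro emb_fwd[OF k]) auto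
   thus ?thesis unfolding chain_map_chain_map by (rule chain_map_id_gen[OF yc])
  qed
  \<comment> \<open>The cycle \<open>y\<close> bounds in the disc bundle, so its projection bounds
    in the base; only the torus term of \<open>homol_punctured_plane\<close> survives.\<close>
  have proj: "homol p (PS S (-{0})) (chain_map p (%b. (b,1)) (chain_map p fst (chain_map p (fwd k) y))) 0"
  proof -
   have "chain_map p fst (chain_map p (fwd k) y) = chain_map p fst y" by (simp add: chain_map_chain_map fwd_def)
   also have "... = chain_boundary (Suc p) (chain_map (Suc p) fst D')"
    using chain_boundary_chain_map[OF D'c, of fst] by (simp add: y_def)
   finally have "homol p S (chain_map p fst (chain_map p (fwd k) y)) 0"
    unfolding homol_iff using singular_chain_chain_map[OF D'c cN1] by auto
   from homol_chain_map[OF this continuous_map_section] show ?thesis by auto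
  qed
  have emb': "continuous_map (PS S (-{0})) (E ?J) (emb k)"
   using cont_emb[OF k] insert.prems(1) unfolding E_def by (auto simp: continuous_map_in_subtopology)
  have eb: "homol p (E ?J) (chain_boundary (Suc p) e) 0" unfolding homol_iff using e by auto
  show ?case proof (cases p)
   case 0
   with homol_punctured_plane[OF fy] have "homol p (PS S (-{0})) (chain_map p (fwd k) y) 0"
    using proj homologous_rel_trans by blast
   from homol_chain_map[OF this emb'] bf have "homol p (E ?J) y 0" by simp
   from homologous_rel_add[OF this eb] have "homol p (E ?J) (c - W) 0" by (simp add: yeq)
   hence "homol p (E ?J) c W" by (simp add: homologous_rel_def)
   thus ?thesis using \<beta> 0 \<gamma> unfolding W_def by (auto intro!: exI[of _ \<beta>] exI[of _ "%_. 0"])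
  next
   case (Suc m)
   with homol_punctured_plane[OF fy] obtain g where g: "cycle m S g"
    and hg: "homol p (PS S (-{0})) (chain_map p (fwd k) y) (chain_map p (%b. (b,1)) (chain_map p fst (chain_map p (fwd k) y)) + tor m g)"
    by auto
   have "homol p (PS S (-{0})) (chain_map p (fwd k) y) (0 + tor m g)"
    using homologous_rel_trans[OF homologous_rel_add[OF proj homologous_rel_refl] hg] .
   from homol_chain_map[OF this emb'] bf have "homol p (E ?J) y (chain_map p (emb k) (tor m g))" by simp
   from homologous_rel_add[OF this eb] have "homol p (E ?J) (c - W) (chain_map p (emb k) (tor m g))" by (simp add: yeq)
   from homologous_rel_add[OF this homologous_rel_refl[of _ _ _ W]]
   have *: "homol p (E ?J) c (W + chain_map p (emb k) (tor m g))" by (simp add: add.commute)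
   have eq: "W + chain_map p (emb k) (tor m g) = chain_map p sec \<beta> +
     (if p = 0 then 0 else \<Sum>j\<in>?J. chain_map p (emb j) (tor (p - 1) ((\<gamma>(k := g)) j)))"
    using insert.hyps Suc by (auto simp: W_def add_ac intro!: sum.cong)
   show ?thesis using \<beta> \<gamma> g * insert.hyps Suc unfolding eq
    by (intro exI[of _ \<beta>] exI[of _ "\<gamma>(k := g)"]) auto
  qed
 qed
qed

corollary hom_fun_zero:
 assumes sec: "continuous_map S (E K) sec" "!!b. b \<in> topspace S ==> fst (sec b) = b"
  and l: "hom_fun p (E K) \<phi>"
  and l0: "!!\<beta>. cycle p S \<beta> ==> \<phi> (chain_map p sec \<beta>) = 0"
  and l1: "!!k m \<gamma>. k \<in> K ==> p = Suc m ==> cycle m S \<gamma> ==> \<phi> (chain_map p (emb k) (tor m \<gamma>)) = 0"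
  and c: "cycle p (E K) c" shows "\<phi> c = 0"
proof -
 obtain \<beta> \<gamma> where b: "cycle p S \<beta>" and g: "ALL k:K. cycle (p - 1) S (\<gamma> k)" and
  h: "homol p (E K) c (chain_map p sec \<beta> + (if p = 0 then 0 else \<Sum>k\<in>K. chain_map p (emb k) (tor (p - 1) (\<gamma> k))))"
  using generation[OF sec order_refl c] by blast
 have cs: "cycle p (E K) (chain_map p sec \<beta>)" by (rule cycle_chain_map[OF b sec(1)])
 show ?thesis proof (cases p)
  case 0
  thus ?thesis using hom_fun_homol[OF l h] cs l0[OF b] by simp
 next
  case (Suc m)
  have ct: "cycle p (E K) (chain_map p (emb k) (tor (p - 1) (\<gamma> k)))" if "k \<in> K" for k
   using cycle_chain_map[OF cycle_tor cont_emb, of "p - 1" "\<gamma> k" k] that g Suc by auto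
  have cS: "cycle p (E K) (\<Sum>k\<in>K. chain_map p (emb k) (tor (p - 1) (\<gamma> k)))"
   by (rule singular_relcycle_sum[OF ct])
  have "\<phi> c = \<phi> (chain_map p sec \<beta> + (\<Sum>k\<in>K. chain_map p (emb k) (tor (p - 1) (\<gamma> k))))"
   using hom_fun_homol[OF l h] singular_relcycle_add[OF cs cS] Suc by simp
  also have "... = 0 + (\<Sum>k\<in>K. \<phi> (chain_map p (emb k) (tor (p - 1) (\<gamma> k))))"
   using hom_fun_add[OF l cs cS] l0[OF b] hom_fun_sum[OF l finK ct] by simp
  also have "... = 0" using l1[of _ m] g Suc by (auto intro!: sum.neutral)
  finally show ?thesis .
 qed
qed

end

section \<open>Logarithmic cochains\<close>

definition linc :: "(real => complex) => complex" where
 "linc g = (SOME d. EX L. continuous_on {0..1} L & (ALL t:{0..1}. g t = exp (L t)) & d = L 1 - L 0)"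

text \<open>Two logarithms of the same path differ by a continuous function with values in the
  multiples of 2 pi i, hence by a constant. This makes the choice in \<open>linc\<close> harmless as
  soon as a logarithm exists.\<close>

lemma linc_eq:
 assumes L: "continuous_on {0..1} L" "!!t. 0 <= t ==> t <= 1 ==> g t = exp (L t)" shows "linc g = L 1 - L 0"
 unfolding linc_def
proof (rule some_equality)
 show "EX La. continuous_on {0..1} La & (ALL t:{0..1}. g t = exp (La t)) & L 1 - L 0 = La 1 - La 0"
  using L by (intro exI[of _ L]) auto
next
 fix d assume "EX L. continuous_on {0..1} L & (ALL t:{0..1}. g t = exp (L t)) & d = L 1 - L 0"
 then obtain M where M: "continuous_on {0..1} M" "ALL t:{0..1}. g t = exp (M t)" and d: "d = M 1 - M 0" by blast
 have ex: "EX n::int. M t - L t = of_int (2 * n) * of_real pi * \<i>" if t: "t \<in> {0..1}" for t proof -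
  have "exp (M t) = exp (L t)" using M(2) L(2) t by auto
  thus ?thesis by (auto simp: exp_eq algebra_simps)
 qed
 have "(%t. M t - L t) constant_on {0..1}" proof (rule continuous_discrete_range_constant)
  show "connected {0..1::real}" by simp
  show "continuous_on {0..1} (%t. M t - L t)" using M L by (intro continuous_intros)
  fix x :: real assume x: "x \<in> {0..1}"
  obtain n :: int where n: "M x - L x = of_int (2 * n) * of_real pi * \<i>" using ex[OF x] by blast
  show "EX e>0. ALL y. y \<in> {0..1} & M y - L y ~= M x - L x --> e <= cmod (M y - L y - (M x - L x))"
  proof (intro exI[of _ "2*pi"] conjI allI impI)
   show "0 < 2 * pi" by simp
   fix y assume y: "y \<in> {0..1} & M y - L y ~= M x - L x"
   obtain m :: int where m: "M y - L y = of_int (2 * m) * of_real pi * \<i>" using ex y by blast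
   have "m ~= n" using y m n by auto
   hence "\<bar>real_of_int (m - n)\<bar> \<ge> 1" by linarith
   moreover have "M y - L y - (M x - L x) = of_int (m - n) * of_real (2 * pi) * \<i>" unfolding m n by (simp add: algebra_simps)
   hence "cmod (M y - L y - (M x - L x)) = \<bar>real_of_int (m - n)\<bar> * (2 * pi)" by (simp only: norm_mult norm_of_real norm_of_int norm_ii) simp
   ultimately show "2 * pi <= cmod (M y - L y - (M x - L x))" by (simp add: mult_left_mono)
  qed
 qed
 then obtain k where "!!t. t \<in> {0..1} ==> M t - L t = k" by (auto simp: constant_on_def)
 from this[of 0] this[of 1] show "d = L 1 - L 0" unfolding d by (simp add: algebra_simps)
qed

abbreviation (input) vx :: "nat => nat => real" where "vx a \<equiv> (%i. if i = a then 1 else 0)"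

definition seg :: "nat => nat => real => nat => real" where
 "seg a b t = (%i. (1 - t) * vx a i + t * vx b i)"

definition inc :: "('a => complex) => ((nat => real) => 'a) => nat => nat => complex" where
 "inc f s a b = linc (%t. f (s (seg a b t)))"

definition units :: "'a topology => ('a => complex) => bool" where
 "units S f \<longleftrightarrow> continuous_map S (top_of_set (-{0})) f"

lemma units_iff: "units S f \<longleftrightarrow> continuous_map S euclidean f & (ALL x:topspace S. f x ~= 0)"
 by (auto simp: units_def continuous_map_in_subtopology)

lemma units_compose: "units T f ==> continuous_map S T g ==> units S (%x. f (g x))"
 unfolding units_def using continuous_map_compose[of S T g _ f] by (simp add: o_def)

lemma seg_in_simplex:
 assumes "a <= p" "b <= p" "0 <= t" "t <= 1" shows "seg a b t \<in> standard_simplex p"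
 unfolding seg_def by (rule convex_standard_simplex) (use assms in auto)

text \<open>The triangle spanned by three vertices is contractible, so one logarithm serves its
  three edges. Vertices may coincide.\<close>

lemma triangle_log:
 assumes s: "singular_simplex p S s" and f: "units S f" and abc: "a <= p" "b <= p" "c <= p"
 obtains L where "continuous_on {0..1} (%t. L (t, 0))" "continuous_on {0..1} (%t. L (1 - t, t))" "continuous_on {0..1} (%t. L (0, t))"
  "!!t. 0 <= t ==> t <= 1 ==> f (s (seg a b t)) = exp (L (t, 0 :: real))"
  "!!t. 0 <= t ==> t <= 1 ==> f (s (seg b c t)) = exp (L (1 - t, t))"
  "!!t. 0 <= t ==> t <= 1 ==> f (s (seg a c t)) = exp (L (0 :: real, t))"
proof -
 define T where "T = {z :: real \<times> real. 0 <= fst z & 0 <= snd z & fst z + snd z <= 1}"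
 define m where "m z = (%i. (1 - fst z - snd z) * vx a i + fst z * vx b i + snd z * vx c i)" for z :: "real \<times> real"
 have "convex T" unfolding T_def convex_alt proof (intro ballI allI impI)
  fix x y :: "real \<times> real" and u :: real
  assume *: "x \<in> {z. 0 <= fst z & 0 <= snd z & fst z + snd z <= 1}"
   "y \<in> {z. 0 <= fst z & 0 <= snd z & fst z + snd z <= 1}" "0 <= u & u <= 1"
  hence "(1 - u) * (fst x + snd x) + u * (fst y + snd y) <= 1" by (intro convex_bound_le) auto
  moreover have "0 <= (1 - u) * fst x + u * fst y" "0 <= (1 - u) * snd x + u * snd y" using * by auto
  ultimately show "(1 - u) *\<^sub>R x + u *\<^sub>R y \<in> {z. 0 <= fst z & 0 <= snd z & fst z + snd z <= 1}"
   by (simp add: algebra_simps)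
 qed
 hence cT: "contractible T" by (rule convex_imp_contractible)
 have mT: "m z \<in> standard_simplex p" if "z \<in> T" for z proof -
  have x: "0 <= fst z" "0 <= snd z" "fst z + snd z <= 1" using that by (auto simp: T_def)
  let ?A = "%i. (1 - fst z - snd z) * vx a i" and ?B = "%i. fst z * vx b i" and ?C = "%i. snd z * vx c i"
  have "m z i = ?A i + ?B i + ?C i" for i by (simp add: m_def)
  moreover have "(\<Sum>i\<le>p. ?A i + ?B i + ?C i) = 1" proof -
   have v: "(\<Sum>i\<le>p. r * vx a i) = r" if "a <= p" for r a using that by (simp flip: sum_distrib_left)
   show ?thesis unfolding sum.distrib v[OF abc(1)] v[OF abc(2)] v[OF abc(3)] by simp
  qed
  ultimately show ?thesis using x abc by (auto simp: standard_simplex_def)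
 qed
 have cm: "continuous_map (top_of_set T) (subtopology (powertop_real UNIV) (standard_simplex p)) m"
  unfolding continuous_map_in_subtopology proof
  show "continuous_map (top_of_set T) (powertop_real UNIV) m"
   unfolding m_def continuous_map_componentwise_UNIV by (auto intro!: continuous_intros)
  show "m \<in> topspace (top_of_set T) \<rightarrow> standard_simplex p" using mT by auto
 qed
 have u: "units (top_of_set T) (%z. f (s (m z)))"
  by (rule units_compose[OF f]) (use continuous_map_compose[OF cm] s in "auto simp: singular_simplex_def o_def")
 hence "continuous_on T (%z. f (s (m z)))" "!!z. z \<in> T ==> f (s (m z)) ~= 0" by (auto simp: units_iff)
 then obtain L where L: "continuous_on T L" "!!z. z \<in> T ==> f (s (m z)) = exp (L z)"
  using continuous_logarithm_on_contractible[OF _ cT] by metis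
 have m1: "m (t, 0) = seg a b t" "m (1 - t, t) = seg b c t" "m (0, t) = seg a c t" for t
  by (auto simp: m_def seg_def fun_eq_iff)
 have tT: "(t, 0) \<in> T" "(1 - t, t) \<in> T" "(0, t) \<in> T" if "0 <= t" "t <= 1" for t
  using that by (auto simp: T_def)
 have e: "f (s (seg a b t)) = exp (L (t, 0))" "f (s (seg b c t)) = exp (L (1 - t, t))" "f (s (seg a c t)) = exp (L (0, t))"
  if "0 <= t" "t <= 1" for t
  using L(2)[OF tT(1)[OF that]] L(2)[OF tT(2)[OF that]] L(2)[OF tT(3)[OF that]] by (simp_all only: m1)
 show thesis proof (rule that[of L])
  show "continuous_on {0..1} (%t. L (t, 0))" "continuous_on {0..1} (%t. L (1 - t, t))" "continuous_on {0..1} (%t. L (0, t))"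
   by (rule continuous_on_compose2[OF L(1)], intro continuous_intros, use tT in force)+
 qed (rule e; assumption)+
qed

lemma inc_triangle:
 assumes "singular_simplex p S s" "units S f" "a <= p" "b <= p" "c <= p"
 shows "inc f s a b + inc f s b c = inc f s a c"
proof -
 obtain L where L: "continuous_on {0..1} (%t. L (t, 0))" "continuous_on {0..1} (%t. L (1 - t, t))" "continuous_on {0..1} (%t. L (0, t))"
  "!!t. 0 <= t ==> t <= 1 ==> f (s (seg a b t)) = exp (L (t, 0 :: real))"
  "!!t. 0 <= t ==> t <= 1 ==> f (s (seg b c t)) = exp (L (1 - t, t))"
  "!!t. 0 <= t ==> t <= 1 ==> f (s (seg a c t)) = exp (L (0 :: real, t))"
  by (rule triangle_log[OF assms]) (rule that)
 show ?thesis unfolding inc_def using linc_eq[OF L(1,4)] linc_eq[OF L(2,5)] linc_eq[OF L(3,6)] by simp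
qed

lemma inc_refl: "singular_simplex p S s ==> units S f ==> a <= p ==> inc f s a a = 0"
 using inc_triangle[of p S s f a a a] by simp

lemma inc_mult_exp:
 assumes "singular_simplex p S s" "units S f" "a <= p" "b <= p"
  and g: "!!t. 0 <= t ==> t <= 1 ==> g t = f (s (seg a b t)) * exp (c + m * of_real t)"
 shows "linc g = inc f s a b + m"
proof -
 obtain L where L: "continuous_on {0..1} (%t. L (t, 0))"
  "!!t. 0 <= t ==> t <= 1 ==> f (s (seg a b t)) = exp (L (t, 0 :: real))"
  by (rule triangle_log[OF assms(1-4,4)]) (rule that)
 have "linc g = (L (1,0) + (c + m * of_real 1)) - (L (0,0) + (c + m * of_real 0))" proof (rule linc_eq)
  show "continuous_on {0..1} (%t. L (t,0) + (c + m * of_real t))" by (intro continuous_intros L(1))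
 qed (simp add: g L(2) exp_add)
 moreover have "inc f s a b = L (1,0) - L (0,0)" unfolding inc_def by (rule linc_eq[OF L])
 ultimately show ?thesis by simp
qed

text \<open>The cup product of the logarithmic 1-cochains of the entries: factor \<open>i\<close> is
  evaluated on the edge from vertex \<open>i\<close> to vertex \<open>i + 1\<close>.\<close>

definition lform :: "('a => complex) list => ((nat => real) => 'a) => complex" where
 "lform F s = (\<Prod>i<length F. inc (F ! i) s i (Suc i))"

lemma inc_cong:
 assumes "singular_simplex p S s" "a <= p" "b <= p" "!!x. x \<in> topspace S ==> f x = c * g x" "c ~= 0" "units S g"
 shows "inc f s a b = inc g s a b"
proof -
 have "f (s (seg a b t)) = g (s (seg a b t)) * exp (Ln c + 0 * of_real t)" if "0 <= t" "t <= 1" for t proof -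
  have "s (seg a b t) \<in> topspace S"
   using assms(1) seg_in_simplex[OF assms(2,3) that] by (auto simp: singular_simplex_def continuous_map_def)
  thus ?thesis using assms(4)[of "s (seg a b t)"] exp_Ln[OF assms(5)] by (simp add: mult.commute)
 qed
 from inc_mult_exp[OF assms(1,6,2,3) this] show ?thesis by (simp add: inc_def)
qed

lemma lform_cong:
 assumes "singular_simplex p S s" "length F <= p" "length G = length F"
  "!!i. i < length F ==> units S (G ! i) & (EX c. c ~= 0 & (ALL x:topspace S. (F ! i) x = c * (G ! i) x))"
 shows "lform F s = lform G s" unfolding lform_def assms(3)
proof (rule prod.cong[OF refl])
 fix i assume "i \<in> {..<length F}"
 hence i: "i < length F" by simp
 from assms(4)[OF this] obtain c where "units S (G ! i)" "c ~= 0" "ALL x:topspace S. (F ! i) x = c * (G ! i) x" by blast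
 thus "inc (F ! i) s i (Suc i) = inc (G ! i) s i (Suc i)"
  by (intro inc_cong[OF assms(1)]) (use i assms(2) in auto)
qed

lemma ev_lform_cong:
 assumes "singular_chain p S c" "length F <= p" "length G = length F"
  "!!i. i < length F ==> units S (G ! i) & (EX c. c ~= 0 & (ALL x:topspace S. (F ! i) x = c * (G ! i) x))"
 shows "ev (lform F) c = ev (lform G) c"
 by (rule ev_cong, rule lform_cong[of p S]) (use assms in "auto simp: singular_chain_def")

lemma inc_simplex_map: "a <= p ==> b <= p ==> inc f (simplex_map p g s) a b = inc (%x. f (g x)) s a b"
proof -
 assume ab: "a <= p" "b <= p"
 have "linc (%t. f (simplex_map p g s (seg a b t))) = linc (%t. f (g (s (seg a b t))))"
  unfolding linc_def using seg_in_simplex[OF ab] by (simp add: simplex_map_def cong: conj_cong)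
 thus ?thesis by (simp add: inc_def)
qed

lemma lform_simplex_map: "length F <= p ==> lform F (simplex_map p g s) = lform (map (%f x. f (g x)) F) s"
 by (auto simp: lform_def inc_simplex_map intro!: prod.cong)

lemma ev_lform_chain_map:
 assumes "length F <= p" shows "ev (lform F) (chain_map p g c) = ev (lform (map (%f x. f (g x)) F)) c"
 by (simp add: chain_map_def ev_frag_extend lform_simplex_map[OF assms])

lemma inc_singular_face:
 assumes "a <= p" "b <= p" "k <= Suc p"
 shows "inc f (singular_face (Suc p) k s) a b = inc f s (shift_at k a) (shift_at k b)"
proof -
 have "simplical_face k (seg a b t) = seg (shift_at k a) (shift_at k b) t" for t
  by (auto simp: simplical_face_def seg_def shift_at_def fun_eq_iff)
 hence "linc (%t. f (singular_face (Suc p) k s (seg a b t))) = linc (%t. f (s (seg (shift_at k a) (shift_at k b) t)))"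
  unfolding linc_def using seg_in_simplex[OF assms(1,2)] by (simp add: singular_face_def cong: conj_cong)
 thus ?thesis by (simp add: inc_def)
qed

text \<open>The coboundary of a product of 1-cocycles. If \<open>y k\<close> denotes the product
  that skips edge \<open>k\<close>, face \<open>k\<close> contributes \<open>y k\<close> and
  \<open>y (k - 1)\<close>, each where defined, and the alternating sum telescopes.\<close>

lemma telescope_faces:
 fixes x :: "nat => nat => complex" and z :: "nat => nat => complex"
 assumes z: "!!i k. i < p ==> k <= Suc p ==> z k i =
  (if Suc i < k then x i i else if Suc i = k then x i i + x i (Suc i) else x i (Suc i))"
 shows "(\<Sum>k\<le>Suc p. (-1)^k * (\<Prod>i<p. z k i)) = 0"
proof -
 define y where "y k = (\<Prod>i<p. if i < k then x i i else x i (Suc i))" for k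
 have 0: "(\<Prod>i<p. z k i) = (if k <= p then y k else 0) + (if k \<ge> 1 then y (k - 1) else 0)" if k: "k <= Suc p" for k
 proof -
  consider "k = 0" | "k = Suc p" | j where "k = Suc j" "j < p" using k by (cases k) (auto simp: less_Suc_eq_le le_less)
  thus ?thesis proof cases
   case 1
   thus ?thesis by (auto simp: y_def z intro!: prod.cong)
  next
   case 2
   thus ?thesis by (auto simp: y_def z intro!: prod.cong)
  next
   case 3
   have "(\<Prod>i<p. z k i) = z k j * (\<Prod>i\<in>{..<p}-{j}. z k i)" by (rule prod.remove) (use 3 in auto)
   moreover have "(\<Prod>i\<in>{..<p}-{j}. if i < l then x i i else x i (Suc i)) = (\<Prod>i\<in>{..<p}-{j}. z k i)" if "l = j | l = k" for l
    by (rule prod.cong[OF refl]) (use 3 that in "auto simp: z")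
   hence "y k = x j j * (\<Prod>i\<in>{..<p}-{j}. z k i)" "y j = x j (Suc j) * (\<Prod>i\<in>{..<p}-{j}. z k i)"
    unfolding y_def using 3 by (simp_all add: prod.remove[of "{..<p}" j])
   ultimately show ?thesis using 3 by (simp add: z distrib_right)
  qed
 qed
 have "(\<Sum>k\<le>Suc p. (-1)^k * (\<Prod>i<p. z k i)) =
   (\<Sum>k\<le>Suc p. (-1)^k * (if k <= p then y k else 0)) + (\<Sum>k\<le>Suc p. (-1)^k * (if k \<ge> 1 then y (k - 1) else 0))"
  unfolding sum.distrib[symmetric] by (rule sum.cong) (simp_all add: 0 distrib_left)
 also have "(\<Sum>k\<le>Suc p. (-1)^k * (if k <= p then y k else 0)) = (\<Sum>k\<le>p. (-1)^k * y k)" by simp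
 also have "(\<Sum>k\<le>Suc p. (-1)^k * (if k \<ge> 1 then y (k - 1) else 0)) = (\<Sum>k\<le>p. - ((-1)^k * y k))"
  by (subst sum.atMost_Suc_shift) simp
 finally show ?thesis by (simp add: sum_negf)
qed

lemma lform_closed:
 assumes "singular_chain (Suc (length F)) S c" "!!f. f \<in> set F ==> units S f"
 shows "ev (lform F) (chain_boundary (Suc (length F)) c) = 0" using assms(1) unfolding singular_chain_def
proof (induction rule: frag_induction)
 case (one s)
 hence s: "singular_simplex (Suc (length F)) S s" by simp
 let ?p = "length F"
 let ?x = "%i j. inc (F ! i) s j (Suc j)"
 have "ev (lform F) (chain_boundary (Suc ?p) (frag_of s)) =
  (\<Sum>k\<le>Suc ?p. (-1)^k * (\<Prod>i<?p. inc (F ! i) (singular_face (Suc ?p) k s) i (Suc i)))"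
  by (simp add: chain_boundary_of ev_sum ev_cmul lform_def del: sum.atMost_Suc)
 also have "... = 0" proof (rule telescope_faces[of ?p _ ?x])
  fix i k assume i: "i < ?p" and k: "k <= Suc ?p"
  have "inc (F ! i) s i (Suc i) + inc (F ! i) s (Suc i) (Suc (Suc i)) = inc (F ! i) s i (Suc (Suc i))"
   by (rule inc_triangle[OF s assms(2)]) (use i in auto)
  thus "inc (F ! i) (singular_face (Suc ?p) k s) i (Suc i) =
   (if Suc i < k then ?x i i else if Suc i = k then ?x i i + ?x i (Suc i) else ?x i (Suc i))"
   using i k by (auto simp: inc_singular_face shift_at_def)
 qed
 finally show ?case .
qed (auto simp: ev_diff chain_boundary_diff)

lemma hom_fun_lform:
 assumes "length F = p" "!!f. f \<in> set F ==> units S f" shows "hom_fun p S (ev (lform F))"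
 using lform_closed[of F S] assms by (auto simp: hom_fun_def ev_add singular_boundary)

section \<open>Homotopy of units and residues along circles\<close>

definition logeq :: "'a topology => ('a => complex) => ('a => complex) => bool" where
 "logeq S f f' \<longleftrightarrow> (EX g. continuous_map S euclidean g & (ALL x:topspace S. f x = f' x * exp (g x)))"

text \<open>Over the product with the interval the factors \<open>G i * exp (t * g i)\<close>
  interpolate between the two families; closedness of their product is evaluated on the prism over
  \<open>c\<close>.\<close>

lemma lform_logeq:
 assumes c: "cycle p S c" and len: "length F = p" "length G = p"
  and G: "!!i. i < p ==> units S (G ! i)" and FG: "!!i. i < p ==> logeq S (F ! i) (G ! i)"
 shows "ev (lform F) c = ev (lform G) c"
proof -
 obtain g where g: "!!i. i < p ==> continuous_map S euclidean (g i) & (ALL x:topspace S. (F ! i) x = (G ! i) x * exp (g i x))"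
  using FG unfolding logeq_def by metis
 define H where "H = map (%i z. (G ! i) (fst z) * exp (complex_of_real (snd z) * g i (fst z))) [0..<p]"
 let ?T = "prod_topology S I01"
 have lenH: "length H = p" by (simp add: H_def)
 have H: "units ?T h" if hH: "h \<in> set H" for h proof -
  obtain i where i: "i < p" "h = (%z. (G ! i) (fst z) * exp (complex_of_real (snd z) * g i (fst z)))"
   using hH by (auto simp: H_def)
  have 1: "continuous_map ?T euclidean (%x. k (fst x))" if "continuous_map S euclidean k" for k :: "_ => complex"
   using continuous_map_compose[OF continuous_map_fst that] by (simp add: o_def)
  have 2: "continuous_map ?T euclidean (%x. snd x)"
   by (rule continuous_map_snd_into[OF continuous_map_id[unfolded id_def]])
  have "continuous_map ?T euclidean (%x. (G ! i) (fst x) * exp (complex_of_real (snd x) * g i (fst x)))"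
   by (intro continuous_map_mult_complex continuous_map_exp_complex continuous_map_of_real_complex 1 2)
    (use g[OF i(1)] G[OF i(1)] in "auto simp: units_iff")
  thus ?thesis using G[OF i(1)] unfolding i(2) by (auto simp: units_iff case_prod_unfold)
 qed
 have cc: "singular_chain p S c" "chain_boundary p c = 0" using c by (auto simp: singular_cycle)
 have "0 = ev (lform H) (chain_boundary (Suc p) (prism p c))"
  using lform_closed[of H ?T "prism p c"] singular_chain_prism[OF cc(1)] H lenH by auto
 also have "... = ev (lform H) (chain_map p (%b. (b,1)) c) - ev (lform H) (chain_map p (%b. (b,0)) c)"
  by (simp add: chain_boundary_prism[OF cc(1)] cc(2) ev_diff)
 also have "ev (lform H) (chain_map p (%b. (b,1)) c) = ev (lform F) c"
  unfolding ev_lform_chain_map[of H p, simplified lenH, OF order_refl] proof (rule ev_lform_cong[OF cc(1)])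
  fix i assume "i < length (map (%f x. f (x, 1::real)) H)"
  hence i: "i < p" by (simp add: lenH)
  have "continuous_map S euclidean (%x. (G ! i) x * exp (g i x))"
   by (intro continuous_intros) (use g[OF i] G[OF i] in "auto simp: units_iff")
  hence "continuous_map S euclidean (F ! i)" by (rule continuous_map_eq) (use g[OF i] in auto)
  hence "units S (F ! i)" using g[OF i] G[OF i] by (auto simp: units_iff)
  thus "units S (F ! i) & (EX c. c ~= 0 & (ALL x:topspace S. (map (%f x. f (x, 1)) H ! i) x = c * (F ! i) x))"
   using g[OF i] i by (intro conjI exI[of _ 1]) (auto simp: H_def)
 qed (simp_all add: lenH len)
 also have "ev (lform H) (chain_map p (%b. (b,0)) c) = ev (lform G) c"
  unfolding ev_lform_chain_map[of H p, simplified lenH, OF order_refl] proof (rule ev_lform_cong[OF cc(1)])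
  fix i assume "i < length (map (%f x. f (x, 0::real)) H)"
  hence i: "i < p" by (simp add: lenH)
  thus "units S (G ! i) & (EX c. c ~= 0 & (ALL x:topspace S. (map (%f x. f (x, 0)) H ! i) x = c * (G ! i) x))"
   using G[OF i] by (intro conjI exI[of _ 1]) (auto simp: H_def)
 qed (simp_all add: lenH len)
 finally show ?thesis by simp
qed

lemma pr_explicit:
 "pr vs = (\<Sum>j<length vs. frag_cmul ((-1)^j) (frag_of (map (%u. (u,0)) (take (Suc j) vs) @ map (%u. (u,1)) (drop j vs))))"
proof (induction vs)
 case (Cons v vs)
 show ?case
  by (simp add: Cons consf_def frag_extend_sum frag_extend_cmul sum.lessThan_Suc_shift del: sum.lessThan_Suc flip: sum_negf)
qed simp

lemma inc_psimp:
 assumes s: "singular_simplex p S s" and f: "units S f" and L: "L ~= []" "fst ` set L <= {..p}"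
  and kl: "k < length L" "l < length L"
  and g: "!!b t. b \<in> topspace S ==> g (b, t) = f b * exp (c + m * of_real t)"
 shows "inc g (psimp s L) k l = inc f s (fst (L ! k)) (fst (L ! l)) + m * of_real (snd (L ! l) - snd (L ! k))"
proof -
 have kp: "fst (L ! k) <= p" "fst (L ! l) <= p" using L kl by (auto simp: set_conv_nth)
 have delta: "(\<Sum>j<length L. (if P j then (1 - t) * vx k j + t * vx l j else 0) :: real) = (1 - t) * (if P k then 1 else 0) + t * (if P l then 1 else 0)" for P t
 proof -
  have "(\<Sum>j<length L. (if P j then (1 - t) * vx k j + t * vx l j else 0) :: real) =
   (\<Sum>j<length L. if j = k then (if P k then 1 - t else 0) else 0) + (\<Sum>j<length L. if j = l then (if P l then t else 0) else 0)"
   unfolding sum.distrib[symmetric] by (rule sum.cong) auto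
  thus ?thesis using kl by auto
 qed
 have b: "bpt L (seg k l t) = seg (fst (L ! k)) (fst (L ! l)) t" for t
  unfolding bpt_def seg_def delta by (auto simp: fun_eq_iff)
 have t: "tpt L (seg k l t) = snd (L ! k) + t * (snd (L ! l) - snd (L ! k))" for t proof -
  have "tpt L (seg k l t) = (\<Sum>j<length L. (1 - t) * (vx k j * snd (L ! j))) + (\<Sum>j<length L. t * (vx l j * snd (L ! j)))"
   unfolding tpt_def seg_def sum.distrib[symmetric] by (rule sum.cong) (auto simp: algebra_simps)
  also have "... = (1 - t) * snd (L ! k) + t * snd (L ! l)"
   using kl by (simp add: if_distrib[of "%x. x * _"] flip: sum_distrib_left cong: if_cong)
  finally show ?thesis by (simp add: algebra_simps)
 qed
 have sS: "s (seg (fst (L ! k)) (fst (L ! l)) t) \<in> topspace S" if "0 <= t" "t <= 1" for t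
  using s seg_in_simplex[OF kp that] by (auto simp: singular_simplex_def continuous_map_def)
 show ?thesis unfolding inc_def[of g] proof (rule inc_mult_exp[OF s f kp])
  fix t :: real assume t01: "0 <= t" "t <= 1"
  have "seg k l t \<in> standard_simplex (length L - 1)" by (rule seg_in_simplex) (use kl t01 in auto)
  thus "g (psimp s L (seg k l t)) = f (s (seg (fst (L ! k)) (fst (L ! l)) t)) *
   exp ((c + m * of_real (snd (L ! k))) + m * of_real (snd (L ! l) - snd (L ! k)) * of_real t)"
   by (simp add: psimp_def b t g[OF sS[OF t01]] algebra_simps)
 qed
qed

text \<open>Integration along the interval. On the j-th simplex of the prism edge \<open>j\<close>
  is vertical and contributes \<open>m j\<close>; the other edges run along the base at level 0 or 1
  and see the factors other than \<open>A j\<close>.\<close>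

lemma ev_lform_prism:
 assumes c: "singular_chain p S c" and len: "length A = Suc p" "length F = Suc p"
  and A: "!!i. i <= p ==> units S (A ! i)"
  and F: "!!i b t. i <= p ==> b \<in> topspace S ==> (F ! i) (b, t) = (A ! i) b * exp (k i + m i * of_real t)"
 shows "ev (lform F) (prism p c) = (\<Sum>j\<le>p. (-1)^j * m j * ev (lform (drp j A)) c)"
 using c unfolding singular_chain_def
proof (induction rule: frag_induction)
 case (one s)
 hence s: "singular_simplex p S s" by simp
 define Lj where "Lj j = map (%u. (u,0::real)) (take (Suc j) [0..<Suc p]) @ map (%u. (u,1)) (drop j [0..<Suc p])" for j
 have Lj: "length (Lj j) = Suc (Suc p)" "fst ` set (Lj j) <= {..p}" if "j <= p" for j
  using that by (auto simp: Lj_def min_def simp del: upt_Suc dest!: in_set_takeD in_set_dropD)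
 have nth: "Lj j ! i = (if i <= j then (i, 0) else (i - 1, 1))" if "j <= p" "i <= Suc p" for i j
  using that by (auto simp: Lj_def nth_append min_def simp del: upt_Suc)
 have "lform F (psimp s (Lj j)) = m j * lform (drp j A) s" if j: "j <= p" for j proof -
  have *: "inc (F ! i) (psimp s (Lj j)) i (Suc i) =
    (if i < j then inc (A ! i) s i (Suc i) else if i = j then m j else inc (A ! i) s (i - 1) i)" if i: "i <= p" for i
  proof -
   have "inc (F ! i) (psimp s (Lj j)) i (Suc i) = inc (A ! i) s (fst (Lj j ! i)) (fst (Lj j ! Suc i)) + m i * of_real (snd (Lj j ! Suc i) - snd (Lj j ! i))"
    by (rule inc_psimp[OF s A[OF i] _ Lj(2)[OF j]]) (use Lj[OF j] i F[OF i] in auto)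
   thus ?thesis using i j by (auto simp: nth inc_refl[OF s A[OF j]])
  qed
  have "lform F (psimp s (Lj j)) = (\<Prod>i\<in>{..<Suc p}. inc (F ! i) (psimp s (Lj j)) i (Suc i))"
   by (simp add: lform_def len)
  also have "... = inc (F ! j) (psimp s (Lj j)) j (Suc j) * (\<Prod>i\<in>{..<Suc p}-{j}. inc (F ! i) (psimp s (Lj j)) i (Suc i))"
   by (rule prod.remove) (use j in auto)
  also have "... = m j * (\<Prod>i\<in>{..<Suc p}-{j}. if i < j then inc (A ! i) s i (Suc i) else inc (A ! i) s (i - 1) i)"
   using * j by (intro arg_cong2[where f = "(*)"] prod.cong) auto
  also have "(\<Prod>i\<in>{..<Suc p}-{j}. if i < j then inc (A ! i) s i (Suc i) else inc (A ! i) s (i - 1) i) =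
    (\<Prod>i<p. inc (drp j A ! i) s i (Suc i))"
  proof (rule prod.reindex_bij_witness[of _ "shift_at j" "%i. if i < j then i else i - 1"])
   fix i assume "i \<in> {..<Suc p} - {j}"
   thus "inc (drp j A ! (if i < j then i else i - 1)) s (if i < j then i else i - 1) (Suc (if i < j then i else i - 1)) =
      (if i < j then inc (A ! i) s i (Suc i) else inc (A ! i) s (i - 1) i)" using j len by (auto simp: nth_drp)
  qed (use j in "auto simp: shift_at_def split: if_splits")
  also have "(\<Prod>i<p. inc (drp j A ! i) s i (Suc i)) = lform (drp j A) s"
   using j len by (simp add: lform_def)
  finally show ?thesis .
 qed
 moreover have "prism p (frag_of s) = (\<Sum>j\<le>p. frag_cmul ((-1)^j) (frag_of (psimp s (Lj j))))"
  unfolding prism_def frag_extend_of pr_explicit Lj_def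
  by (simp add: frag_extend_sum frag_extend_cmul o_def lessThan_Suc_atMost del: upt_Suc take_Suc_conv_app_nth sum.atMost_Suc)
 ultimately show ?case by (simp add: ev_sum ev_cmul mult.assoc del: sum.atMost_Suc)
qed (auto simp: ev_diff prism_diff right_diff_distrib sum_subtractf)

text \<open>Residue formula; \<open>w\<close> marks the factors that carry the fibre coordinate.
  Each half circle turns the argument by -pi, so a marked factor contributes -2 pi i and is
  deleted.\<close>

lemma ev_lform_tor:
 fixes w :: "nat => bool"
 assumes c: "singular_chain p S c" and len: "length A = Suc p" "length F = Suc p"
  and A: "!!i. i <= p ==> units S (A ! i)"
  and F: "!!i b z. i <= p ==> b \<in> topspace S ==> (F ! i) (b, z) = (A ! i) b * (if w i then z else 1)"
 shows "ev (lform F) (tor p c) = - (2 * pi * \<i>) * (\<Sum>j\<le>p. (-1)^j * (if w j then 1 else 0) * ev (lform (drp j A)) c)"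
proof -
 have half: "ev (lform F) (halfcirc (exp \<theta>) p c) = (\<Sum>j\<le>p. (-1)^j * (if w j then - (pi * \<i>) else 0) * ev (lform (drp j A)) c)" for \<theta>
 proof -
  have "ev (lform F) (halfcirc (exp \<theta>) p c) = ev (lform (map (%f x. f (fst x, exp \<theta> * arc (snd x))) F)) (prism p c)"
   unfolding halfcirc_def by (rule ev_lform_chain_map) (simp add: len)
  also have "... = (\<Sum>j\<le>p. (-1)^j * (if w j then - (pi * \<i>) else 0) * ev (lform (drp j A)) c)"
  proof (rule ev_lform_prism[OF c len(1) _ A, where k = "%i. if w i then \<theta> + \<i> * (pi/2) else 0"])
   fix i b t assume i: "i <= p" and b: "b \<in> topspace S"
   have "exp \<theta> * arc t = exp (\<theta> + \<i> * (pi/2) + - (pi * \<i>) * of_real t)"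
    unfolding arc_def cis_conv_exp exp_add[symmetric] by (simp add: algebra_simps)
   thus "(map (%f x. f (fst x, exp \<theta> * arc (snd x))) F ! i) (b, t) =
    (A ! i) b * exp ((if w i then \<theta> + \<i> * (pi/2) else 0) + (if w i then - (pi * \<i>) else 0) * of_real t)"
    using i len F[OF i b] by simp
  qed (simp_all add: len)
  finally show ?thesis .
 qed
 \<comment> \<open>The correction term of \<open>tor\<close> sits over the fibre coordinate 1, where
   no factor varies along the interval.\<close>
 have flat: "ev (lform F) (chain_map (Suc p) (%x. (fst x, 1)) (halfcirc \<theta> p c)) = 0" for \<theta> proof -
  have "ev (lform F) (chain_map (Suc p) (%x. (fst x, 1)) (halfcirc \<theta> p c)) = ev (lform (map (%f x. f (fst x, 1)) F)) (prism p c)"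
   unfolding halfcirc_def chain_map_chain_map by (subst ev_lform_chain_map) (simp_all add: len)
  also have "... = (\<Sum>j\<le>p. (-1)^j * 0 * ev (lform (drp j A)) c)"
   by (rule ev_lform_prism[OF c len(1) _ A, where k = "%i. 0"]) (use F len in auto)
  finally show ?thesis by simp
 qed
 have "ev (lform F) (tor p c) = ev (lform F) (halfcirc (exp 0) p c) + ev (lform F) (halfcirc (exp (pi * \<i>)) p c)"
  by (simp add: tor_def circ_def ev_diff ev_add chain_map_add flat)
 also have "... = (\<Sum>j\<le>p. 2 * ((-1)^j * (if w j then - (pi * \<i>) else 0) * ev (lform (drp j A)) c))"
  unfolding half by (simp add: sum_distrib_left)
 also have "... = - (2 * pi * \<i>) * (\<Sum>j\<le>p. (-1)^j * (if w j then 1 else 0) * ev (lform (drp j A)) c)"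
  unfolding sum_distrib_left by (rule sum.cong) auto
 finally show ?thesis .
qed

section \<open>The hyperplane arrangement\<close>

text \<open>\<open>None\<close> stands for the point 0 and \<open>Some (j, a)\<close> for \<open>z\<^sup>a x\<^sub>j\<close>; a pair of points stands for the hyperplane
 on which they coincide. Equal points are admitted, with defining function 1, so that restriction to a hyperplane
 is a total operation on pairs.\<close>

type_synonym pt = "(nat \<times> nat) option"
type_synonym hyp = "pt \<times> pt"

definition pval :: "'f::field => (nat => 'f) => pt => 'f" where
 "pval z x s = (case s of None => 0 | Some (j, a) => z ^ a * x j)"

lemma pval_simps [simp]: "pval z x None = 0" "pval z x (Some (j, a)) = z ^ a * x j" by (simp_all add: pval_def)

abbreviation trivh :: "hyp => bool" where "trivh h \<equiv> fst h = snd h"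

definition pts :: "nat => nat => pt set" where
 "pts d n = insert None (Some ` ({..<n} \<times> {..<d}))"

definition hyps :: "nat => nat => hyp set" where
 "hyps d n = pts d n \<times> pts d n"

lemma finite_pts [simp]: "finite (pts d n)" by (simp add: pts_def)
lemma finite_hyps [simp]: "finite (hyps d n)" by (simp add: hyps_def)

lemma in_pts [simp]: "None \<in> pts d n" "Some (j, a) \<in> pts d n \<longleftrightarrow> j < n & a < d"
 by (auto simp: pts_def)

definition lists :: "nat => nat => nat => hyp list set" where
 "lists d n p = {R. set R <= hyps d n & length R = p}"

lemma finite_lists [simp]: "finite (lists d n p)" unfolding lists_def by (rule finite_lists_length_eq) simp

definition newpt :: "nat => pt => bool" where
 "newpt n s \<longleftrightarrow> (EX a. s = Some (n, a))"

text \<open>Restriction to the hyperplane on which the last coordinate equals point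
  \<open>k\<close>: the coordinate is replaced by that point and the exponents of the root of unity
  add up.\<close>

definition psub :: "nat => nat => pt => pt => pt" where
 "psub d n k s = (case s of None => None | Some (j, a) =>
   if j = n then (case k of None => None | Some (i, b) => Some (i, (a + b) mod d)) else Some (j, a))"

definition hsub :: "nat => nat => pt => hyp => hyp" where
 "hsub d n k = map_prod (psub d n k) (psub d n k)"

definition newh :: "nat => hyp => bool" where
 "newh n h \<longleftrightarrow> newpt n (fst h) | newpt n (snd h)"

lemma psub_in: "d > 0 ==> k \<in> pts d n ==> s \<in> pts d (Suc n) ==> psub d n k s \<in> pts d n"
 by (auto simp: psub_def pts_def less_Suc_eq split: option.splits)

lemma hsub_in: "d > 0 ==> k \<in> pts d n ==> h \<in> hyps d (Suc n) ==> hsub d n k h \<in> hyps d n"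
 by (cases h) (auto simp: hsub_def hyps_def psub_in)

lemma psub_old: "s \<in> pts d n ==> psub d n k s = s" by (auto simp: psub_def pts_def)

lemma hsub_old: "h \<in> hyps d n ==> hsub d n k h = h" by (cases h) (auto simp: hsub_def hyps_def psub_old)

lemma pts_Suc: "s \<in> pts d (Suc n) ==> \<not> newpt n s ==> s \<in> pts d n"
 by (auto simp: pts_def newpt_def less_Suc_eq)

lemma hyps_Suc: "h \<in> hyps d (Suc n) ==> \<not> newh n h ==> h \<in> hyps d n"
 by (cases h) (auto simp: hyps_def newh_def pts_Suc)

lemma not_newpt: "s \<in> pts d n ==> \<not> newpt n s" by (auto simp: pts_def newpt_def)

lemma not_newh: "h \<in> hyps d n ==> \<not> newh n h" by (auto simp: hyps_def newh_def not_newpt)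

lemma pts_mono: "s \<in> pts d n ==> s \<in> pts d (Suc n)" by (auto simp: pts_def)
lemma hyps_mono: "h \<in> hyps d n ==> h \<in> hyps d (Suc n)" by (auto simp: hyps_def pts_mono)

text \<open>The coefficient of the coordinate x_n in the linear form attached to
  \<open>s\<close>.\<close>

definition pcoef :: "'f::field => nat => pt => 'f" where
 "pcoef z n s = (case s of None => 0 | Some (j, a) => if j = n then z ^ a else 0)"

lemma power_mod_root: "z ^ d = 1 ==> (z :: 'f::field) ^ (m mod d) = z ^ m"
 by (metis div_mult_mod_eq mult_1 power_add power_mult power_one mult.commute)

lemma pval_psub:
 fixes z :: "'f::field"
 assumes "z ^ d = 1" "k \<in> pts d n"
 shows "pval z (x(n := pval z x k + e)) s = pval z x (psub d n k s) + pcoef z n s * e"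
 using assms(2) by (auto simp: psub_def pcoef_def pts_def power_mod_root[OF assms(1)] power_add algebra_simps split: option.splits)

definition van :: "'f::field => (nat => 'f) => hyp => bool" where
 "van z y h \<longleftrightarrow> \<not> trivh h & pval z y (fst h) = pval z y (snd h)"

definition alpha :: "'f::field => hyp => (nat => 'f) => 'f" where
 "alpha z h x = (if trivh h then 1 else pval z x (fst h) - pval z x (snd h))"

lemma alpha_0_iff: "alpha z h x = 0 \<longleftrightarrow> van z x h" by (simp add: alpha_def van_def)

lemma alpha_triv: "trivh h ==> alpha z h x = 1" by (simp add: alpha_def)

lemma trivh_hsub: "trivh h ==> trivh (hsub d n k h)" by (simp add: hsub_def map_prod_def case_prod_beta)

locale orbit_arrangement =
 fixes d :: nat
 assumes d: "d > 0"
begin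

definition \<omega> :: complex where "\<omega> = cis (2 * pi / real d)"

lemma omega_power: "\<omega> ^ k = cis (2 * pi * real k / real d)"
 by (simp only: \<omega>_def Complex.DeMoivre) (simp add: mult_ac)

lemma omega_d: "\<omega> ^ d = 1" using d by (simp add: omega_power)

lemma omega_nz [simp]: "\<omega> ~= 0" by (simp add: \<omega>_def)

lemma omega_inj: "a < d ==> b < d ==> \<omega> ^ a = \<omega> ^ b \<longleftrightarrow> a = b"
 using Complex.bij_betw_roots_unity[OF d] unfolding bij_betw_def omega_power inj_on_def by auto

lemma roots_unity: "\<zeta> ^ d = 1 ==> EX a<d. \<zeta> = \<omega> ^ a"
 using Complex.bij_betw_roots_unity[OF d] unfolding bij_betw_def omega_power by auto

lemma norm_omega [simp]: "norm \<omega> = 1" by (simp add: \<omega>_def)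

abbreviation "al \<equiv> alpha \<omega>"
abbreviation "M \<equiv> orbit_conf d"

text \<open>Distinct points take distinct values: for equal index this is nonvanishing of a
  coordinate and distinctness of powers of \<open>\<omega>\<close>, for different indices the
  quotient of two such powers is again a d-th root of unity.\<close>

lemma topspace_M:
 "topspace (M n) = {x \<in> extensional {..<n}. ALL h:hyps d n. \<not> van \<omega> x h}"
proof (intro Set.set_eqI iffI)
 fix x assume x: "x \<in> topspace (M n)"
 hence e: "x \<in> extensional {..<n}" and nz: "!!i. i < n ==> x i ~= 0"
  and ne: "!!i j \<zeta>. i < n ==> j < n ==> i ~= j ==> \<zeta> ^ d = 1 ==> x i ~= \<zeta> * x j"
  by (auto simp: orbit_conf_def PiE_def)
 have st_eq: "s = t" if st: "s \<in> pts d n" "t \<in> pts d n" and eq: "pval \<omega> x s = pval \<omega> x t" for s t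
 proof (cases s)
  case None
  with st eq nz show ?thesis by (cases t) auto
 next
  case (Some ja)
  obtain j a where s: "s = Some (j, a)" "j < n" "a < d" using Some st(1) by (cases ja) auto
  show ?thesis proof (cases t)
   case None
   with s eq nz show ?thesis by auto
  next
   case (Some ib)
   obtain i b where t: "t = Some (i, b)" "i < n" "b < d" using Some st(2) by (cases ib) auto
   have e: "\<omega> ^ a * x j = \<omega> ^ b * x i" using eq s t by simp
   have "j = i" proof (rule ccontr)
    assume "j ~= i"
    have "(\<omega> ^ b / \<omega> ^ a) ^ d = 1"
     by (simp add: power_divide power_mult[symmetric] mult.commute[of _ d]) (simp add: power_mult omega_d)
    from ne[OF s(2) t(2) \<open>j ~= i\<close> this] e show False by (simp add: field_simps)
   qed
   with e nz[OF s(2)] omega_inj[OF s(3) t(3)] s t show ?thesis by simp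
  qed
 qed
 with e show "x \<in> {x \<in> extensional {..<n}. ALL h:hyps d n. \<not> van \<omega> x h}"
  by (auto simp: van_def hyps_def)
next
 fix x assume "x \<in> {x \<in> extensional {..<n}. ALL h:hyps d n. \<not> van \<omega> x h}"
 hence e: "x \<in> extensional {..<n}" and v: "!!s t. s \<in> pts d n ==> t \<in> pts d n ==> s ~= t ==> pval \<omega> x s ~= pval \<omega> x t"
  by (auto simp: van_def hyps_def)
 have "x i ~= 0" if "i < n" for i using v[of "Some (i,0)" None] that d by simp
 moreover have "x i ~= \<zeta> * x j" if ij: "i < n" "j < n" "i ~= j" "\<zeta> ^ d = 1" for i j \<zeta> proof -
  obtain a where "a < d" "\<zeta> = \<omega> ^ a" using roots_unity[OF ij(4)] by blast
  thus ?thesis using v[of "Some (i,0)" "Some (j,a)"] ij d by simp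
 qed
 ultimately show "x \<in> topspace (M n)" using e by (auto simp: orbit_conf_def PiE_def)
qed

lemma al_nz: "x \<in> topspace (M n) ==> h \<in> hyps d n ==> al h x ~= 0"
 by (auto simp: topspace_M alpha_0_iff)

lemma cont_coord: "i < n ==> continuous_map (M n) euclidean (%x. x i)" unfolding orbit_conf_def
 by (intro continuous_map_from_subtopology continuous_map_product_projection) auto

lemma cont_pval: "s \<in> pts d n ==> continuous_map (M n) euclidean (%x. pval \<omega> x s)"
 by (cases s) (auto intro!: continuous_intros cont_coord)

lemma cont_into_M:
 assumes "!!i. i < n ==> continuous_map T euclidean (%x. f x i)" "!!x. x \<in> topspace T ==> f x \<in> topspace (M n)"
 shows "continuous_map T (M n) f"
proof -
 have "f x \<in> extensional {..<n}" if "x \<in> topspace T" for x using assms(2)[OF that] by (simp add: topspace_M)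
 moreover have "f x \<in> {x. (ALL i<n. x i ~= 0) & (ALL i<n. ALL j<n. i ~= j --> (ALL \<zeta>. \<zeta> ^ d = 1 --> x i ~= \<zeta> * x j))}" if "x \<in> topspace T" for x
  using assms(2)[OF that] by (simp add: orbit_conf_def)
 ultimately show ?thesis
  using assms(1) unfolding orbit_conf_def continuous_map_in_subtopology continuous_map_componentwise
  by (auto simp: Pi_iff)
qed

lemma cont_al: "h \<in> hyps d n ==> continuous_map (M n) euclidean (al h)"
 unfolding alpha_def[abs_def] by (cases "trivh h") (auto simp: hyps_def intro!: continuous_intros cont_pval)

lemma units_al: "h \<in> hyps d n ==> units (M n) (al h)" by (auto simp: units_iff cont_al al_nz)

lemma units_1: "units T (%_. 1)" by (simp add: units_iff)

definition vf :: "hyp list => (nat => complex) chain => complex" where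
 "vf R = ev (lform (map al R))"

lemma hom_fun_vf: "R \<in> lists d n p ==> hom_fun p (M n) (vf R)"
 unfolding vf_def by (rule hom_fun_lform) (auto simp: lists_def subset_iff units_al)

lemma vf_eqI:
 assumes "cycle p S c" "length R = p" "length G = p" "continuous_map S (M n) f"
  "!!i. i < p ==> units S (G ! i)" "!!i. i < p ==> logeq S (%x. al (R ! i) (f x)) (G ! i)"
 shows "vf R (chain_map p f c) = ev (lform G) c" unfolding vf_def using assms(2)
 by (subst ev_lform_chain_map) (auto intro!: lform_logeq[OF assms(1)] assms simp: o_def)

lemma lform_1:
 assumes "singular_chain p S c" "length G <= p" "i < length G" "!!x. x \<in> topspace S ==> (G ! i) x = 1"
 shows "ev (lform G) c = 0"
proof -
 have "lform G s = 0" if "s \<in> pkeys c" for s proof -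
  have s: "singular_simplex p S s" using that assms(1) by (auto simp: singular_chain_def)
  have "inc (G ! i) s i (Suc i) = inc (%_. 1) s i (Suc i)"
   by (rule inc_cong[OF s, where c = 1]) (use assms units_1 in auto)
  also have "... = 0" unfolding inc_def using linc_eq[of "%_. 0" "%_. 1"] by simp
  finally show ?thesis unfolding lform_def using assms(3) by (intro prod_zero) auto
 qed
 thus ?thesis by (simp add: ev_def)
qed

lemma vf_triv:
 assumes "cycle p (M n) c" "length R = p" "h \<in> set R" "trivh h" shows "vf R c = 0"
proof -
 obtain i where "i < p" "R ! i = h" using assms(2,3) by (auto simp: in_set_conv_nth)
 thus ?thesis unfolding vf_def
  by (intro lform_1[of p "M n" _ _ i]) (use assms in "auto simp: singular_cycle alpha_triv")
qed

text \<open>Removes from a defining function a factor that avoids the closed negative half axis,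
  such as a positive function or 1 plus a small perturbation, together with a constant.\<close>

lemma logeq_Ln:
 assumes "continuous_map S euclidean u" "!!x. x \<in> topspace S ==> u x \<notin> \<real>\<^sub>\<le>\<^sub>0"
  "!!x. x \<in> topspace S ==> f x = f' x * u x * c" "c ~= 0" shows "logeq S f f'" unfolding logeq_def
proof (intro exI conjI ballI)
 show "continuous_map S euclidean (%x. Ln (u x) + Ln c)"
  using assms(1,2) by (auto simp: continuous_map_atin intro!: tendsto_intros)
 fix x assume "x \<in> topspace S"
 moreover from this have "u x ~= 0" using assms(2) by force
 ultimately show "f x = f' x * exp (Ln (u x) + Ln c)" using assms(3,4) by (simp add: exp_add)
qed

lemma logeq_refl: "(!!x. x \<in> topspace S ==> f x = f' x) ==> logeq S f f'"
 by (rule logeq_Ln[where u = "%_. 1" and c = 1]) auto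

subsection \<open>The fibration over the space with one point fewer\<close>

text \<open>A continuous substitute for the minimal distance from point \<open>k\<close> to the
  other points: the inverse of 1 plus the sum of the inverse distances is at most each
  distance.\<close>

definition rad :: "nat => pt => (nat => complex) => real" where
 "rad n k b = inverse (1 + (\<Sum>j\<in>pts d n - {k}. inverse (norm (pval \<omega> b j - pval \<omega> b k))))"

lemma pval_distinct:
 "b \<in> topspace (M n) ==> j \<in> pts d n ==> k \<in> pts d n ==> j ~= k ==> pval \<omega> b j ~= pval \<omega> b k"
 using al_nz[of b n "(j,k)"] by (simp add: hyps_def alpha_def)

lemma rad_denom_pos: "1 + (\<Sum>j\<in>pts d n - {k}. inverse (norm (pval \<omega> b j - pval \<omega> b k))) > 0"
 by (intro add_pos_nonneg sum_nonneg) auto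

lemma sections_M: "sections (M n) (pts d n) (%k b. pval \<omega> b k) (rad n)"
proof
 fix k assume k: "k \<in> pts d n"
 show "continuous_map (M n) euclideanreal (rad n k)" unfolding rad_def
 proof (intro continuous_map_real_inverse continuous_map_add continuous_map_sum continuous_map_norm continuous_map_diff)
  show "1 + (\<Sum>j\<in>pts d n - {k}. inverse (norm (pval \<omega> b j - pval \<omega> b k))) ~= 0" for b
   using rad_denom_pos[of b k n] by simp
 qed (auto simp: k cont_pval pval_distinct)
 fix b assume b: "b \<in> topspace (M n)"
 show "0 < rad n k b" unfolding rad_def using rad_denom_pos by simp
 fix j assume j: "j \<in> pts d n" "j ~= k"
 have nz: "norm (pval \<omega> b j - pval \<omega> b k) > 0" using pval_distinct[OF b j(1) k j(2)] by simp
 have "inverse (norm (pval \<omega> b j - pval \<omega> b k)) <= (\<Sum>j\<in>pts d n - {k}. inverse (norm (pval \<omega> b j - pval \<omega> b k)))"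
  by (rule member_le_sum[where f = "%j. inverse (norm (pval \<omega> b j - pval \<omega> b k))"]) (use j in auto)
 hence "inverse (norm (pval \<omega> b j - pval \<omega> b k)) <= 1 + (\<Sum>j\<in>pts d n - {k}. inverse (norm (pval \<omega> b j - pval \<omega> b k)))" by simp
 from le_imp_inverse_le[OF this] nz show "rad n k b <= norm (pval \<omega> b j - pval \<omega> b k)" by (simp add: rad_def)
qed (auto simp: cont_pval)

abbreviation (input) "EE n \<equiv> sections.E (M n) (%k b. pval \<omega> b k) (pts d n)"
abbreviation (input) "emb n \<equiv> sections.emb (%k b. pval \<omega> b k) (rad n)"

definition ext1 :: "nat => (nat => complex) \<times> complex => nat => complex" where
 "ext1 n x = (fst x)(n := snd x)"

definition proj1 :: "nat => (nat => complex) => (nat => complex) \<times> complex" where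
 "proj1 n x = (restrict x {..<n}, x n)"

lemma pval_upd_old: "s \<in> pts d n ==> pval z (x(n := y)) s = pval z x s" by (cases s) auto

lemma pval_restrict: "s \<in> pts d n ==> pval z (restrict x {..<n}) s = pval z x s" by (cases s) auto

lemma alpha_upd_old: "h \<in> hyps d n ==> alpha z h (x(n := y)) = alpha z h x"
 by (auto simp: alpha_def hyps_def pval_upd_old)

text \<open>A relation \<omega>^a x_n = \<omega>^c x_j is the same as x_n = \<omega>^(c - a) x_j,
  and the exponent can be reduced mod d; so avoiding the finitely many sections in
  \<open>pts d n\<close> suffices.\<close>

lemma ext1_in_M:
 assumes b: "b \<in> topspace (M n)" and z: "!!k. k \<in> pts d n ==> z ~= pval \<omega> b k"
 shows "b(n := z) \<in> topspace (M (Suc n))"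
proof -
 have nz: "z ~= 0" using z[of None] by simp
 have *: "\<omega> ^ a * z ~= pval \<omega> b s" if ad: "a < d" and sp: "s \<in> pts d n" for a s proof
  assume eq: "\<omega> ^ a * z = pval \<omega> b s"
  show False proof (cases s)
   case None
   with eq nz show False by simp
  next
   case (Some jb)
   obtain j c where s: "s = Some (j, c)" "j < n" "c < d" using Some sp by (cases jb) auto
   have "\<omega> ^ ((c + (d - a)) mod d) * \<omega> ^ a = \<omega> ^ (c + (d - a) + a)" by (simp add: power_mod_root[OF omega_d] power_add)
   also have "c + (d - a) + a = c + d" using ad by simp
   finally have "\<omega> ^ ((c + (d - a)) mod d) * \<omega> ^ a = \<omega> ^ c" by (simp add: power_add omega_d)
   hence "\<omega> ^ a * (\<omega> ^ ((c + (d - a)) mod d) * b j) = \<omega> ^ a * z"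
    using eq s by (simp add: mult_ac)
   hence "z = pval \<omega> b (Some (j, (c + (d - a)) mod d))" by simp
   moreover have "Some (j, (c + (d - a)) mod d) \<in> pts d n" using s d by simp
   ultimately show False using z by blast
  qed
 qed
 have "pval \<omega> (b(n := z)) s ~= pval \<omega> (b(n := z)) t" if st: "s \<in> pts d (Suc n)" "t \<in> pts d (Suc n)" "s ~= t" for s t
 proof -
  consider "s \<in> pts d n" "t \<in> pts d n" | a where "s = Some (n, a)" "a < d" "t \<in> pts d n"
   | a where "t = Some (n, a)" "a < d" "s \<in> pts d n" | a c where "s = Some (n, a)" "t = Some (n, c)" "a < d" "c < d"
   using st pts_Suc[of s d n] pts_Suc[of t d n] unfolding newpt_def by (metis in_pts(2))
  thus ?thesis proof cases
   case 1
   thus ?thesis using pval_distinct[OF b] st(3) by (simp add: pval_upd_old)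
  next
   case 2
   thus ?thesis using * by (simp add: pval_upd_old)
  next
   case 3
   thus ?thesis using *[of a s] by (simp add: pval_upd_old)
  next
   case 4
   thus ?thesis using st(3) nz omega_inj by auto
  qed
 qed
 moreover have "b(n := z) \<in> extensional {..<Suc n}" using b by (auto simp: topspace_M extensional_def)
 ultimately show ?thesis by (auto simp: topspace_M van_def hyps_def)
qed

lemma restrict_in_M: "x \<in> topspace (M (Suc n)) ==> restrict x {..<n} \<in> topspace (M n)"
 by (auto simp: topspace_M van_def hyps_def pval_restrict pts_mono)

lemma cont_ext1: "continuous_map (EE n) (M (Suc n)) (ext1 n)"
proof (rule cont_into_M)
 fix i assume "i < Suc n"
 thus "continuous_map (EE n) euclidean (%x. ext1 n x i)"
  using continuous_map_compose[OF sections.cont_fst_E[OF sections_M] cont_coord] sections.cont_snd_E[OF sections_M]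
  by (cases "i = n") (auto simp: ext1_def o_def)
next
 fix x assume "x \<in> topspace (EE n)"
 thus "ext1 n x \<in> topspace (M (Suc n))" unfolding ext1_def by (intro ext1_in_M) (auto simp: sections.topspace_E[OF sections_M])
qed

lemma cont_proj1: "continuous_map (M (Suc n)) (EE n) (proj1 n)" unfolding proj1_def
proof (rule sections.cont_into_E[OF sections_M])
 show "continuous_map (M (Suc n)) (M n) (%x. restrict x {..<n})"
  by (rule cont_into_M) (auto simp: restrict_in_M intro!: cont_coord)
 show "continuous_map (M (Suc n)) euclidean (%x. x n)" by (rule cont_coord) simp
 fix x k assume x: "x \<in> topspace (M (Suc n))" and k: "k \<in> pts d n"
 have "pval \<omega> x (Some (n, 0)) ~= pval \<omega> x k"
  by (rule pval_distinct[OF x]) (use k d not_newpt[OF k] in "auto simp: pts_mono newpt_def")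
 thus "x n ~= pval \<omega> (restrict x {..<n}) k" using k by (simp add: pval_restrict)
qed

text \<open>A positive number beyond all sections. The resulting section stays far out, where every
  function involving the new coordinate has a global logarithm (\<open>logeq_far\<close>).\<close>

definition far_val :: "nat => (nat => complex) => real" where
 "far_val n b = 1 + (\<Sum>k\<in>pts d n. norm (pval \<omega> b k))"

definition far :: "nat => (nat => complex) => nat => complex" where
 "far n b = b(n := of_real (far_val n b))"

definition tube :: "nat => pt => (nat => complex) \<times> complex => nat => complex" where
 "tube n k x = (fst x)(n := pval \<omega> (fst x) k + of_real (rad n k (fst x) / (1 + norm (snd x))) * snd x)"

lemma far_val_gt: "k \<in> pts d n ==> norm (pval \<omega> b k) < far_val n b"
 using member_le_sum[of k "pts d n" "%k. norm (pval \<omega> b k)"] by (simp add: far_val_def)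

lemma cont_far_val: "continuous_map (M n) euclideanreal (far_val n)"
 unfolding far_val_def by (intro continuous_map_add continuous_map_sum continuous_map_norm) (auto simp: cont_pval)

lemma cont_far_sec: "continuous_map (M n) (EE n) (%b. (b, of_real (far_val n b)))"
proof (rule sections.cont_into_E[OF sections_M])
 show "continuous_map (M n) euclidean (%x. complex_of_real (far_val n x))"
  by (intro continuous_map_of_real_complex cont_far_val)
 fix x k assume "k \<in> pts d n"
 from far_val_gt[OF this, of x] show "complex_of_real (far_val n x) ~= pval \<omega> x k"
  by (metis norm_of_real abs_ge_self not_less)
qed auto

lemma cont_far: "continuous_map (M n) (M (Suc n)) (far n)"
 using continuous_map_compose[OF cont_far_sec cont_ext1] by (simp add: o_def ext1_def far_def[abs_def])

lemma tube_eq: "tube n k x = ext1 n (emb n k x)"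
 by (simp add: tube_def ext1_def sections.emb_def[OF sections_M])

lemma cont_tube: "k \<in> pts d n ==> continuous_map (PS (M n) (-{0})) (M (Suc n)) (tube n k)"
 using continuous_map_compose[OF sections.cont_emb[OF sections_M] cont_ext1] by (simp add: o_def tube_eq[abs_def])

text \<open>\<open>ext1\<close> and \<open>proj1\<close> identify the space of n + 1 points with the
  complement of the sections. Spanning, the ideal property of relations and the vanishing of
  dependent products are all proved by this test: on the far section and on the tubes the problem
  has one point fewer.\<close>

theorem hom_fun_zero_Suc:
 assumes l: "hom_fun p (M (Suc n)) \<phi>"
  and l0: "!!\<beta>. cycle p (M n) \<beta> ==> \<phi> (chain_map p (far n) \<beta>) = 0"
  and l1: "!!k m \<gamma>. k \<in> pts d n ==> p = Suc m ==> cycle m (M n) \<gamma> ==> \<phi> (chain_map p (tube n k) (tor m \<gamma>)) = 0"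
  and c: "cycle p (M (Suc n)) c" shows "\<phi> c = 0"
proof -
 have "\<phi> (chain_map p (ext1 n) (chain_map p (proj1 n) c)) = 0"
 proof (rule sections.hom_fun_zero[OF sections_M cont_far_sec _ hom_fun_chain_map[OF l cont_ext1]])
  show "cycle p (EE n) (chain_map p (proj1 n) c)" by (rule cycle_chain_map[OF c cont_proj1])
  show "\<phi> (chain_map p (ext1 n) (chain_map p (%b. (b, of_real (far_val n b))) \<beta>)) = 0" if "cycle p (M n) \<beta>" for \<beta>
   using l0[OF that] by (simp add: chain_map_chain_map ext1_def far_def[abs_def])
  show "\<phi> (chain_map p (ext1 n) (chain_map p (emb n k) (tor m \<gamma>))) = 0" if "k \<in> pts d n" "p = Suc m" "cycle m (M n) \<gamma>" for k m \<gamma>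
   using l1[OF that] by (simp add: chain_map_chain_map tube_eq[abs_def])
 qed auto
 moreover have "chain_map p (ext1 n) (chain_map p (proj1 n) c) = c" unfolding chain_map_chain_map
 proof (rule chain_map_id_gen)
  show "singular_chain p (M (Suc n)) c" using c by (simp add: singular_cycle)
  fix x assume "x \<in> topspace (M (Suc n))"
  hence "x \<in> extensional {..<Suc n}" by (simp add: topspace_M)
  thus "ext1 n (proj1 n x) = x" by (auto simp: ext1_def proj1_def extensional_def fun_eq_iff)
 qed
 ultimately show ?thesis by simp
qed

end

subsection \<open>Pullbacks of the logarithmic classes\<close>

text \<open>The transpose of the coordinate action: a linear form evaluated after
  \<open>wact\<close> is the form moved by \<open>pact\<close> (\<open>pval_wact\<close>).\<close>

definition pact :: "nat => (nat => int) \<times> (nat => nat) => pt => pt" where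
 "pact d w s = (case s of None => None | Some (j, a) => Some (inv_into UNIV (snd w) j, (a + nat (fst w j)) mod d))"

definition hact :: "nat => (nat => int) \<times> (nat => nat) => hyp => hyp" where
 "hact d w = map_prod (pact d w) (pact d w)"

definition wact :: "'f::field => nat => (nat => int) \<times> (nat => nat) => (nat => 'f) => nat => 'f" where
 "wact z n w x = (\<lambda>i\<in>{..<n}. z ^ nat (fst w i) * x (inv_into UNIV (snd w) i))"

lemma carrier_wreath:
 assumes "d > 0"
 shows "(g, \<sigma>) \<in> wcar d n \<longleftrightarrow> g \<in> {..<n} \<rightarrow>\<^sub>E {0..<int d} & \<sigma> permutes {..<n}"
proof -
 have "carrier (integer_mod_group d) = {0..<int d}" using assms by (simp add: carrier_integer_mod_group)
 thus ?thesis by (simp add: wreath_def)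
qed

lemma wreath_fst_range:
 assumes "d > 0" "w \<in> wcar d n" "j < n" shows "0 <= fst w j" "fst w j < int d" "nat (fst w j) < d"
proof -
 have "fst w \<in> {..<n} \<rightarrow>\<^sub>E {0..<int d}" using assms(2) carrier_wreath[OF assms(1), of "fst w" "snd w" n] by simp
 from PiE_mem[OF this, of j] assms(3) have "fst w j \<in> {0..<int d}" by simp
 thus "0 <= fst w j" "fst w j < int d" "nat (fst w j) < d" by auto
qed

lemma wreath_snd_permutes: "d > 0 ==> w \<in> wcar d n ==> snd w permutes {..<n}"
 using carrier_wreath[of d "fst w" "snd w" n] by simp

lemma inv_less: "\<sigma> permutes {..<n} ==> j < n ==> inv_into UNIV \<sigma> j < n"
 using permutes_in_image[OF permutes_inv, of \<sigma> "{..<n}" j] by simp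

lemma inv_inj: "\<sigma> permutes {..<n} ==> inv_into UNIV \<sigma> j = inv_into UNIV \<sigma> i \<longleftrightarrow> j = i"
 using permutes_inj[OF permutes_inv, of \<sigma> "{..<n}"] by (simp add: inj_eq)

lemma mod_add_cancel: "a < d ==> b < d ==> (a + (c::nat)) mod d = (b + c) mod d \<longleftrightarrow> a = b"
proof
 assume "a < d" "b < d" and eq: "(a + c) mod d = (b + c) mod d"
 have "[a + c = b + c] (mod d)" using eq by (simp add: cong_def)
 hence "[a = b] (mod d)" by (simp add: cong_add_rcancel_nat)
 thus "a = b" using \<open>a < d\<close> \<open>b < d\<close> by (simp add: cong_def)
qed simp

lemma pact_in:
 assumes "d > 0" "w \<in> wcar d n" "s \<in> pts d n" shows "pact d w s \<in> pts d n"
 using assms inv_less[OF wreath_snd_permutes[OF assms(1,2)]] by (cases s) (auto simp: pact_def)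

lemma pact_inj:
 assumes "d > 0" "w \<in> wcar d n" "s \<in> pts d n" "t \<in> pts d n"
 shows "pact d w s = pact d w t \<longleftrightarrow> s = t"
 using assms inv_inj[OF wreath_snd_permutes[OF assms(1,2)]]
 by (cases s; cases t) (auto simp: pact_def mod_add_cancel)

lemma hact_in:
 assumes "d > 0" "w \<in> wcar d n" "h \<in> hyps d n" shows "hact d w h \<in> hyps d n"
 using assms pact_in by (cases h) (auto simp: hact_def hyps_def)

lemma trivh_hact:
 assumes "d > 0" "w \<in> wcar d n" "h \<in> hyps d n" shows "trivh (hact d w h) \<longleftrightarrow> trivh h"
 using assms pact_inj by (cases h) (auto simp: hact_def hyps_def)

lemma pval_wact:
 assumes "(z::'f::field) ^ d = 1" "s \<in> pts d n" shows "pval z (wact z n w x) s = pval z x (pact d w s)"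
 using assms(2) by (cases s) (auto simp: pact_def wact_def power_mod_root[OF assms(1)] power_add mult_ac)

lemma van_wact:
 assumes "d > 0" "w \<in> wcar d n" "(z::'f::field) ^ d = 1" "h \<in> hyps d n"
 shows "van z (wact z n w x) h \<longleftrightarrow> van z x (hact d w h)"
 using assms trivh_hact[OF assms(1,2,4)] by (auto simp: van_def hact_def pval_wact hyps_def)

lemma alpha_wact:
 assumes "d > 0" "w \<in> wcar d n" "(z::'f::field) ^ d = 1" "h \<in> hyps d n"
 shows "alpha z h (wact z n w x) = alpha z (hact d w h) x"
 using assms trivh_hact[OF assms(1,2,4)] by (auto simp: alpha_def hact_def pval_wact hyps_def)

lemma listsD: "R \<in> lists d n m ==> length R = m" "R \<in> lists d n m ==> i < m ==> R ! i \<in> hyps d n"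
 by (auto simp: lists_def dest: nth_mem)

lemma pts_Suc_cases: "s \<in> pts d (Suc n) ==> (EX a<d. s = Some (n, a)) | s \<in> pts d n"
 by (auto simp: pts_def less_Suc_eq)

lemma pval_upd: "pval z (b(n := y)) s = pval z (b(n := 0)) s + pcoef z n s * y"
 by (auto simp: pval_def pcoef_def split: option.splits)

context orbit_arrangement
begin

section \<open>Defining functions on tubes, on parallel sections and on the far section\<close>

lemma upd_in_M:
 assumes "b \<in> topspace (M n)" "k \<in> pts d n" "e ~= 0" "norm e < rad n k b"
 shows "b(n := pval \<omega> b k + e) \<in> topspace (M (Suc n))"
proof (rule ext1_in_M[OF assms(1)])
 fix j assume j: "j \<in> pts d n"
 show "pval \<omega> b k + e ~= pval \<omega> b j" proof (cases "j = k")
  case False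
  have "rad n k b <= norm (pval \<omega> b j - pval \<omega> b k)" by (rule sections.r_le[OF sections_M j assms(2) False assms(1)])
  thus ?thesis using assms(4) by (metis add_diff_cancel_left' not_less)
 qed (use assms(3) in simp)
qed

definition dlt :: "nat => pt => (nat => complex) \<times> complex => complex" where
 "dlt n k x = of_real (rad n k (fst x) / (1 + norm (snd x))) * snd x"

lemma dlt:
 assumes "x \<in> topspace (PS (M n) (-{0}))" "k \<in> pts d n"
 shows "dlt n k x ~= 0" "norm (dlt n k x) < rad n k (fst x)"
  "rad n k (fst x) / (1 + norm (snd x)) > 0"
proof -
 have x: "fst x \<in> topspace (M n)" "snd x ~= 0" using assms by auto
 have rp: "rad n k (fst x) > 0" by (rule sections.r_pos[OF sections_M assms(2) x(1)])
 have n: "1 + norm (snd x) > 0" by (simp add: add_pos_nonneg)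
 show q: "rad n k (fst x) / (1 + norm (snd x)) > 0" using rp n by simp
 hence "rad n k (fst x) / (1 + norm (snd x)) ~= 0" by (metis less_irrefl)
 thus "dlt n k x ~= 0" unfolding dlt_def using x(2) by (simp only: mult_eq_0_iff of_real_eq_0_iff simp_thms)
 have "norm (dlt n k x) = rad n k (fst x) * (norm (snd x) / (1 + norm (snd x)))"
  unfolding dlt_def using q by (simp only: norm_mult norm_of_real abs_of_pos times_divide_eq_left times_divide_eq_right)
 also have "norm (snd x) / (1 + norm (snd x)) < 1" using n by (simp add: divide_less_eq)
 from mult_strict_left_mono[OF this rp] have "rad n k (fst x) * (norm (snd x) / (1 + norm (snd x))) < rad n k (fst x)" by simp
 finally show "norm (dlt n k x) < rad n k (fst x)" .
qed

lemma cont_rad_quot: "k \<in> pts d n ==>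
 continuous_map (PS (M n) (-{0})) euclideanreal (%x. rad n k (fst x) / (1 + norm (snd x)))"
proof -
 assume k: "k \<in> pts d n"
 have "continuous_map (PS (M n) (-{0})) euclideanreal (%x. 1 + norm (snd x))"
  by (intro continuous_map_add continuous_map_norm sections.cont_PS_snd[OF sections_M] continuous_map_canonical_const)
 thus ?thesis
  by (rule continuous_map_real_divide[OF sections.cont_r'[OF sections_M k sections.cont_PS_fst[OF sections_M]]])
   (rule sections.one_plus_norm_nz[OF sections_M])
qed

lemma cont_dlt: "k \<in> pts d n ==> continuous_map (PS (M n) (-{0})) euclidean (dlt n k)"
 unfolding dlt_def[abs_def]
 by (intro continuous_map_mult_complex continuous_map_of_real_complex cont_rad_quot sections.cont_PS_snd[OF sections_M])

text \<open>The equation of \<open>h\<close> is a multiple of that of the hyperplane on which x_n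
  equals point \<open>k\<close>; these are the factors that wind once around the tube.\<close>

definition wt :: "nat => pt => hyp => bool" where
 "wt n k h \<longleftrightarrow> \<not> trivh h & trivh (hsub d n k h)"

lemma al_psub_upd:
 assumes "k \<in> pts d n" "\<not> trivh h"
 shows "al h (b(n := pval \<omega> b k + e)) = (if trivh (hsub d n k h) then 0 else al (hsub d n k h) b)
  + (pcoef \<omega> n (fst h) - pcoef \<omega> n (snd h)) * e"
proof -
 have "al h (b(n := pval \<omega> b k + e)) =
  (pval \<omega> b (psub d n k (fst h)) + pcoef \<omega> n (fst h) * e) - (pval \<omega> b (psub d n k (snd h)) + pcoef \<omega> n (snd h) * e)"
  using assms(2) by (simp only: alpha_def if_False pval_psub[OF omega_d assms(1)])
 also have "... = (if trivh (hsub d n k h) then 0 else al (hsub d n k h) b) + (pcoef \<omega> n (fst h) - pcoef \<omega> n (snd h)) * e"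
  by (auto simp: alpha_def hsub_def algebra_simps)
 finally show ?thesis .
qed

text \<open>Near section \<open>k\<close> the function is its restriction plus a constant times the
  offset \<open>dlt\<close>. If the restriction is trivial, only a positive multiple of the fibre
  coordinate is left, up to that constant; otherwise the restriction dominates in the sense that the
  quotient avoids the negative half axis.\<close>

lemma logeq_tube:
 assumes k: "k \<in> pts d n" and h: "h \<in> hyps d (Suc n)"
 shows "logeq (PS (M n) (-{0})) (%x. al h (tube n k x))
  (%x. al (hsub d n k h) (fst x) * (if wt n k h then snd x else 1))"
proof (cases "trivh h")
 case True
 thus ?thesis by (intro logeq_refl) (simp add: wt_def alpha_triv trivh_hsub)
next
 case False
 let ?T = "PS (M n) (-{0})" and ?h = "hsub d n k h"
 define C where "C = pcoef \<omega> n (fst h) - pcoef \<omega> n (snd h)"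
 have tube: "tube n k x = (fst x)(n := pval \<omega> (fst x) k + dlt n k x)" for x by (simp add: tube_def dlt_def)
 have eq: "al h (tube n k x) = (if trivh ?h then 0 else al ?h (fst x)) + C * dlt n k x" for x
  unfolding tube C_def by (rule al_psub_upd[OF k False])
 \<comment> \<open>Nonvanishing is needed on the whole segment towards the section, not only at the
   point of the tube.\<close>
 have nz: "(if trivh ?h then 0 else al ?h (fst x)) + C * (of_real t * dlt n k x) ~= 0"
  if x: "x \<in> topspace ?T" and t: "0 < t" "t <= 1" for x t proof -
  have "(fst x)(n := pval \<omega> (fst x) k + of_real t * dlt n k x) \<in> topspace (M (Suc n))"
  proof (rule upd_in_M[OF _ k])
   show "of_real t * dlt n k x ~= 0" using dlt(1)[OF x k] t by simp
   have "norm (of_real t * dlt n k x) <= norm (dlt n k x)" using t by (simp add: norm_mult mult_left_le_one_le)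
   thus "norm (of_real t * dlt n k x) < rad n k (fst x)" using dlt(2)[OF x k] by simp
  qed (use x in auto)
  from al_nz[OF this h] show ?thesis unfolding C_def al_psub_upd[OF k False] .
 qed
 show ?thesis proof (cases "trivh ?h")
  case True
  show ?thesis proof (rule logeq_Ln[where u = "%x. of_real (rad n k (fst x) / (1 + norm (snd x)))" and c = C])
   show "continuous_map ?T euclidean (%x. complex_of_real (rad n k (fst x) / (1 + norm (snd x))))"
    by (intro continuous_map_of_real_complex cont_rad_quot k)
   fix x assume x: "x \<in> topspace ?T"
   show "complex_of_real (rad n k (fst x) / (1 + norm (snd x))) \<notin> \<real>\<^sub>\<le>\<^sub>0"
    using dlt(3)[OF x k] unfolding complex_nonpos_Reals_iff Re_complex_of_real by linarith
   show "al h (tube n k x) = al ?h (fst x) * (if wt n k h then snd x else 1) * complex_of_real (rad n k (fst x) / (1 + norm (snd x))) * C"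
    unfolding eq using True False by (simp only: wt_def alpha_triv dlt_def if_True) simp
  next
   show "C ~= 0" proof
    assume C: "C = 0"
    obtain a b where h': "h = (a, b)" by (cases h)
    have ab: "a \<in> pts d (Suc n)" "b \<in> pts d (Suc n)" "a ~= b" using h False by (auto simp: hyps_def h')
    from True have s: "psub d n k a = psub d n k b" by (simp add: h' hsub_def)
    show False using C ab s by (auto simp: C_def h' pcoef_def pts_def psub_def omega_inj split: option.splits if_splits)
   qed
  qed
 next
  case F: False
  have hin: "?h \<in> hyps d n" by (rule hsub_in[OF d k h])
  have Anz: "al ?h (fst x) ~= 0" if "x \<in> topspace ?T" for x using al_nz[OF _ hin] that by auto
  have cA: "continuous_map ?T euclidean (%x. al ?h (fst x))"
   using continuous_map_compose[OF sections.cont_PS_fst[OF sections_M] cont_al[OF hin]] by (simp add: o_def)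
  show ?thesis proof (rule logeq_Ln[where u = "%x. 1 + C * dlt n k x / al ?h (fst x)" and c = 1])
   show "continuous_map ?T euclidean (%x. 1 + C * dlt n k x / al ?h (fst x))"
    by (intro continuous_map_add continuous_map_divide_complex continuous_map_mult_complex cA cont_dlt[OF k] Anz continuous_map_canonical_const)
   fix x assume x: "x \<in> topspace ?T"
   show "1 + C * dlt n k x / al ?h (fst x) \<notin> \<real>\<^sub>\<le>\<^sub>0" proof
    assume "1 + C * dlt n k x / al ?h (fst x) \<in> \<real>\<^sub>\<le>\<^sub>0"
    then obtain r where r: "r <= 0" "1 + C * dlt n k x / al ?h (fst x) = of_real r" by (auto elim: nonpos_Reals_cases)
    hence e: "C * dlt n k x = of_real (r - 1) * al ?h (fst x)" using Anz[OF x] by (simp add: field_simps)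
    \<comment> \<open>If the quotient were a real number r <= 0, shrinking the offset by the factor
      1 / (1 - r), which lies in (0, 1], would produce a zero.\<close>
    have "C * (of_real (1 / (1 - r)) * dlt n k x) = of_real (1 / (1 - r)) * (C * dlt n k x)" by simp
    also have "... = of_real (1 / (1 - r) * (r - 1)) * al ?h (fst x)" unfolding e by simp
    also have "1 / (1 - r) * (r - 1) = -1" using r(1) by (simp add: field_simps)
    finally show False using nz[OF x, of "1 / (1 - r)"] r(1) F by simp
   qed
   show "al h (tube n k x) = al ?h (fst x) * (if wt n k h then snd x else 1) * (1 + C * dlt n k x / al ?h (fst x)) * 1"
    unfolding eq using F Anz[OF x] by (simp add: wt_def field_simps)
  qed simp
 qed
qed

lemma units_fst_al: "h \<in> hyps d n ==> units (PS (M n) A) (%x. al h (fst x))"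
 by (rule units_compose[OF units_al]) (auto intro: continuous_map_fst)

lemma units_snd: "units (PS S (-{0})) snd" unfolding units_def by (rule continuous_map_snd)

lemma units_mult: "units S f ==> units S g ==> units S (%x. f x * g x)"
 by (auto simp: units_iff intro: continuous_map_mult_complex)

text \<open>The residue of a product of logarithmic classes along a hyperplane: each winding factor
  in turn is removed, and the remaining ones are restricted by \<open>hsub\<close>.\<close>

theorem vf_tube:
 assumes k: "k \<in> pts d n" and R: "R \<in> lists d (Suc n) (Suc m)" and c: "cycle m (M n) c"
 shows "vf R (chain_map (Suc m) (tube n k) (tor m c)) =
  - (2 * pi * \<i>) * (\<Sum>j\<le>m. (-1)^j * (if wt n k (R ! j) then 1 else 0) * vf (map (hsub d n k) (drp j R)) c)"
proof -
 have Rl: "length R = Suc m" and Rin: "!!i. i <= m ==> R ! i \<in> hyps d (Suc n)" using listsD[OF R] by auto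
 define G where "G = map (%h x. al (hsub d n k h) (fst x) * (if wt n k h then snd x else 1)) R"
 have "vf R (chain_map (Suc m) (tube n k) (tor m c)) = ev (lform G) (tor m c)"
 proof (rule vf_eqI[OF cycle_tor[OF c] Rl _ cont_tube[OF k]])
  show "length G = Suc m" by (simp add: G_def Rl)
  fix i assume i: "i < Suc m"
  hence h: "R ! i \<in> hyps d (Suc n)" using Rin by simp
  show "units (PS (M n) (-{0})) (G ! i)" "logeq (PS (M n) (-{0})) (%x. al (R ! i) (tube n k x)) (G ! i)"
   using i logeq_tube[OF k h] units_mult[OF units_fst_al[OF hsub_in[OF d k h]] units_snd] units_fst_al[OF hsub_in[OF d k h]]
   by (cases "wt n k (R ! i)"; simp add: G_def Rl)+
 qed
 also have "... = - (2 * pi * \<i>) * (\<Sum>j\<le>m. (-1)^j * (if wt n k (R ! j) then 1 else 0) * ev (lform (drp j (map (%h. al (hsub d n k h)) R))) c)"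
 proof (rule ev_lform_tor[of _ "M n"])
  fix i assume "i <= m"
  thus "units (M n) (map (%h. al (hsub d n k h)) R ! i)"
   using units_al[OF hsub_in[OF d k Rin]] by (simp add: Rl)
 qed (use c in "simp_all add: singular_cycle G_def Rl")
 finally show ?thesis by (simp add: vf_def map_drp o_def)
qed

text \<open>A section parallel to section \<open>k\<close>. Pulling back along it restricts classes
  to the hyperplane; a winding factor becomes trivial there, in accordance with the value 1 of
  \<open>alpha\<close> on trivial pairs.\<close>

definition near :: "nat => pt => (nat => complex) => nat => complex" where
 "near n k b = tube n k (b, 1)"

lemma cont_near: "k \<in> pts d n ==> continuous_map (M n) (M (Suc n)) (near n k)"
 using continuous_map_compose[OF continuous_map_section cont_tube, of 1 k n] by (simp add: o_def near_def[abs_def])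

theorem vf_near:
 assumes k: "k \<in> pts d n" and R: "R \<in> lists d (Suc n) m" and c: "cycle m (M n) c"
 shows "vf R (chain_map m (near n k) c) = vf (map (hsub d n k) R) c"
proof -
 have Rl: "length R = m" and Rin: "!!i. i < m ==> R ! i \<in> hyps d (Suc n)" using listsD[OF R] by auto
 show ?thesis unfolding vf_def[of "map (hsub d n k) R"] proof (rule vf_eqI[OF c Rl _ cont_near[OF k]])
  fix i assume i: "i < m"
  hence h: "R ! i \<in> hyps d (Suc n)" using Rin by simp
  show "units (M n) (map al (map (hsub d n k) R) ! i)" using i Rl units_al[OF hsub_in[OF d k h]] by simp
  obtain g where g: "continuous_map (PS (M n) (-{0})) euclidean g"
   "ALL x:topspace (PS (M n) (-{0})). al (R ! i) (tube n k x) = al (hsub d n k (R ! i)) (fst x) * (if wt n k (R ! i) then snd x else 1) * exp (g x)"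
   using logeq_tube[OF k h] unfolding logeq_def by blast
  have "continuous_map (M n) euclidean (%b. g (b, 1))"
   using continuous_map_compose[OF continuous_map_section g(1), of 1] by (simp add: o_def)
  thus "logeq (M n) (%x. al (R ! i) (near n k x)) (map al (map (hsub d n k) R) ! i)"
   unfolding logeq_def using g(2) i Rl by (intro exI[of _ "%b. g (b,1)"]) (auto simp: near_def)
 qed (simp add: Rl)
qed

text \<open>The function is B + C r with r = \<open>far_val\<close> and |B| < |C| r, so after
  division by C its values lie in the right half plane.\<close>

lemma logeq_far:
 assumes h: "h \<in> hyps d (Suc n)" "newh n h" shows "logeq (M n) (%b. al h (far n b)) (%_. 1)"
proof (cases "trivh h")
 case True
 thus ?thesis by (intro logeq_refl) (simp add: alpha_triv)
next
 case False
 define C where "C = pcoef \<omega> n (fst h) - pcoef \<omega> n (snd h)"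
 define B where "B b = pval \<omega> (b(n := 0)) (fst h) - pval \<omega> (b(n := 0)) (snd h)" for b
 have eq: "al h (far n b) = B b + C * of_real (far_val n b)" for b
  using False by (simp add: alpha_def far_def pval_upd[of \<omega> _ n "of_real _"] B_def C_def algebra_simps)
 obtain s t where h': "h = (s, t)" by (cases h)
 have st: "s \<in> pts d (Suc n)" "t \<in> pts d (Suc n)" "s ~= t" using h(1) False by (auto simp: h' hyps_def)
 have fpos: "far_val n b > 0" for b using far_val_gt[of None n b] by simp
 have C: "C ~= 0 & (ALL b. norm (B b) < norm C * far_val n b)" proof -
  consider a where "s = Some (n, a)" "t \<in> pts d n" | a where "t = Some (n, a)" "s \<in> pts d n"
   | a c where "s = Some (n, a)" "t = Some (n, c)" "a < d" "c < d"
   using pts_Suc_cases[OF st(1)] pts_Suc_cases[OF st(2)] h(2) not_newpt[of s d n] not_newpt[of t d n]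
   unfolding newh_def h' fst_conv snd_conv by blast
  thus ?thesis proof cases
   case 1
   have "pcoef \<omega> n t = 0" using not_newpt[OF 1(2)] by (auto simp: pcoef_def newpt_def split: option.splits)
   hence "C = \<omega> ^ a" "!!b. B b = - pval \<omega> b t" using 1 by (simp_all add: C_def B_def h' pcoef_def pval_upd_old)
   thus ?thesis using far_val_gt[OF 1(2)] by (simp add: norm_power)
  next
   case 2
   have "pcoef \<omega> n s = 0" using not_newpt[OF 2(2)] by (auto simp: pcoef_def newpt_def split: option.splits)
   hence "C = - (\<omega> ^ a)" "!!b. B b = pval \<omega> b s" using 2 by (simp_all add: C_def B_def h' pcoef_def pval_upd_old)
   thus ?thesis using far_val_gt[OF 2(2)] by (simp add: norm_power)
  next
   case 3
   hence "C = \<omega> ^ a - \<omega> ^ c" "!!b. B b = 0" by (simp_all add: C_def B_def h' pcoef_def)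
   moreover have "\<omega> ^ a ~= \<omega> ^ c" using 3 st(3) by (simp add: omega_inj)
   ultimately show ?thesis using fpos by simp
  qed
 qed
 have cB: "continuous_map (M n) euclidean B" proof -
  have "continuous_map (M n) euclidean (%b. pval \<omega> (b(n := 0)) s)" if "s \<in> pts d (Suc n)" for s
   using that by (cases s) (auto simp: less_Suc_eq intro!: continuous_intros cont_coord)
  thus ?thesis unfolding B_def[abs_def] using st by (intro continuous_map_diff) (auto simp: h')
 qed
 show ?thesis proof (rule logeq_Ln[where u = "%b. of_real (far_val n b) + B b / C" and c = C])
  show "continuous_map (M n) euclidean (%b. of_real (far_val n b) + B b / C)"
   by (intro continuous_map_add continuous_map_of_real_complex cont_far_val continuous_map_divide_complex cB continuous_map_canonical_const)
    (use C in auto)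
  show "C ~= 0" using C by blast
  fix b
  show "of_real (far_val n b) + B b / C \<notin> \<real>\<^sub>\<le>\<^sub>0" proof -
   have "norm (B b / C) < far_val n b" using C by (simp add: norm_divide divide_less_eq mult.commute)
   hence "Re (B b / C) > - far_val n b" using abs_Re_le_cmod[of "B b / C"] by linarith
   thus ?thesis by (auto simp: complex_nonpos_Reals_iff)
  qed
  have "C ~= 0" using C by blast
  thus "al h (far n b) = 1 * (of_real (far_val n b) + B b / C) * C" unfolding eq by (simp add: distrib_left mult.commute)
 qed
qed

theorem vf_far:
 assumes R: "R \<in> lists d (Suc n) m" and c: "cycle m (M n) c"
 shows "vf R (chain_map m (far n) c) = (if EX h:set R. newh n h then 0 else vf R c)"
proof -
 have Rl: "length R = m" and Rin: "!!i. i < m ==> R ! i \<in> hyps d (Suc n)" using listsD[OF R] by auto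
 define G where "G = map (%h. if newh n h then (%_. 1) else al h) R"
 have eq: "vf R (chain_map m (far n) c) = ev (lform G) c" proof (rule vf_eqI[OF c Rl _ cont_far])
  show "length G = m" by (simp add: G_def Rl)
  fix i assume i: "i < m"
  hence h: "R ! i \<in> hyps d (Suc n)" using Rin by simp
  show "units (M n) (G ! i)" using i Rl units_al[OF hyps_Suc[OF h]] units_1 by (auto simp: G_def)
  have "al (R ! i) (far n b) = al (R ! i) b" if "\<not> newh n (R ! i)" for b
   unfolding far_def by (rule alpha_upd_old[OF hyps_Suc[OF h that]])
  thus "logeq (M n) (%x. al (R ! i) (far n x)) (G ! i)"
   using i Rl logeq_far[OF h] by (auto simp: G_def intro: logeq_refl)
 qed
 show ?thesis proof (cases "EX h:set R. newh n h")
  case True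
  then obtain i where i: "i < m" "newh n (R ! i)" using Rl by (auto simp: in_set_conv_nth)
  have "ev (lform G) c = 0"
   by (rule lform_1[of m "M n" _ _ i]) (use c i Rl in "auto simp: singular_cycle G_def")
  thus ?thesis using eq True by simp
 next
  case False
  hence "G = map al R" by (auto simp: G_def)
  thus ?thesis using eq False by (simp add: vf_def)
 qed
qed

section \<open>Scaling and localisation at a point\<close>

definition scl :: "nat => (nat => complex) \<times> complex => nat => complex" where
 "scl n x = (\<lambda>i\<in>{..<n}. snd x * fst x i)"

lemma pval_scl: "s \<in> pts d n ==> pval \<omega> (scl n x) s = snd x * pval \<omega> (fst x) s"
 by (cases s) (auto simp: scl_def)

lemma cont_scl: "continuous_map (PS (M n) (-{0})) (M n) (scl n)"
proof (rule cont_into_M)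
 fix i assume "i < n"
 thus "continuous_map (PS (M n) (-{0})) euclidean (%x. scl n x i)"
  using continuous_map_compose[OF sections.cont_PS_fst[OF sections_M] cont_coord]
  by (simp add: scl_def o_def continuous_map_mult_complex sections.cont_PS_snd[OF sections_M])
next
 fix x assume "x \<in> topspace (PS (M n) (-{0}))"
 thus "scl n x \<in> topspace (M n)" by (auto simp: topspace_M van_def hyps_def pval_scl) (auto simp: scl_def)
qed

text \<open>Every nontrivial defining function is homogeneous of degree 1 and winds once when a
  cycle is rotated about 0; evaluation on the rotated cycle is therefore contraction with the Euler
  field.\<close>

theorem vf_scl:
 assumes R: "R \<in> lists d n (Suc m)" and c: "cycle m (M n) c"
 shows "vf R (chain_map (Suc m) (scl n) (tor m c)) =
  - (2 * pi * \<i>) * (\<Sum>j\<le>m. (-1)^j * (if \<not> trivh (R ! j) then 1 else 0) * vf (drp j R) c)"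
proof -
 have Rl: "length R = Suc m" and Rin: "!!i. i <= m ==> R ! i \<in> hyps d n" using listsD[OF R] by auto
 define G where "G = map (%h x. al h (fst x) * (if \<not> trivh h then snd x else 1)) R"
 have "vf R (chain_map (Suc m) (scl n) (tor m c)) = ev (lform G) (tor m c)"
 proof (rule vf_eqI[OF cycle_tor[OF c] Rl _ cont_scl])
  show "length G = Suc m" by (simp add: G_def Rl)
  fix i assume i: "i < Suc m"
  hence h: "R ! i \<in> hyps d n" using Rin by simp
  show "units (PS (M n) (-{0})) (G ! i)"
   using i units_mult[OF units_fst_al[OF h] units_snd] units_fst_al[OF h] by (cases "trivh (R ! i)") (auto simp: G_def Rl)
  show "logeq (PS (M n) (-{0})) (%x. al (R ! i) (scl n x)) (G ! i)"
   using i h by (intro logeq_refl) (auto simp: G_def Rl alpha_def hyps_def pval_scl algebra_simps)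
 qed
 also have "... = - (2 * pi * \<i>) * (\<Sum>j\<le>m. (-1)^j * (if \<not> trivh (R ! j) then 1 else 0) * ev (lform (drp j (map al R))) c)"
  by (rule ev_lform_tor[of _ "M n"])
   (use c Rin in "auto simp: singular_cycle G_def Rl less_Suc_eq_le intro!: units_al")
 finally show ?thesis by (simp add: vf_def map_drp)
qed

text \<open>Makes the perturbation at every hyperplane not through \<open>y\<close> smaller than the
  value at \<open>y\<close> (\<open>eps_small\<close>). A sum replaces the maximum to keep it
  continuous in \<open>v\<close>.\<close>

definition eps :: "nat => (nat => complex) => (nat => complex) => real" where
 "eps n y v = inverse (1 + (\<Sum>h\<in>{h\<in>hyps d n. \<not> van \<omega> y h}. norm (al h v) * inverse (norm (al h y))))"

definition loc :: "nat => (nat => complex) => (nat => complex) => nat => complex" where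
 "loc n y v = (\<lambda>i\<in>{..<n}. y i + of_real (eps n y v) * v i)"

lemma eps_denom: "1 + (\<Sum>h\<in>{h\<in>hyps d n. \<not> van \<omega> y h}. norm (al h v) * inverse (norm (al h y))) > 0"
 by (intro add_pos_nonneg sum_nonneg) auto

lemma eps_pos: "eps n y v > 0" unfolding eps_def using eps_denom by simp

lemma eps_small:
 assumes "h \<in> hyps d n" "\<not> van \<omega> y h"
 shows "norm (of_real (eps n y v) * al h v) < norm (al h y)"
proof -
 have nz: "norm (al h y) > 0" using assms(2) by (simp add: alpha_0_iff)
 let ?S = "\<Sum>h\<in>{h\<in>hyps d n. \<not> van \<omega> y h}. norm (al h v) * inverse (norm (al h y))"
 have "norm (al h v) * inverse (norm (al h y)) <= ?S"
  by (rule member_le_sum[where f = "%h. norm (al h v) * inverse (norm (al h y))"]) (use assms in auto)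
 hence "norm (al h v) * inverse (norm (al h y)) < 1 + ?S" by simp
 hence "norm (al h v) < (1 + ?S) * norm (al h y)" using nz by (simp add: field_simps)
 moreover have "norm (of_real (eps n y v) * al h v) = norm (al h v) / (1 + ?S)"
  unfolding norm_mult norm_of_real abs_of_pos[OF eps_pos] by (simp add: eps_def field_simps)
 ultimately show ?thesis using eps_denom[of v y n] by (simp only: pos_divide_less_eq mult.commute)
qed

lemma cont_eps: "continuous_map (M n) euclideanreal (eps n y)" unfolding eps_def
proof (intro continuous_map_real_inverse continuous_map_add continuous_map_sum continuous_map_real_mult continuous_map_norm)
 show "1 + (\<Sum>h\<in>{h\<in>hyps d n. \<not> van \<omega> y h}. norm (al h v) * inverse (norm (al h y))) ~= 0" for v
  using eps_denom[of v y n] by simp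
qed (auto simp: cont_al alpha_0_iff)

lemma pval_loc: "s \<in> pts d n ==> pval \<omega> (loc n y v) s = pval \<omega> y s + of_real (eps n y v) * pval \<omega> v s"
 by (cases s) (auto simp: loc_def algebra_simps)

lemma al_loc: "h \<in> hyps d n ==> \<not> trivh h ==> al h (loc n y v) = al h y + of_real (eps n y v) * al h v"
 by (auto simp: alpha_def hyps_def pval_loc algebra_simps)

lemma al_loc_nz:
 assumes v: "v \<in> topspace (M n)" and h: "h \<in> hyps d n" shows "al h (loc n y v) ~= 0"
proof (cases "trivh h")
 case False
 show ?thesis proof (cases "van \<omega> y h")
  case True
  hence "al h y = 0" by (simp add: alpha_0_iff)
  thus ?thesis using al_loc[OF h False] al_nz[OF v h] eps_pos[of n y v] by simp
 next
  case F: False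
  show ?thesis proof
   assume "al h (loc n y v) = 0"
   hence "of_real (eps n y v) * al h v = - al h y" using al_loc[OF h False, of y v] by (simp add: eq_neg_iff_add_eq_0 add.commute)
   thus False using eps_small[OF h F, of v] by simp
  qed
 qed
qed (simp add: alpha_triv)

lemma cont_loc: "continuous_map (M n) (M n) (loc n y)"
proof (rule cont_into_M)
 fix i assume "i < n"
 thus "continuous_map (M n) euclidean (%x. loc n y x i)"
  by (simp add: loc_def continuous_map_add continuous_map_mult_complex continuous_map_of_real_complex cont_eps cont_coord)
next
 fix v assume "v \<in> topspace (M n)"
 thus "loc n y v \<in> topspace (M n)" using al_loc_nz unfolding alpha_0_iff topspace_M by (auto simp: loc_def)
qed

text \<open>Near \<open>y\<close> a function vanishing at \<open>y\<close> is a positive multiple of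
  itself at \<open>v\<close>, while every other one is a constant times a factor in the right half
  plane. So localisation is the projection to lists of hyperplanes through \<open>y\<close>.\<close>

theorem vf_loc:
 assumes R: "R \<in> lists d n m" and c: "cycle m (M n) c"
 shows "vf R (chain_map m (loc n y) c) = (if ALL h:set R. van \<omega> y h then vf R c else 0)"
proof -
 have Rl: "length R = m" and Rin: "!!i. i < m ==> R ! i \<in> hyps d n" using listsD[OF R] by auto
 define G where "G = map (%h. if van \<omega> y h then al h else (%_. 1)) R"
 have eq: "vf R (chain_map m (loc n y) c) = ev (lform G) c" proof (rule vf_eqI[OF c Rl _ cont_loc])
  show "length G = m" by (simp add: G_def Rl)
  fix i assume i: "i < m"
  hence h: "R ! i \<in> hyps d n" using Rin by simp
  show "units (M n) (G ! i)" using i Rl units_al[OF h] units_1 by (auto simp: G_def)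
  show "logeq (M n) (%x. al (R ! i) (loc n y x)) (G ! i)" proof (cases "trivh (R ! i)")
   case True
   thus ?thesis using i Rl by (intro logeq_refl) (auto simp: G_def alpha_triv van_def)
  next
   case nt: False
   show ?thesis proof (cases "van \<omega> y (R ! i)")
    case True
    hence y0: "al (R ! i) y = 0" by (simp add: alpha_0_iff)
    show ?thesis proof (rule logeq_Ln[where u = "%v. of_real (eps n y v)" and c = 1])
     show "continuous_map (M n) euclidean (%v. complex_of_real (eps n y v))"
      by (intro continuous_map_of_real_complex cont_eps)
     fix v
     show "complex_of_real (eps n y v) \<notin> \<real>\<^sub>\<le>\<^sub>0"
      using eps_pos[of n y v] unfolding complex_nonpos_Reals_iff Re_complex_of_real by linarith
     show "al (R ! i) (loc n y v) = (G ! i) v * complex_of_real (eps n y v) * 1"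
      using True i Rl by (simp add: G_def al_loc[OF h nt] y0)
    qed simp
   next
    case False
    hence y0: "al (R ! i) y ~= 0" by (simp add: alpha_0_iff)
    show ?thesis
    proof (rule logeq_Ln[where u = "%v. 1 + of_real (eps n y v) * al (R ! i) v / al (R ! i) y" and c = "al (R ! i) y"])
     show "continuous_map (M n) euclidean (%v. 1 + of_real (eps n y v) * al (R ! i) v / al (R ! i) y)"
      by (intro continuous_map_add continuous_map_divide_complex continuous_map_mult_complex continuous_map_of_real_complex
       cont_eps cont_al[OF h] continuous_map_canonical_const) (use y0 in auto)
     fix v
     show "1 + of_real (eps n y v) * al (R ! i) v / al (R ! i) y \<notin> \<real>\<^sub>\<le>\<^sub>0" proof -
      have "norm (of_real (eps n y v) * al (R ! i) v / al (R ! i) y) < 1"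
       using eps_small[OF h False, of v] y0 by (simp add: norm_divide divide_less_eq)
      hence "Re (of_real (eps n y v) * al (R ! i) v / al (R ! i) y) > - 1"
       using abs_Re_le_cmod[of "of_real (eps n y v) * al (R ! i) v / al (R ! i) y"] by linarith
      thus ?thesis by (auto simp: complex_nonpos_Reals_iff)
     qed
     show "al (R ! i) (loc n y v) = (G ! i) v * (1 + of_real (eps n y v) * al (R ! i) v / al (R ! i) y) * al (R ! i) y"
      using False i Rl y0 by (simp add: G_def al_loc[OF h nt] field_simps)
    qed (rule y0)
   qed
  qed
 qed
 show ?thesis proof (cases "ALL h:set R. van \<omega> y h")
  case False
  then obtain i where i: "i < m" "\<not> van \<omega> y (R ! i)" using Rl by (auto simp: in_set_conv_nth)
  have "ev (lform G) c = 0"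
   by (rule lform_1[of m "M n" _ _ i]) (use c i Rl in "auto simp: singular_cycle G_def")
  thus ?thesis using eq False by auto
 next
  case True
  hence "G = map al R" by (auto simp: G_def)
  thus ?thesis using eq True by (simp add: vf_def)
 qed
qed

section \<open>The group action on products of logarithmic classes\<close>

lemma conf_act_eq_wact:
 assumes "w \<in> wcar d n" shows "conf_act d n w x = wact \<omega> n w x"
proof -
 have "cis (2 * pi * of_int (fst w i) / of_nat d) = \<omega> ^ nat (fst w i)" if "i < n" for i
  using wreath_fst_range(1)[OF d assms that] by (simp add: omega_power)
 thus ?thesis by (auto simp: conf_act_def wact_def case_prod_beta intro!: restrict_ext)
qed

lemma cont_wact:
 assumes "w \<in> wcar d n" shows "continuous_map (M n) (M n) (wact \<omega> n w)"
proof (rule cont_into_M)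
 fix i assume "i < n"
 thus "continuous_map (M n) euclidean (%x. wact \<omega> n w x i)"
  using inv_less[OF wreath_snd_permutes[OF d assms]] by (simp add: wact_def continuous_map_mult_complex cont_coord)
next
 fix x assume "x \<in> topspace (M n)"
 thus "wact \<omega> n w x \<in> topspace (M n)"
  using van_wact[OF d assms omega_d] hact_in[OF d assms] by (auto simp: topspace_M) (auto simp: wact_def)
qed

theorem vf_act:
 assumes w: "w \<in> wcar d n" and R: "R \<in> lists d n m" and c: "cycle m (M n) c"
 shows "vf R (chain_map m (conf_act d n w) c) = vf (map (hact d w) R) c"
proof -
 have Rl: "length R = m" and Rin: "!!i. i < m ==> R ! i \<in> hyps d n" using listsD[OF R] by auto
 have "chain_map m (conf_act d n w) c = chain_map m (wact \<omega> n w) c"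
  by (rule chain_map_eq[of m "M n"]) (use c conf_act_eq_wact[OF w] in "auto simp: singular_cycle")
 moreover have "vf R (chain_map m (wact \<omega> n w) c) = vf (map (hact d w) R) c"
  unfolding vf_def[of "map (hact d w) R"] proof (rule vf_eqI[OF c Rl _ cont_wact[OF w]])
  fix i assume i: "i < m"
  hence h: "R ! i \<in> hyps d n" using Rin by simp
  show "units (M n) (map al (map (hact d w) R) ! i)" using i Rl units_al[OF hact_in[OF d w h]] by simp
  show "logeq (M n) (%x. al (R ! i) (wact \<omega> n w x)) (map al (map (hact d w) R) ! i)"
   using i Rl by (intro logeq_refl) (simp add: alpha_wact[OF d w omega_d h])
 qed (simp add: Rl)
 ultimately show ?thesis by simp
qed

end

section \<open>Cohomology is spanned by the logarithmic classes\<close>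

lemma hom_fun_minus_diff:
 assumes "hom_fun p S \<phi>" "cycle p S a" "cycle p S b" shows "\<phi> (a - b) = \<phi> a - \<phi> b"
 using hom_fun_add[OF assms(1) singular_relcycle_diff[OF assms(2,3)] assms(3)] by simp

lemma hom_fun_scale: "hom_fun p S f ==> hom_fun p S (%c. a * f c)" by (auto simp: hom_fun_def distrib_left)

lemma hom_fun_add_fun: "hom_fun p S f ==> hom_fun p S g ==> hom_fun p S (%c. f c + g c)"
 by (auto simp: hom_fun_def)

lemma hom_fun_sum_list: "(!!y. y \<in> set L ==> hom_fun p S (f y)) ==> hom_fun p S (%c. \<Sum>y\<leftarrow>L. f y c)"
proof (induction L)
 case Nil
 thus ?case by (simp add: hom_fun_def)
next
 case (Cons a L)
 thus ?case by (auto intro!: hom_fun_add_fun)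
qed

context orbit_arrangement
begin

definition spn :: "nat => nat => ((nat => complex) chain => complex) => bool" where
 "spn n p \<phi> \<longleftrightarrow> (EX x. ALL c. singular_relcycle p (M n) {} c --> \<phi> c = (\<Sum>R\<in>lists d n p. x R * vf R c))"

lemma spn_vf: "R \<in> lists d n p ==> spn n p (vf R)" unfolding spn_def
 by (rule exI[of _ "%R'. if R' = R then 1 else 0"]) (simp add: if_distrib[of "%x. x * _"] cong: if_cong)

lemma spn_0: "spn n p (%c. 0)" unfolding spn_def by (rule exI[of _ "%R'. 0"]) simp

lemma spn_add: "spn n p f ==> spn n p g ==> spn n p (%c. f c + g c)" unfolding spn_def
proof (elim exE)
 fix x y assume "ALL c. singular_relcycle p (M n) {} c --> f c = (\<Sum>R\<in>lists d n p. x R * vf R c)"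
  "ALL c. singular_relcycle p (M n) {} c --> g c = (\<Sum>R\<in>lists d n p. y R * vf R c)"
 thus "EX x. ALL c. singular_relcycle p (M n) {} c --> f c + g c = (\<Sum>R\<in>lists d n p. x R * vf R c)"
  by (intro exI[of _ "%R. x R + y R"]) (simp add: distrib_right sum.distrib)
qed

lemma spn_scale: "spn n p f ==> spn n p (%c. a * f c)" unfolding spn_def
proof (elim exE)
 fix x assume "ALL c. singular_relcycle p (M n) {} c --> f c = (\<Sum>R\<in>lists d n p. x R * vf R c)"
 thus "EX x. ALL c. singular_relcycle p (M n) {} c --> a * f c = (\<Sum>R\<in>lists d n p. x R * vf R c)"
  by (intro exI[of _ "%R. a * x R"]) (simp add: sum_distrib_left mult.assoc)
qed

lemma spn_sum: "finite I ==> (!!i. i \<in> I ==> spn n p (f i)) ==> spn n p (%c. \<Sum>i\<in>I. a i * f i c)"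
proof (induction I rule: finite_induct)
 case (insert x F)
 hence "spn n p (%c. a x * f x c)" "spn n p (%c. \<Sum>i\<in>F. a i * f i c)" by (auto intro!: spn_scale)
 from spn_add[OF this] show ?case using insert(1,2) by simp
qed (simp add: spn_0)

lemma spn_cong: "spn n p f ==> (!!c. cycle p (M n) c ==> g c = f c) ==> spn n p g" unfolding spn_def by metis

lemma wt_old: "h \<in> hyps d n ==> \<not> wt n k h" by (auto simp: wt_def hsub_old)

lemma map_hsub_old: "R \<in> lists d n p ==> map (hsub d n k) R = R"
 by (rule map_idI) (auto simp: lists_def hsub_old)

lemma lists_mono: "R \<in> lists d n p ==> R \<in> lists d (Suc n) p"
 by (auto simp: lists_def subset_iff hyps_mono)

lemma lists_Cons: "h \<in> hyps d n ==> R \<in> lists d n p ==> h # R \<in> lists d n (Suc p)"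
 by (auto simp: lists_def)

lemma vf_tube_old:
 assumes "k \<in> pts d n" "R \<in> lists d n (Suc m)" "cycle m (M n) c"
 shows "vf R (chain_map (Suc m) (tube n k) (tor m c)) = 0"
proof -
 have "(if wt n k (R ! j) then 1 else 0) = (0::complex)" if "j <= m" for j
  using wt_old[OF listsD(2)[OF assms(2)], of j] that by simp
 thus ?thesis unfolding vf_tube[OF assms(1) lists_mono[OF assms(2)] assms(3)] by simp
qed

lemma vf_tube_Cons:
 assumes k: "k \<in> pts d n" and H: "H \<in> hyps d (Suc n)" and R: "R \<in> lists d (Suc n) m" and c: "cycle m (M n) c"
 shows "vf (H # R) (chain_map (Suc m) (tube n k) (tor m c)) = - (2 * pi * \<i>) *
  ((if wt n k H then vf (map (hsub d n k) R) c else 0) -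
   (\<Sum>i<m. (-1)^i * (if wt n k (R ! i) then 1 else 0) * vf (hsub d n k H # map (hsub d n k) (drp i R)) c))"
 unfolding vf_tube[OF k lists_Cons[OF H R] c] lessThan_Suc_atMost[symmetric] sum.lessThan_Suc_shift
 by (simp add: sum_negf)

lemma vf_tube_sec:
 assumes jk: "j \<in> pts d n" "k \<in> pts d n" and R: "R \<in> lists d n m" and c: "cycle m (M n) c"
 shows "vf ((Some (n, 0), k) # R) (chain_map (Suc m) (tube n j) (tor m c)) = - (2 * pi * \<i>) * (if j = k then vf R c else 0)"
proof -
 have h: "(Some (n, 0), k) \<in> hyps d (Suc n)" using jk d by (simp add: hyps_def pts_mono)
 have "psub d n j (Some (n, 0)) = j" using jk(1) by (cases j) (auto simp: psub_def)
 hence w: "wt n j (Some (n, 0), k) \<longleftrightarrow> j = k"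
  using jk(2) not_newpt[OF jk(2)] by (auto simp: wt_def hsub_def psub_old newpt_def)
 have "(\<Sum>i<m. (-1)^i * (if wt n j (R ! i) then 1 else 0) * vf (hsub d n j (Some (n, 0), k) # map (hsub d n j) (drp i R)) c) = 0"
  using wt_old[OF listsD(2)[OF R]] by (intro sum.neutral) auto
 thus ?thesis
  unfolding vf_tube_Cons[OF jk(1) h lists_mono[OF R] c] w map_hsub_old[OF R] by (simp only: diff_zero)
qed

lemma topspace_M0: "topspace (M 0) = {%_. undefined}" by (auto simp: topspace_M van_def hyps_def pts_def)

text \<open>Induction on the number of points. Residues along all tubes are functionals in fewer
  points, hence combinations of lists; subtracting products with the classes of x_n minus a point
  removes them. What remains is determined by the far section and is matched there by lists in n
  points.\<close>

theorem vf_span: "hom_fun p (M n) \<phi> ==> spn n p \<phi>"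
proof (induction n arbitrary: p \<phi>)
 case 0
 show ?case proof (cases p)
  case (Suc m)
  have "\<phi> c = 0" if "cycle p (M 0) c" for c
   using singular_boundary_eq_cycle_singleton[OF topspace_M0, of p c] that 0 Suc by (simp add: hom_fun_def)
  thus ?thesis by (intro spn_cong[OF spn_0]) auto
 next
  case p0: 0
  let ?s = "restrict (%x. %_. undefined) (standard_simplex 0) :: (nat => real) => nat => complex"
  have "\<phi> c = \<phi> (frag_of ?s) * vf [] c" if c: "cycle 0 (M 0) c" for c proof -
   have "pkeys c <= {?s}"
    using c by (auto simp: singular_cycle singular_chain_def singular_simplex_singleton[OF topspace_M0])
   hence "cycle 0 (M 0) c & \<phi> c = \<phi> (frag_of ?s) * vf [] c" proof (induction rule: frag_induction)
    case zero
    thus ?case using hom_fun_0[OF 0] by (simp add: p0 vf_def)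
   next
    case (one x)
    hence "singular_simplex 0 (M 0) x" by (simp add: singular_simplex_singleton[OF topspace_M0])
    hence "cycle 0 (M 0) (frag_of x)" by (simp add: singular_cycle singular_chain_of chain_boundary_def)
    moreover have "vf [] (frag_of x) = 1" by (simp add: vf_def lform_def)
    moreover have "x = ?s" using one by blast
    ultimately show ?case by (simp only: mult_1_right simp_thms)
   next
    case (diff a b)
    thus ?case using hom_fun_minus_diff[OF 0, of a b]
     by (auto simp: p0 singular_relcycle_diff vf_def ev_diff right_diff_distrib)
   qed
   thus ?thesis by blast
  qed
  moreover have "spn 0 0 (%c. \<phi> (frag_of ?s) * vf [] c)" by (intro spn_scale spn_vf) (simp add: lists_def)
  ultimately show ?thesis unfolding p0 by (rule spn_cong[rotated])
 qed
next
 case (Suc n)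
 note l = Suc.prems
 have "EX \<psi>. hom_fun p (M (Suc n)) \<psi> & spn (Suc n) p (%c. \<phi> c - \<psi> c) &
   (ALL k:pts d n. ALL m \<gamma>. p = Suc m --> cycle m (M n) \<gamma> --> \<psi> (chain_map p (tube n k) (tor m \<gamma>)) = 0)"
 proof (cases p)
  case 0
  thus ?thesis using l by (intro exI[of _ \<phi>]) (auto simp: spn_0)
 next
  case p: (Suc m)
  have "EX x. ALL c. cycle m (M n) c --> \<phi> (chain_map (Suc m) (tube n k) (tor m c)) = (\<Sum>R\<in>lists d n m. x R * vf R c)"
   if k: "k \<in> pts d n" for k
   using Suc.IH[OF hom_fun_tor[OF hom_fun_chain_map[OF l[unfolded p] cont_tube[OF k]]]] unfolding spn_def .
  hence "ALL k:pts d n. EX x. ALL c. cycle m (M n) c --> \<phi> (chain_map (Suc m) (tube n k) (tor m c)) = (\<Sum>R\<in>lists d n m. x R * vf R c)"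
   by blast
  from bchoice[OF this] obtain x where "ALL k:pts d n. ALL c. cycle m (M n) c --> \<phi> (chain_map (Suc m) (tube n k) (tor m c)) = (\<Sum>R\<in>lists d n m. x k R * vf R c)"
   by (elim exE) (rule that)
  hence x: "!!k c. k \<in> pts d n ==> cycle m (M n) c ==>
    \<phi> (chain_map (Suc m) (tube n k) (tor m c)) = (\<Sum>R\<in>lists d n m. x k R * vf R c)" by blast
  \<comment> \<open>The factor for \<open>(Some (n, 0), k)\<close> has residue only along tube
    \<open>k\<close>; the coefficient -x / (2 pi i) inverts the constant in
    \<open>vf_tube_sec\<close>.\<close>
  define \<psi>' where "\<psi>' c = (\<Sum>kR\<in>pts d n \<times> lists d n m. (- x (fst kR) (snd kR) / (2 * pi * \<i>)) * vf ((Some (n, 0), fst kR) # snd kR) c)" for c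
  have inl: "(Some (n, 0), k) # R \<in> lists d (Suc n) p" if "k \<in> pts d n" "R \<in> lists d n m" for k R
   unfolding p by (rule lists_Cons[OF _ lists_mono[OF that(2)]]) (use that d in "auto simp: hyps_def pts_mono")
  have h': "hom_fun p (M (Suc n)) \<psi>'" unfolding \<psi>'_def
   by (rule hom_fun_lincomb) (auto intro!: hom_fun_vf inl)
  have s': "spn (Suc n) p \<psi>'" unfolding \<psi>'_def by (rule spn_sum) (auto intro!: spn_vf inl)
  have kk: "K ~= 0 ==> - a / K * (- K * (if b then V else 0)) = (if b then a * V else 0)" for a K V :: complex and b
   by simp
  have "\<psi>' (chain_map p (tube n j) (tor m c)) = \<phi> (chain_map p (tube n j) (tor m c))" if j: "j \<in> pts d n" and c: "cycle m (M n) c" for j c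
  proof -
   have "\<psi>' (chain_map p (tube n j) (tor m c)) = (\<Sum>kR\<in>pts d n \<times> lists d n m. (if j = fst kR then x (fst kR) (snd kR) * vf (snd kR) c else 0))"
    unfolding \<psi>'_def p proof (rule sum.cong[OF refl])
    fix kR assume "kR \<in> pts d n \<times> lists d n m"
    hence "fst kR \<in> pts d n" "snd kR \<in> lists d n m" by (auto simp: mem_Times_iff)
    from vf_tube_sec[OF j this c] show "- x (fst kR) (snd kR) / (2 * pi * \<i>) * vf ((Some (n, 0), fst kR) # snd kR) (chain_map (Suc m) (tube n j) (tor m c)) =
     (if j = fst kR then x (fst kR) (snd kR) * vf (snd kR) c else 0)" by (simp only:) (rule kk, simp)
   qed
   also have "... = (\<Sum>k\<in>pts d n. if j = k then (\<Sum>R\<in>lists d n m. x k R * vf R c) else 0)"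
    unfolding sum.cartesian_product' fst_conv snd_conv by (rule sum.cong) auto
   also have "... = (\<Sum>R\<in>lists d n m. x j R * vf R c)" using j by simp
   finally show ?thesis using x[OF j c] p by simp
  qed
  thus ?thesis using p s'
hom_fun_diff[OF l h'] by (intro exI[of _ "%c. \<phi> c - \<psi>' c"]) auto
 qed
 then obtain \<psi> where \<psi>: "hom_fun p (M (Suc n)) \<psi>" and s1: "spn (Suc n) p (%c. \<phi> c - \<psi> c)"
  and t: "!!k m \<gamma>. k \<in> pts d n ==> p = Suc m ==> cycle m (M n) \<gamma> ==> \<psi> (chain_map p (tube n k) (tor m \<gamma>)) = 0"
  by blast
 obtain x where x: "!!c. cycle p (M n) c ==> \<psi> (chain_map p (far n) c) = (\<Sum>R\<in>lists d n p. x R * vf R c)"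
  using Suc.IH[OF hom_fun_chain_map[OF \<psi> cont_far]] unfolding spn_def by blast
 \<comment> \<open>Lists in n points have no residue along any tube, so subtracting
   \<open>\<mu>\<close> corrects the far section without spoiling the tubes.\<close>
 define \<mu> where "\<mu> c = (\<Sum>R\<in>lists d n p. x R * vf R c)" for c
 have h: "hom_fun p (M (Suc n)) (%c. \<psi> c - \<mu> c)"
  unfolding \<mu>_def by (intro hom_fun_diff \<psi> hom_fun_lincomb finite_lists hom_fun_vf lists_mono)
 have z: "\<psi> c - \<mu> c = 0" if "cycle p (M (Suc n)) c" for c proof (rule hom_fun_zero_Suc[OF h _ _ that])
  fix \<beta> assume b: "cycle p (M n) \<beta>"
  have "vf R (chain_map p (far n) \<beta>) = vf R \<beta>" if "R \<in> lists d n p" for R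
   using vf_far[OF lists_mono[OF that] b] that not_newh by (auto simp: lists_def)
  thus "\<psi> (chain_map p (far n) \<beta>) - \<mu> (chain_map p (far n) \<beta>) = 0"
   using x[OF b] by (simp add: \<mu>_def)
 next
  fix k m \<gamma> assume k: "k \<in> pts d n" and p: "p = Suc m" and g: "cycle m (M n) \<gamma>"
  have "\<mu> (chain_map p (tube n k) (tor m \<gamma>)) = 0"
   unfolding \<mu>_def p using vf_tube_old[OF k _ g] by (intro sum.neutral) auto
  thus "\<psi> (chain_map p (tube n k) (tor m \<gamma>)) - \<mu> (chain_map p (tube n k) (tor m \<gamma>)) = 0"
   using t[OF k p g] by simp
 qed
 have "spn (Suc n) p \<mu>" unfolding \<mu>_def by (rule spn_sum) (auto intro: spn_vf lists_mono)
 from spn_add[OF s1 this] show ?case by (rule spn_cong) (use z in auto)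
qed

section \<open>Relations between the logarithmic classes\<close>

text \<open>Formal combinations are lists of pairs with repetitions allowed, so that residues,
  restriction and adjoining a factor act on lists without collecting terms.\<close>

definition comb :: "(complex \<times> hyp list) list => (nat => complex) chain => complex" where
 "comb L c = (\<Sum>y\<leftarrow>L. fst y * vf (snd y) c)"

definition rel :: "nat => nat => (complex \<times> hyp list) list => bool" where
 "rel n p L \<longleftrightarrow> snd ` set L <= lists d n p & (ALL c. singular_relcycle p (M n) {} c --> comb L c = 0)"

lemma hom_fun_comb: "snd ` set L <= lists d n p ==> hom_fun p (M n) (comb L)"
 unfolding comb_def by (rule hom_fun_sum_list) (auto intro!: hom_fun_scale hom_fun_vf)

lemma sum_list_zero: "(!!y. y \<in> set L ==> f y = (0::complex)) ==> (\<Sum>y\<leftarrow>L. f y) = 0"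
 by (induction L) auto

lemma sum_list_filter: "(\<Sum>y\<leftarrow>filter P L. f y) = (\<Sum>y\<leftarrow>L. if P y then f y else (0::complex))"
 by (induction L) auto

lemma drp_in_lists: "R \<in> lists d n (Suc m) ==> i <= m ==> drp i R \<in> lists d n m"
 using set_drp[of i R] by (auto simp: lists_def)

lemma map_hsub_in_lists: "k \<in> pts d n ==> R \<in> lists d (Suc n) m ==> map (hsub d n k) R \<in> lists d n m"
 by (auto simp: lists_def intro!: hsub_in[OF d])

definition Res :: "nat => pt => nat => (complex \<times> hyp list) list => (complex \<times> hyp list) list" where
 "Res n k m L = concat (map (%y. map (%i. (fst y * ((-1)^i * (if wt n k (snd y ! i) then 1 else 0)),
   map (hsub d n k) (drp i (snd y)))) [0..<Suc m]) L)"

lemma sum_list_upt: "(\<Sum>i\<leftarrow>[0..<m]. f i) = (\<Sum>i<m. f i :: complex)"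
 by (simp add: sum_list_sum_nth atLeast0LessThan)

lemma sum_list_Res:
 "(\<Sum>y\<leftarrow>Res n k m L. g (fst y) (snd y)) = (\<Sum>y\<leftarrow>L. \<Sum>i\<le>m. g (fst y * ((-1)^i * (if wt n k (snd y ! i) then 1 else 0)))
   (map (hsub d n k) (drp i (snd y))) :: complex)" unfolding Res_def
proof (induction L)
 case (Cons y L)
 thus ?case
  by (simp only: map_append map_map o_def list.map concat.simps sum_list_append sum_list.Cons fst_conv snd_conv sum_list_upt lessThan_Suc_atMost)
qed simp

lemma rel_Res:
 assumes "rel (Suc n) (Suc m) L" "k \<in> pts d n" shows "rel n m (Res n k m L)" unfolding rel_def
proof (intro conjI allI impI)
 have L: "snd ` set L <= lists d (Suc n) (Suc m)" using assms(1) by (simp add: rel_def)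
 thus "snd ` set (Res n k m L) <= lists d n m" using drp_in_lists[of _ "Suc n" m] map_hsub_in_lists[OF assms(2)]
  by (auto simp: Res_def image_subset_iff simp del: upt_Suc)
 fix c assume c: "cycle m (M n) c"
 have "0 = comb L (chain_map (Suc m) (tube n k) (tor m c))"
  using assms(1) cycle_chain_map[OF cycle_tor[OF c] cont_tube[OF assms(2)]] by (simp add: rel_def)
 also have "... = (\<Sum>y\<leftarrow>L. - (2 * pi * \<i>) * (\<Sum>i\<le>m. (fst y * ((-1)^i * (if wt n k (snd y ! i) then 1 else 0))) * vf (map (hsub d n k) (drp i (snd y))) c))"
  unfolding comb_def proof (intro arg_cong[where f = sum_list] map_cong refl)
  fix y assume "y \<in> set L"
  hence "snd y \<in> lists d (Suc n) (Suc m)" using L by auto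
  from vf_tube[OF assms(2) this c] show "fst y * vf (snd y) (chain_map (Suc m) (tube n k) (tor m c)) =
   - (2 * pi * \<i>) * (\<Sum>i\<le>m. (fst y * ((-1)^i * (if wt n k (snd y ! i) then 1 else 0))) * vf (map (hsub d n k) (drp i (snd y))) c)"
   by (simp only: sum_distrib_left) (simp only: mult_ac)
 qed
 also have "... = - (2 * pi * \<i>) * comb (Res n k m L) c"
  unfolding comb_def sum_list_Res[where g = "%a R. a * vf R c"] sum_list_const_mult ..
 finally show "comb (Res n k m L) c = 0" by simp
qed

lemma rel_near:
 assumes "rel (Suc n) m L" "k \<in> pts d n" shows "rel n m (map (apsnd (map (hsub d n k))) L)"
 unfolding rel_def
proof (intro conjI allI impI)
 have L: "snd ` set L <= lists d (Suc n) m" using assms(1) by (simp add: rel_def)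
 thus "snd ` set (map (apsnd (map (hsub d n k))) L) <= lists d n m" using map_hsub_in_lists[OF assms(2)] by auto
 fix c assume c: "cycle m (M n) c"
 have "0 = comb L (chain_map m (near n k) c)"
  using assms(1) cycle_chain_map[OF c cont_near[OF assms(2)]] by (simp add: rel_def)
 also have "... = comb (map (apsnd (map (hsub d n k))) L) c" unfolding comb_def map_map
 proof (intro arg_cong[where f = sum_list] map_cong refl)
  fix y assume "y \<in> set L"
  hence "snd y \<in> lists d (Suc n) m" using L by auto
  from vf_near[OF assms(2) this c] show "fst y * vf (snd y) (chain_map m (near n k) c) =
   ((%y. fst y * vf (snd y) c) \<circ> apsnd (map (hsub d n k))) y" by simp
 qed
 finally show "comb (map (apsnd (map (hsub d n k))) L) c = 0" by simp
qed

lemma rel_far: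
 assumes "rel (Suc n) m L" shows "rel n m (filter (%y. \<not> (EX h:set (snd y). newh n h)) L)"
 unfolding rel_def
proof (intro conjI allI impI)
 have L: "snd ` set L <= lists d (Suc n) m" using assms(1) by (simp add: rel_def)
 thus "snd ` set (filter (%y. \<not> (EX h:set (snd y). newh n h)) L) <= lists d n m"
  using hyps_Suc unfolding lists_def by fastforce
 fix c assume c: "cycle m (M n) c"
 have "0 = comb L (chain_map m (far n) c)" using assms(1) cycle_chain_map[OF c cont_far] by (simp add: rel_def)
 also have "... = comb (filter (%y. \<not> (EX h:set (snd y). newh n h)) L) c"
  unfolding comb_def sum_list_filter proof (intro arg_cong[where f = sum_list] map_cong refl)
  fix y assume "y \<in> set L"
  hence "snd y \<in> lists d (Suc n) m" using L by auto
  from vf_far[OF this c] show "fst y * vf (snd y) (chain_map m (far n) c) =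
   (if \<not> (EX h:set (snd y). newh n h) then fst y * vf (snd y) c else 0)" by simp
 qed
 finally show "comb (filter (%y. \<not> (EX h:set (snd y). newh n h)) L) c = 0" by simp
qed

text \<open>Relations form an ideal. On the far section the product either vanishes or is an
  instance in fewer points. Along a tube its residue is the residue of \<open>H\<close> times the
  restricted relation minus the restricted \<open>H\<close> times the residue of the relation, and
  both terms vanish by relations in fewer points.\<close>

theorem rel_Cons:
 "rel n p L ==> H \<in> hyps d n ==> rel n (Suc p) (map (apsnd ((#) H)) L)"
proof (induction n arbitrary: p L H)
 case 0
 hence t: "trivh H" by (auto simp: hyps_def pts_def)
 have L: "snd ` set L <= lists d 0 p" using 0 by (simp add: rel_def)
 have "fst y * vf (H # snd y) c = 0" if "y \<in> set L" "cycle (Suc p) (M 0) c" for y c proof -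
  have "length (snd y) = p" using L that(1) by (auto simp: lists_def)
  thus ?thesis using vf_triv[OF that(2), of "H # snd y" H] t by simp
 qed
 thus ?case using L lists_Cons[OF 0(2)] by (auto simp: rel_def comb_def o_def intro!: sum_list_zero)
next
 case (Suc n)
 have L: "snd ` set L <= lists d (Suc n) p" using Suc.prems(1) by (simp add: rel_def)
 let ?L = "map (apsnd ((#) H)) L"
 have L': "snd ` set ?L <= lists d (Suc n) (Suc p)" using L lists_Cons[OF Suc.prems(2)] by auto
 have "comb ?L c = 0" if "cycle (Suc p) (M (Suc n)) c" for c
 proof (rule hom_fun_zero_Suc[OF hom_fun_comb[OF L'] _ _ that])
  fix \<beta> assume b: "cycle (Suc p) (M n) \<beta>"
  have eq: "comb ?L (chain_map (Suc p) (far n) \<beta>) = (\<Sum>y\<leftarrow>L. if newh n H | (EX h:set (snd y). newh n h) then 0 else fst y * vf (H # snd y) \<beta>)"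
   unfolding comb_def map_map proof (intro arg_cong[where f = sum_list] map_cong refl)
   fix y assume "y \<in> set L"
   hence "snd y \<in> lists d (Suc n) p" using L by auto
   from vf_far[OF lists_Cons[OF Suc.prems(2) this] b]
   show "((%y. fst y * vf (snd y) (chain_map (Suc p) (far n) \<beta>)) \<circ> apsnd ((#) H)) y =
    (if newh n H | (EX h:set (snd y). newh n h) then 0 else fst y * vf (H # snd y) \<beta>)" by auto
  qed
  show "comb ?L (chain_map (Suc p) (far n) \<beta>) = 0" proof (cases "newh n H")
   case True
   thus ?thesis unfolding eq by (intro sum_list_zero) auto
  next
   case False
   have "comb (map (apsnd ((#) H)) (filter (%y. \<not> (EX h:set (snd y). newh n h)) L)) \<beta> = 0"
    using Suc.IH[OF rel_far[OF Suc.prems(1)] hyps_Suc[OF Suc.prems(2) False]] b unfolding rel_def by blast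
   also have "comb (map (apsnd ((#) H)) (filter (%y. \<not> (EX h:set (snd y). newh n h)) L)) \<beta> =
    (\<Sum>y\<leftarrow>L. if newh n H | (EX h:set (snd y). newh n h) then 0 else fst y * vf (H # snd y) \<beta>)"
    unfolding comb_def map_map sum_list_filter
    by (intro arg_cong[where f = sum_list] map_cong refl) (use False in auto)
   finally show ?thesis using eq by simp
  qed
 next
  fix k m \<gamma> assume k: "k \<in> pts d n" and m: "Suc p = Suc m" and g: "cycle m (M n) \<gamma>"
  hence g: "cycle p (M n) \<gamma>" and mp: "m = p" by auto
  let ?s = "%y. (\<Sum>i<p. (fst y * ((-1)^i * (if wt n k (snd y ! i) then 1 else 0))) * vf (hsub d n k H # map (hsub d n k) (drp i (snd y))) \<gamma>)"
  have "comb ?L (chain_map (Suc p) (tube n k) (tor p \<gamma>)) =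
   (\<Sum>y\<leftarrow>L. - (2 * pi * \<i>) * ((if wt n k H then fst y * vf (map (hsub d n k) (snd y)) \<gamma> else 0) - ?s y))"
   unfolding comb_def map_map proof (intro arg_cong[where f = sum_list] map_cong refl)
   fix y assume "y \<in> set L"
   hence "snd y \<in> lists d (Suc n) p" using L by auto
   from vf_tube_Cons[OF k Suc.prems(2) this g]
   show "((%y. fst y * vf (snd y) (chain_map (Suc p) (tube n k) (tor p \<gamma>))) \<circ> apsnd ((#) H)) y =
    - (2 * pi * \<i>) * ((if wt n k H then fst y * vf (map (hsub d n k) (snd y)) \<gamma> else 0) - ?s y)"
    by (simp add: right_diff_distrib sum_distrib_left mult_ac)
  qed
  also have "... = - (2 * pi * \<i>) * ((if wt n k H then comb (map (apsnd (map (hsub d n k))) L) \<gamma> else 0) - (\<Sum>y\<leftarrow>L. ?s y))"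
   unfolding sum_list_const_mult sum_list_subtractf by (simp add: comb_def o_def)
  also have "comb (map (apsnd (map (hsub d n k))) L) \<gamma> = 0"
   using rel_near[OF Suc.prems(1) k] g by (simp add: rel_def)
  also have "(\<Sum>y\<leftarrow>L. ?s y) = 0" proof (cases p)
   case 0
   thus ?thesis by simp
  next
   case p: (Suc q)
   have "rel n (Suc q) (map (apsnd ((#) (hsub d n k H))) (Res n k q L))"
    by (rule Suc.IH[OF rel_Res[OF Suc.prems(1)[unfolded p] k] hsub_in[OF d k Suc.prems(2)]])
   hence "0 = comb (map (apsnd ((#) (hsub d n k H))) (Res n k q L)) \<gamma>" using g p by (simp add: rel_def)
   also have "... = (\<Sum>y\<leftarrow>Res n k q L. fst y * vf (hsub d n k H # snd y) \<gamma>)" by (simp add: comb_def o_def)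
   also have "... = (\<Sum>y\<leftarrow>L. ?s y)"
    unfolding sum_list_Res[where g = "%a R. a * vf (hsub d n k H # R) \<gamma>"] p lessThan_Suc_atMost ..
   finally show ?thesis by simp
  qed
  finally show "comb ?L (chain_map (Suc p) (tube n k) (tor m \<gamma>)) = 0" using mp by simp
 qed
 with L' show ?case by (simp add: rel_def)
qed

end

subsection \<open>Dependent lists\<close>

definition Vset :: "'f::field => 'f set => nat => hyp list => (nat => 'f) set" where
 "Vset z F n R = {y \<in> {..<n} \<rightarrow>\<^sub>E F. ALL h:set R. van z y h}"

text \<open>Flats are cut out by equations x_i = z^a x_j and x_i = 0 only, so their dimension can be
  measured by counting points with coordinates in a finite set \<open>F\<close> that contains 0 and
  is stable under the roots of unity.\<close>

locale finite_field_pts = orbit_arrangement +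
 fixes z :: "'f::field" and F :: "'f set"
 assumes z_d: "z ^ d = 1" and z_inj: "!!a b. a < d ==> b < d ==> z ^ a = z ^ b ==> a = b"
  and F0: "0 \<in> F" and F_mult: "!!x a. x \<in> F ==> z ^ a * x \<in> F" and finF: "finite F"
begin

lemma van_upd_old: "h \<in> hyps d n ==> van z (y(n := e)) h \<longleftrightarrow> van z y h"
 by (auto simp: van_def hyps_def pval_upd_old)

lemma van_restrict: "h \<in> hyps d n ==> van z (restrict y {..<n}) h \<longleftrightarrow> van z y h"
 by (auto simp: van_def hyps_def pval_restrict)

lemma z_nz: "z ~= 0" using z_d d by (metis power_0_left not_gr0 zero_neq_one)

lemma pval_in_F: "y \<in> {..<n} \<rightarrow>\<^sub>E F ==> s \<in> pts d n ==> pval z y s \<in> F"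
 by (cases s) (auto simp: F0 F_mult PiE_def Pi_def)

lemma card_Vset_old:
 assumes "R \<in> lists d n p" shows "card (Vset z F (Suc n) R) = card (Vset z F n R) * card F"
proof -
 have R: "h \<in> hyps d n" if "h \<in> set R" for h using assms that by (auto simp: lists_def)
 have "bij_betw (%(y, e). y(n := e)) (Vset z F n R \<times> F) (Vset z F (Suc n) R)"
 proof (rule bij_betw_byWitness[where f' = "%y. (restrict y {..<n}, y n)"])
  show "ALL a:Vset z F n R \<times> F. (restrict (case a of (y, e) => y(n := e)) {..<n}, (case a of (y, e) => y(n := e)) n) = a"
   by (auto simp: Vset_def fun_eq_iff PiE_def extensional_def)
  show "ALL a':Vset z F (Suc n) R. (case (restrict a' {..<n}, a' n) of (y, e) => y(n := e)) = a'"
   by (auto simp: Vset_def fun_eq_iff PiE_def extensional_def)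
  show "(%(y, e). y(n := e)) ` (Vset z F n R \<times> F) <= Vset z F (Suc n) R" proof safe
   fix y e assume y: "y \<in> Vset z F n R" "e \<in> F"
   have "y(n := e) \<in> {..<Suc n} \<rightarrow>\<^sub>E F" using y by (auto simp: Vset_def PiE_def Pi_def extensional_def)
   moreover have "van z (y(n := e)) h" if "h \<in> set R" for h
    using y(1) that van_upd_old[OF R[OF that]] by (simp add: Vset_def)
   ultimately show "y(n := e) \<in> Vset z F (Suc n) R" by (simp add: Vset_def)
  qed
  show "(%y. (restrict y {..<n}, y n)) ` Vset z F (Suc n) R <= Vset z F n R \<times> F" proof safe
   fix y assume y: "y \<in> Vset z F (Suc n) R"
   have "restrict y {..<n} \<in> {..<n} \<rightarrow>\<^sub>E F" "y n \<in> F" using y by (auto simp: Vset_def PiE_def Pi_def)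
   moreover have "van z (restrict y {..<n}) h" if "h \<in> set R" for h
    using y that van_restrict[OF R[OF that]] by (simp add: Vset_def)
   ultimately show "restrict y {..<n} \<in> Vset z F n R" "y n \<in> F" by (simp_all add: Vset_def)
  qed
 qed
 thus ?thesis using bij_betw_same_card by (metis card_cartesian_product)
qed

lemma van_upd_psub:
 assumes k: "k \<in> pts d n" and h: "h \<in> hyps d (Suc n)" and nt: "\<not> trivh (hsub d n k h)"
 shows "van z (y(n := pval z y k)) h \<longleftrightarrow> van z y (hsub d n k h)"
proof -
 have "\<not> trivh h" using nt trivh_hsub by blast
 thus ?thesis using nt pval_psub[OF z_d k, of y 0] by (auto simp: van_def hsub_def)
qed

lemma van_wt:
 assumes k: "k \<in> pts d n" and h: "h \<in> hyps d (Suc n)" and w: "wt n k h"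
 shows "van z (y(n := e)) h \<longleftrightarrow> e = pval z y k"
proof -
 have nt: "\<not> trivh h" and s: "psub d n k (fst h) = psub d n k (snd h)" using w by (auto simp: wt_def hsub_def)
 have nz: "pcoef z n (fst h) - pcoef z n (snd h) ~= 0" proof
  assume C: "pcoef z n (fst h) - pcoef z n (snd h) = 0"
  obtain a b where h': "h = (a, b)" by (cases h)
  have ab: "a \<in> pts d (Suc n)" "b \<in> pts d (Suc n)" "a ~= b" using h nt by (auto simp: hyps_def h')
  show False using C ab s z_inj z_nz by (auto simp: h' pcoef_def pts_def psub_def split: option.splits if_splits)
 qed
 have "y(n := e) = y(n := pval z y k + (e - pval z y k))" by simp
 hence "van z (y(n := e)) h \<longleftrightarrow> (pcoef z n (fst h) - pcoef z n (snd h)) * (e - pval z y k) = 0"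
  using nt s unfolding van_def by (simp only: pval_psub[OF z_d k]) (simp add: algebra_simps)
 thus ?thesis using nz by simp
qed

text \<open>The equation \<open>R ! j\<close> determines the last coordinate as the value at
  \<open>k\<close>; substituting it turns the other equations into their restrictions. Trivial
  restrictions are excluded because \<open>van\<close> is false on trivial pairs.\<close>

lemma card_Vset_new:
 assumes k: "k \<in> pts d n" and R: "R \<in> lists d (Suc n) (Suc m)" and j: "j <= m" and w: "wt n k (R ! j)"
  and nt: "!!h. h \<in> set (map (hsub d n k) (drp j R)) ==> \<not> trivh h"
 shows "card (Vset z F (Suc n) R) = card (Vset z F n (map (hsub d n k) (drp j R)))"
proof -
 let ?R = "map (hsub d n k) (drp j R)"
 have Rin: "h \<in> hyps d (Suc n)" if "h \<in> set R" for h using R that by (auto simp: lists_def)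
 have len: "length R = Suc m" using R by (simp add: lists_def)
 have Rj: "R ! j \<in> set R" using j len by simp
 have setR: "set R = insert (R ! j) (set (drp j R))"
  using id_take_nth_drop[of j R] j len by (metis drp_def le_imp_less_Suc list.simps(15) set_append Un_insert_right)
 have van_iff: "van z (y(n := pval z y k)) h \<longleftrightarrow> van z y (hsub d n k h)" if "h \<in> set (drp j R)" for h y
 proof (rule van_upd_psub[OF k])
  show "h \<in> hyps d (Suc n)" using Rin that set_drp[of j R] by blast
  have "hsub d n k h \<in> set ?R" using that by simp
  thus "\<not> trivh (hsub d n k h)" by (rule nt)
 qed
 have "bij_betw (%y. y(n := pval z y k)) (Vset z F n ?R) (Vset z F (Suc n) R)"
 proof (rule bij_betw_byWitness[where f' = "%y. restrict y {..<n}"])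
  show "ALL a:Vset z F n ?R. restrict (a(n := pval z a k)) {..<n} = a"
   by (auto simp: Vset_def fun_eq_iff PiE_def extensional_def)
  have val: "y n = pval z y k" if "y \<in> Vset z F (Suc n) R" for y
   using van_wt[OF k Rin[OF Rj] w, of y "y n"] that Rj by (auto simp: Vset_def)
  show "ALL y:Vset z F (Suc n) R. (restrict y {..<n})(n := pval z (restrict y {..<n}) k) = y"
   using val k by (auto simp: fun_eq_iff pval_restrict) (auto simp: Vset_def PiE_def extensional_def)
  show "(%y. y(n := pval z y k)) ` Vset z F n ?R <= Vset z F (Suc n) R" proof safe
   fix y assume y: "y \<in> Vset z F n ?R"
   have "y(n := pval z y k) \<in> {..<Suc n} \<rightarrow>\<^sub>E F"
    using y pval_in_F[OF _ k, of y] by (auto simp: Vset_def PiE_def Pi_def extensional_def)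
   moreover have "van z (y(n := pval z y k)) h" if "h \<in> set R" for h
    using that y van_iff[of h y] van_wt[OF k Rin[OF Rj] w] unfolding setR by (auto simp: Vset_def)
   ultimately show "y(n := pval z y k) \<in> Vset z F (Suc n) R" by (simp add: Vset_def)
  qed
  show "(%y. restrict y {..<n}) ` Vset z F (Suc n) R <= Vset z F n ?R" proof safe
   fix y assume y: "y \<in> Vset z F (Suc n) R"
   have "restrict y {..<n} \<in> {..<n} \<rightarrow>\<^sub>E F" using y by (auto simp: Vset_def PiE_def Pi_def)
   moreover have "van z (restrict y {..<n}) h" if hR: "h \<in> set ?R" for h proof -
    obtain g where g: "g \<in> set (drp j R)" "h = hsub d n k g" using hR by auto
    have "g \<in> hyps d (Suc n)" using g(1) set_drp[of j R] Rin by blast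
    hence h: "h \<in> hyps d n" unfolding g(2) by (rule hsub_in[OF d k])
    have "y(n := pval z y k) = y" using val[OF y] by auto
    hence "van z y h" using van_iff[OF g(1), of y] y g setR by (auto simp: Vset_def)
    thus ?thesis using van_restrict[OF h] by simp
   qed
   ultimately show "restrict y {..<n} \<in> Vset z F n ?R" by (simp add: Vset_def)
  qed
 qed
 thus ?thesis by (metis bij_betw_same_card)
qed

text \<open>The inequality says that the hyperplanes are dependent. It passes to the list itself in
  fewer points and to every residue without trivial entries, while a residue with a trivial entry is
  0; so all test values vanish.\<close>

theorem dependent_vf:
 "R \<in> lists d n p ==> card (Vset z F n R) * card F ^ p ~= card F ^ n ==> cycle p (M n) c ==> vf R c = 0"
proof (induction n arbitrary: p R c)
 case 0
 show ?case proof (cases R)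
  case Nil
  hence "p = 0" using 0 by (simp add: lists_def)
  thus ?thesis using 0(2) Nil by (simp add: Vset_def)
 next
  case (Cons h R')
  hence "trivh h" using 0(1) by (auto simp: lists_def hyps_def pts_def)
  thus ?thesis using vf_triv[OF 0(3), of R h] 0(1) Cons by (auto simp: lists_def)
 qed
next
 case (Suc n)
 have Fpos: "card F > 0" using F0 finF by (auto simp: card_gt_0_iff)
 show ?case proof (rule hom_fun_zero_Suc[OF hom_fun_vf[OF Suc.prems(1)] _ _ Suc.prems(3)])
  fix \<beta> assume b: "cycle p (M n) \<beta>"
  show "vf R (chain_map p (far n) \<beta>) = 0" proof (cases "EX h:set R. newh n h")
   case True
   thus ?thesis using vf_far[OF Suc.prems(1) b] by simp
  next
   case False
   hence R: "R \<in> lists d n p" using Suc.prems(1) hyps_Suc by (auto simp: lists_def)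
   have "card (Vset z F n R) * card F ^ p ~= card F ^ n"
    using Suc.prems(2) card_Vset_old[OF R] by (auto simp: mult_ac)
   from Suc.IH[OF R this b] show ?thesis using vf_far[OF Suc.prems(1) b] False by simp
  qed
 next
  fix k m \<gamma> assume k: "k \<in> pts d n" and p: "p = Suc m" and g: "cycle m (M n) \<gamma>"
  have "(if wt n k (R ! j) then 1 else 0) * vf (map (hsub d n k) (drp j R)) \<gamma> = 0" if j: "j <= m" for j
  proof (cases "wt n k (R ! j)")
   case True
   let ?R = "map (hsub d n k) (drp j R)"
   have R: "?R \<in> lists d n m" using map_hsub_in_lists[OF k drp_in_lists] Suc.prems(1) p j by simp
   show ?thesis proof (cases "EX h:set ?R. trivh h")
    case True
    then obtain h where "h \<in> set ?R" "trivh h" by blast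
    thus ?thesis using vf_triv[OF g listsD(1)[OF R]] by simp
   next
    case False
    have "card (Vset z F (Suc n) R) = card (Vset z F n ?R)"
     by (rule card_Vset_new[OF k _ j True]) (use Suc.prems(1) p False in auto)
    hence "card (Vset z F n ?R) * card F ^ m ~= card F ^ n" using Suc.prems(2) Fpos p by auto
    from Suc.IH[OF R this g] show ?thesis by simp
   qed
  qed simp
  thus "vf R (chain_map p (tube n k) (tor m \<gamma>)) = 0" proof -
   assume *: "!!j. j <= m ==> (if wt n k (R ! j) then 1 else 0) * vf (map (hsub d n k) (drp j R)) \<gamma> = 0"
   have "(\<Sum>j\<le>m. (-1)^j * (if wt n k (R ! j) then 1 else 0) * vf (map (hsub d n k) (drp j R)) \<gamma>) = 0"
    unfolding mult.assoc by (rule sum.neutral) (use * in "simp del: mult_eq_0_iff")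
   thus ?thesis unfolding p vf_tube[OF k Suc.prems(1)[unfolded p] g] by (simp only: mult_zero_right)
  qed
 qed
qed

end

section \<open>Characters of the cohomology\<close>

text \<open>An element is adjoined only if on \<open>C\<close> it is not a combination of those
  already chosen. With \<open>C\<close> the set of cycles this gives a basis of classes without
  forming a quotient.\<close>

lemma exists_basis:
 fixes v :: "'i => 'c => complex"
 assumes "finite I"
 shows "\<exists>B\<subseteq>I. (EX \<kappa>. ALL R:I. ALL c:C. v R c = (\<Sum>S\<in>B. \<kappa> R S * v S c)) &
  (ALL a. (ALL c:C. (\<Sum>S\<in>B. a S * v S c) = 0) --> (ALL S:B. a S = 0))" using assms
proof (induction I rule: finite_induct)
 case empty
 show ?case by simp
next
 case (insert x I)
 then obtain B \<kappa> where B: "B <= I" and k: "!!R c. R \<in> I ==> c \<in> C ==> v R c = (\<Sum>S\<in>B. \<kappa> R S * v S c)"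
  and i: "!!a. (ALL c:C. (\<Sum>S\<in>B. a S * v S c) = 0) ==> (ALL S:B. a S = 0)" by blast
 have finB: "finite B" and xB: "x \<notin> B" using B insert finite_subset by auto
 show ?case proof (cases "EX b. ALL c:C. v x c = (\<Sum>S\<in>B. b S * v S c)")
  case True
  then obtain b where "ALL c:C. v x c = (\<Sum>S\<in>B. b S * v S c)" by blast
  thus ?thesis using B k i insert(2) by (intro exI[of _ B] conjI exI[of _ "\<kappa>(x := b)"]) auto
 next
  case False
  show ?thesis proof (intro exI[of _ "insert x B"] conjI)
   show "insert x B <= insert x I" using B by blast
   show "EX \<kappa>. ALL R:insert x I. ALL c:C. v R c = (\<Sum>S\<in>insert x B. \<kappa> R S * v S c)"
   proof (intro exI ballI)
    fix R c assume R: "R \<in> insert x I" and c: "c \<in> C"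
    show "v R c = (\<Sum>S\<in>insert x B. (if R = x then (if S = x then 1 else 0) else if S = x then 0 else \<kappa> R S) * v S c)"
    proof (cases "R = x")
     case True
     have "(\<Sum>S\<in>B. (if S = x then 1 else 0) * v S c) = 0" by (rule sum.neutral) (use xB in auto)
     thus ?thesis using True finB xB by simp
    next
     case False
     hence "v R c = (\<Sum>S\<in>B. \<kappa> R S * v S c)" using R k c by auto
     also have "... = (\<Sum>S\<in>B. (if S = x then 0 else \<kappa> R S) * v S c)" by (rule sum.cong) (use xB in auto)
     finally show ?thesis using False finB xB by simp
    qed
   qed
   show "ALL a. (ALL c:C. (\<Sum>S\<in>insert x B. a S * v S c) = 0) --> (ALL S:insert x B. a S = 0)"
   proof (intro allI impI)
    fix a assume a: "ALL c:C. (\<Sum>S\<in>insert x B. a S * v S c) = 0"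
    have ax: "a x = 0" proof (rule ccontr)
     assume nz: "a x ~= 0"
     have "v x c = (\<Sum>S\<in>B. (- a S / a x) * v S c)" if "c \<in> C" for c proof -
      have "a x * v x c = - (\<Sum>S\<in>B. a S * v S c)" using a that finB xB by (auto simp: eq_neg_iff_add_eq_0)
      hence "v x c = - (\<Sum>S\<in>B. a S * v S c) / a x" using nz by (simp add: field_simps)
      thus ?thesis by (simp add: sum_divide_distrib sum_negf)
     qed
     hence "EX b. ALL c:C. v x c = (\<Sum>S\<in>B. b S * v S c)" by (intro exI[of _ "%S. - a S / a x"] ballI)
     with False show False ..
    qed
    thus "ALL S:insert x B. a S = 0" using i[of a] a finB xB by simp
   qed
  qed
 qed
qed

lemma ex1_unique: "EX! x. P x ==> P a ==> P b ==> a = b" by blast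

text \<open>Change of basis shows that the trace does not depend on the basis.\<close>

lemma quotient_trace_eqI:
 assumes B0: "(%_. 0) \<in> B" and Bc: "!!f g a. f \<in> B ==> g \<in> B ==> (%s. f s + a * g s) \<in> B"
  and ZB: "(%_. 0) \<in> Z" and TZ: "!!f. f \<in> B ==> T f \<in> B"
  and Tlin: "!!f g a. T (%s. f s + a * g s) = (%s. T f s + a * T g s)"
  and b: "quotient_basis Z B m c" and M: "ALL j<m. (%s. T (c j) s - (\<Sum>i<m. M i j * c i s)) \<in> B"
 shows "quotient_trace Z B T = (\<Sum>j<m. M j j)"
proof -
 define eq where "eq f g \<longleftrightarrow> (%s. f s - g s) \<in> B" for f g
 have sm: "(%s. a * f s) \<in> B" if "f \<in> B" for f a using Bc[OF B0 that, of a] by simp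
 have ad: "(%s. f s + g s) \<in> B" if "f \<in> B" "g \<in> B" for f g using Bc[OF that, of 1] by simp
 have eq_refl: "eq f f" for f using B0 by (simp add: eq_def)
 have eq_sym: "eq f g ==> eq g f" for f g unfolding eq_def using sm[of _ "-1"] by fastforce
 have eq_trans: "eq f g ==> eq g h ==> eq f h" for f g h unfolding eq_def using ad[of "%s. f s - g s" "%s. g s - h s"] by simp
 have eq_sum: "eq (%s. \<Sum>i<n. a i * f i s) (%s. \<Sum>i<n. a i * g i s)" if "!!i. i < n ==> eq (f i) (g i)"
  for n :: nat and a f g using that proof (induction n)
  case 0
  show ?case using eq_refl[of "%_. 0"] by simp
 next
  case (Suc n)
  have "(%s. ((\<Sum>i<n. a i * f i s) - (\<Sum>i<n. a i * g i s)) + a n * (f n s - g n s)) \<in> B"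
   using Suc by (intro Bc) (auto simp: eq_def)
  thus ?case by (simp add: eq_def algebra_simps)
 qed
 have T0: "T (%_. 0) = (%_. 0)" using Tlin[of "%_. 0" 1 "%_. 0"] by (simp add: fun_eq_iff)
 have T_sum: "T (%s. \<Sum>i<n. a i * f i s) = (%s. \<Sum>i<n. a i * T (f i) s)" for n :: nat and a f
 proof (induction n)
  case (Suc n)
  thus ?case using Tlin[of "%s. \<Sum>i<n. a i * f i s" "a n" "f n"] by simp
 qed (simp add: T0)
 have T_eq: "eq (T f) (T g)" if "eq f g" for f g proof -
  have "T (%s. f s + (-1) * g s) \<in> B" using that by (intro TZ) (simp add: eq_def)
  thus ?thesis unfolding Tlin by (simp add: eq_def)
 qed
 have ind: "ALL i<m. x i = y i" if qb: "quotient_basis Z B m c" and e: "eq (%s. \<Sum>i<m. x i * c i s) (%s. \<Sum>i<m. y i * c i s)" for m c x y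
 proof -
  have "EX! a. a \<in> ({..<m} \<rightarrow>\<^sub>E UNIV) & (%s. 0 - (\<Sum>j<m. a j * c j s)) \<in> B" proof -
   have "ALL z:Z. EX! a. a \<in> ({..<m} \<rightarrow>\<^sub>E UNIV) & (%s. z s - (\<Sum>j<m. a j * c j s)) \<in> B"
    using qb unfolding quotient_basis_def by (rule conjunct2)
   from bspec[OF this ZB] show ?thesis .
  qed
  moreover have "(%s. 0 - (\<Sum>j<m. restrict (%i. x i - y i) {..<m} j * c j s)) \<in> B"
   using eq_sym[OF e] by (simp add: eq_def left_diff_distrib sum_subtractf)
  moreover have "(%s. 0 - (\<Sum>j<m. restrict (%i. 0) {..<m} j * c j s)) \<in> B" using B0 by simp
  ultimately have eq0: "restrict (%i. x i - y i) {..<m} = restrict (%i. 0) {..<m}"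
   by (intro ex1_unique[of "%a. a \<in> ({..<m} \<rightarrow>\<^sub>E UNIV) & (%s. 0 - (\<Sum>j<m. a j * c j s)) \<in> B"]) simp_all
  show ?thesis proof (intro allI impI)
   fix i assume "i < m"
   with fun_cong[OF eq0, of i] show "x i = y i" by simp
  qed
 qed
 have ex: "EX a. eq z (%s. \<Sum>j<m. a j * c j s)" if "quotient_basis Z B m c" "z \<in> Z" for m c z
  using that unfolding quotient_basis_def eq_def by blast
 have uniq: "(\<Sum>j<m'. M' j j) = (\<Sum>j<m. M j j)"
  if b': "quotient_basis Z B m' c'" and M': "ALL j<m'. (%s. T (c' j) s - (\<Sum>i<m'. M' i j * c' i s)) \<in> B" for m' c' M'
 proof -
  have cZ: "!!j. j < m ==> c j \<in> Z" and cZ': "!!j. j < m' ==> c' j \<in> Z" using b b' by (auto simp: quotient_basis_def)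
  have "ALL l. EX a. l < m' --> eq (c' l) (%s. \<Sum>i<m. a i * c i s)" using ex[OF b cZ'] by blast
  from choice[OF this] obtain p0 where p0: "!!l. l < m' ==> eq (c' l) (%s. \<Sum>i<m. p0 l i * c i s)" by blast
  have "ALL i. EX a. i < m --> eq (c i) (%s. \<Sum>l<m'. a l * c' l s)" using ex[OF b' cZ] by blast
  from choice[OF this] obtain q0 where q0: "!!i. i < m ==> eq (c i) (%s. \<Sum>l<m'. q0 i l * c' l s)" by blast
  define p q where "p i l = p0 l i" and "q l i = q0 i l" for i l
  have p: "eq (c' l) (%s. \<Sum>i<m. p i l * c i s)" if "l < m'" for l using p0[OF that] by (simp add: p_def)
  have q: "eq (c i) (%s. \<Sum>l<m'. q l i * c' l s)" if "i < m" for i using q0[OF that] by (simp add: q_def)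
  have swap: "(%s. \<Sum>l<n. x l * (\<Sum>i<k. y i l * f i s)) = (%s. \<Sum>i<k. (\<Sum>l<n. y i l * x l) * f i s)"
   for n k :: nat and x and y :: "nat => nat => complex" and f :: "nat => 'a => complex"
   unfolding sum_distrib_left sum_distrib_right by (subst sum.swap) (simp add: mult_ac)
  have pq: "(\<Sum>l<m'. p i l * q l j) = (if i = j then 1 else 0)" if ij: "i < m" "j < m" for i j proof -
   have "eq (c j) (%s. \<Sum>l<m'. q l j * (\<Sum>i<m. p i l * c i s))"
    by (rule eq_trans[OF q[OF ij(2)] eq_sum[OF p]])
   hence "eq (%s. \<Sum>i<m. (if i = j then 1 else 0) * c i s) (%s. \<Sum>i<m. (\<Sum>l<m'. p i l * q l j) * c i s)"
    using ij by (simp add: swap if_distrib[of "%x. x * _"] cong: if_cong)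
   from ind[OF b this] show ?thesis using ij by auto
  qed
  have pM: "(\<Sum>j<m'. p i j * M' j l) = (\<Sum>k<m. M i k * p k l)" if il: "i < m" "l < m'" for i l proof -
   have "eq (T (c' l)) (%s. \<Sum>j<m'. M' j l * c' j s)" using M' il by (simp add: eq_def)
   moreover have "eq (%s. \<Sum>j<m'. M' j l * c' j s) (%s. \<Sum>j<m'. M' j l * (\<Sum>i<m. p i j * c i s))" by (rule eq_sum[OF p])
   ultimately have 1: "eq (T (c' l)) (%s. \<Sum>i<m. (\<Sum>j<m'. p i j * M' j l) * c i s)"
    unfolding swap by (rule eq_trans)
   have "eq (T (c' l)) (%s. \<Sum>k<m. p k l * T (c k) s)" using T_eq[OF p[OF il(2)]] by (simp add: T_sum)
   moreover have "eq (%s. \<Sum>k<m. p k l * T (c k) s) (%s. \<Sum>k<m. p k l * (\<Sum>i<m. M i k * c i s))"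
    by (rule eq_sum) (use M in "simp add: eq_def")
   ultimately have 2: "eq (T (c' l)) (%s. \<Sum>i<m. (\<Sum>k<m. M i k * p k l) * c i s)"
    unfolding swap by (rule eq_trans)
   from ind[OF b eq_trans[OF eq_sym[OF 1] 2]] il show ?thesis by simp
  qed
  have qp: "(\<Sum>i<m. q j i * p i l) = (if j = l then 1 else 0)" if jl: "j < m'" "l < m'" for j l proof -
   have "eq (c' l) (%s. \<Sum>i<m. p i l * (\<Sum>j<m'. q j i * c' j s))"
    by (rule eq_trans[OF p[OF jl(2)] eq_sum[OF q]])
   hence "eq (%s. \<Sum>j<m'. (if j = l then 1 else 0) * c' j s) (%s. \<Sum>j<m'. (\<Sum>i<m. q j i * p i l) * c' j s)"
    using jl by (simp add: swap if_distrib[of "%x. x * _"] cong: if_cong)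
   from ind[OF b' this] show ?thesis using jl by auto
  qed
  \<comment> \<open>With p and q the mutually inverse base changes, tr M' = tr (q p M') = tr (q M p)
    = tr (M p q) = tr M.\<close>
  have "(\<Sum>j<m'. M' j j) = (\<Sum>l<m'. \<Sum>j<m'. (if l = j then 1 else 0) * M' j l)"
   by (simp add: if_distrib[of "%x. x * _"] cong: if_cong)
  also have "... = (\<Sum>l<m'. \<Sum>j<m'. (\<Sum>i<m. q l i * p i j) * M' j l)" by (simp add: qp)
  also have "... = (\<Sum>l<m'. \<Sum>i<m. q l i * (\<Sum>j<m'. p i j * M' j l))"
   unfolding sum_distrib_left sum_distrib_right by (subst (2) sum.swap) (simp add: mult_ac)
  also have "... = (\<Sum>l<m'. \<Sum>i<m. q l i * (\<Sum>k<m. M i k * p k l))" by (simp add: pM)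
  also have "... = (\<Sum>l<m'. \<Sum>i<m. \<Sum>k<m. M i k * (p k l * q l i))"
   by (simp add: sum_distrib_left mult_ac)
  also have "... = (\<Sum>i<m. \<Sum>k<m. M i k * (\<Sum>l<m'. p k l * q l i))"
   unfolding sum_distrib_left by (subst sum.swap, rule sum.cong[OF refl], subst sum.swap) simp
  also have "... = (\<Sum>i<m. \<Sum>k<m. M i k * (if k = i then 1 else 0))" by (simp add: pq)
  also have "... = (\<Sum>i<m. M i i)" by (simp add: if_distrib[of "%x. _ * x"] cong: if_cong)
  finally show ?thesis .
 qed
 show ?thesis unfolding quotient_trace_def by (rule the_equality) (use b M uniq in blast)+
qed

context orbit_arrangement
begin

text \<open>Basis elements are lists of hyperplanes, so a group element acts on them entrywise;
  \<open>coord\<close> fixes one expansion of every list, unique by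
  \<open>basis_indep\<close>.\<close>

definition basis :: "nat => nat => hyp list set" where
 "basis n p = (SOME B. B <= lists d n p & (EX \<kappa>. ALL R:lists d n p. ALL c:{c. singular_relcycle p (M n) {} c}. vf R c = (\<Sum>S\<in>B. \<kappa> R S * vf S c)) &
  (ALL a. (ALL c:{c. singular_relcycle p (M n) {} c}. (\<Sum>S\<in>B. a S * vf S c) = 0) --> (ALL S:B. a S = 0)))"

definition coord :: "nat => nat => hyp list => hyp list => complex" where
 "coord n p = (SOME \<kappa>. ALL R:lists d n p. ALL c:{c. singular_relcycle p (M n) {} c}. vf R c = (\<Sum>S\<in>basis n p. \<kappa> R S * vf S c))"

lemma basis: shows basis_sub: "basis n p <= lists d n p"
  and coord: "R \<in> lists d n p ==> cycle p (M n) c ==> vf R c = (\<Sum>S\<in>basis n p. coord n p R S * vf S c)"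
  and basis_indep: "(!!c. cycle p (M n) c ==> (\<Sum>S\<in>basis n p. a S * vf S c) = 0) ==> S \<in> basis n p ==> a S = 0"
proof -
 let ?C = "{c. singular_relcycle p (M n) {} c}"
 have *: "basis n p <= lists d n p & (EX \<kappa>. ALL R:lists d n p. ALL c:?C. vf R c = (\<Sum>S\<in>basis n p. \<kappa> R S * vf S c)) &
  (ALL a. (ALL c:?C. (\<Sum>S\<in>basis n p. a S * vf S c) = 0) --> (ALL S:basis n p. a S = 0))"
  unfolding basis_def by (rule someI_ex[OF exists_basis[OF finite_lists]])
 thus "basis n p <= lists d n p" by blast
 from * have "EX \<kappa>. ALL R:lists d n p. ALL c:?C. vf R c = (\<Sum>S\<in>basis n p. \<kappa> R S * vf S c)" by blast
 from someI_ex[OF this] have "ALL R:lists d n p. ALL c:?C. vf R c = (\<Sum>S\<in>basis n p. coord n p R S * vf S c)"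
  unfolding coord_def .
 thus "R \<in> lists d n p ==> cycle p (M n) c ==> vf R c = (\<Sum>S\<in>basis n p. coord n p R S * vf S c)" by blast
 show "(!!c. cycle p (M n) c ==> (\<Sum>S\<in>basis n p. a S * vf S c) = 0) ==> S \<in> basis n p ==> a S = 0"
  using * by blast
qed

lemma finite_basis [simp]: "finite (basis n p)" using basis_sub finite_lists finite_subset by blast

lemma basis_eq:
 assumes "!!c. cycle p (M n) c ==> (\<Sum>S\<in>basis n p. a S * vf S c) = (\<Sum>S\<in>basis n p. b S * vf S c)" "S \<in> basis n p"
 shows "a S = b S"
 using basis_indep[of p n "%S. a S - b S" S] assms by (simp add: left_diff_distrib sum_subtractf)

lemma coord_rel:
 assumes "finite J" "!!j. j \<in> J ==> r j \<in> lists d n p" "finite J'" "!!j. j \<in> J' ==> r' j \<in> lists d n p"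
  "!!c. cycle p (M n) c ==> (\<Sum>j\<in>J. a j * vf (r j) c) = (\<Sum>j\<in>J'. a' j * vf (r' j) c)" "S \<in> basis n p"
 shows "(\<Sum>j\<in>J. a j * coord n p (r j) S) = (\<Sum>j\<in>J'. a' j * coord n p (r' j) S)"
proof (rule basis_eq[OF _ assms(6)])
 have E: "(\<Sum>S\<in>basis n p. (\<Sum>j\<in>J. a j * coord n p (r j) S) * vf S c) = (\<Sum>j\<in>J. a j * vf (r j) c)"
  if "cycle p (M n) c" "!!j. j \<in> J ==> r j \<in> lists d n p" for c J and a :: "'x => complex" and r
  using coord[OF that(2,1)] unfolding sum_distrib_right
  by (subst sum.swap) (simp add: sum_distrib_left mult.assoc)
 fix c assume "cycle p (M n) c"
 thus "(\<Sum>S\<in>basis n p. (\<Sum>j\<in>J. a j * coord n p (r j) S) * vf S c) = (\<Sum>S\<in>basis n p. (\<Sum>j\<in>J'. a' j * coord n p (r' j) S) * vf S c)"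
  using E[of c J r a] E[of c J' r' a'] assms by simp
qed

definition cochain_of :: "nat => nat => hyp list => (nat => complex) cochain" where
 "cochain_of n p R s = (if singular_simplex p (M n) s then lform (map al R) s else 0)"

lemma ev_cochain_of: "singular_chain p (M n) c ==> ev (cochain_of n p R) c = vf R c"
 unfolding vf_def by (rule ev_cong) (auto simp: cochain_of_def singular_chain_def)

lemma cochain_of_cocycle:
 assumes "R \<in> lists d n p" shows "cochain_of n p R \<in> cocycles p (M n)"
proof -
 have "coboundary p (M n) (cochain_of n p R) s = 0" for s proof (cases "singular_simplex (Suc p) (M n) s")
  case True
  hence c: "singular_chain (Suc p) (M n) (frag_of s)" by (simp add: singular_chain_of)
  have "coboundary p (M n) (cochain_of n p R) s = ev (cochain_of n p R) (chain_boundary (Suc p) (frag_of s))"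
   using ev_coboundary[OF c, of "cochain_of n p R"] by simp
  also have "... = vf R (chain_boundary (Suc p) (frag_of s))"
   by (rule ev_cochain_of[OF singular_chain_boundary_alt[OF c]])
  also have "... = 0" using hom_fun_vf[OF assms] c unfolding hom_fun_def singular_boundary by blast
  finally show ?thesis .
 qed (simp add: coboundary_def)
 thus ?thesis by (auto simp: cocycles_def cochains_def cochain_of_def)
qed

lemma cochains_lincomb: "f \<in> cochains p S ==> (!!i. i \<in> I ==> g i \<in> cochains p S) ==> (%s. f s - (\<Sum>i\<in>I. a i * g i s)) \<in> cochains p S"
 by (auto simp: cochains_def intro!: sum.neutral)

lemma in_coboundaries_iff: "u \<in> coboundaries p S \<longleftrightarrow> u \<in> cochains p S & (ALL c. singular_relcycle p S {} c --> ev u c = 0)"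
proof
 assume u: "u \<in> coboundaries p S"
 hence "u \<in> cochains p S" by (cases p) (auto simp: coboundaries_def cochains_def coboundary_def)
 with u coboundaries_vanish show "u \<in> cochains p S & (ALL c. singular_relcycle p S {} c --> ev u c = 0)" by blast
qed (use cochain_null_imp_coboundary in blast)

lemma wreath_finite: "finite (wcar d n)"
proof -
 have "carrier (integer_mod_group d) = {0..<int d}" using d by (simp add: carrier_integer_mod_group)
 thus ?thesis by (simp add: wreath_def finite_PiE finite_permutations)
qed

text \<open>The chosen lists form a basis of cohomology, by \<open>vf_span\<close> and since a
  cochain vanishing on cycles is a coboundary. By \<open>vf_act\<close> the pullback acts on them
  through \<open>hact\<close>, which makes the trace explicit.\<close>

theorem conf_char_pullback:
 assumes w: "w \<in> wcar d n"
 shows "quotient_trace (cocycles p (M n)) (coboundaries p (M n)) (cochain_pullback p (M n) (conf_act d n w))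
  = (\<Sum>S\<in>basis n p. coord n p (map (hact d w) S) S)"
proof -
 obtain e where e: "bij_betw e {..<card (basis n p)} (basis n p)"
  using ex_bij_betw_nat_finite[OF finite_basis] by (metis atLeast0LessThan)
 let ?m = "card (basis n p)" and ?Z = "cocycles p (M n)" and ?B = "coboundaries p (M n)"
 define c where "c j = cochain_of n p (e j)" for j
 define Xm where "Xm i j = coord n p (map (hact d w) (e j)) (e i)" for i j
 have eb: "e j \<in> basis n p" if "j < ?m" for j using e that by (auto simp: bij_betw_def)
 have ein: "e j \<in> lists d n p" if "j < ?m" for j using eb[OF that] basis_sub by blast
 have evc: "ev (c j) b = vf (e j) b" if "cycle p (M n) b" for j b
  using that ev_cochain_of unfolding c_def singular_cycle by blast
 have reidx: "(\<Sum>j<?m. f (e j)) = (\<Sum>S\<in>basis n p. f S)" for f :: "hyp list => complex"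
  by (rule sum.reindex_bij_betw[OF e])
 have ce: "c j \<in> cochains p (M n)" for j by (auto simp: c_def cochain_of_def cochains_def)
 have evdiff: "ev (%s. f s - (\<Sum>j<?m. a j * c j s)) b = ev f b - (\<Sum>j<?m. a j * vf (e j) b)"
  if "cycle p (M n) b" for f a b using evc[OF that] by (simp add: ev_fun_diff ev_fun_sum)
 have qb: "quotient_basis ?Z ?B ?m c" unfolding quotient_basis_def proof (intro conjI allI impI ballI)
  show "c j \<in> ?Z" if "j < ?m" for j unfolding c_def by (rule cochain_of_cocycle[OF ein[OF that]])
  fix u assume u: "u \<in> ?Z"
  hence uc: "u \<in> cochains p (M n)" and cb: "coboundary p (M n) u = (%_. 0)" by (auto simp: cocycles_def)
  have hu: "hom_fun p (M n) (ev u)" unfolding hom_fun_def proof (intro conjI allI impI)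
   fix b assume "singular_relboundary p (M n) {} b"
   then obtain g where g: "singular_chain (Suc p) (M n) g" "chain_boundary (Suc p) g = b" by (auto simp: singular_boundary)
   from ev_coboundary[OF g(1), of u] show "ev u b = 0" using cb g(2) by (simp add: ev_def)
  qed (rule ev_add)
  obtain x where x: "!!b. cycle p (M n) b ==> ev u b = (\<Sum>R\<in>lists d n p. x R * vf R b)"
   using vf_span[OF hu] unfolding spn_def by blast
  define a where "a j = (\<Sum>R\<in>lists d n p. x R * coord n p R (e j))" for j
  have ua: "ev u b = (\<Sum>j<?m. a j * vf (e j) b)" if b: "cycle p (M n) b" for b proof -
   have "(\<Sum>j<?m. a j * vf (e j) b) = (\<Sum>R\<in>lists d n p. x R * (\<Sum>j<?m. coord n p R (e j) * vf (e j) b))"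
    unfolding a_def sum_distrib_right sum_distrib_left by (subst sum.swap) (simp add: mult.assoc)
   also have "... = (\<Sum>R\<in>lists d n p. x R * vf R b)"
    using coord[OF _ b] reidx[of "%S. coord n p _ S * vf S b"] by simp
   finally show ?thesis using x[OF b] by simp
  qed
  show "EX! a. a \<in> {..<?m} \<rightarrow>\<^sub>E UNIV & (%s. u s - (\<Sum>j<?m. a j * c j s)) \<in> ?B"
  proof (rule ex1I[of _ "restrict a {..<?m}"])
   show "restrict a {..<?m} \<in> {..<?m} \<rightarrow>\<^sub>E UNIV & (%s. u s - (\<Sum>j<?m. restrict a {..<?m} j * c j s)) \<in> ?B"
    unfolding in_coboundaries_iff using evdiff ua cochains_lincomb[OF uc ce] by auto
   fix a' assume a': "a' \<in> {..<?m} \<rightarrow>\<^sub>E UNIV & (%s. u s - (\<Sum>j<?m. a' j * c j s)) \<in> ?B"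
   let ?i = "inv_into {..<?m} e"
   have inv: "?i (e j) = j" if "j < ?m" for j using e that by (simp add: bij_betw_def inv_into_f_f)
   have "a (?i S) = a' (?i S)" if "S \<in> basis n p" for S proof (rule basis_eq[OF _ that])
    fix b assume b: "cycle p (M n) b"
    have "(\<Sum>S\<in>basis n p. f (?i S) * vf S b) = (\<Sum>j<?m. f j * vf (e j) b)" for f
     unfolding reidx[symmetric] by (rule sum.cong) (auto simp: inv)
    moreover have "ev u b = (\<Sum>j<?m. a' j * vf (e j) b)"
     using a' evdiff[OF b, of u a'] b unfolding in_coboundaries_iff by auto
    ultimately show "(\<Sum>S\<in>basis n p. a (?i S) * vf S b) = (\<Sum>S\<in>basis n p. a' (?i S) * vf S b)"
     using ua[OF b] by simp
   qed
   hence "a j = a' j" if "j < ?m" for j using eb[OF that] inv[OF that] by metis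
   thus "a' = restrict a {..<?m}" using a' by (auto simp: fun_eq_iff PiE_def extensional_def)
  qed
 qed
 let ?T = "cochain_pullback p (M n) (conf_act d n w)"
 have contw: "continuous_map (M n) (M n) (conf_act d n w)"
  using continuous_map_eq[OF cont_wact[OF w]] conf_act_eq_wact[OF w] by metis
 have Xc: "ALL j<?m. (%s. ?T (c j) s - (\<Sum>i<?m. Xm i j * c i s)) \<in> ?B" proof (intro allI impI)
  fix j assume j: "j < ?m"
  have mh: "map (hact d w) (e j) \<in> lists d n p" using ein[OF j] hact_in[OF d w] by (auto simp: lists_def)
  have "ev (?T (c j)) b = (\<Sum>i<?m. Xm i j * vf (e i) b)" if b: "cycle p (M n) b" for b proof -
   have "ev (?T (c j)) b = ev (c j) (chain_map p (conf_act d n w) b)"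
    using b by (intro ev_pullback) (simp add: singular_cycle)
   also have "... = vf (e j) (chain_map p (conf_act d n w) b)" by (rule evc[OF cycle_chain_map[OF b contw]])
   also have "... = vf (map (hact d w) (e j)) b" by (rule vf_act[OF w ein[OF j] b])
   also have "... = (\<Sum>i<?m. Xm i j * vf (e i) b)" unfolding coord[OF mh b] reidx[symmetric] Xm_def ..
   finally show ?thesis .
  qed
  moreover have "?T (c j) \<in> cochains p (M n)" by (auto simp: cochains_def cochain_pullback_def)
  ultimately show "(%s. ?T (c j) s - (\<Sum>i<?m. Xm i j * c i s)) \<in> ?B"
   unfolding in_coboundaries_iff using evdiff cochains_lincomb[OF _ ce] by auto
 qed
 have evT: "ev (?T f) b = ev f (chain_map p (conf_act d n w) b)" if "cycle p (M n) b" for f b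
  using that by (intro ev_pullback) (simp add: singular_cycle)
 have "quotient_trace ?Z ?B ?T = (\<Sum>j<?m. Xm j j)" proof (rule quotient_trace_eqI[OF _ _ _ _ _ qb Xc])
  show "(%_. 0) \<in> ?B" by (simp add: in_coboundaries_iff cochains_def ev_def)
  show "(%_. 0) \<in> ?Z" by (simp add: cocycles_def cochains_def coboundary_def fun_eq_iff)
  fix f g :: "(nat => complex) cochain" and a
  show "?T (%s. f s + a * g s) = (%s. ?T f s + a * ?T g s)" by (auto simp: cochain_pullback_def)
  have "ev (%s. f s + a * g s) b = ev f b + a * ev g b" for b
   by (simp add: ev_def distrib_left sum.distrib sum_distrib_left mult_ac)
  thus "f \<in> ?B ==> g \<in> ?B ==> (%s. f s + a * g s) \<in> ?B"
   unfolding in_coboundaries_iff by (auto simp: cochains_def)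
  show "f \<in> ?B ==> ?T f \<in> ?B"
   unfolding in_coboundaries_iff using evT cycle_chain_map[OF _ contw] by (auto simp: cochains_def cochain_pullback_def)
 qed
 also have "... = (\<Sum>S\<in>basis n p. coord n p (map (hact d w) S) S)" unfolding Xm_def by (rule reidx)
 finally show ?thesis .
qed

end

subsection \<open>Acyclicity of the local cohomology algebras\<close>

context orbit_arrangement
begin

lemma vf_Cons_eq:
 assumes "finite J" "!!S. S \<in> J ==> S \<in> lists d n p" "R \<in> lists d n p" "H \<in> hyps d n"
  and eq: "!!c. cycle p (M n) c ==> vf R c = (\<Sum>S\<in>J. a S * vf S c)" and c: "cycle (Suc p) (M n) c"
 shows "vf (H # R) c = (\<Sum>S\<in>J. a S * vf (H # S) c)"
proof -
 obtain xs where xs: "set xs = J" "distinct xs" using finite_distinct_list[OF assms(1)] by blast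
 define L where "L = (-1, R) # map (%S. (a S, S)) xs"
 have sl: "(\<Sum>S\<leftarrow>xs. f S) = (\<Sum>S\<in>J. f S)" for f :: "hyp list => complex"
  using sum_list_distinct_conv_sum_set[OF xs(2)] xs(1) by simp
 have "rel n p L" unfolding rel_def proof (intro conjI allI impI)
  show "snd ` set L <= lists d n p" using assms(2,3) xs(1) by (auto simp: L_def)
  show "comb L c = 0" if "cycle p (M n) c" for c using eq[OF that] sl by (simp add: comb_def L_def o_def)
 qed
 from rel_Cons[OF this assms(4)] have "comb (map (apsnd ((#) H)) L) c = 0" using c by (simp add: rel_def)
 thus ?thesis using sl by (simp add: comb_def L_def o_def)
qed

lemma map_hact_in: "w \<in> wcar d n ==> R \<in> lists d n p ==> map (hact d w) R \<in> lists d n p"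
 unfolding lists_def using hact_in[OF d, of w n] by (force simp del: split_paired_All)

lemma vf_hact_eq:
 assumes w: "w \<in> wcar d n" and "!!S. S \<in> J ==> S \<in> lists d n p" "R \<in> lists d n p"
  and eq: "!!c. cycle p (M n) c ==> vf R c = (\<Sum>S\<in>J. a S * vf S c)" and c: "cycle p (M n) c"
 shows "vf (map (hact d w) R) c = (\<Sum>S\<in>J. a S * vf (map (hact d w) S) c)"
proof -
 have contw: "continuous_map (M n) (M n) (conf_act d n w)"
  by (rule continuous_map_eq[OF cont_wact[OF w]]) (use conf_act_eq_wact[OF w] in simp)
 have "(\<Sum>S\<in>J. a S * vf (map (hact d w) S) c) = (\<Sum>S\<in>J. a S * vf S (chain_map p (conf_act d n w) c))"
  using vf_act[OF w assms(2) c] by simp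
 thus ?thesis using eq[OF cycle_chain_map[OF c contw]] vf_act[OF w assms(3) c] by simp
qed

lemma sum_atMost_Suc_drop_Cons:
 fixes f :: "'x list => complex"
 shows "(\<Sum>i\<le>p. (-1) ^ i * f (drp i (a # S))) = f S - (\<Sum>i<p. (-1) ^ i * f (a # drp i S))"
proof -
 have D: "drp (Suc i) (a # S) = a # drp i S" for i by (simp add: drp_def)
 have "(\<Sum>i\<le>p. (-1) ^ i * f (drp i (a # S))) = (\<Sum>i<Suc p. (-1) ^ i * f (drp i (a # S)))"
  by (simp add: lessThan_Suc_atMost)
 also have "... = f S + (\<Sum>i<p. (-1) ^ Suc i * f (a # drp i S))"
  by (subst sum.lessThan_Suc_shift) (simp add: D)
 finally show ?thesis by (simp add: sum_negf)
qed

context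
 fixes n :: nat and y :: "nat => complex" and C :: "hyp set" and w
 assumes C: "C = {h\<in>hyps d n. van \<omega> y h}" and w: "w \<in> wcar d n" and st: "!!h. h \<in> C ==> hact d w h \<in> C"
begin

text \<open>The part of the basis supported on the hyperplanes through \<open>y\<close>. Stability
  of \<open>C\<close> under \<open>w\<close> is asked instead of invariance of \<open>y\<close>,
  because \<open>y\<close> will be a complex stand-in for a finite-field point.\<close>

definition lbasis :: "nat => hyp list set" where "lbasis p = {S\<in>basis n p. set S <= C}"

lemma finite_lbasis [simp]: "finite (lbasis p)" by (simp add: lbasis_def)
lemma lbasis_lists: "S \<in> lbasis p ==> S \<in> lists d n p" using basis_sub by (auto simp: lbasis_def)
lemma lbasis_basis: "S \<in> lbasis p ==> S \<in> basis n p" by (auto simp: lbasis_def)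

text \<open>Pullback along \<open>loc n y\<close> fixes the lists inside \<open>C\<close> and kills
  all others; comparing the two expansions of the class leaves only coordinates inside
  \<open>C\<close>.\<close>

lemma coord_local:
 assumes R: "R \<in> lists d n p" "set R <= C" and S: "S \<in> basis n p" "\<not> set S <= C"
 shows "coord n p R S = 0"
proof -
 let ?P = "%S. set S <= C"
 have P: "?P S \<longleftrightarrow> (ALL h:set S. van \<omega> y h)" if "S \<in> lists d n p" for S using that by (auto simp: C lists_def)
 have "coord n p R S = (if ?P S then coord n p R S else 0)" proof (rule basis_eq[OF _ S(1)])
  fix c assume c: "cycle p (M n) c"
  have "(\<Sum>S\<in>basis n p. coord n p R S * vf S c) = vf R c" using coord[OF R(1) c] by simp
  also have "... = vf R (chain_map p (loc n y) c)" using vf_loc[OF R(1) c, of y] R P by auto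
  also have "... = (\<Sum>S\<in>basis n p. coord n p R S * vf S (chain_map p (loc n y) c))"
   by (rule coord[OF R(1) cycle_chain_map[OF c cont_loc]])
  also have "... = (\<Sum>S\<in>basis n p. (if ?P S then coord n p R S else 0) * vf S c)"
  proof (rule sum.cong[OF refl])
   fix S assume "S \<in> basis n p"
   hence "S \<in> lists d n p" using basis_sub by blast
   from vf_loc[OF this c, of y] P[OF this]
   show "coord n p R S * vf S (chain_map p (loc n y) c) = (if ?P S then coord n p R S else 0) * vf S c" by auto
  qed
  finally show "(\<Sum>S\<in>basis n p. coord n p R S * vf S c) = (\<Sum>S\<in>basis n p. (if ?P S then coord n p R S else 0) * vf S c)" .
 qed
 thus ?thesis using S(2) by simp
qed

lemma vf_local:
 assumes R: "R \<in> lists d n p" "set R <= C" and c: "cycle p (M n) c"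
 shows "vf R c = (\<Sum>S\<in>lbasis p. coord n p R S * vf S c)" unfolding coord[OF R(1) c]
 by (rule sum.mono_neutral_right) (use coord_local[OF R] in "auto simp: lbasis_def")

lemma nontriv_C: "h \<in> C ==> \<not> trivh h" by (auto simp: C van_def)

text \<open>Contraction is defined on lists. It respects their linear relations because, up to the
  factor -2 pi i, it is evaluation on cycles rotated by \<open>scl\<close>.\<close>

lemma coord_derivation:
 assumes R: "R \<in> lists d n (Suc p)" "set R <= C" and S: "S \<in> basis n p"
 shows "(\<Sum>i\<le>p. (-1) ^ i * coord n p (drp i R) S) =
  (\<Sum>U\<in>lbasis (Suc p). coord n (Suc p) R U * (\<Sum>i\<le>p. (-1) ^ i * coord n p (drp i U) S))"
proof -
 have D: "(\<Sum>i\<le>p. (-1) ^ i * vf (drp i R) c) = - vf R (chain_map (Suc p) (scl n) (tor p c)) / (2 * pi * \<i>)"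
  if R: "R \<in> lists d n (Suc p)" "set R <= C" and c: "cycle p (M n) c" for R c proof -
  have "\<not> trivh (R ! j)" if j: "j <= p" for j proof -
   have "R ! j \<in> set R" using listsD(1)[OF R(1)] j by simp
   hence "R ! j \<in> C" using R(2) by blast
   thus ?thesis by (rule nontriv_C)
  qed
  thus ?thesis unfolding vf_scl[OF R(1) c] by simp
 qed
 have "(\<Sum>i\<le>p. (-1) ^ i * coord n p (drp i R) S) =
  (\<Sum>j\<in>lbasis (Suc p) \<times> {..p}. (coord n (Suc p) R (fst j) * (-1) ^ snd j) * coord n p (drp (snd j) (fst j)) S)"
 proof (rule coord_rel[OF _ _ _ _ _ S])
  fix c assume c: "cycle p (M n) c"
  have cy: "cycle (Suc p) (M n) (chain_map (Suc p) (scl n) (tor p c))"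
   by (rule cycle_chain_map[OF cycle_tor[OF c] cont_scl])
  have "(\<Sum>i\<le>p. (-1) ^ i * vf (drp i R) c) =
   (\<Sum>U\<in>lbasis (Suc p). coord n (Suc p) R U * (- vf U (chain_map (Suc p) (scl n) (tor p c)) / (2 * pi * \<i>)))"
   unfolding D[OF R c] vf_local[OF R cy] by (simp add: sum_divide_distrib sum_negf)
  also have "... = (\<Sum>U\<in>lbasis (Suc p). coord n (Suc p) R U * (\<Sum>i\<le>p. (-1) ^ i * vf (drp i U) c))"
   by (rule sum.cong[OF refl], subst D) (auto simp: lbasis_lists c lbasis_def)
  also have "... = (\<Sum>j\<in>lbasis (Suc p) \<times> {..p}. (coord n (Suc p) R (fst j) * (-1) ^ snd j) * vf (drp (snd j) (fst j)) c)"
   by (simp add: sum.cartesian_product' sum_distrib_left mult.assoc)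
  finally show "(\<Sum>i\<le>p. (-1) ^ i * vf (drp i R) c) =
   (\<Sum>j\<in>lbasis (Suc p) \<times> {..p}. (coord n (Suc p) R (fst j) * (-1) ^ snd j) * vf (drp (snd j) (fst j)) c)" .
 qed (use drp_in_lists[OF R(1)] drp_in_lists[OF lbasis_lists] in auto)
 also have "... = (\<Sum>U\<in>lbasis (Suc p). coord n (Suc p) R U * (\<Sum>i\<le>p. (-1) ^ i * coord n p (drp i U) S))"
  by (simp add: sum.cartesian_product' sum_distrib_left mult.assoc)
 finally show ?thesis .
qed

definition ltrace :: "nat => complex" where
 "ltrace p = (\<Sum>S\<in>lbasis p. coord n p (map (hact d w) S) S)"

text \<open>If no hyperplane passes through \<open>y\<close>, then \<open>y\<close> is a point of
  the space and the unit class has value 1 on it; no nonempty list is supported on \<open>C\<close>,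
  so only degree 0 contributes.\<close>

lemma acyclic_empty:
 assumes "C = {}" shows "(\<Sum>p\<le>N. (-1) ^ p * ltrace p) = 1"
proof -
 have y: "restrict y {..<n} \<in> topspace (M n)" proof -
  have "van \<omega> (restrict y {..<n}) h \<longleftrightarrow> van \<omega> y h" if "h \<in> hyps d n" for h
   using that by (auto simp: van_def hyps_def pval_restrict)
  thus ?thesis using assms C unfolding topspace_M by auto
 qed
 have E: "lbasis p = {}" if "p ~= 0" for p proof -
  have "S \<notin> lbasis p" for S proof
   assume S: "S \<in> lbasis p"
   hence "set S <= C" by (simp add: lbasis_def)
   hence "set S = {}" unfolding assms subset_empty .
   thus False using listsD(1)[OF lbasis_lists[OF S]] \<open>p ~= 0\<close> by simp
  qed
  thus ?thesis by blast
 qed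
 define c where "c = frag_of (restrict (%_. restrict y {..<n}) (standard_simplex 0))"
 have c: "cycle 0 (M n) c"
  using y by (auto simp: c_def singular_cycle singular_chain_of singular_simplex_def chain_boundary_def intro!: continuous_map_canonical_const)
 have v: "vf [] c = 1" by (simp add: vf_def c_def lform_def)
 have nil: "[] \<in> lists d n 0" and B: "basis n 0 <= {[]}" using basis_sub[of n 0] by (auto simp: lists_def)
 have s1: "(\<Sum>S\<in>basis n 0. coord n 0 [] S * vf S c) = 1" using coord[OF nil c] v by (rule subst)
 have "basis n 0 ~= {}" proof
  assume "basis n 0 = {}"
  with s1 show False by (simp only: sum.empty zero_neq_one)
 qed
 hence b: "basis n 0 = {[]}" using B by (simp add: subset_singleton_iff)
 have "coord n 0 [] [] = 1" using s1 unfolding b by (simp add: v)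
 moreover have "lbasis 0 = {[]}" unfolding lbasis_def b by auto
 ultimately have "ltrace 0 = 1" by (simp add: ltrace_def)
 moreover have "ltrace p = 0" if "p ~= 0" for p using E[OF that] by (simp add: ltrace_def)
 ultimately have "(\<Sum>p\<le>N. (-1) ^ p * ltrace p) = (\<Sum>p\<le>N. if p = 0 then 1 else 0)"
  by (intro sum.cong refl) auto
 thus ?thesis by simp
qed

text \<open>Contraction with the Euler field and multiplication by a fixed \<open>H \<in> C\<close> give a contracting homotopy.\<close>

lemma acyclic_nonempty:
 assumes H: "H \<in> C" and N: "basis n (Suc N) = {}" shows "(\<Sum>p\<le>N. (-1) ^ p * ltrace p) = 0"
proof -
 define k where "k p U R = coord n p (map (hact d w) (H # R)) U" for p U R
 define g where "g p = (\<Sum>U\<in>lbasis p. \<Sum>i<p. (-1) ^ i * k p U (drp i U))" for p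
 have Hh: "H \<in> hyps d n" using H by (simp add: C)
 have lC: "set (map (hact d w) (H # S)) <= C" "map (hact d w) (H # S) \<in> lists d n (Suc p)"
  if "S \<in> lbasis p" for S p
  using that H st map_hact_in[OF w lists_Cons[OF Hh lbasis_lists]] by (auto simp: lbasis_def)
 \<comment> \<open>Multiplication by \<open>H\<close> followed by \<open>w\<close> is defined on
   lists; the ideal property of relations makes it compatible with expansion in the basis.\<close>
 have ideal: "k (Suc p) U R = (\<Sum>S\<in>lbasis p. coord n p R S * k (Suc p) U S)"
  if U: "U \<in> basis n (Suc p)" and R: "R \<in> lists d n p" "set R <= C" for p U R proof -
  have "vf (H # R) c = (\<Sum>S\<in>lbasis p. coord n p R S * vf (H # S) c)" if "cycle (Suc p) (M n) c" for c
   by (rule vf_Cons_eq[OF finite_lbasis lbasis_lists R(1) Hh vf_local[OF R] that])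
  hence "vf (map (hact d w) (H # R)) c = (\<Sum>S\<in>(#) H ` lbasis p. coord n p R (tl S) * vf (map (hact d w) S) c)"
   if "cycle (Suc p) (M n) c" for c
   by (intro vf_hact_eq[OF w _ _ _ that]) (auto simp: sum.reindex lists_Cons[OF Hh] lbasis_lists R(1))
  hence "(\<Sum>j\<in>{R}. 1 * coord n (Suc p) (map (hact d w) (H # j)) U) = (\<Sum>S\<in>lbasis p. coord n p R S * coord n (Suc p) (map (hact d w) (H # S)) U)"
   by (intro coord_rel U) (auto simp: sum.reindex lC(2)[simplified] map_hact_in[OF w lists_Cons[OF Hh R(1)], simplified])
  thus ?thesis by (simp add: k_def)
 qed
 \<comment> \<open>Let E be multiplication by \<open>H\<close> followed by \<open>w\<close>, and i
   the contraction. Since \<open>w\<close> commutes with i and fixes the value 1 of i on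
   \<open>H\<close>, one has i E + E i = w. The trace of i E in degree p equals that of E i in
   degree p + 1, which is \<open>g (Suc p)\<close>.\<close>
 have tr: "ltrace p = g p + g (Suc p)" for p proof -
  have "g (Suc p) = (\<Sum>U\<in>lbasis (Suc p). \<Sum>i\<le>p. (-1) ^ i * k (Suc p) U (drp i U))"
   by (simp add: g_def lessThan_Suc_atMost)
  also have "... = (\<Sum>U\<in>lbasis (Suc p). \<Sum>i\<le>p. (-1) ^ i * (\<Sum>S\<in>lbasis p. coord n p (drp i U) S * k (Suc p) U S))"
  proof (intro sum.cong refl)
   fix U i assume U: "U \<in> lbasis (Suc p)" and i: "i \<in> {..p}"
   have "set (drp i U) <= C" using U set_drp[of i U] by (auto simp: lbasis_def)
   from ideal[OF lbasis_basis[OF U] drp_in_lists[OF lbasis_lists[OF U]] this]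
   show "(-1) ^ i * k (Suc p) U (drp i U) = (-1) ^ i * (\<Sum>S\<in>lbasis p. coord n p (drp i U) S * k (Suc p) U S)"
    using i by simp
  qed
  also have "... = (\<Sum>U\<in>lbasis (Suc p). \<Sum>S\<in>lbasis p. k (Suc p) U S * (\<Sum>i\<le>p. (-1) ^ i * coord n p (drp i U) S))"
   unfolding sum_distrib_left by (rule sum.cong[OF refl], subst sum.swap) (simp add: mult_ac)
  also have "... = (\<Sum>S\<in>lbasis p. \<Sum>U\<in>lbasis (Suc p). k (Suc p) U S * (\<Sum>i\<le>p. (-1) ^ i * coord n p (drp i U) S))"
   by (rule sum.swap)
  also have "... = (\<Sum>S\<in>lbasis p. \<Sum>i\<le>p. (-1) ^ i * coord n p (drp i (map (hact d w) (H # S))) S)"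
   unfolding k_def using coord_derivation[OF lC(2,1) lbasis_basis] by simp
  also have "... = (\<Sum>S\<in>lbasis p. coord n p (map (hact d w) S) S - (\<Sum>i<p. (-1) ^ i * k p S (drp i S)))"
   unfolding list.map(2) sum_atMost_Suc_drop_Cons[where f = "%R. coord n p R _"] by (simp add: k_def map_drp)
  finally show ?thesis by (simp add: ltrace_def g_def sum_subtractf)
 qed
 have "(\<Sum>p\<le>N. (-1) ^ p * ltrace p) = g 0 + (-1) ^ N * g (Suc N)" for N
  by (induction N) (simp_all add: tr algebra_simps)
 moreover have "g 0 = 0" "g (Suc N) = 0" using N by (simp_all add: g_def lbasis_def)
 ultimately show ?thesis by simp
qed

theorem acyclic_trace:
 assumes "basis n (Suc N) = {}"
 shows "(\<Sum>p\<le>N. (-1) ^ p * (\<Sum>S\<in>{S\<in>basis n p. set S <= C}. coord n p (map (hact d w) S) S)) = (if C = {} then 1 else 0)"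
 using acyclic_empty acyclic_nonempty[OF _ assms] unfolding ltrace_def lbasis_def by (cases "C = {}") auto

end

end

section \<open>Counting twisted Frobenius fixed points\<close>

lemma card_roots_separable:
 fixes p :: "'a::alg_closed_field poly"
 assumes "p ~= 0" "!!a. poly p a = 0 ==> poly (pderiv p) a ~= 0" shows "card {x. poly p x = 0} = degree p"
 using assms
proof (induction "degree p" arbitrary: p)
 case 0
 hence "!!x. poly p x ~= 0" by (metis degree_eq_zeroE poly_const_conv pCons_0_0)
 thus ?case using 0 by simp
next
 case (Suc m)
 then obtain a where a: "poly p a = 0" using alg_closed_imp_poly_has_root[of p] by auto
 then obtain q where q: "p = [:- a, 1:] * q" by (metis dvd_def poly_eq_0_iff_dvd)
 have q0: "q ~= 0" using Suc.prems q by auto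
 have pd: "poly (pderiv p) x = poly q x + (x - a) * poly (pderiv q) x" for x
  unfolding q pderiv_mult by (simp add: pderiv_pCons algebra_simps)
 have "degree p = degree [:- a, 1:] + degree q" unfolding q by (rule degree_mult_eq) (use q0 in auto)
 hence dq: "m = degree q" using Suc.hyps by simp
 have "poly (pderiv q) x ~= 0" if "poly q x = 0" for x using Suc.prems(2)[of x] pd[of x] that by (auto simp: q)
 from Suc.hyps(1)[OF dq q0 this] have c: "card {x. poly q x = 0} = m" using dq by simp
 have qa: "poly q a ~= 0" using Suc.prems(2)[OF a] pd[of a] by simp
 have "{x. poly p x = 0} = insert a {x. poly q x = 0}" by (auto simp: q)
 thus ?case using qa c poly_roots_finite[OF q0] Suc.hyps(2) by simp
qed

text \<open>The derivative of y^N - c y is the nonzero constant -c, because N vanishes in the field;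
  so all N roots are simple.\<close>

lemma card_twisted_power:
 fixes c :: "'a::alg_closed_field"
 assumes "of_nat N = (0 :: 'a)" "N > 1" "c ~= 0" shows "card {y. y ^ N = c * y} = N"
proof -
 let ?p = "monom 1 N - monom c 1 :: 'a poly"
 have "degree (monom 1 N + (- monom c 1) :: 'a poly) = degree (monom 1 N :: 'a poly)"
  by (rule degree_add_eq_left) (use assms(2,3) in "simp add: degree_monom_eq")
 hence d: "degree ?p = N" by (simp add: degree_monom_eq)
 have "pderiv ?p = [:- c:]" by (simp add: pderiv_diff pderiv_monom assms(1) monom_0)
 hence pd: "poly (pderiv ?p) a ~= 0" for a using assms(3) by simp
 have "card {x. poly ?p x = 0} = degree ?p" by (rule card_roots_separable) (use d assms(2) pd in auto)
 thus ?thesis using d by (simp add: poly_monom)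
qed

text \<open>Eliminating one variable along a cycle multiplies the exponents; a fixed index is a one-variable equation.\<close>

lemma card_twisted_tuples:
 fixes c :: "'i => 'a::alg_closed_field" and N :: "'i => nat"
 assumes "finite I" "\<tau> ` I <= I" "inj_on \<tau> I"
  "!!i. i \<in> I ==> of_nat (N i) = (0 :: 'a) & N i > 1 & c i ~= 0"
 shows "card {t \<in> I \<rightarrow>\<^sub>E UNIV. ALL i:I. t i ^ N i = c i * t (\<tau> i)} = (\<Prod>i\<in>I. N i)"
 using assms
proof (induction I arbitrary: \<tau> N c rule: finite_induct)
 case empty
 show ?case by simp
next
 case (insert r I)
 let ?T = "{t \<in> insert r I \<rightarrow>\<^sub>E UNIV. ALL i:insert r I. t i ^ N i = c i * t (\<tau> i)}"
 have eqI: "t = t'" if "t \<in> insert r I \<rightarrow>\<^sub>E UNIV" "t' \<in> insert r I \<rightarrow>\<^sub>E UNIV" "t r = t' r" "!!i. i \<in> I ==> t i = t' i"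
  for t t' :: "'i => 'a" by (rule PiE_ext[OF that(1,2)]) (use that(3,4) in auto)
 show ?case proof (cases "\<tau> r = r")
  case True
  have tI: "\<tau> i \<in> I" if "i \<in> I" for i
   using insert.prems(1,2) that insert.hyps(2) True by (metis image_subset_iff inj_on_eq_iff insertCI insertE)
  let ?T' = "{t \<in> I \<rightarrow>\<^sub>E UNIV. ALL i:I. t i ^ N i = c i * t (\<tau> i)}"
  let ?Y = "{y. y ^ N r = c r * y}"
  have IH: "card ?T' = prod N I" by (rule insert.IH) (use tI insert.prems in "auto simp: inj_on_def")
  have "bij_betw (%(t, y). t(r := y)) (?T' \<times> ?Y) ?T"
  proof (rule bij_betw_byWitness[where f' = "%t. (restrict t I, t r)"])
   show "ALL a:?T' \<times> ?Y. (restrict (case a of (t, y) => t(r := y)) I, (case a of (t, y) => t(r := y)) r) = a"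
    using insert.hyps(2) by (auto simp: fun_eq_iff PiE_def extensional_def)
   show "ALL a:?T. (case (restrict a I, a r) of (t, y) => t(r := y)) = a"
    by (auto simp: fun_eq_iff PiE_def extensional_def)
   show "(%(t, y). t(r := y)) ` (?T' \<times> ?Y) <= ?T" proof (rule image_subsetI)
    fix x assume "x \<in> ?T' \<times> ?Y"
    then obtain t y where x: "x = (t, y)"
     and t: "t \<in> I \<rightarrow>\<^sub>E (UNIV :: 'a set)" "ALL i:I. t i ^ N i = c i * t (\<tau> i)" and y: "y ^ N r = c r * y" by blast
    have ne: "i \<in> I ==> i ~= r" for i using insert.hyps(2) by blast
    have "(t(r := y)) i ^ N i = c i * (t(r := y)) (\<tau> i)" if "i \<in> insert r I" for i
     using that t(2) y True ne tI by (cases "i = r") auto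
    moreover have "t(r := y) \<in> insert r I \<rightarrow>\<^sub>E UNIV" using t(1) by (auto simp: PiE_def extensional_def)
    ultimately show "(case x of (t, y) => t(r := y)) \<in> ?T"
     unfolding x prod.case mem_Collect_eq by (intro conjI ballI)
   qed
   show "(%t. (restrict t I, t r)) ` ?T <= ?T' \<times> ?Y" using tI True by auto
  qed
  hence "card ?T = card (?T' \<times> ?Y)" by (rule bij_betw_same_card[symmetric])
  also have "... = prod N I * N r"
   using card_twisted_power[of "N r" "c r"] insert.prems(3)[of r] IH by (simp add: card_cartesian_product)
  finally show ?thesis using insert.hyps by (simp add: mult.commute)
 next
  case False
  have "\<tau> ` insert r I = insert r I" by (rule endo_inj_surj[OF _ insert.prems(1,2)]) (use insert.hyps in simp)
  hence "r \<in> \<tau> ` insert r I" by blast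
  then obtain u where u: "u \<in> insert r I" "\<tau> u = r" by blast
  hence uI: "u \<in> I" using False by auto
  have ur: "u ~= r" using uI insert.hyps(2) by blast
  have rI: "\<tau> r \<in> I" using insert.prems(1) False by blast
  have tI: "\<tau> i \<in> I" if "i \<in> I" "i ~= u" for i proof -
   have "\<tau> i ~= r" using insert.prems(2) u that by (metis inj_onD insertCI)
   thus ?thesis using insert.prems(1) that(1) by blast
  qed
  define \<tau>' where "\<tau>' = \<tau>(u := \<tau> r)"
  \<comment> \<open>\<open>u\<close> is the index preceding \<open>r\<close>. Substituting t r = t u
    ^ N u / c u into the equation at \<open>r\<close> gives an equation for \<open>u\<close> with
    exponent \<open>N u * N r\<close>.\<close>
  define N' where "N' = N(u := N u * N r)"
  define c' where "c' = c(u := c u ^ N r * c r)"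
  let ?T' = "{t \<in> I \<rightarrow>\<^sub>E UNIV. ALL i:I. t i ^ N' i = c' i * t (\<tau>' i)}"
  have IH: "card ?T' = prod N' I" proof (rule insert.IH)
   show "\<tau>' ` I <= I" using rI tI by (auto simp: \<tau>'_def)
   show "inj_on \<tau>' I" proof (rule inj_onI)
    fix i j assume ij: "i \<in> I" "j \<in> I" "\<tau>' i = \<tau>' j"
    have inj: "\<tau> a = \<tau> b ==> a \<in> insert r I ==> b \<in> insert r I ==> a = b" for a b
     using insert.prems(2) by (rule inj_onD)
    have "i = u ==> j ~= u ==> r = j" "j = u ==> i ~= u ==> i = r" "i ~= u ==> j ~= u ==> i = j"
     using inj[of r j] inj[of i r] inj[of i j] ij by (auto simp: \<tau>'_def)
    thus "i = j" using ij insert.hyps(2) by (cases "i = u"; cases "j = u") auto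
   qed
   show "of_nat (N' i) = (0::'a) & 1 < N' i & c' i ~= 0" if "i \<in> I" for i
    using insert.prems(3)[of i] insert.prems(3)[of r] insert.prems(3)[of u] uI that less_1_mult[of "N u" "N r"]
    by (auto simp: N'_def c'_def)
  qed
  have "bij_betw (%t. restrict t I) ?T ?T'"
  proof (rule bij_betw_byWitness[where f' = "%t. t(r := t u ^ N u / c u)"])
   have cu: "c u ~= 0" using insert.prems(3)[of u] uI by simp
   have tr: "t r = t u ^ N u / c u" if "t \<in> ?T" for t proof -
    have "t u ^ N u = c u * t r" using that uI u(2) by fastforce
    thus ?thesis using cu by simp
   qed
   show "ALL t:?T. (restrict t I)(r := restrict t I u ^ N u / c u) = t" proof
    fix t assume t: "t \<in> ?T"
    show "(restrict t I)(r := restrict t I u ^ N u / c u) = t"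
     by (rule eqI) (use t tr[OF t] uI insert.hyps(2) in "auto simp: PiE_def extensional_def")
   qed
   show "ALL t:?T'. restrict (t(r := t u ^ N u / c u)) I = t"
    using insert.hyps(2) by (auto simp: fun_eq_iff PiE_def extensional_def)
   show "(%t. restrict t I) ` ?T <= ?T'" proof (rule image_subsetI)
    fix t assume t: "t \<in> ?T"
    have "(restrict t I) i ^ N' i = c' i * (restrict t I) (\<tau>' i)" if i: "i \<in> I" for i
    proof (cases "i = u")
     case True
     have "t u ^ N u = c u * t r" using t uI u(2) by fastforce
     hence "t u ^ (N u * N r) = c u ^ N r * t r ^ N r" by (simp add: power_mult power_mult_distrib)
     also have "t r ^ N r = c r * t (\<tau> r)" using t by blast
     finally show ?thesis using True i rI by (simp add: N'_def c'_def \<tau>'_def mult.assoc)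
    next
     case False
     thus ?thesis using t i tI by (auto simp: N'_def c'_def \<tau>'_def)
    qed
    thus "restrict t I \<in> ?T'" by simp
   qed
   show "(%t. t(r := t u ^ N u / c u)) ` ?T' <= ?T" proof (rule image_subsetI)
    fix t assume t: "t \<in> ?T'"
    let ?s = "t(r := t u ^ N u / c u)"
    have "?s \<in> insert r I \<rightarrow>\<^sub>E UNIV" using t by (auto simp: PiE_def extensional_def)
    moreover have "?s i ^ N i = c i * ?s (\<tau> i)" if i: "i \<in> insert r I" for i proof -
     consider "i = r" | "i = u" | "i \<in> I" "i ~= u" using i by blast
     thus ?thesis proof cases
      case 1
      have "t u ^ N' u = c' u * t (\<tau>' u)" using t uI by blast
      hence "(t u ^ N u) ^ N r = c u ^ N r * (c r * t (\<tau> r))"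
       by (simp add: N'_def c'_def \<tau>'_def power_mult mult.assoc)
      thus ?thesis using 1 False cu by (simp add: power_divide)
     next
      case 2
      thus ?thesis using u(2) ur cu by simp
     next
      case 3
      have "t i ^ N' i = c' i * t (\<tau>' i)" using t 3 by blast
      moreover have "i ~= r" "\<tau> i ~= r" using 3 tI insert.hyps(2) by blast+
      ultimately show ?thesis using 3 by (simp add: N'_def c'_def \<tau>'_def)
     qed
    qed
    ultimately show "?s \<in> ?T" by blast
   qed
  qed
  hence "card ?T = prod N' I" unfolding IH[symmetric] by (rule bij_betw_same_card)
  also have "... = N' u * prod N' (I - {u})" using uI insert.hyps(1) by (rule prod.remove[rotated])
  also have "prod N' (I - {u}) = prod N (I - {u})" by (rule prod.cong) (auto simp: N'_def)
  also have "N' u * prod N (I - {u}) = N r * (N u * prod N (I - {u}))" by (simp add: N'_def mult_ac)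
  also have "N u * prod N (I - {u}) = prod N I" using uI insert.hyps(1) by (rule prod.remove[rotated, symmetric])
  finally show ?thesis using insert.hyps by simp
 qed
qed

subsection \<open>Points of the arrangement over a finite field\<close>

text \<open>\<open>Q\<close> stands for the size of a finite field: that it vanishes in the closure
  makes the equations y^Q = c y with nonzero c separable, and \<open>d dvd Q - 1\<close> makes
  Frobenius fix the d-th roots of unity.\<close>

locale fpts = orbit_arrangement +
 fixes z :: "'f::alg_closed_field" and Q :: nat
 assumes z_d': "z ^ d = 1" and z_inj': "!!a b. a < d ==> b < d ==> z ^ a = z ^ b ==> a = b"
  and Q0: "of_nat Q = (0 :: 'f)" and Q1: "Q > 1" and dQ: "d dvd Q - 1"
begin

lemma z_Q: "z ^ Q = z"
proof -
 obtain k where "Q - 1 = d * k" using dQ by blast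
 hence "Q = Suc (d * k)" using Q1 by simp
 thus ?thesis by (simp add: power_mult z_d')
qed

sublocale finite_field_pts d z "{y. y ^ Q = y}"
proof
 show "z ^ d = 1" by (rule z_d')
 show "a < d ==> b < d ==> z ^ a = z ^ b ==> a = b" for a b by (rule z_inj')
 show "0 \<in> {y::'f. y ^ Q = y}" using Q1 by simp
 have "(z ^ a) ^ Q = z ^ a" for a by (metis z_Q power_mult mult.commute)
 thus "x \<in> {y. y ^ Q = y} ==> z ^ a * x \<in> {y. y ^ Q = y}" for x a by (simp add: power_mult_distrib)
 have "card {y::'f. y ^ Q = y} = Q" using card_twisted_power[OF Q0 Q1, of 1] by simp
 thus "finite {y::'f. y ^ Q = y}" using Q1 card_ge_0_finite by force
qed

lemma card_F: "card {y::'f. y ^ Q = y} = Q" using card_twisted_power[OF Q0 Q1, of 1] by simp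

lemma z_power_eq: "z ^ a = z ^ b \<longleftrightarrow> a mod d = b mod d"
 using z_inj[of "a mod d" "b mod d"] d power_mod_root[OF z_d] by (metis mod_less_divisor)

lemma omega_power_eq: "\<omega> ^ a = \<omega> ^ b \<longleftrightarrow> a mod d = b mod d"
 using omega_inj[of "a mod d" "b mod d"] d power_mod_root[OF omega_d] by (metis mod_less_divisor)

lemma z_roots:
 assumes "x ^ d = 1" shows "EX a<d. x = z ^ a"
proof -
 let ?p = "monom 1 d - 1 :: 'f poly"
 have eq: "{x. poly ?p x = 0} = {x. x ^ d = 1}" by (auto simp: poly_monom)
 have "degree (monom 1 d + (- 1) :: 'f poly) = degree (monom 1 d :: 'f poly)"
  by (rule degree_add_eq_left) (use d in "simp add: degree_monom_eq")
 hence dp: "degree ?p = d" by (simp add: degree_monom_eq)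
 hence p0: "?p ~= 0" using d by (metis degree_0 less_irrefl)
 have f: "finite {x::'f. x ^ d = 1}" and "card {x::'f. x ^ d = 1} <= d"
  using poly_roots_finite[OF p0] card_poly_roots_bound[OF p0] unfolding eq dp by auto
 moreover have sub: "(%a. z ^ a) ` {..<d} <= {x. x ^ d = 1}" proof safe
  fix a show "(z ^ a) ^ d = 1" by (metis z_d mult.commute power_mult power_one)
 qed
 moreover have "card ((%a. z ^ a) ` {..<d}) = d" by (subst card_image) (auto intro!: inj_onI z_inj)
 ultimately have "(%a. z ^ a) ` {..<d} = {x. x ^ d = 1}"
  using card_subset_eq[OF f sub] card_mono[OF f sub] by simp
 thus ?thesis using assms by force
qed

text \<open>Coordinates with equal nonzero d-th powers differ by a root of unity, recorded by the
  exponent \<open>a i\<close> relative to a chosen root. Replacing z by \<open>\<omega>\<close> and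
  giving different d-th powers different positive integers as moduli preserves all coincidences
  among 0 and the multiples of coordinates.\<close>

lemma complex_model:
 "EX x. ALL h:hyps d n. van \<omega> x h \<longleftrightarrow> van z y h"
proof -
 define V where "V = (%i. y i ^ d) ` {..<n}"
 have "finite V" by (simp add: V_def)
 then obtain f :: "'f => nat" where f: "inj_on f V"
  using ex_bij_betw_finite_nat[of V] by (auto simp: bij_betw_def)
 define b where "b v = (SOME b. b ^ d = v)" for v :: 'f
 have b: "b (u ^ d) ^ d = u ^ d" for u unfolding b_def by (rule someI[of _ u]) simp
 have "EX a. a < d & y i = z ^ a * b (y i ^ d)" for i proof (cases "y i = 0")
  case True
  hence "b (y i ^ d) ^ d = 0" using b[of "y i"] d by (simp add: zero_power)
  hence "b (y i ^ d) = 0" by simp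
  thus ?thesis using True d by (intro exI[of _ 0]) simp
 next
  case False
  hence "b (y i ^ d) ~= 0" using b[of "y i"] d by (metis power_eq_0_iff power_0_left not_gr0)
  hence "(y i / b (y i ^ d)) ^ d = 1" "y i = (y i / b (y i ^ d)) * b (y i ^ d)" using b[of "y i"] False by (simp_all add: power_divide)
  with z_roots show ?thesis by metis
 qed
 then obtain a where a: "!!i. y i = z ^ a i * b (y i ^ d)" by metis
 define x where "x i = \<omega> ^ a i * (if y i = 0 then 0 else of_nat (Suc (f (y i ^ d))))" for i
 have eq0: "x i = 0 \<longleftrightarrow> y i = 0" for i by (simp add: x_def del: of_nat_Suc)
 have eq: "\<omega> ^ k * x i = \<omega> ^ l * x j \<longleftrightarrow> z ^ k * y i = z ^ l * y j" if ij: "i < n" "j < n" for i j k l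
 proof (cases "y i = 0 | y j = 0")
  case True
  have "\<omega> ^ k * x i = 0 \<longleftrightarrow> z ^ k * y i = 0" "\<omega> ^ l * x j = 0 \<longleftrightarrow> z ^ l * y j = 0" by (simp_all add: eq0 z_nz)
  moreover have "z ^ k * y i = 0 | z ^ l * y j = 0" using True by auto
  ultimately show ?thesis by metis
 next
  case False
  have V: "y i ^ d \<in> V" "y j ^ d \<in> V" using ij by (auto simp: V_def)
  have zd: "(z ^ k * u) ^ d = u ^ d" for k u
   by (simp add: power_mult_distrib power_mult[symmetric] mult.commute[of k] power_mult[of z d] z_d)
  show ?thesis proof (cases "y i ^ d = y j ^ d")
   case True
   have bn: "b (y j ^ d) ~= 0" using a[of j] False by auto
   have "\<omega> ^ k * x i = \<omega> ^ l * x j \<longleftrightarrow> \<omega> ^ (k + a i) = \<omega> ^ (l + a j)"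
    using False True by (simp add: x_def power_add del: of_nat_Suc)
   also have "... \<longleftrightarrow> z ^ (k + a i) = z ^ (l + a j)" by (simp only: omega_power_eq z_power_eq)
   also have "... \<longleftrightarrow> z ^ k * y i = z ^ l * y j"
    using bn True by (subst a[of i], subst a[of j]) (simp add: power_add mult.assoc[symmetric])
   finally show ?thesis .
  next
   case F: False
   have "norm (\<omega> ^ k * x i) = Suc (f (y i ^ d))" "norm (\<omega> ^ l * x j) = Suc (f (y j ^ d))"
    using False by (simp_all add: x_def norm_mult norm_power del: of_nat_Suc)
   moreover have "f (y i ^ d) ~= f (y j ^ d)" using F V f by (auto dest: inj_onD)
   ultimately have "\<omega> ^ k * x i ~= \<omega> ^ l * x j" by (metis of_nat_eq_iff nat.inject)
   moreover have "z ^ k * y i ~= z ^ l * y j" using F zd by metis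
   ultimately show ?thesis by simp
  qed
 qed
 have "pval \<omega> x s = pval \<omega> x t \<longleftrightarrow> pval z y s = pval z y t" if "s \<in> pts d n" "t \<in> pts d n" for s t
  using that eq eq0 z_nz by (cases s; cases t) (auto simp: in_pts)
 hence "ALL h:hyps d n. van \<omega> x h \<longleftrightarrow> van z y h" by (auto simp: van_def hyps_def)
 thus ?thesis by blast
qed

lemma pval_frob: "pval z (%i. y i ^ Q) s = pval z y s ^ Q"
proof (cases s)
 case (Some ja)
 have "(z ^ a) ^ Q = z ^ a" for a by (metis z_Q power_mult mult.commute)
 thus ?thesis using Some by (cases ja) (simp add: power_mult_distrib)
qed (use Q1 in simp)

lemma van_frob: "van z y h ==> van z (%i. y i ^ Q) h" by (simp add: van_def pval_frob)

lemma van_eq_on: "h \<in> hyps d n ==> (!!i. i < n ==> y i = y' i) ==> van z y h \<longleftrightarrow> van z y' h"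
 by (auto simp: van_def hyps_def pts_def)

lemma wact_surj:
 assumes w: "w \<in> wcar d n" and v: "v \<in> {..<n} \<rightarrow>\<^sub>E UNIV"
 shows "EX u:{..<n} \<rightarrow>\<^sub>E UNIV. wact z n w u = v"
proof -
 have perm: "snd w permutes {..<n}" by (rule wreath_snd_permutes[OF d w])
 define u where "u = (\<lambda>i\<in>{..<n}. inverse (z ^ nat (fst w (snd w i))) * v (snd w i))"
 have "wact z n w u i = v i" if "i < n" for i
  using permutes_inverses(1)[OF perm, of i] z_nz inv_less[OF perm that] that by (simp add: u_def wact_def)
 hence "wact z n w u = v" by (intro PiE_ext[OF _ v]) (auto simp: wact_def)
 moreover have "u \<in> {..<n} \<rightarrow>\<^sub>E UNIV" by (simp add: u_def)
 ultimately show ?thesis by blast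
qed

definition fixed :: "nat => (nat => int) \<times> (nat => nat) => (nat => 'f) set" where
 "fixed n w = {y \<in> {..<n} \<rightarrow>\<^sub>E UNIV. ALL i<n. y i ^ Q = wact z n w y i}"

section \<open>A flat as an affine space on representatives of its coordinates\<close>

context
 fixes n :: nat and R :: "hyp list"
 assumes R: "set R <= hyps d n" and nontriv: "!!h. h \<in> set R ==> \<not> trivh h"
begin

abbreviation "VR \<equiv> Vset z UNIV n R"

text \<open>On the flat the coordinates \<open>i\<close> and \<open>j\<close> are proportional by a
  root of unity. Taking the least index of each class and dropping coordinates that vanish
  identically identifies the flat with the affine space on \<open>reps\<close>.\<close>

definition crel :: "nat => nat => bool" where "crel i j \<longleftrightarrow> (EX a. ALL v:VR. v i = z ^ a * v j)"
definition cnz :: "nat => bool" where "cnz i \<longleftrightarrow> (EX v:VR. v i ~= 0)"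
definition rep :: "nat => nat" where "rep i = (LEAST k. crel i k)"
definition cexp :: "nat => nat" where "cexp i = (SOME a. ALL v:VR. v i = z ^ a * v (rep i))"
definition reps :: "nat set" where "reps = rep ` {i. i < n & cnz i}"

lemma crel_refl: "crel i i" unfolding crel_def by (rule exI[of _ 0]) simp

lemma crel_sym: "crel i j ==> crel j i" unfolding crel_def
proof (elim exE)
 fix a assume a: "ALL v:VR. v i = z ^ a * v j"
 have "z ^ (d - a mod d) * z ^ a = z ^ ((d - a mod d) + a mod d)"
  by (simp only: power_add power_mod_root[OF z_d])
 also have "... = 1" using d z_d by simp
 finally have "z ^ (d - a mod d) * z ^ a = 1" .
 show "EX a. ALL v:VR. v j = z ^ a * v i" proof (intro exI[of _ "d - a mod d"] ballI)
  fix v assume "v \<in> VR"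
  hence "z ^ (d - a mod d) * v i = (z ^ (d - a mod d) * z ^ a) * v j" using a by (simp only: mult.assoc)
  thus "v j = z ^ (d - a mod d) * v i" using \<open>z ^ (d - a mod d) * z ^ a = 1\<close> by simp
 qed
qed

lemma crel_trans: "crel i j ==> crel j k ==> crel i k" unfolding crel_def
proof (elim exE)
 fix a b assume "ALL v:VR. v i = z ^ a * v j" "ALL v:VR. v j = z ^ b * v k"
 thus "EX a. ALL v:VR. v i = z ^ a * v k" by (intro exI[of _ "a + b"]) (simp add: power_add mult.assoc)
qed

lemma crel_rep: "crel i (rep i)" unfolding rep_def by (rule LeastI[of _ i], rule crel_refl)
lemma rep_le: "rep i <= i" unfolding rep_def by (rule Least_le, rule crel_refl)
lemma rep_eq: "crel i j ==> rep i = rep j"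
proof -
 assume "crel i j"
 hence "crel i k \<longleftrightarrow> crel j k" for k using crel_trans crel_sym by blast
 thus ?thesis by (simp add: rep_def)
qed
lemma rep_rep: "rep (rep i) = rep i" using rep_eq[OF crel_rep] by simp
lemma crel_nz: "crel i j ==> cnz i \<longleftrightarrow> cnz j"
proof -
 assume "crel i j"
 then obtain a where a: "ALL v:VR. v i = z ^ a * v j" unfolding crel_def by blast
 have "v i = 0 \<longleftrightarrow> v j = 0" if "v \<in> VR" for v unfolding bspec[OF a that] using z_nz by simp
 thus ?thesis unfolding cnz_def by blast
qed
lemma cexp: "v \<in> VR ==> v i = z ^ cexp i * v (rep i)"
proof -
 assume v: "v \<in> VR"
 have "EX a. ALL v:VR. v i = z ^ a * v (rep i)" using crel_rep[of i] by (simp add: crel_def)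
 from someI_ex[OF this] have "ALL v:VR. v i = z ^ cexp i * v (rep i)" unfolding cexp_def .
 thus ?thesis using v by blast
qed

lemma repsD: "r \<in> reps ==> r < n & cnz r & rep r = r & z ^ cexp r = 1"
proof -
 assume "r \<in> reps"
 then obtain i where i: "i < n" "cnz i" "r = rep i" by (auto simp: reps_def)
 have r: "r < n" "cnz r" "rep r = r" using i rep_le[of i] crel_nz[OF crel_rep[of i]] rep_rep by auto
 then obtain v where "v \<in> VR" "v r ~= 0" by (auto simp: cnz_def)
 hence "z ^ cexp r = 1" using cexp[of v r] r(3) mult_cancel_right1[of "v r" "z ^ cexp r"] by metis
 with r show ?thesis by blast
qed

lemma rep_in_reps: "i < n ==> cnz i ==> rep i \<in> reps" by (auto simp: reps_def)

text \<open>An equation of \<open>R\<close> whose sides are not identically zero on the flat puts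
  the two indices into one class with matching exponents; otherwise both sides vanish. So
  proportionality to representatives and vanishing imply every equation.\<close>

lemma VR_iff: "y \<in> VR \<longleftrightarrow> y \<in> {..<n} \<rightarrow>\<^sub>E UNIV & (ALL i<n. y i = (if cnz i then z ^ cexp i * y (rep i) else 0))"
proof
 assume "y \<in> VR"
 thus "y \<in> {..<n} \<rightarrow>\<^sub>E UNIV & (ALL i<n. y i = (if cnz i then z ^ cexp i * y (rep i) else 0))"
 proof (intro conjI allI impI)
  fix i assume "i < n"
  show "y i = (if cnz i then z ^ cexp i * y (rep i) else 0)" proof (cases "cnz i")
   case False
   hence "y i = 0" using \<open>y \<in> VR\<close> unfolding cnz_def by blast
   with False show ?thesis by simp
  qed (simp only: if_True cexp[OF \<open>y \<in> VR\<close>, symmetric])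
 qed (simp add: Vset_def)
next
 assume y: "y \<in> {..<n} \<rightarrow>\<^sub>E UNIV & (ALL i<n. y i = (if cnz i then z ^ cexp i * y (rep i) else 0))"
 have "van z y h" if hR: "h \<in> set R" for h proof -
  obtain s t where h: "h = (s, t)" by (cases h)
  have st: "s \<in> pts d n" "t \<in> pts d n" using R hR h by (auto simp: hyps_def)
  have v: "van z v h" if "v \<in> VR" for v using that hR by (auto simp: Vset_def)
  hence eqv: "pval z v s = pval z v t" if "v \<in> VR" for v using that h by (auto simp: van_def)
  have zero: "y i = 0" if "i < n" "\<not> cnz i" for i using conjunct2[OF y, rule_format, of i] that by simp
  have key: "pval z y s = pval z y t" proof (cases "EX i a. s = Some (i, a) & cnz i | t = Some (i, a) & cnz i")
   case False
   hence "pval z y s = 0" "pval z y t = 0" using st zero by (cases s; cases t; force)+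
   thus ?thesis by simp
  next
   case True
   then obtain i a where ia: "s = Some (i, a) | t = Some (i, a)" "cnz i" by blast
   obtain u where u: "u \<in> VR" "u i ~= 0" using ia(2) by (auto simp: cnz_def)
   have "pval z u s ~= 0" "pval z u t ~= 0" using eqv[OF u(1)] ia(1) u(2) z_nz by auto
   then obtain k b l c where s: "s = Some (k, b)" "u k ~= 0" and t: "t = Some (l, c)" "u l ~= 0" by (cases s; cases t) auto
   have kl: "k < n" "l < n" "b < d" "c < d" using st s t by auto
   have nz: "cnz k" "cnz l" using u s t by (auto simp: cnz_def)
   have "crel k l" unfolding crel_def proof (intro exI ballI)
    fix v assume "v \<in> VR"
    from eqv[OF this] have "z ^ (d - b) * (z ^ b * v k) = z ^ (d - b) * (z ^ c * v l)" using s t by simp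
    hence "z ^ (d - b + b) * v k = z ^ (d - b + c) * v l" by (simp only: power_add mult.assoc)
    thus "v k = z ^ (d - b + c) * v l" using kl(3) z_d by simp
   qed
   hence r: "rep k = rep l" by (rule rep_eq)
   have "z ^ b * (z ^ cexp k * u (rep k)) = z ^ c * (z ^ cexp l * u (rep k))"
    using eqv[OF u(1)] s t cexp[OF u(1), of k] cexp[OF u(1), of l] r by simp
   moreover have "u (rep k) ~= 0" using cexp[OF u(1), of k] s(2) by auto
   ultimately have "z ^ b * z ^ cexp k = z ^ c * z ^ cexp l" by (simp add: mult.assoc[symmetric])
   hence "z ^ b * (z ^ cexp k * y (rep k)) = z ^ c * (z ^ cexp l * y (rep k))" by (simp add: mult.assoc[symmetric])
   thus ?thesis using y kl nz r s t by simp
  qed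
  thus ?thesis using nontriv[OF hR] h by (simp add: van_def)
 qed
 thus "y \<in> VR" using conjunct1[OF y] by (simp add: Vset_def)
qed

text \<open>A group element preserving the flat permutes the classes of coordinates, so on
  representatives the equation y^Q = w y is a twisted permutation system, whose number of solutions
  does not depend on the twist.\<close>

theorem card_fixed_VR:
 assumes w: "w \<in> wcar d n"
  and st: "!!y. y \<in> {..<n} \<rightarrow>\<^sub>E UNIV ==> wact z n w y \<in> VR \<longleftrightarrow> y \<in> VR"
 shows "card (VR \<inter> fixed n w) = Q ^ card reps"
proof -
 define \<sigma> where "\<sigma> = snd w"
 define s where "s = inv_into UNIV \<sigma>"
 define g where "g i = nat (fst w i)" for i
 have perm: "\<sigma> permutes {..<n}" unfolding \<sigma>_def by (rule wreath_snd_permutes[OF d w])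
 have sl: "s i < n" if "i < n" for i unfolding s_def by (rule inv_less[OF perm that])
 have gd: "g i < d" if "i < n" for i unfolding g_def by (rule wreath_fst_range(3)[OF d w that])
 have wa: "wact z n w y i = z ^ g i * y (s i)" if "i < n" for y i using that by (simp add: wact_def g_def s_def \<sigma>_def)
 have surj: "EX u:VR. v = wact z n w u" if v: "v \<in> VR" for v proof -
  have "v \<in> {..<n} \<rightarrow>\<^sub>E UNIV" using v by (simp add: Vset_def)
  from wact_surj[OF w this] obtain u where "u \<in> {..<n} \<rightarrow>\<^sub>E UNIV" "wact z n w u = v" by blast
  thus ?thesis using st[of u] v by auto
 qed
 have wV: "wact z n w u \<in> VR" if "u \<in> VR" for u using st[of u] that by (simp add: Vset_def)
 have cnz_s: "cnz (s i) \<longleftrightarrow> cnz i" if i: "i < n" for i proof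
  assume "cnz (s i)"
  then obtain u where "u \<in> VR" "u (s i) ~= 0" unfolding cnz_def by blast
  hence "wact z n w u \<in> VR" "wact z n w u i ~= 0" using wV wa[OF i] z_nz by auto
  thus "cnz i" unfolding cnz_def by blast
 next
  assume "cnz i"
  then obtain v where v: "v \<in> VR" "v i ~= 0" unfolding cnz_def by blast
  obtain u where "u \<in> VR" "v = wact z n w u" using surj[OF v(1)] by blast
  thus "cnz (s i)" unfolding cnz_def using v(2) wa[OF i] by (intro bexI[of _ u]) auto
 qed
 have crel_s: "crel i j" if ij: "i < n" "j < n" and c: "crel (s i) (s j)" for i j proof -
  obtain a where a: "!!u. u \<in> VR ==> u (s i) = z ^ a * u (s j)" using c unfolding crel_def by blast
  show ?thesis unfolding crel_def proof (intro exI ballI)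
   fix v assume "v \<in> VR"
   then obtain u where u: "u \<in> VR" "v = wact z n w u" using surj by blast
   have "v i = z ^ g i * (z ^ a * u (s j))" unfolding u(2) wa[OF ij(1)] by (subst a[OF u(1)]) rule
   also have "... = z ^ (g i + a) * (z ^ (d - g j + g j) * u (s j))"
    using gd[OF ij(2)] z_d by (simp add: power_add mult.assoc)
   also have "... = z ^ (g i + a + (d - g j)) * v j" unfolding u(2) wa[OF ij(2)] by (simp only: power_add mult.assoc)
   finally show "v i = z ^ (g i + a + (d - g j)) * v j" .
  qed
 qed
 define \<tau> where "\<tau> r = rep (s r)" for r
 define c where "c r = z ^ g r * z ^ cexp (s r)" for r
 have fin: "finite reps" by (simp add: reps_def)
 let ?T = "{t \<in> reps \<rightarrow>\<^sub>E UNIV. ALL r:reps. t r ^ Q = c r * t (\<tau> r)}"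
 have \<tau>: "\<tau> r \<in> reps" if "r \<in> reps" for r
  unfolding \<tau>_def using repsD[OF that] by (intro rep_in_reps) (simp_all add: sl cnz_s)
 have cT: "card ?T = Q ^ card reps" proof -
  have "inj_on \<tau> reps" proof (rule inj_onI)
   fix r r' assume r: "r \<in> reps" "r' \<in> reps" "\<tau> r = \<tau> r'"
   hence "crel (s r) (s r')"
    using crel_trans[OF crel_rep[of "s r"], of "s r'"] crel_sym[OF crel_rep[of "s r'"]] by (simp add: \<tau>_def)
   from rep_eq[OF crel_s[OF _ _ this]] show "r = r'" using repsD[OF r(1)] repsD[OF r(2)] by simp
  qed
  moreover have "\<tau> ` reps <= reps" using \<tau> by blast
  ultimately show ?thesis using card_twisted_tuples[OF fin, of \<tau> "%_. Q" c] Q0 Q1 z_nz by (simp add: c_def)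
 qed
 define ext where "ext t = (\<lambda>i\<in>{..<n}. if cnz i then z ^ cexp i * t (rep i) else 0)" for t :: "nat => 'f"
 have ext_rep: "ext t r = t r" if "r \<in> reps" for r t using repsD[OF that] by (simp add: ext_def)
 have extV: "ext t \<in> VR" for t unfolding VR_iff proof (intro conjI allI impI)
  fix i assume i: "i < n"
  show "ext t i = (if cnz i then z ^ cexp i * ext t (rep i) else 0)" proof (cases "cnz i")
   case True
   show ?thesis unfolding ext_rep[OF rep_in_reps[OF i True]] using i by (simp add: ext_def)
  qed (use i in "simp add: ext_def")
 qed (simp add: ext_def)
 have det: "v i = v' i" if v: "v \<in> VR" "v' \<in> VR" "!!r. r \<in> reps ==> v r = v' r" and i: "i < n" for v v' i
  using v(1,2)[unfolded VR_iff, THEN conjunct2, rule_format, OF i] v(3)[OF rep_in_reps[OF i]] by (cases "cnz i") simp_all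
 have "bij_betw (%y. restrict y reps) (VR \<inter> fixed n w) ?T"
 proof (rule bij_betw_byWitness[where f' = ext])
  show "ALL y:VR \<inter> fixed n w. ext (restrict y reps) = y" proof
   fix y assume y: "y \<in> VR \<inter> fixed n w"
   show "ext (restrict y reps) = y" proof (rule PiE_ext)
    show "ext (restrict y reps) \<in> {..<n} \<rightarrow>\<^sub>E UNIV" by (simp add: ext_def)
    show "y \<in> {..<n} \<rightarrow>\<^sub>E UNIV" using y by (simp add: Vset_def)
    show "ext (restrict y reps) i = y i" if "i \<in> {..<n}" for i
     by (rule det[OF extV]) (use y that ext_rep in auto)
   qed
  qed
  show "ALL t:?T. restrict (ext t) reps = t" by (auto simp: ext_rep fun_eq_iff PiE_def extensional_def)
  show "(%y. restrict y reps) ` (VR \<inter> fixed n w) <= ?T" proof (rule image_subsetI)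
   fix y assume y: "y \<in> VR \<inter> fixed n w"
   have "y r ^ Q = c r * y (\<tau> r)" if r: "r \<in> reps" for r proof -
    have "y r ^ Q = z ^ g r * y (s r)" using y repsD[OF r] wa[of r y] by (auto simp: fixed_def)
    also have "y (s r) = z ^ cexp (s r) * y (\<tau> r)" unfolding \<tau>_def by (rule cexp) (use y in blast)
    finally show ?thesis by (simp add: c_def mult.assoc)
   qed
   thus "restrict y reps \<in> ?T" using \<tau> by simp
  qed
  show "ext ` ?T <= VR \<inter> fixed n w" proof (rule image_subsetI)
   fix t assume t: "t \<in> ?T"
   let ?y = "ext t"
   have ye: "?y \<in> {..<n} \<rightarrow>\<^sub>E UNIV" by (simp add: ext_def)
   \<comment> \<open>Frobenius preserves the equations of the flat. Both sides of y^Q = w y then lie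
     in the flat and need only be compared on representatives.\<close>
   have fV: "(\<lambda>i\<in>{..<n}. ?y i ^ Q) \<in> VR" proof -
    have "van z (\<lambda>i\<in>{..<n}. ?y i ^ Q) h" if h: "h \<in> set R" for h proof -
     have "van z ?y h" using extV[of t] h by (simp add: Vset_def)
     hence "van z (%i. ?y i ^ Q) h" by (rule van_frob)
     thus ?thesis using van_eq_on[of h n "\<lambda>i\<in>{..<n}. ?y i ^ Q" "%i. ?y i ^ Q"] R h by auto
    qed
    thus ?thesis by (simp add: Vset_def)
   qed
   have "?y i ^ Q = wact z n w ?y i" if i: "i < n" for i proof -
    have "(\<lambda>i\<in>{..<n}. ?y i ^ Q) i = wact z n w ?y i" proof (rule det[OF fV wV[OF extV] _ i])
     fix r assume r: "r \<in> reps"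
     have "?y (s r) = z ^ cexp (s r) * t (\<tau> r)"
      using repsD[OF r] sl cnz_s by (simp add: ext_def \<tau>_def)
     hence "wact z n w ?y r = c r * t (\<tau> r)" using repsD[OF r] wa by (simp add: c_def mult.assoc)
     moreover have "t r ^ Q = c r * t (\<tau> r)" using t r by blast
     ultimately show "(\<lambda>i\<in>{..<n}. ?y i ^ Q) r = wact z n w ?y r" using repsD[OF r] ext_rep[OF r] by simp
    qed
    thus ?thesis using i by simp
   qed
   thus "?y \<in> VR \<inter> fixed n w" using extV ye by (simp add: fixed_def)
  qed
 qed
 from bij_betw_same_card[OF this] show ?thesis unfolding cT .
qed

corollary card_Vset_F: "card (Vset z {y. y ^ Q = y} n R) = Q ^ card reps"
proof -
 let ?e = "((\<lambda>i\<in>{..<n}. 0), id) :: (nat => int) \<times> (nat => nat)"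
 have e: "?e \<in> wcar d n" using d by (auto simp: carrier_wreath permutes_id)
 have act: "wact z n ?e y = y" if "y \<in> {..<n} \<rightarrow>\<^sub>E UNIV" for y
  using that by (auto simp: wact_def fun_eq_iff PiE_def extensional_def)
 have "VR \<inter> fixed n ?e = Vset z {y. y ^ Q = y} n R"
  using act by (auto simp: Vset_def fixed_def PiE_def Pi_def)
 with card_fixed_VR[OF e] act show ?thesis by simp
qed

end

lemma basis_nontriv: "S \<in> basis n p ==> h \<in> set S ==> \<not> trivh h"
proof
 assume S: "S \<in> basis n p" and h: "h \<in> set S" "trivh h"
 have Sl: "S \<in> lists d n p" using S basis_sub by blast
 have "(if S = S then 1 else 0) = (0::complex)"
 proof (rule basis_indep[of p n "%T. if T = S then 1 else 0", OF _ S])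
  fix c assume "cycle p (M n) c"
  from vf_triv[OF this listsD(1)[OF Sl] h] show "(\<Sum>T\<in>basis n p. (if T = S then 1 else 0) * vf T c) = 0"
   by (intro sum.neutral) auto
 qed
 thus False by simp
qed

lemma basis_card:
 assumes S: "S \<in> basis n p" shows "card (Vset z {y. y ^ Q = y} n S) * Q ^ p = Q ^ n"
proof (rule ccontr)
 assume ne: "card (Vset z {y. y ^ Q = y} n S) * Q ^ p ~= Q ^ n"
 have Sl: "S \<in> lists d n p" using S basis_sub by blast
 have "(if S = S then 1 else 0) = (0::complex)"
 proof (rule basis_indep[of p n "%T. if T = S then 1 else 0", OF _ S])
  fix c assume "cycle p (M n) c"
  from dependent_vf[OF Sl _ this] ne show "(\<Sum>T\<in>basis n p. (if T = S then 1 else 0) * vf T c) = 0"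
   unfolding card_F by (intro sum.neutral) auto
 qed
 thus False by simp
qed

lemma set_basis: "S \<in> basis n p ==> set S <= hyps d n" using basis_sub by (auto simp: lists_def)

text \<open>A basis element is not a dependent list, so its flat has codimension p, read off by
  comparing powers of \<open>Q\<close>.\<close>

lemma card_reps:
 assumes S: "S \<in> basis n p" shows "p <= n" "card (reps n S) = n - p"
proof -
 have "Q ^ card (reps n S) * Q ^ p = Q ^ n"
  using basis_card[OF S] card_Vset_F[OF set_basis[OF S] basis_nontriv[OF S]] by simp
 hence "Q ^ (card (reps n S) + p) = Q ^ n" by (simp add: power_add)
 hence "card (reps n S) + p = n" using Q1 by (simp add: power_inject_exp)
 thus "p <= n" "card (reps n S) = n - p" by auto
qed

text \<open>Only flats preserved by \<open>w\<close> contribute to the trace. If \<open>w y\<close>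
  lies on the flat of \<open>S\<close>, all entries of \<open>map (hact d w) S\<close> vanish at
  \<open>y\<close>; were some hyperplane of \<open>S\<close> not through \<open>y\<close>, then
  \<open>coord_local\<close> at a complex model of \<open>y\<close> would make the coefficient
  0.\<close>

lemma coord_stable:
 assumes w: "w \<in> wcar d n" and S: "S \<in> basis n p" and nz: "coord n p (map (hact d w) S) S ~= 0"
  and y: "y \<in> {..<n} \<rightarrow>\<^sub>E UNIV"
 shows "wact z n w y \<in> Vset z UNIV n S \<longleftrightarrow> y \<in> Vset z UNIV n S"
proof -
 let ?V = "Vset z UNIV n S"
 have SH: "h \<in> hyps d n" if "h \<in> set S" for h using set_basis[OF S] that by blast
 have wext: "wact z n w y \<in> {..<n} \<rightarrow>\<^sub>E UNIV" for y by (simp add: wact_def)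
 \<comment> \<open>\<open>coord_local\<close> is stated relative to a group element stabilising
   \<open>C\<close>; the identity serves for any \<open>C\<close>.\<close>
 let ?e = "((\<lambda>i\<in>{..<n}. 0), id) :: (nat => int) \<times> (nat => nat)"
 have e: "?e \<in> wcar d n" using d by (auto simp: carrier_wreath permutes_id)
 have he: "hact d ?e h = h" if "h \<in> hyps d n" for h
  using that by (cases h) (auto simp: hact_def pact_def hyps_def pts_def)
 have back1: "y \<in> ?V" if y: "y \<in> {..<n} \<rightarrow>\<^sub>E UNIV" and wy: "wact z n w y \<in> ?V" for y
 proof -
  obtain x where x: "ALL h:hyps d n. van \<omega> x h \<longleftrightarrow> van z y h" using complex_model by blast
  define C where "C = {h\<in>hyps d n. van \<omega> x h}"
  have "set (map (hact d w) S) <= C" proof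
   fix h assume "h \<in> set (map (hact d w) S)"
   then obtain h' where h': "h' \<in> set S" "h = hact d w h'" by auto
   have "van z (wact z n w y) h'" using wy h'(1) by (simp add: Vset_def)
   hence "van z y h" unfolding h'(2) using van_wact[OF d w z_d SH[OF h'(1)]] by blast
   thus "h \<in> C" using x hact_in[OF d w SH[OF h'(1)]] by (simp add: C_def h'(2))
  qed
  moreover have "map (hact d w) S \<in> lists d n p" using map_hact_in[OF w] S basis_sub by blast
  ultimately have "set S <= C"
   using coord_local[OF C_def e, of "map (hact d w) S" p S] he S nz by (auto simp: C_def)
  thus ?thesis using x y by (auto simp: Vset_def C_def)
 qed
 define Cl where "Cl = {h\<in>hyps d n. ALL y:?V. van z y h}"
 have hinj: "inj_on (hact d w) (hyps d n)" by (rule inj_onI) (auto simp: hact_def hyps_def pact_inj[OF d w])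
 have "hact d w ` hyps d n = hyps d n" by (rule endo_inj_surj[OF _ _ hinj]) (simp, use hact_in[OF d w] in blast)
 \<comment> \<open>So far only preimages of points of the flat are controlled. The set
   \<open>Cl\<close> of all hyperplanes containing the flat lies in its own image and equals it by
   finiteness, which gives the converse.\<close>
 have "Cl <= hact d w ` Cl" proof
  fix h assume h: "h \<in> Cl"
  hence "h \<in> hact d w ` hyps d n" using \<open>hact d w ` hyps d n = hyps d n\<close> by (simp add: Cl_def)
  then obtain h' where h': "h' \<in> hyps d n" "h = hact d w h'" by blast
  have "van z v h'" if v: "v \<in> ?V" for v proof -
   obtain u where u: "u \<in> {..<n} \<rightarrow>\<^sub>E UNIV" "wact z n w u = v" using wact_surj[OF w, of v] v by (auto simp: Vset_def)
   have "van z u h" using back1[OF u(1)] u(2) v h by (simp add: Cl_def)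
   thus ?thesis unfolding u(2)[symmetric] h'(2) using van_wact[OF d w z_d h'(1)] by blast
  qed
  thus "h \<in> hact d w ` Cl" using h' by (simp add: Cl_def)
 qed
 moreover have "finite Cl" unfolding Cl_def by simp
 ultimately have Cl: "hact d w ` Cl = Cl"
  using card_seteq[of "hact d w ` Cl" Cl] card_image_le by (metis finite_imageI)
 show ?thesis proof
  assume yV: "y \<in> ?V"
  have "van z (wact z n w y) h" if h: "h \<in> set S" for h proof -
   have "h \<in> Cl" using h SH by (auto simp: Cl_def Vset_def)
   hence "hact d w h \<in> Cl" using Cl by blast
   thus ?thesis using van_wact[OF d w z_d SH[OF h]] yV by (simp add: Cl_def)
  qed
  thus "wact z n w y \<in> ?V" using wext by (simp add: Vset_def)
 qed (rule back1[OF y])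
qed

lemma finite_fixed:
 assumes "w \<in> wcar d n" shows "finite (fixed n w)"
proof -
 have "Vset z UNIV n [] \<inter> fixed n w = fixed n w" by (auto simp: Vset_def fixed_def)
 hence "card (fixed n w) = Q ^ card (reps n [])"
  using card_fixed_VR[of "[]" n w] assms by (simp add: Vset_def wact_def)
 thus ?thesis using Q1 by (intro card_ge_0_finite) simp
qed

definition trc :: "nat => nat => (nat => int) \<times> (nat => nat) => complex" where
 "trc n p w = (\<Sum>S\<in>basis n p. coord n p (map (hact d w) S) S)"

text \<open>A fixed-point formula by double counting. For each solution y of y^Q = w y the
  alternating local trace is 1 or 0 according to whether y avoids all hyperplanes. After exchanging
  the sums, a basis element with nonzero diagonal coefficient is counted once for each solution on
  its flat, that is Q^(n-p) times.\<close>

theorem card_complement: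
 assumes w: "w \<in> wcar d n" shows "(\<Sum>p\<le>n. (-1) ^ p * (of_nat Q ^ (n - p) * trc n p w)) =
  of_nat (card {y \<in> fixed n w. ALL h:hyps d n. \<not> van z y h})"
proof -
 define C where "C y = {h\<in>hyps d n. van z y h}" for y
 let ?c = "%p S. coord n p (map (hact d w) S) S"
 have E: "(\<Sum>p\<le>n. (-1) ^ p * (\<Sum>S\<in>{S\<in>basis n p. set S <= C y}. ?c p S)) = (if C y = {} then 1 else 0)"
  if y: "y \<in> fixed n w" for y proof -
  obtain x where x: "ALL h:hyps d n. van \<omega> x h \<longleftrightarrow> van z y h" using complex_model by blast
  show ?thesis proof (rule acyclic_trace[OF _ w])
   show "C y = {h\<in>hyps d n. van \<omega> x h}" using x by (auto simp: C_def)
   show "basis n (Suc n) = {}" using card_reps(1) by fastforce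
   fix h assume "h \<in> C y"
   hence h: "h \<in> hyps d n" "van z y h" by (auto simp: C_def)
   have "van z (%i. y i ^ Q) h" by (rule van_frob[OF h(2)])
   moreover have "y i ^ Q = wact z n w y i" if "i < n" for i using y that by (simp add: fixed_def)
   ultimately have "van z (wact z n w y) h" using van_eq_on[OF h(1), of "%i. y i ^ Q" "wact z n w y"] by blast
   thus "hact d w h \<in> C y" using van_wact[OF d w z_d h(1)] hact_in[OF d w h(1)] by (simp add: C_def)
  qed
 qed
 have fin: "finite (fixed n w)" by (rule finite_fixed[OF w])
 have "of_nat (card {y \<in> fixed n w. ALL h:hyps d n. \<not> van z y h}) = (\<Sum>y\<in>fixed n w. if C y = {} then 1 else 0 :: complex)"
 proof -
  have "{y \<in> fixed n w. ALL h:hyps d n. \<not> van z y h} = {y \<in> fixed n w. C y = {}}" by (auto simp: C_def)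
  thus ?thesis using fin by (simp add: sum.If_cases Int_def)
 qed
 also have "... = (\<Sum>y\<in>fixed n w. \<Sum>p\<le>n. (-1) ^ p * (\<Sum>S\<in>{S\<in>basis n p. set S <= C y}. ?c p S))"
  using E by simp
 also have "... = (\<Sum>p\<le>n. (-1) ^ p * (\<Sum>y\<in>fixed n w. \<Sum>S\<in>{S\<in>basis n p. set S <= C y}. ?c p S))"
  by (subst sum.swap) (simp add: sum_distrib_left)
 also have "... = (\<Sum>p\<le>n. (-1) ^ p * (of_nat Q ^ (n - p) * trc n p w))"
 proof (rule sum.cong[OF refl], rule arg_cong[where f = "%x. _ * x"])
  fix p
  have "(\<Sum>y\<in>fixed n w. \<Sum>S\<in>{S\<in>basis n p. set S <= C y}. ?c p S) =
   (\<Sum>y\<in>fixed n w. \<Sum>S\<in>basis n p. if set S <= C y then ?c p S else 0)"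
   by (simp add: sum.inter_filter)
  also have "... = (\<Sum>S\<in>basis n p. \<Sum>y\<in>fixed n w. if set S <= C y then ?c p S else 0)" by (rule sum.swap)
  also have "... = (\<Sum>S\<in>basis n p. of_nat Q ^ (n - p) * ?c p S)" proof (rule sum.cong[OF refl])
   fix S assume S: "S \<in> basis n p"
   have "(\<Sum>y\<in>fixed n w. if set S <= C y then ?c p S else 0) = of_nat (card {y\<in>fixed n w. set S <= C y}) * ?c p S"
    using fin by (simp add: sum.If_cases Int_def)
   also have "... = of_nat Q ^ (n - p) * ?c p S" proof (cases "?c p S = 0")
    case False
    have "{y\<in>fixed n w. set S <= C y} = Vset z UNIV n S \<inter> fixed n w"
     using set_basis[OF S] by (auto simp: Vset_def fixed_def C_def)
    hence "card {y\<in>fixed n w. set S <= C y} = Q ^ (n - p)"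
     using card_fixed_VR[OF set_basis[OF S] basis_nontriv[OF S] w coord_stable[OF w S False]] card_reps(2)[OF S] by simp
    thus ?thesis by simp
   qed simp
   finally show "(\<Sum>y\<in>fixed n w. if set S <= C y then ?c p S else 0) = of_nat Q ^ (n - p) * ?c p S" .
  qed
  finally show "(\<Sum>y\<in>fixed n w. \<Sum>S\<in>{S\<in>basis n p. set S <= C y}. ?c p S) = of_nat Q ^ (n - p) * trc n p w"
   by (simp add: trc_def sum_distrib_left)
 qed
 finally show ?thesis ..
qed

end

subsection \<open>Sums over Frobenius-stable sets\<close>

definition winv :: "nat => nat => (nat => int) \<times> (nat => nat) => (nat => int) \<times> (nat => nat)" where
 "winv d n w = ((\<lambda>i\<in>{..<n}. (- fst w (snd w i)) mod int d), inv_into UNIV (snd w))"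

lemma winv_carrier:
 assumes "d > 0" "w \<in> wcar d n" shows "winv d n w \<in> wcar d n"
 using assms permutes_inv[OF wreath_snd_permutes[OF assms]] by (auto simp: winv_def carrier_wreath)

lemma inv_wreath:
 assumes d: "d > 0" and w: "w \<in> wcar d n" shows "inv\<^bsub>wreath d n\<^esub> w = winv d n w"
proof -
 obtain g \<sigma> where gs: "w = (g, \<sigma>)" by (cases w)
 have gr: "0 <= g i & g i < int d" if "i < n" for i using wreath_fst_range[OF d w that] by (simp add: gs)
 have perm: "\<sigma> permutes {..<n}" using wreath_snd_permutes[OF d w] by (simp add: gs)
 let ?s = "inv_into UNIV \<sigma>"
 have bij: "bij \<sigma>" by (rule permutes_bij[OF perm])
 have sl: "?s i < n" if "i < n" for i by (rule inv_less[OF perm that])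
 have ss: "\<sigma> (?s i) = i" "?s (\<sigma> i) = i" for i using permutes_inverses[OF perm] by simp_all
 have \<sigma>l: "\<sigma> i < n" if "i < n" for i using permutes_in_image[OF perm, of i] that by simp
 \<comment> \<open>The inverse is a definite description; it is resolved by exhibiting
   \<open>winv\<close> and solving the group equation for an arbitrary inverse.\<close>
 show ?thesis unfolding m_inv_def proof (rule the_equality)
  have "((g i + (- g i) mod int d) mod int d) = 0" for i by (simp add: mod_simps)
  moreover have "(((- g (\<sigma> i)) mod int d + g (inv_into UNIV ?s i)) mod int d) = 0" for i
   using inv_inv_eq[OF bij] by (simp add: mod_simps)
  moreover have "\<sigma> \<circ> ?s = id" "?s \<circ> \<sigma> = id" using ss by (auto simp: fun_eq_iff)
  ultimately show "winv d n w \<in> wcar d n & w \<otimes>\<^bsub>wreath d n\<^esub> winv d n w = \<one>\<^bsub>wreath d n\<^esub> &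
   winv d n w \<otimes>\<^bsub>wreath d n\<^esub> w = \<one>\<^bsub>wreath d n\<^esub>"
   using winv_carrier[OF d w] sl ss \<sigma>l
   by (auto simp: wreath_def winv_def gs fun_eq_iff restrict_def mod_simps)
 next
  fix v assume v: "v \<in> wcar d n & w \<otimes>\<^bsub>wreath d n\<^esub> v = \<one>\<^bsub>wreath d n\<^esub> & v \<otimes>\<^bsub>wreath d n\<^esub> w = \<one>\<^bsub>wreath d n\<^esub>"
  obtain h \<tau> where h: "v = (h, \<tau>)" by (cases v)
  have hr: "0 <= h i & h i < int d" if "i < n" for i using wreath_fst_range[OF d _ that, of v] v by (simp add: h)
  have he: "h \<in> {..<n} \<rightarrow>\<^sub>E {0..<int d}" using v carrier_wreath[OF d] by (simp add: h)
  have m1: "(\<lambda>i\<in>{..<n}. (g i + h (?s i)) mod int d) = (\<lambda>i\<in>{..<n}. 0)" and m2: "\<sigma> \<circ> \<tau> = id"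
   using v by (simp_all add: wreath_def gs h)
  have "\<tau> = ?s" using m2 ss by (metis comp_apply id_apply ext)
  moreover have "h i = (- g (\<sigma> i)) mod int d" if i: "i < n" for i proof -
   have "(g (\<sigma> i) + h i) mod int d = 0" using fun_cong[OF m1, of "\<sigma> i"] \<sigma>l[OF i] ss by simp
   hence "(- g (\<sigma> i) + (g (\<sigma> i) + h i)) mod int d = (- g (\<sigma> i)) mod int d"
    by (metis add.right_neutral mod_add_right_eq)
   thus ?thesis using hr[OF i] by (simp add: mod_pos_pos_trivial)
  qed
  ultimately show "v = winv d n w" using he by (auto simp: winv_def gs h fun_eq_iff PiE_def extensional_def)
 qed
qed

context fpts
begin

text \<open>Numberings with chosen d-th roots on which Frobenius acts as \<open>w\<close>. The
  exponent is read at the target index, as in \<open>frobenius_elem\<close>.\<close>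

definition frobs :: "nat => (nat => int) \<times> (nat => nat) => (nat => 'f) set" where
 "frobs n w = {y \<in> {..<n} \<rightarrow>\<^sub>E UNIV. (ALL j<n. y j ~= 0) & inj_on (%j. y j ^ d) {..<n} &
  (ALL j<n. y j ^ Q = z ^ nat (fst w (snd w j)) * y (snd w j))}"

lemma z_pow_d: "(z ^ k * u) ^ d = u ^ d"
 by (simp add: power_mult_distrib power_mult[symmetric] mult.commute[of k] power_mult[of z d] z_d)

lemma same_power_d:
 assumes "u ^ d = v ^ d" "v ~= 0" shows "EX a<d. u = z ^ a * v"
proof -
 have "(u / v) ^ d = 1" using assms d by (simp add: power_divide)
 with z_roots obtain a where "a < d" "u / v = z ^ a" by blast
 thus ?thesis using assms(2) by (auto simp: field_simps)
qed

lemma no_van_iff: "(ALL h:hyps d n. \<not> van z y h) \<longleftrightarrow> (ALL j<n. y j ~= 0) & inj_on (%j. y j ^ d) {..<n}"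
proof
 assume nv: "ALL h:hyps d n. \<not> van z y h"
 have nz: "y j ~= 0" if "j < n" for j
  using bspec[OF nv, of "(Some (j, 0), None)"] that d by (auto simp: hyps_def van_def)
 moreover have "inj_on (%j. y j ^ d) {..<n}" proof (rule inj_onI)
  fix i j assume ij: "i \<in> {..<n}" "j \<in> {..<n}" "y i ^ d = y j ^ d"
  then obtain a where a: "a < d" "y i = z ^ a * y j" using same_power_d nz by blast
  thus "i = j" using bspec[OF nv, of "(Some (i, 0), Some (j, a))"] ij d by (auto simp: hyps_def van_def)
 qed
 ultimately show "(ALL j<n. y j ~= 0) & inj_on (%j. y j ^ d) {..<n}" by blast
next
 assume r: "(ALL j<n. y j ~= 0) & inj_on (%j. y j ^ d) {..<n}"
 have "s = t" if st: "s \<in> pts d n" "t \<in> pts d n" and eq: "pval z y s = pval z y t" for s t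
 proof (cases s)
  case None
  thus ?thesis using st eq r z_nz by (cases t) auto
 next
  case (Some ja)
  obtain j a where s: "s = Some (j, a)" "j < n" "a < d" using Some st(1) by (cases ja) auto
  show ?thesis proof (cases t)
   case None
   thus ?thesis using s eq r z_nz by auto
  next
   case (Some ib)
   obtain i b where t: "t = Some (i, b)" "i < n" "b < d" using Some st(2) by (cases ib) auto
   have e: "z ^ a * y j = z ^ b * y i" using eq s t by simp
   have "y j ^ d = y i ^ d" using arg_cong[OF e, of "%u. u ^ d"] by (simp only: z_pow_d)
   hence ji: "j = i" using r s t by (auto dest: inj_onD)
   hence "z ^ a = z ^ b" using e r s by auto
   thus ?thesis using z_inj s t ji by simp
  qed
 qed
 thus "ALL h:hyps d n. \<not> van z y h" by (auto simp: van_def hyps_def)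
qed

text \<open>Inverting coordinates turns the condition for \<open>w\<inverse>\<close> into the one for \<open>w\<close>.\<close>

lemma card_frobs:
 assumes w: "w \<in> wcar d n"
 shows "card {y \<in> fixed n (winv d n w). ALL h:hyps d n. \<not> van z y h} = card (frobs n w)"
  and "finite (frobs n w)"
proof -
 let ?i = "%y :: nat => 'f. \<lambda>i\<in>{..<n}. inverse (y i)"
 let ?A = "{y \<in> fixed n (winv d n w). ALL h:hyps d n. \<not> van z y h}"
 have perm: "snd w permutes {..<n}" by (rule wreath_snd_permutes[OF d w])
 have sl: "snd w j < n" if "j < n" for j using permutes_in_image[OF perm, of j] that by simp
 have ii: "inv_into UNIV (inv_into UNIV (snd w)) = snd w" by (rule inv_inv_eq[OF permutes_bij[OF perm]])
 have zi: "inverse (z ^ nat ((- a) mod int d)) = z ^ nat a" if "0 <= a" "a < int d" for a proof -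
  have "nat ((- a) mod int d) + nat a = nat ((- a) mod int d + a)" using that d by (simp add: nat_add_distrib)
  also have "... mod d = nat (((- a) mod int d + a) mod int d)" using that d by (simp add: nat_mod_distrib)
  also have "((- a) mod int d + a) mod int d = 0" by (simp add: mod_simps)
  finally have "z ^ (nat ((- a) mod int d) + nat a) = z ^ 0" unfolding z_power_eq by simp
  thus ?thesis by (simp add: power_add inverse_unique)
 qed
 have r: "0 <= fst w j" "fst w j < int d" if "j < n" for j using wreath_fst_range[OF d w that] by auto
 have A: "y \<in> ?A \<longleftrightarrow> y \<in> {..<n} \<rightarrow>\<^sub>E UNIV & (ALL j<n. y j ^ Q = z ^ nat ((- fst w (snd w j)) mod int d) * y (snd w j)) &
  (ALL j<n. y j ~= 0) & inj_on (%j. y j ^ d) {..<n}" for y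
  unfolding mem_Collect_eq no_van_iff by (auto simp: fixed_def wact_def winv_def ii)
 have inj: "inj_on (%j. ?i y j ^ d) {..<n} \<longleftrightarrow> inj_on (%j. y j ^ d) {..<n}" for y
  by (simp add: inj_on_def power_inverse)
 have "bij_betw ?i ?A (frobs n w)" proof (rule bij_betw_byWitness[where f' = ?i])
  have inv2: "?i (?i y) = y" if "y \<in> {..<n} \<rightarrow>\<^sub>E UNIV" for y
   using that by (auto simp: fun_eq_iff PiE_def extensional_def)
  show "ALL y:?A. ?i (?i y) = y" "ALL y:frobs n w. ?i (?i y) = y" using inv2 A by (auto simp: frobs_def)
  show "?i ` ?A <= frobs n w" proof (rule image_subsetI)
   fix y assume "y \<in> ?A"
   note y = this[unfolded A]
   have "?i y j ^ Q = z ^ nat (fst w (snd w j)) * ?i y (snd w j)" if "j < n" for j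
    using y that sl[OF that] zi[OF r[OF sl[OF that]]] by (simp add: power_inverse)
   thus "?i y \<in> frobs n w" using y inj[of y] by (simp add: frobs_def)
  qed
  show "?i ` frobs n w <= ?A" proof (rule image_subsetI)
   fix y assume "y \<in> frobs n w"
   note y = this[unfolded frobs_def, simplified]
   have "?i y j ^ Q = z ^ nat ((- fst w (snd w j)) mod int d) * ?i y (snd w j)" if "j < n" for j
    using y that sl[OF that] zi[OF r[OF sl[OF that]], symmetric] by (simp add: power_inverse)
   thus "?i y \<in> ?A" unfolding A using y inj[of y] by simp
  qed
 qed
 thus "card ?A = card (frobs n w)" "finite (frobs n w)"
  using finite_fixed[OF winv_carrier[OF d w]] bij_betw_finite[of ?i ?A] bij_betw_same_card[of ?i ?A] by simp_all
qed

text \<open>The conjugation in \<open>conf_inner\<close> cancels that of \<open>class_inner\<close>,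
  so P itself appears. The character at \<open>w\<close> is a trace for the inverse of
  \<open>w\<close>, which \<open>card_frobs\<close> converts back to \<open>w\<close>.\<close>

lemma conf_inner_frobs:
 "(\<Sum>p\<le>n. (-1) ^ p * (of_nat Q ^ (n - p) * conf_inner d P p n)) =
  (\<Sum>w\<in>wcar d n. char_poly_fun d P n w * of_nat (card (frobs n w))) / of_nat (card (wcar d n))"
proof -
 let ?W = "wcar d n"
 have ch: "conf_cohomology_char d p n w = trc n p (winv d n w)" if "w \<in> ?W" for p w
  unfolding conf_cohomology_char_def trc_def inv_wreath[OF d that]
  by (rule conf_char_pullback[OF winv_carrier[OF d that]])
 have "(\<Sum>p\<le>n. (-1) ^ p * (of_nat Q ^ (n - p) * conf_inner d P p n)) =
  (\<Sum>p\<le>n. \<Sum>w\<in>?W. char_poly_fun d P n w * ((-1) ^ p * (of_nat Q ^ (n - p) * trc n p (winv d n w)))) / of_nat (card ?W)"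
  unfolding conf_inner_def class_inner_def using ch by (simp add: sum_divide_distrib sum_distrib_left mult_ac)
 also have "(\<Sum>p\<le>n. \<Sum>w\<in>?W. char_poly_fun d P n w * ((-1) ^ p * (of_nat Q ^ (n - p) * trc n p (winv d n w)))) =
  (\<Sum>w\<in>?W. char_poly_fun d P n w * (\<Sum>p\<le>n. (-1) ^ p * (of_nat Q ^ (n - p) * trc n p (winv d n w))))"
  unfolding sum_distrib_left by (rule sum.swap)
 also have "... = (\<Sum>w\<in>?W. char_poly_fun d P n w * of_nat (card (frobs n w)))"
  using card_complement[OF winv_carrier[OF d]] card_frobs(1) by simp
 finally show ?thesis .
qed

section \<open>Simply transitive action of the wreath product on choices of d-th roots over a
  set\<close>

definition frob :: "'f => 'f" where "frob x = x ^ Q"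

definition stable :: "nat => 'f set set" where
 "stable n = {D. finite D & card D = n & 0 \<notin> D & frob ` D = D}"

definition tuples :: "nat => 'f set => (nat => 'f) set" where
 "tuples n D = {y \<in> {..<n} \<rightarrow>\<^sub>E UNIV. bij_betw (%j. y j ^ d) {..<n} D}"

lemma tuples_nz: "y \<in> tuples n D ==> 0 \<notin> D ==> j < n ==> y j ~= 0"
proof
 assume y: "y \<in> tuples n D" "0 \<notin> D" "j < n" "y j = 0"
 hence "y j ^ d \<in> D" unfolding tuples_def bij_betw_def by blast
 thus False using y d by (simp add: zero_power)
qed

lemma wact_tuples:
 assumes w: "w \<in> wcar d n" and y: "y \<in> tuples n D" shows "wact z n w y \<in> tuples n D"
proof -
 have perm: "inv_into UNIV (snd w) permutes {..<n}" by (rule permutes_inv[OF wreath_snd_permutes[OF d w]])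
 have "bij_betw (%j. y j ^ d) {..<n} D" using y by (simp add: tuples_def)
 hence "bij_betw ((%j. y j ^ d) \<circ> inv_into UNIV (snd w)) {..<n} D"
  by (rule bij_betw_trans[OF permutes_imp_bij[OF perm]])
 hence "bij_betw (%j. wact z n w y j ^ d) {..<n} D"
  by (rule iffD1[OF bij_betw_cong, rotated]) (simp add: wact_def z_pow_d)
 thus ?thesis by (simp add: tuples_def wact_def)
qed

text \<open>\<open>\<tau> j\<close> is the index at which \<open>y\<close> has the same d-th power
  as \<open>u\<close> at \<open>j\<close>; the remaining discrepancy is a d-th root of
  unity.\<close>

lemma wreath_torsor:
 assumes D: "0 \<notin> D" and y: "y \<in> tuples n D" and u: "u \<in> tuples n D"
 shows "EX w:wcar d n. wact z n w y = u"
proof -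
 let ?f = "%j. y j ^ d" and ?g = "%j. u j ^ d"
 have bf: "bij_betw ?f {..<n} D" and bg: "bij_betw ?g {..<n} D" using y u by (simp_all add: tuples_def)
 define \<tau> where "\<tau> j = (if j < n then inv_into {..<n} ?f (?g j) else j)" for j
 have "bij_betw (inv_into {..<n} ?f \<circ> ?g) {..<n} {..<n}" by (rule bij_betw_trans[OF bg bij_betw_inv_into[OF bf]])
 hence "bij_betw \<tau> {..<n} {..<n}" by (rule iffD1[OF bij_betw_cong, rotated]) (simp add: \<tau>_def)
 hence \<tau>: "\<tau> permutes {..<n}" by (rule bij_imp_permutes) (simp add: \<tau>_def)
 have f\<tau>: "?f (\<tau> j) = ?g j" if "j < n" for j
  using bij_betw_inv_into_right[OF bf, of "?g j"] bg that by (auto simp: \<tau>_def bij_betw_def)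
 have "EX a. j < n --> a < d & u j = z ^ a * y (\<tau> j)" for j proof (cases "j < n")
  case True
  hence "\<tau> j < n" using permutes_in_image[OF \<tau>, of j] by simp
  from same_power_d[OF f\<tau>[OF True, symmetric] tuples_nz[OF y D this]] show ?thesis by blast
 qed simp
 then obtain a where a: "!!j. j < n ==> a j < d & u j = z ^ a j * y (\<tau> j)" by metis
 let ?w = "(\<lambda>j\<in>{..<n}. int (a j), inv_into UNIV \<tau>)"
 have "?w \<in> wcar d n" using a permutes_inv[OF \<tau>] by (auto simp: carrier_wreath[OF d])
 moreover have "wact z n ?w y = u" using a u inv_inv_eq[OF permutes_bij[OF \<tau>]]
  by (auto simp: wact_def fun_eq_iff tuples_def PiE_def extensional_def)
 ultimately show ?thesis by blast
qed

lemma wact_inj: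
 assumes D: "0 \<notin> D" and y: "y \<in> tuples n D" and w: "w \<in> wcar d n" "w' \<in> wcar d n"
  and eq: "wact z n w y = wact z n w' y" shows "w = w'"
proof -
 let ?s = "inv_into UNIV (snd w)" and ?s' = "inv_into UNIV (snd w')"
 have perm: "snd w permutes {..<n}" "snd w' permutes {..<n}" using w wreath_snd_permutes[OF d] by blast+
 have e: "z ^ nat (fst w j) * y (?s j) = z ^ nat (fst w' j) * y (?s' j)" if "j < n" for j
  using fun_cong[OF eq, of j] that by (simp add: wact_def)
 have inj: "inj_on (%j. y j ^ d) {..<n}" using y by (simp add: tuples_def bij_betw_def)
 have s: "?s j = ?s' j" if j: "j < n" for j proof -
  have "y (?s j) ^ d = y (?s' j) ^ d" using arg_cong[OF e[OF j], of "%u. u ^ d"] by (simp only: z_pow_d)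
  thus ?thesis using inj inv_less[OF perm(1) j] inv_less[OF perm(2) j] by (auto dest: inj_onD)
 qed
 have "?s = ?s'" proof
  fix j show "?s j = ?s' j"
   using s permutes_not_in[OF permutes_inv[OF perm(1)], of j] permutes_not_in[OF permutes_inv[OF perm(2)], of j]
   by (cases "j < n") auto
 qed
 hence snd: "snd w = snd w'" using inv_inv_eq permutes_bij[OF perm(1)] permutes_bij[OF perm(2)] by metis
 have "fst w j = fst w' j" if j: "j < n" for j proof -
  have "z ^ nat (fst w j) = z ^ nat (fst w' j)"
   using e[OF j] s[OF j] tuples_nz[OF y D inv_less[OF perm(1) j]] by simp
  hence "nat (fst w j) = nat (fst w' j)" using z_inj wreath_fst_range(3)[OF d _ j] w by blast
  thus ?thesis using wreath_fst_range(1)[OF d _ j] w by (simp add: nat_eq_iff)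
 qed
 moreover have "fst w \<in> {..<n} \<rightarrow>\<^sub>E {0..<int d}" "fst w' \<in> {..<n} \<rightarrow>\<^sub>E {0..<int d}"
  using w carrier_wreath[OF d, of "fst w" "snd w" n] carrier_wreath[OF d, of "fst w'" "snd w'" n] by simp_all
 ultimately have "fst w = fst w'" by (intro PiE_ext) auto
 with snd show ?thesis by (rule prod_eqI[rotated])
qed

lemma tuples_nonempty:
 assumes "finite D" "card D = n" shows "tuples n D ~= {}"
proof -
 obtain e where e: "bij_betw e {..<n} D"
  using ex_bij_betw_nat_finite[OF assms(1)] assms(2) by (auto simp: atLeast0LessThan)
 have "EX u. u ^ d = e j" for j using nth_root_exists[OF d] by blast
 then obtain r where r: "!!j. r j ^ d = e j" by metis
 have "restrict r {..<n} \<in> tuples n D"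
  unfolding tuples_def using e by (auto intro!: iffD1[OF bij_betw_cong, rotated, OF e] simp: r)
 thus ?thesis by blast
qed

lemma card_tuples:
 assumes "finite D" "card D = n" "0 \<notin> D" shows "card (tuples n D) = card (wcar d n)"
proof -
 obtain y where y: "y \<in> tuples n D" using tuples_nonempty[OF assms(1,2)] by blast
 have "inj_on (%w. wact z n w y) (wcar d n)" by (rule inj_onI) (rule wact_inj[OF assms(3) y])
 moreover have "(%w. wact z n w y) ` wcar d n = tuples n D" proof (intro subset_antisym image_subsetI subsetI)
  fix u assume "u \<in> tuples n D"
  from wreath_torsor[OF assms(3) y this] show "u \<in> (%w. wact z n w y) ` wcar d n" by blast
 qed (rule wact_tuples[OF _ y])
 ultimately show ?thesis by (metis card_image)
qed

lemma frobs_tuples: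
 assumes w: "w \<in> wcar d n" and y: "y \<in> frobs n w"
 shows "(%j. y j ^ d) ` {..<n} \<in> stable n" "y \<in> tuples n ((%j. y j ^ d) ` {..<n})"
proof -
 have perm: "snd w permutes {..<n}" by (rule wreath_snd_permutes[OF d w])
 have "frob (y j ^ d) = y (snd w j) ^ d" if "j < n" for j proof -
  have "frob (y j ^ d) = (y j ^ Q) ^ d" by (simp add: frob_def power_mult[symmetric] mult.commute)
  also have "... = y (snd w j) ^ d" using y that by (simp add: frobs_def z_pow_d)
  finally show ?thesis .
 qed
 hence "frob ` (%j. y j ^ d) ` {..<n} = (%j. y j ^ d) ` snd w ` {..<n}" by (simp add: image_image)
 hence "frob ` (%j. y j ^ d) ` {..<n} = (%j. y j ^ d) ` {..<n}" using permutes_image[OF perm] by simp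
 thus "(%j. y j ^ d) ` {..<n} \<in> stable n" using y by (auto simp: stable_def frobs_def card_image)
 show "y \<in> tuples n ((%j. y j ^ d) ` {..<n})" using y by (simp add: tuples_def frobs_def bij_betw_def)
qed

text \<open>Frobenius maps a tuple over a stable set to another tuple over it, and the group acts
  simply transitively on such tuples.\<close>

lemma tuples_frobs:
 assumes D: "D \<in> stable n" and y: "y \<in> tuples n D" shows "EX! w. w \<in> wcar d n & y \<in> frobs n w"
proof -
 have D0: "0 \<notin> D" and fD: "frob ` D = D" "finite D" using D by (auto simp: stable_def)
 have inj: "inj_on frob D" by (rule eq_card_imp_inj_on) (use fD in auto)
 have bf: "bij_betw (%j. y j ^ d) {..<n} D" and ye: "y \<in> {..<n} \<rightarrow>\<^sub>E UNIV" using y by (simp_all add: tuples_def)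
 let ?u = "\<lambda>j\<in>{..<n}. y j ^ Q"
 have "bij_betw (frob \<circ> (%j. y j ^ d)) {..<n} D"
  by (rule bij_betw_trans[OF bf]) (use inj fD in "simp add: bij_betw_def")
 hence "bij_betw (%j. ?u j ^ d) {..<n} D"
  by (rule iffD1[OF bij_betw_cong, rotated]) (simp add: frob_def power_mult[symmetric] mult.commute)
 hence u: "?u \<in> tuples n D" by (simp add: tuples_def)
 have fr: "y \<in> frobs n w \<longleftrightarrow> (ALL j<n. y j ^ Q = z ^ nat (fst w (snd w j)) * y (snd w j))" for w
  using y tuples_nz[OF y D0] by (auto simp: frobs_def tuples_def bij_betw_def)
 \<comment> \<open>Translates the convention of \<open>frobs\<close>, which reads the twist at the
   target index, into that of \<open>wact\<close>; applied twice it is the identity.\<close>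
 let ?inv = "%w :: (nat => int) \<times> (nat => nat). (\<lambda>j\<in>{..<n}. fst w (snd w j), inv_into UNIV (snd w))"
 have ic: "?inv w \<in> wcar d n" if w: "w \<in> wcar d n" for w proof -
  have perm: "snd w permutes {..<n}" by (rule wreath_snd_permutes[OF d w])
  have "snd w j < n" if "j < n" for j using permutes_in_image[OF perm, of j] that by simp
  thus ?thesis using permutes_inv[OF perm] wreath_fst_range[OF d w] by (auto simp: carrier_wreath[OF d])
 qed
 have fri: "y \<in> frobs n w \<longleftrightarrow> wact z n (?inv w) y = ?u" if w: "w \<in> wcar d n" for w
 proof -
  have "inv_into UNIV (inv_into UNIV (snd w)) = snd w" by (rule inv_inv_eq[OF permutes_bij[OF wreath_snd_permutes[OF d w]]])
  thus ?thesis unfolding fr by (auto simp: wact_def fun_eq_iff)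
 qed
 have ii: "?inv (?inv w) = w" if w: "w \<in> wcar d n" for w proof -
  have perm: "snd w permutes {..<n}" by (rule wreath_snd_permutes[OF d w])
  have "fst w \<in> {..<n} \<rightarrow>\<^sub>E {0..<int d}" using w carrier_wreath[OF d, of "fst w" "snd w" n] by simp
  hence "fst (?inv (?inv w)) = fst w" using inv_less[OF perm] permutes_inverses(1)[OF perm]
   by (auto simp: fun_eq_iff PiE_def extensional_def)
  moreover have "snd (?inv (?inv w)) = snd w" using inv_inv_eq[OF permutes_bij[OF perm]] by simp
  ultimately show ?thesis by (rule prod_eqI)
 qed
 obtain v where v: "v \<in> wcar d n" "wact z n v y = ?u" using wreath_torsor[OF D0 y u] by blast
 show ?thesis proof (rule ex1I[of _ "?inv v"])
  show "?inv v \<in> wcar d n & y \<in> frobs n (?inv v)"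
   using ic[OF v(1)] fri[OF ic[OF v(1)]] ii[OF v(1)] v(2) by simp
  fix w assume w: "w \<in> wcar d n & y \<in> frobs n w"
  have "wact z n (?inv w) y = wact z n v y" using iffD1[OF fri[OF conjunct1[OF w]] conjunct2[OF w]] v(2) by (rule trans[OF _ sym])
  hence "?inv w = v" using wact_inj[OF D0 y ic v(1)] w by blast
  thus "w = ?inv v" using ii w by metis
 qed
qed

text \<open>Pairs of a group element and a tuple in \<open>frobs\<close> are counted twice: each
  stable set carries as many tuples as the group has elements, and each tuple belongs to exactly one
  element.\<close>

theorem sum_frobs:
 assumes PD: "!!w y. w \<in> wcar d n ==> y \<in> frobs n w ==> f w = F ((%j. y j ^ d) ` {..<n})"
 shows "(\<Sum>w\<in>wcar d n. f w * of_nat (card (frobs n w))) =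
  of_nat (card (wcar d n)) * (\<Sum>D\<in>stable n. F D :: complex)" and "finite (stable n)"
proof -
 let ?W = "wcar d n"
 let ?e = "%wy :: ((nat => int) \<times> (nat => nat)) \<times> (nat => 'f). ((%j. snd wy j ^ d) ` {..<n}, snd wy)"
 have fin1: "finite (Sigma ?W (frobs n))" using wreath_finite card_frobs(2) by auto
 have inj: "inj_on ?e (Sigma ?W (frobs n))" proof (rule inj_onI)
  fix a b assume ab: "a \<in> Sigma ?W (frobs n)" "b \<in> Sigma ?W (frobs n)" "?e a = ?e b"
  hence s: "snd a = snd b" by simp
  have "fst a \<in> ?W" "fst b \<in> ?W" "snd a \<in> frobs n (fst a)" "snd a \<in> frobs n (fst b)" using ab s by auto
  hence "fst a = fst b" using tuples_frobs[OF frobs_tuples] by blast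
  with s show "a = b" by (rule prod_eqI[rotated])
 qed
 have img: "?e ` Sigma ?W (frobs n) = Sigma (stable n) (tuples n)"
 proof (intro subset_antisym image_subsetI subsetI)
  fix a assume "a \<in> Sigma ?W (frobs n)"
  hence "fst a \<in> ?W" "snd a \<in> frobs n (fst a)" by auto
  from frobs_tuples[OF this] show "?e a \<in> Sigma (stable n) (tuples n)" by simp
 next
  fix b assume "b \<in> Sigma (stable n) (tuples n)"
  hence b: "fst b \<in> stable n" "snd b \<in> tuples n (fst b)" by auto
  obtain w where w: "w \<in> ?W" "snd b \<in> frobs n w" using tuples_frobs[OF b] by blast
  have "(%j. snd b j ^ d) ` {..<n} = fst b" using b(2) by (simp add: tuples_def bij_betw_def)
  hence "b = ?e (w, snd b)" by (simp add: prod_eq_iff)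
  thus "b \<in> ?e ` Sigma ?W (frobs n)" using w by blast
 qed
 have tne: "tuples n D ~= {}" if "D \<in> stable n" for D using tuples_nonempty that by (simp add: stable_def)
 have fin2: "finite (Sigma (stable n) (tuples n))" using finite_imageI[OF fin1, of ?e] unfolding img .
 have "stable n = fst ` Sigma (stable n) (tuples n)" using tne by force
 thus finS: "finite (stable n)" using finite_imageI[OF fin2, of fst] by simp
 have finT: "finite (tuples n D)" if "D \<in> stable n" for D
  by (rule finite_subset[OF _ finite_imageI[OF fin2, of snd]]) (use that in force)
 have "(\<Sum>w\<in>?W. f w * of_nat (card (frobs n w))) = (\<Sum>wy\<in>Sigma ?W (frobs n). f (fst wy))"
  using sum.Sigma[of ?W "frobs n" "%w y. f w"] wreath_finite card_frobs(2)
  by (simp add: case_prod_beta mult.commute)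
 also have "... = (\<Sum>wy\<in>Sigma ?W (frobs n). F (fst (?e wy)))"
  by (rule sum.cong[OF refl]) (use PD in auto)
 also have "... = (\<Sum>b\<in>Sigma (stable n) (tuples n). F (fst b))"
  unfolding img[symmetric] by (subst sum.reindex[OF inj]) (simp add: o_def)
 also have "... = (\<Sum>D\<in>stable n. \<Sum>y\<in>tuples n D. F D)"
  by (subst sum.Sigma) (simp_all add: finS finT case_prod_beta)
 also have "... = (\<Sum>D\<in>stable n. of_nat (card ?W) * F D)"
  by (rule sum.cong[OF refl]) (use card_tuples in "auto simp: stable_def")
 finally show "(\<Sum>w\<in>?W. f w * of_nat (card (frobs n w))) = of_nat (card ?W) * (\<Sum>D\<in>stable n. F D)"
  by (simp add: sum_distrib_left)
qed

end

context fpts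
begin

text \<open>Type \<open>(i, a)\<close>: an orbit of size i over which the i-th iterate of Frobenius
  multiplies every d-th root by z^a. It is the decoration of the corresponding cycle.\<close>

definition ctype :: "nat \<times> int => 'f set => bool" where
 "ctype v C \<longleftrightarrow> card C = fst v & (ALL u. u ^ d \<in> C --> u ^ (Q ^ fst v) = z ^ nat (snd v) * u)"

lemma frobs_iterate:
 assumes w: "w \<in> wcar d n" and y: "y \<in> frobs n w" and j: "j < n"
 shows "y j ^ (Q ^ k) = z ^ (\<Sum>l<k. nat (fst w (snd w ((snd w ^^ l) j)))) * y ((snd w ^^ k) j)"
  and "(snd w ^^ k) j < n"
proof (induction k)
 case (Suc k)
 have perm: "snd w permutes {..<n}" by (rule wreath_snd_permutes[OF d w])
 case 1
 have "y j ^ (Q ^ Suc k) = (z ^ (\<Sum>l<k. nat (fst w (snd w ((snd w ^^ l) j)))) * y ((snd w ^^ k) j)) ^ Q"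
  by (simp only: Suc(1)[symmetric] power_Suc2 power_mult)
 also have "... = z ^ (\<Sum>l<k. nat (fst w (snd w ((snd w ^^ l) j)))) * y ((snd w ^^ k) j) ^ Q"
  by (simp only: power_mult_distrib power_mult[symmetric] mult.commute[of _ Q] power_mult[of z Q] z_Q)
 also have "y ((snd w ^^ k) j) ^ Q = z ^ nat (fst w (snd w ((snd w ^^ k) j))) * y ((snd w ^^ Suc k) j)"
  using y Suc(2) by (simp add: frobs_def)
 finally show ?case by (simp add: power_add mult.assoc)
 case 2
 show ?case using Suc(2) permutes_in_image[OF perm, of "(snd w ^^ k) j"] by simp
qed (use j in simp_all)

text \<open>The d-th powers carry cycles of the permutation to Frobenius orbits. Going once around a
  cycle multiplies a root by z to the sum of the decorations; the same factor applies to every other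
  d-th root, as these differ by roots of unity fixed by Frobenius.\<close>

lemma cycle_count_frobs:
 assumes w: "w \<in> wcar d n" and y: "y \<in> frobs n w" and a: "0 <= a" "a < int d"
 shows "cycle_count d n (i, a) w = card {C \<in> orbit frob ` (%j. y j ^ d) ` {..<n}. ctype (i, a) C}"
proof -
 define \<sigma> where "\<sigma> = snd w"
 define g where "g = fst w"
 define b where "b j = y j ^ d" for j
 have perm: "\<sigma> permutes {..<n}" unfolding \<sigma>_def by (rule wreath_snd_permutes[OF d w])
 have gr: "0 <= g j" if "j < n" for j unfolding g_def by (rule wreath_fst_range(1)[OF d w that])
 have \<sigma>k: "(\<sigma> ^^ k) j < n" if "j < n" for j k unfolding \<sigma>_def by (rule frobs_iterate(2)[OF w y that])
 have bk: "b ((\<sigma> ^^ k) j) = (frob ^^ k) (b j)" if j: "j < n" for j k proof (induction k)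
  case (Suc k)
  have "frob (b ((\<sigma> ^^ k) j)) = (y ((\<sigma> ^^ k) j) ^ Q) ^ d"
   by (simp add: frob_def b_def power_mult[symmetric] mult.commute)
  also have "... = b ((\<sigma> ^^ Suc k) j)" using y \<sigma>k[OF j] by (simp add: frobs_def z_pow_d b_def \<sigma>_def)
  finally show ?case using Suc by simp
 qed simp
 have orb: "orbit frob (b j) = b ` orbit \<sigma> j" if "j < n" for j
  unfolding orbit_altdef bk[OF that, symmetric] by blast
 have osub: "orbit \<sigma> j <= {..<n}" if "j < n" for j using \<sigma>k[OF that] by (auto simp: orbit_altdef)
 have binj: "inj_on b {..<n}" using y by (simp add: frobs_def inj_on_def b_def)
 have fin\<sigma>: "permutation \<sigma>" using perm permutation_permutes by blast
 have key: "ctype (i, a) (b ` orbit \<sigma> j) \<longleftrightarrow> card (orbit \<sigma> j) = i & (\<Sum>l\<in>orbit \<sigma> j. g l) mod int d = a" if j: "j < n" for j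
 proof -
  have cb: "card (b ` orbit \<sigma> j) = card (orbit \<sigma> j)"
   by (rule card_image[OF inj_on_subset[OF binj osub[OF j]]])
  let ?s = "\<Sum>l\<in>orbit \<sigma> j. g l"
  have "(ALL u. u ^ d \<in> b ` orbit \<sigma> j --> u ^ (Q ^ i) = z ^ nat a * u) \<longleftrightarrow> ?s mod int d = a" if i: "card (orbit \<sigma> j) = i"
  proof -
   have yi: "y l ^ (Q ^ i) = z ^ nat ?s * y l" if l: "l \<in> orbit \<sigma> j" for l proof -
    have ln: "l < n" using osub[OF j] l by blast
    have self: "l \<in> orbit \<sigma> l" by (rule permutation_self_in_orbit[OF fin\<sigma>])
    have ol: "orbit \<sigma> l = orbit \<sigma> j" by (rule orbit_cyclic_eq3[OF _ l]) (rule cyclic_on_orbit[OF perm finite_lessThan])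
    let ?k = "funpow_dist1 \<sigma> l l"
    have img: "orbit \<sigma> l = (%k. (\<sigma> ^^ k) l) ` {0..<?k}" by (rule orbit_conv_funpow_dist1[OF self])
    have inj: "inj_on (%k. (\<sigma> ^^ k) l) {0..<?k}" by (rule inj_on_funpow_dist1[OF self])
    have ki: "?k = i" using card_image[OF inj] img i ol by simp
    have back1: "(\<sigma> ^^ i) l = l" using funpow_dist1_prop[OF self] ki by simp
    have "(\<Sum>k<i. nat (g (\<sigma> ((\<sigma> ^^ k) l)))) = (\<Sum>m\<in>orbit \<sigma> l. nat (g (\<sigma> m)))"
     unfolding img ki[symmetric] by (subst sum.reindex[OF inj]) (simp add: atLeast0LessThan o_def)
    also have "... = (\<Sum>m\<in>\<sigma> ` orbit \<sigma> l. nat (g m))"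
     by (subst sum.reindex) (auto intro: inj_on_subset[OF permutes_inj[OF perm]])
    also have "\<sigma> ` orbit \<sigma> l = orbit \<sigma> l" proof (rule endo_inj_surj)
     show "finite (orbit \<sigma> l)" using osub[OF ln] finite_subset by blast
    qed (auto intro: orbit.intros inj_on_subset[OF permutes_inj[OF perm]])
    also have "(\<Sum>m\<in>orbit \<sigma> l. nat (g m)) = nat ?s" proof -
     have "int (\<Sum>m\<in>orbit \<sigma> l. nat (g m)) = ?s"
      unfolding ol of_nat_sum by (rule sum.cong[OF refl]) (use osub[OF j] gr in auto)
     thus ?thesis by linarith
    qed
    finally show ?thesis using frobs_iterate(1)[OF w y ln, of i] back1 by (simp add: g_def \<sigma>_def)
   qed
   have s0: "0 <= ?s" by (rule sum_nonneg) (use osub[OF j] gr in blast)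
   have "?s mod int d = a \<longleftrightarrow> nat ?s mod d = nat a mod d" proof -
    have "?s mod int d = int (nat ?s mod d)" using s0 by (simp add: zmod_int)
    moreover have "a = int (nat a mod d)" using a by (simp add: zmod_int)
    ultimately show ?thesis by (metis of_nat_eq_iff)
   qed
   also have "... \<longleftrightarrow> z ^ nat ?s = z ^ nat a" by (simp only: z_power_eq)
   also have "... \<longleftrightarrow> (ALL u. u ^ d \<in> b ` orbit \<sigma> j --> u ^ (Q ^ i) = z ^ nat a * u)"
   proof
    assume eq: "z ^ nat ?s = z ^ nat a"
    show "ALL u. u ^ d \<in> b ` orbit \<sigma> j --> u ^ (Q ^ i) = z ^ nat a * u" proof (intro allI impI)
     fix u assume "u ^ d \<in> b ` orbit \<sigma> j"
     then obtain l where l: "l \<in> orbit \<sigma> j" "u ^ d = y l ^ d" by (auto simp: b_def)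
     have "y l ~= 0" using l osub[OF j] y by (auto simp: frobs_def)
     then obtain c where c: "u = z ^ c * y l" using same_power_d[OF l(2)] by blast
     have "(z ^ c) ^ (Q ^ i) = z ^ c" proof (induction i)
      case (Suc i)
      thus ?case by (metis z_Q power_Suc power_mult mult.commute)
     qed simp
     thus "u ^ (Q ^ i) = z ^ nat a * u" using yi[OF l(1)] eq by (simp add: c power_mult_distrib)
    qed
   next
    assume "ALL u. u ^ d \<in> b ` orbit \<sigma> j --> u ^ (Q ^ i) = z ^ nat a * u"
    hence "y j ^ (Q ^ i) = z ^ nat a * y j" using permutation_self_in_orbit[OF fin\<sigma>, of j] by (auto simp: b_def)
    moreover have "y j ~= 0" using j y by (simp add: frobs_def)
    ultimately show "z ^ nat ?s = z ^ nat a" using yi[OF permutation_self_in_orbit[OF fin\<sigma>]] by simp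
   qed
   finally show ?thesis ..
  qed
  thus ?thesis unfolding ctype_def cb by auto
 qed
 have injb: "inj_on ((`) b) (orbit \<sigma> ` {..<n})"
  by (rule inj_on_subset[OF inj_on_image_Pow[OF binj]]) (use osub in auto)
 have "{C \<in> orbit frob ` b ` {..<n}. ctype (i, a) C} =
  (`) b ` {C \<in> orbit \<sigma> ` {..<n}. card C = i & (\<Sum>j\<in>C. g j) mod int d = a}"
  using orb key by (auto simp: image_iff)
 hence "card {C \<in> orbit frob ` b ` {..<n}. ctype (i, a) C} =
  card {C \<in> orbit \<sigma> ` {..<n}. card C = i & (\<Sum>j\<in>C. g j) mod int d = a}"
  by (simp add: card_image inj_on_subset[OF injb])
 thus ?thesis by (simp add: cycle_count_def b_def \<sigma>_def g_def case_prod_beta)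
qed

end

subsection \<open>Closed points\<close>

lemma orbit_card:
 assumes x: "x \<in> orbit f x"
 shows "finite (orbit f x)" "(f ^^ card (orbit f x)) x = x" "0 < card (orbit f x)"
  "0 < k ==> (f ^^ k) x = x \<longleftrightarrow> card (orbit f x) dvd k"
proof -
 let ?k = "funpow_dist1 f x x"
 have img: "orbit f x = (%k. (f ^^ k) x) ` {0..<?k}" by (rule orbit_conv_funpow_dist1[OF x])
 have inj: "inj_on (%k. (f ^^ k) x) {0..<?k}" by (rule inj_on_funpow_dist1[OF x])
 show "finite (orbit f x)" by (rule finite_orbit[OF x])
 have ki: "card (orbit f x) = ?k" using card_image[OF inj] img by simp
 show p: "(f ^^ card (orbit f x)) x = x" using funpow_dist1_prop[OF x] ki by simp
 show k0: "0 < card (orbit f x)" using ki by simp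
 have mult: "(f ^^ (card (orbit f x) * q)) x = x" for q proof (induction q)
  case (Suc q)
  thus ?case using p by (simp add: funpow_add)
 qed simp
 show "(f ^^ k) x = x \<longleftrightarrow> card (orbit f x) dvd k" if "0 < k" proof
  assume e: "(f ^^ k) x = x"
  define r where "r = k mod card (orbit f x)"
  have "(f ^^ k) x = (f ^^ r) ((f ^^ (card (orbit f x) * (k div card (orbit f x)))) x)"
   by (metis r_def add.commute comp_apply funpow_add mult_div_mod_eq)
  hence "(f ^^ r) x = (f ^^ 0) x" using e mult by simp
  moreover have "r < ?k" using k0 ki by (simp add: r_def)
  ultimately have "r = 0" using funpow_neq_less_funpow_dist1[OF x, of r 0] by auto
  thus "card (orbit f x) dvd k" by (auto simp: r_def)
 next
  assume "card (orbit f x) dvd k"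
  thus "(f ^^ k) x = x" using mult by auto
 qed
qed

lemma orbit_eq_self: "x \<in> orbit f x ==> y \<in> orbit f x ==> orbit f y = orbit f x"
 by (rule orbit_cyclic_eq3) (auto simp: cyclic_on_def)

lemma image_orbit: "x \<in> orbit f x ==> f ` orbit f x = orbit f x"
proof (intro subset_antisym image_subsetI subsetI)
 fix y assume x: "x \<in> orbit f x" and y: "y \<in> orbit f x"
 show "f y \<in> orbit f x" using y by (rule orbit.step)
 from y show "y \<in> f ` orbit f x" by cases (use x in auto)
qed

lemma in_orbit_stable:
 assumes "finite D" "f ` D = D" "x \<in> D" shows "x \<in> orbit f x" "orbit f x <= D"
proof -
 \<comment> \<open>\<open>f\<close> is bijective only on \<open>D\<close>; extended by the identity
   it becomes a permutation with the same orbit of \<open>x\<close>.\<close>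
 let ?g = "%y. if y \<in> D then f y else y"
 have inj: "inj_on f D" by (rule eq_card_imp_inj_on) (use assms in auto)
 have "bij_betw ?g D D \<longleftrightarrow> bij_betw f D D" by (rule bij_betw_cong) simp
 hence "?g permutes D" using inj assms(2) by (intro bij_imp_permutes) (auto simp: bij_betw_def)
 hence "permutation ?g" using assms(1) permutation_permutes by blast
 hence "x \<in> orbit ?g x" by (rule permutation_self_in_orbit)
 moreover have "orbit ?g x = orbit f x" by (rule orbit_cong0[OF assms(3)]) (use assms(2) in auto)
 ultimately show "x \<in> orbit f x" by simp
 show "orbit f x <= D" proof
  fix y assume "y \<in> orbit f x"
  thus "y \<in> D" by induction (use assms in auto)
 qed
qed

context fpts
begin

text \<open>Closed points of the punctured line. \<open>orbit\<close> starts with the image of a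
  point, so membership of \<open>x\<close> in its own orbit expresses periodicity.\<close>

definition CP :: "'f set set" where "CP = {orbit frob x | x. x ~= 0 & x \<in> orbit frob x}"

lemma frob_nz: "frob x = 0 \<longleftrightarrow> x = 0" using Q1 by (simp add: frob_def)

lemma frob_pow: "(frob ^^ k) x = x ^ (Q ^ k)"
 by (induction k) (simp_all add: frob_def power_mult[symmetric] mult.commute)

lemma CP_D:
 assumes C: "C \<in> CP"
 shows "finite C" "0 < card C" "0 \<notin> C" "frob ` C = C" "x \<in> C ==> orbit frob x = C" "x \<in> C ==> x ~= 0"
proof -
 obtain y where y: "y ~= 0" "y \<in> orbit frob y" "C = orbit frob y" using C by (auto simp: CP_def)
 show "finite C" "0 < card C" using orbit_card[OF y(2)] y(3) by simp_all
 show "frob ` C = C" using image_orbit[OF y(2)] y(3) by simp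
 show "x \<in> C ==> orbit frob x = C" using orbit_eq_self[OF y(2)] y(3) by simp
 show C0: "0 \<notin> C" proof -
  have "x \<in> orbit frob y ==> x ~= 0" for x by (induction rule: orbit.induct) (simp_all add: frob_nz y(1))
  thus ?thesis unfolding y(3) by blast
 qed
 thus "x \<in> C ==> x ~= 0" by blast
qed

lemma stable_iff_CP:
 "bij_betw Union {E. finite E & E <= CP & (\<Sum>C\<in>E. card C) = n} (stable n)"
 "finite E ==> E <= CP ==> orbit frob ` \<Union>E = E"
proof -
 have orb: "orbit frob ` \<Union>E = E" if E: "E <= CP" for E proof (intro subset_antisym image_subsetI subsetI)
  fix x assume "x \<in> \<Union>E"
  thus "orbit frob x \<in> E" using CP_D(5) E by fastforce
 next
  fix C assume C: "C \<in> E"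
  then obtain x where "x \<in> C" using CP_D(2)[of C] E by (metis card.empty ex_in_conv less_irrefl subsetD)
  thus "C \<in> orbit frob ` \<Union>E" using CP_D(5) E C by blast
 qed
 thus "finite E ==> E <= CP ==> orbit frob ` \<Union>E = E" by blast
 have cU: "card (\<Union>E) = (\<Sum>C\<in>E. card C)" if E: "finite E" "E <= CP" for E
 proof (rule card_Union_disjoint)
  show "pairwise disjnt E" proof (rule pairwiseI)
   fix C C' assume C: "C \<in> E" "C' \<in> E" "C ~= C'"
   hence "\<not> (x \<in> C & x \<in> C')" for x using CP_D(5)[of C x] CP_D(5)[of C' x] E by auto
   thus "disjnt C C'" by (auto simp: disjnt_def)
  qed
 qed (use CP_D(1) E in blast)
 show "bij_betw Union {E. finite E & E <= CP & (\<Sum>C\<in>E. card C) = n} (stable n)"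
 proof (rule bij_betw_byWitness[where f' = "%D. orbit frob ` D"])
  show "ALL E:{E. finite E & E <= CP & (\<Sum>C\<in>E. card C) = n}. orbit frob ` \<Union>E = E" using orb by blast
  have back1: "\<Union>(orbit frob ` D) = D" "orbit frob ` D <= CP" if D: "D \<in> stable n" for D proof -
   have D': "finite D" "frob ` D = D" "0 \<notin> D" using D by (auto simp: stable_def)
   show "\<Union>(orbit frob ` D) = D" using in_orbit_stable[OF D'(1,2)] by blast
   show "orbit frob ` D <= CP" proof (rule image_subsetI)
    fix x assume x: "x \<in> D"
    hence "x ~= 0" using D'(3) by blast
    thus "orbit frob x \<in> CP" using in_orbit_stable(1)[OF D'(1,2) x] by (auto simp: CP_def)
   qed
  qed
  thus "ALL D:stable n. \<Union>(orbit frob ` D) = D" by blast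
  show "Union ` {E. finite E & E <= CP & (\<Sum>C\<in>E. card C) = n} <= stable n" proof (rule image_subsetI)
   fix E assume E: "E \<in> {E. finite E & E <= CP & (\<Sum>C\<in>E. card C) = n}"
   have "frob ` \<Union>E = \<Union>((`) frob ` E)" by blast
   also have "(`) frob ` E = id ` E" proof (rule image_cong[OF refl])
    fix C assume "C \<in> E"
    hence "C \<in> CP" using E by blast
    thus "frob ` C = id C" by (simp add: CP_D(4))
   qed
   also have "\<Union>(id ` E) = \<Union>E" by simp
   finally have f: "frob ` \<Union>E = \<Union>E" .
   have "finite (\<Union>E)" by (rule finite_Union) (use E CP_D(1) in blast)+
   moreover have "0 \<notin> \<Union>E" using E CP_D(3) by blast
   ultimately show "\<Union>E \<in> stable n" using E f cU[of E] by (simp add: stable_def)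
  qed
  show "(%D. orbit frob ` D) ` stable n <= {E. finite E & E <= CP & (\<Sum>C\<in>E. card C) = n}"
  proof (rule image_subsetI)
   fix D assume D: "D \<in> stable n"
   hence "finite (orbit frob ` D)" "card D = n" by (simp_all add: stable_def)
   thus "orbit frob ` D \<in> {E. finite E & E <= CP & (\<Sum>C\<in>E. card C) = n}"
    using back1[OF D] cU[of "orbit frob ` D"] by simp
  qed
 qed
qed

lemma sum_stable:
 "(\<Sum>D\<in>stable n. F (orbit frob ` D)) = (\<Sum>E | finite E & E <= CP & (\<Sum>C\<in>E. card C) = n. F E)"
proof -
 have "(\<Sum>D\<in>stable n. F (orbit frob ` D)) =
  (\<Sum>E | finite E & E <= CP & (\<Sum>C\<in>E. card C) = n. F (orbit frob ` \<Union>E))"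
  by (rule sum.reindex_bij_betw[OF stable_iff_CP(1), symmetric])
 also have "... = (\<Sum>E | finite E & E <= CP & (\<Sum>C\<in>E. card C) = n. F E)"
  by (rule sum.cong[OF refl]) (simp add: stable_iff_CP(2))
 finally show ?thesis .
qed

lemma card_eigen:
 assumes "0 < i" shows "card {u. u ~= 0 & u ^ (Q ^ i) = z ^ a * u} = Q ^ i - 1" "finite {u. u ^ (Q ^ i) = z ^ a * u}"
proof -
 have Qi: "of_nat (Q ^ i) = (0::'f)" "Q ^ i > 1" using Q0 assms one_less_power[OF Q1 assms] by simp_all
 have c: "card {u. u ^ (Q ^ i) = z ^ a * u} = Q ^ i" by (rule card_twisted_power[OF Qi]) (simp add: z_nz)
 have "0 < card {u. u ^ (Q ^ i) = z ^ a * u}" unfolding c using Qi(2) by linarith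
 thus f: "finite {u. u ^ (Q ^ i) = z ^ a * u}" by (rule card_ge_0_finite)
 have "{u. u ~= 0 & u ^ (Q ^ i) = z ^ a * u} = {u. u ^ (Q ^ i) = z ^ a * u} - {0}" by auto
 moreover have "0 \<in> {u. u ^ (Q ^ i) = z ^ a * u}" using Q1 assms by (simp add: power_0_left)
 ultimately show "card {u. u ~= 0 & u ^ (Q ^ i) = z ^ a * u} = Q ^ i - 1" using c f by simp
qed

lemma period_iff:
 assumes "x ~= 0" "0 < m" shows "x ^ (Q ^ m) = x \<longleftrightarrow> (EX C:CP. x \<in> C & card C dvd m)"
proof
 assume "x ^ (Q ^ m) = x"
 hence p: "(frob ^^ m) x = x" by (simp add: frob_pow)
 hence "x \<in> orbit frob x" using assms(2) unfolding orbit_altdef by force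
 moreover from this have "card (orbit frob x) dvd m" using iffD1[OF orbit_card(4)[OF _ assms(2)] p] by simp
 moreover from calculation have "orbit frob x \<in> CP" using assms(1) by (auto simp: CP_def)
 ultimately show "EX C:CP. x \<in> C & card C dvd m" by blast
next
 assume "EX C:CP. x \<in> C & card C dvd m"
 then obtain C where C: "C \<in> CP" "x \<in> C" "card C dvd m" by blast
 have "orbit frob x = C" by (rule CP_D(5)[OF C(1,2)])
 thus "x ^ (Q ^ m) = x" using orbit_card(4)[of x frob m] C assms(2) by (simp add: frob_pow)
qed

lemma finite_CP_dvd: "0 < m ==> finite {C\<in>CP. card C dvd m}"
proof (rule finite_subset)
 assume m: "0 < m"
 show "{C\<in>CP. card C dvd m} <= Pow {u. u ^ (Q ^ m) = z ^ 0 * u}"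
  using period_iff[OF _ m] CP_D(6) by fastforce
 show "finite (Pow {u. u ^ (Q ^ m) = z ^ 0 * u})" using card_eigen(2)[OF m, of 0] by (rule finite_Pow_iff[THEN iffD2])
qed

lemma CP_disjoint: "C \<in> CP ==> C' \<in> CP ==> C ~= C' ==> C \<inter> C' = {}"
 using CP_D(5) by (metis disjoint_iff)

lemma count_points:
 assumes m: "0 < m" shows "(\<Sum>C | C \<in> CP & card C dvd m. card C) = Q ^ m - 1"
proof -
 have "(\<Sum>C | C \<in> CP & card C dvd m. card C) = card (\<Union>{C\<in>CP. card C dvd m})"
 proof (rule card_Union_disjoint[symmetric])
  show "pairwise disjnt {C\<in>CP. card C dvd m}" by (rule pairwiseI) (simp add: disjnt_def CP_disjoint)
 qed (use CP_D(1) in blast)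
 also have "\<Union>{C\<in>CP. card C dvd m} = {u. u ~= 0 & u ^ (Q ^ m) = z ^ 0 * u}" proof (rule Set.set_eqI)
  fix u show "u \<in> \<Union>{C\<in>CP. card C dvd m} \<longleftrightarrow> u \<in> {u. u ~= 0 & u ^ (Q ^ m) = z ^ 0 * u}"
  proof (cases "u = 0")
   case False
   thus ?thesis using period_iff[OF False m] by auto
  qed (auto dest: CP_D(3))
 qed
 finally show ?thesis using card_eigen(1)[OF m, of 0] by simp
qed

lemma card_droots: "x ~= 0 ==> card {u :: 'f. u ^ d = x} = d"
proof -
 assume x: "x ~= 0"
 obtain v where v: "v ^ d = x" using nth_root_exists[OF d, of x] by (rule exE)
 have v0: "v ~= 0" using v x d by (auto simp: zero_power)
 have "{u. u ^ d = x} = (%a. z ^ a * v) ` {..<d}" proof (intro subset_antisym image_subsetI subsetI)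
  fix u assume "u \<in> {u. u ^ d = x}"
  thus "u \<in> (%a. z ^ a * v) ` {..<d}" using same_power_d[of u v] v v0 by auto
 qed (simp add: z_pow_d v)
 moreover have "inj_on (%a. z ^ a * v) {..<d}" using z_inj v0 by (auto intro!: inj_onI)
 ultimately show ?thesis by (simp add: card_image)
qed

lemma zQ: "(z ^ c) ^ (Q ^ i) = z ^ c"
proof (induction i)
 case (Suc i)
 have "(z ^ c) ^ (Q ^ Suc i) = ((z ^ c) ^ (Q ^ i)) ^ Q" by (simp only: power_Suc2 power_mult)
 also have "... = (z ^ Q) ^ c" unfolding Suc by (simp only: power_mult[symmetric] mult.commute)
 finally show ?case by (simp only: z_Q)
qed simp

text \<open>Every d-th root over the orbit has the form z^c v^(Q^k) for one fixed root v over one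
  point. Multiplication by z^c and the iterates of Frobenius commute, so the factor found for v
  serves all of them.\<close>

lemma ctype_exists:
 assumes C: "C \<in> CP" shows "EX b<d. ctype (card C, int b) C"
proof -
 have iff: "x ^ (Q ^ card C) = x" if "x \<in> C" for x
  by (rule iffD2[OF period_iff[OF CP_D(6)[OF C that] CP_D(2)[OF C]]]) (use C that in auto)
 obtain x where x: "x \<in> C" using CP_D(2)[OF C] by fastforce
 obtain v where v: "v ^ d = x" using nth_root_exists[OF d, of x] by (rule exE)
 have v0: "v ~= 0" using v CP_D(6)[OF C x] d by (auto simp: zero_power)
 have "(v ^ (Q ^ card C)) ^ d = (v ^ d) ^ (Q ^ card C)" by (simp only: power_mult[symmetric] mult.commute)
 hence "(v ^ (Q ^ card C)) ^ d = v ^ d" unfolding v iff[OF x] .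
 then obtain b where b: "b < d" "v ^ (Q ^ card C) = z ^ b * v" using same_power_d v0 by blast
 have "u ^ (Q ^ card C) = z ^ b * u" if u: "u ^ d \<in> C" for u proof -
  have "u ^ d \<in> orbit frob x" using CP_D(5)[OF C x] u by simp
  then obtain k where k: "u ^ d = x ^ (Q ^ k)" by (auto simp: orbit_altdef frob_pow)
  have "(v ^ (Q ^ k)) ^ d = (v ^ d) ^ (Q ^ k)" by (simp only: power_mult[symmetric] mult.commute)
  hence "u ^ d = (v ^ (Q ^ k)) ^ d" unfolding v k by simp
  moreover have "v ^ (Q ^ k) ~= 0" using v0 by simp
  ultimately obtain c where c: "u = z ^ c * v ^ (Q ^ k)" using same_power_d by blast
  have "u ^ (Q ^ card C) = z ^ c * (v ^ (Q ^ card C)) ^ (Q ^ k)"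
   unfolding c power_mult_distrib zQ by (simp add: power_mult[symmetric] mult.commute)
  also have "... = z ^ b * u" unfolding b(2) power_mult_distrib zQ c by (simp add: mult_ac)
  finally show ?thesis .
 qed
 thus ?thesis using b(1) by (auto simp: ctype_def)
qed

lemma ctype_unique:
 assumes C: "C \<in> CP" and t: "ctype (card C, int b) C" "ctype (card C, int b') C" "b < d" "b' < d"
 shows "b = b'"
proof -
 obtain x where x: "x \<in> C" using CP_D(2)[OF C] by fastforce
 obtain v where v: "v ^ d = x" using nth_root_exists[OF d, of x] by (rule exE)
 have v0: "v ~= 0" using v CP_D(6)[OF C x] d by (auto simp: zero_power)
 have "v ^ d \<in> C" using x v by simp
 hence e: "v ^ (Q ^ card C) = z ^ b * v" "v ^ (Q ^ card C) = z ^ b' * v" using t by (simp_all add: ctype_def)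
 have "z ^ b * v = z ^ b' * v" by (rule trans[OF e(1)[symmetric] e(2)])
 thus ?thesis using v0 t z_inj by simp
qed

definition npts :: "nat => nat => nat" where "npts e b = card {C\<in>CP. ctype (e, int b) C}"

lemma finite_ctype: "0 < e ==> finite {C\<in>CP. ctype (e, b) C}"
 by (rule finite_subset[OF _ finite_CP_dvd[of e]]) (auto simp: ctype_def)

text \<open>The Q^i - 1 nonzero solutions of u^(Q^i) = z^a u are sorted by the closed point of u^d.
  A point of degree e and type b has d e roots over it, and they are solutions exactly if e divides
  i and b (i / e) is congruent to a mod d.\<close>

lemma count_typed_points:
 assumes i: "0 < i" and a: "a < d"
 shows "(\<Sum>e | e dvd i. \<Sum>b | b < d & (b * (i div e)) mod d = a. d * e * npts e b) = Q ^ i - 1"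
proof -
 define I where "I = Sigma {e. e dvd i} (%e. {b. b < d & (b * (i div e)) mod d = a})"
 have finI: "finite I" using i by (auto simp: I_def)
 define U where "U C = {u. u ^ d \<in> C}" for C :: "'f set"
 have cU: "finite (U C)" "card (U C) = d * card C" if C: "C \<in> CP" for C proof -
  have eq: "U C = (\<Union>x\<in>C. {u. u ^ d = x})" by (auto simp: U_def)
  have f: "finite {u. u ^ d = x}" if "x \<in> C" for x
   using card_droots[OF CP_D(6)[OF C that]] d by (intro card_ge_0_finite) simp
  show "finite (U C)" unfolding eq using f CP_D(1)[OF C] by blast
  have "card (U C) = (\<Sum>x\<in>C. card {u. u ^ d = x})" unfolding eq
   by (rule card_UN_disjoint) (use f CP_D(1)[OF C] in auto)
  also have "... = (\<Sum>x\<in>C. d)" by (rule sum.cong[OF refl], rule card_droots, rule CP_D(6)[OF C])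
  finally show "card (U C) = d * card C" by simp
 qed
 define G where "G = {C\<in>CP. EX eb:I. ctype (fst eb, int (snd eb)) C}"
 have finG: "finite G" by (rule finite_subset[OF _ finite_CP_dvd[OF i]]) (auto simp: G_def I_def ctype_def)
 have pw: "u ^ (Q ^ i) = z ^ (b * (i div e)) * u" if C: "ctype (e, int b) C" "e dvd i" and u: "u ^ d \<in> C" for u C e b
 proof -
  have "u ^ (Q ^ (e * q)) = z ^ (b * q) * u" for q proof (induction q)
   case (Suc q)
   have "u ^ (Q ^ (e * Suc q)) = (u ^ (Q ^ (e * q))) ^ (Q ^ e)" by (simp add: power_add power_mult[symmetric] mult.commute)
   also have "... = z ^ (b * q) * u ^ (Q ^ e)" unfolding Suc power_mult_distrib zQ ..
   also have "u ^ (Q ^ e) = z ^ b * u" using C(1) u by (simp add: ctype_def)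
   finally show ?case by (simp add: power_add mult_ac)
  qed simp
  from this[of "i div e"] show ?thesis using that(2) by simp
 qed
 have "{u. u ~= 0 & u ^ (Q ^ i) = z ^ a * u} = (\<Union>C\<in>G. U C)" proof (intro subset_antisym subsetI)
  fix u assume "u \<in> {u. u ~= 0 & u ^ (Q ^ i) = z ^ a * u}"
  hence u: "u ~= 0" "u ^ (Q ^ i) = z ^ a * u" by auto
  have "(u ^ d) ^ (Q ^ i) = (u ^ (Q ^ i)) ^ d" by (simp only: power_mult[symmetric] mult.commute)
  hence "(u ^ d) ^ (Q ^ i) = u ^ d" using u(2) by (simp add: z_pow_d)
  then obtain C where C: "C \<in> CP" "u ^ d \<in> C" "card C dvd i" using period_iff[OF _ i, of "u ^ d"] u(1) by auto
  obtain b where b: "b < d" "ctype (card C, int b) C" using ctype_exists[OF C(1)] by blast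
  have "z ^ (b * (i div card C)) = z ^ a" using pw[OF b(2) C(3,2)] u by simp
  hence "(b * (i div card C)) mod d = a" unfolding z_power_eq using a by simp
  hence "(card C, b) \<in> I" using b C by (simp add: I_def)
  thus "u \<in> (\<Union>C\<in>G. U C)" using C b(2) by (force simp: G_def U_def)
 next
  fix u assume "u \<in> (\<Union>C\<in>G. U C)"
  then obtain C e b where C: "C \<in> CP" "(e, b) \<in> I" "ctype (e, int b) C" "u ^ d \<in> C" by (auto simp: G_def U_def)
  have "u ^ (Q ^ i) = z ^ (b * (i div e)) * u" using pw[OF C(3) _ C(4)] C(2) by (simp add: I_def)
  also have "z ^ (b * (i div e)) = z ^ a" unfolding z_power_eq using C(2) a by (simp add: I_def)
  finally show "u \<in> {u. u ~= 0 & u ^ (Q ^ i) = z ^ a * u}" using CP_D(6)[OF C(1,4)] d by (auto simp: zero_power)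
 qed
 hence "Q ^ i - 1 = card (\<Union>C\<in>G. U C)" using card_eigen(1)[OF i, of a] by simp
 also from finG have "card (\<Union>C\<in>G. U C) = (\<Sum>C\<in>G. card (U C))" proof (rule card_UN_disjoint)
  show "ALL C:G. finite (U C)" using cU by (simp add: G_def)
  show "ALL C:G. ALL C':G. C ~= C' --> U C \<inter> U C' = {}" using CP_disjoint by (fastforce simp: G_def U_def)
 qed
 also have "... = (\<Sum>C\<in>G. d * card C)" using cU by (simp add: G_def)
 also have "... = (\<Sum>C\<in>(\<Union>eb\<in>I. {C\<in>CP. ctype (fst eb, int (snd eb)) C}). d * card C)"
  by (rule sum.cong) (auto simp: G_def)
 also have "... = (\<Sum>eb\<in>I. \<Sum>C\<in>{C\<in>CP. ctype (fst eb, int (snd eb)) C}. d * card C)"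
 proof (rule sum.UNION_disjoint[OF finI])
  show "ALL eb:I. finite {C\<in>CP. ctype (fst eb, int (snd eb)) C}"
   using finite_ctype i by (auto simp: I_def dest: dvd_pos_nat)
  show "ALL eb:I. ALL eb':I. eb ~= eb' --> {C\<in>CP. ctype (fst eb, int (snd eb)) C} \<inter> {C\<in>CP. ctype (fst eb', int (snd eb')) C} = {}"
  proof (intro ballI impI equals0I)
   fix eb eb' C assume eb: "eb \<in> I" "eb' \<in> I" "eb ~= eb'"
    and "C \<in> {C\<in>CP. ctype (fst eb, int (snd eb)) C} \<inter> {C\<in>CP. ctype (fst eb', int (snd eb')) C}"
   hence C: "C \<in> CP" "ctype (fst eb, int (snd eb)) C" "ctype (fst eb', int (snd eb')) C" by auto
   hence c: "fst eb = card C" "fst eb' = card C" by (auto simp: ctype_def)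
   have "snd eb = snd eb'" by (rule ctype_unique[OF C(1)]) (use C c eb in "auto simp: I_def")
   thus False using c eb(3) by (auto simp: prod_eq_iff)
  qed
 qed
 also have "... = (\<Sum>eb\<in>I. d * fst eb * npts (fst eb) (snd eb))"
  by (rule sum.cong[OF refl]) (simp add: npts_def ctype_def)
 also have "... = (\<Sum>e | e dvd i. \<Sum>b | b < d & (b * (i div e)) mod d = a. d * e * npts e b)"
  unfolding I_def using i by (subst sum.Sigma) (auto simp: case_prod_beta)
 finally show ?thesis ..
qed

end

section \<open>Power series with coefficients polynomial in \<open>q\<close>\<close>

definition pgrow :: "(nat => complex) => bool" where
 "pgrow g \<longleftrightarrow> (EX A b. ALL j. norm (g j) <= A * (real j + 1) ^ b)"

lemma pgrow_le:
 assumes "pgrow g" "!!j. norm (f j) <= c * (real j + 1) ^ e * norm (g j)" shows "pgrow f"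
proof -
 obtain A b where g: "!!j. norm (g j) <= A * (real j + 1) ^ b" using assms(1) by (auto simp: pgrow_def)
 have "norm (f j) <= (\<bar>c\<bar> * A) * (real j + 1) ^ (e + b)" for j proof -
  have "norm (f j) <= \<bar>c\<bar> * (real j + 1) ^ e * norm (g j)"
   by (rule order_trans[OF assms(2)]) (intro mult_right_mono, auto)
  also have "... <= \<bar>c\<bar> * (real j + 1) ^ e * (A * (real j + 1) ^ b)" by (rule mult_left_mono[OF g]) simp
  finally show ?thesis by (simp add: power_add mult_ac)
 qed
 thus ?thesis unfolding pgrow_def by blast
qed

lemma pgrow_bound: "(!!j. norm (f j) <= c) ==> pgrow f"
 unfolding pgrow_def by (intro exI[of _ c] exI[of _ 0]) simp

lemma pgrow_mult:
 assumes "pgrow (fps_nth f)" "pgrow (fps_nth g)" shows "pgrow (fps_nth (f * g))"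
proof -
 obtain A b where f: "!!j. norm (fps_nth f j) <= A * (real j + 1) ^ b" using assms(1) by (auto simp: pgrow_def)
 obtain B c where g: "!!j. norm (fps_nth g j) <= B * (real j + 1) ^ c" using assms(2) by (auto simp: pgrow_def)
 have A0: "A \<ge> 0" and B0: "B \<ge> 0" using order_trans[OF norm_ge_zero f[of 0]] order_trans[OF norm_ge_zero g[of 0]] by simp_all
 have "norm (fps_nth (f * g) j) <= (A * B) * (real j + 1) ^ (b + c + 1)" for j proof -
  have "norm (fps_nth (f * g) j) <= (\<Sum>i=0..j. norm (fps_nth f i * fps_nth g (j - i)))"
   unfolding fps_mult_nth by (rule norm_sum)
  also have "... <= (\<Sum>i=0..j. (A * (real j + 1) ^ b) * (B * (real j + 1) ^ c))" proof (rule sum_mono)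
   fix i assume "i \<in> {0..j}"
   hence "norm (fps_nth f i) <= A * (real j + 1) ^ b" "norm (fps_nth g (j - i)) <= B * (real j + 1) ^ c"
    using A0 B0 by (auto intro!: order_trans[OF f] order_trans[OF g] mult_left_mono power_mono)
   thus "norm (fps_nth f i * fps_nth g (j - i)) <= (A * (real j + 1) ^ b) * (B * (real j + 1) ^ c)"
    unfolding norm_mult using A0 by (intro mult_mono) auto
  qed
  also have "... = (A * B) * (real j + 1) ^ (b + c + 1)" by (simp add: power_add algebra_simps)
  finally show ?thesis .
 qed
 thus ?thesis unfolding pgrow_def by blast
qed

abbreviation qX :: "nat => complex fps" where "qX Q \<equiv> fps_const (of_nat Q) * fps_X"

text \<open>Families in Q that are finite sums of (Q x)^t \<gamma>(x), with \<gamma> independent of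
  Q and of polynomial growth. Each power of Q comes with the same power of x, which is what makes
  the coefficients in \<open>gd_coeff\<close> stabilise. Agreement is asked for Q in A only, where
  the point counts have a meaning.\<close>

inductive gd :: "nat set => (nat => complex fps) => bool" for A where
 base: "pgrow (fps_nth \<gamma>) ==> gd A (%Q. qX Q ^ t * \<gamma>)"
| plus: "gd A f ==> gd A g ==> gd A (%Q. f Q + g Q)"
| cong: "gd A f ==> (!!Q. Q \<in> A ==> g Q = f Q) ==> gd A g"

lemma gd_const: "pgrow (fps_nth \<gamma>) ==> gd A (%Q. \<gamma>)" using gd.base[of \<gamma> A 0] by simp

lemma pgrow_const: "pgrow (fps_nth (fps_const c))"
 by (rule pgrow_bound[of _ "norm c"]) (simp add: fps_const_def)

lemma pgrow_X: "pgrow (fps_nth fps_X)" by (rule pgrow_bound[of _ 1]) (simp add: fps_X_nth)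

lemma gd_X: "gd A (%Q. fps_X)" by (rule gd_const[OF pgrow_X])
lemma gd_c: "gd A (%Q. fps_const c)" by (rule gd_const[OF pgrow_const])
lemma gd_1: "gd A (%Q. 1)" using gd_c[of A 1] by simp
lemma gd_0: "gd A (%Q. 0)" using gd_c[of A 0] by simp

lemma gd_qX: "gd A (%Q. qX Q)" using gd.base[OF pgrow_const[of 1], of A 1] by simp

lemma gd_mult_base: "gd A f ==> pgrow (fps_nth \<delta>) ==> gd A (%Q. qX Q ^ s * \<delta> * f Q)"
proof (induction rule: gd.induct)
 case (base \<gamma> t)
 from gd.base[OF pgrow_mult[OF base(2,1)], of A "s + t"] show ?case by (simp add: power_add mult_ac)
next
 case (plus f g)
 thus ?case using gd.plus by (simp add: distrib_left)
next
 case (cong f g)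
 thus ?case by (auto intro: gd.cong)
qed

lemma gd_mult: "gd A f ==> gd A g ==> gd A (%Q. f Q * g Q)"
proof (induction rule: gd.induct)
 case (base \<gamma> t)
 thus ?case by (intro gd_mult_base)
next
 case (plus f g)
 thus ?case using gd.plus by (simp add: distrib_right)
next
 case (cong f g)
 thus ?case by (auto intro: gd.cong)
qed

lemma gd_power: "gd A f ==> gd A (%Q. f Q ^ k)" by (induction k) (auto intro: gd_mult gd_1)

lemma gd_diff: "gd A f ==> gd A g ==> gd A (%Q. f Q - g Q)"
 using gd.plus[OF _ gd_mult[OF gd_c[of A "-1"]], of f g] by (simp flip: fps_const_neg)

lemma gd_sum: "finite I ==> (!!i. i \<in> I ==> gd A (f i)) ==> gd A (%Q. \<Sum>i\<in>I. f i Q)"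
 by (induction I rule: finite_induct) (auto intro: gd_0 gd.plus)

lemma gd_prod: "finite I ==> (!!i. i \<in> I ==> gd A (f i)) ==> gd A (%Q. \<Prod>i\<in>I. f i Q)"
 by (induction I rule: finite_induct) (auto intro: gd_1 gd_mult)

lemma qX_deriv: "xD (qX Q ^ t) = fps_const (of_nat t) * qX Q ^ t"
proof (induction t)
 case (Suc t)
 have "xD (qX Q ^ Suc t) = qX Q * (xD (qX Q ^ t)) + (xD (qX Q)) * qX Q ^ t"
  unfolding power_Suc fps_deriv_mult by (simp only: distrib_left mult_ac)
 also have "xD (qX Q) = qX Q" by (subst fps_deriv_mult_const_left) (simp add: mult.commute)
 also have "qX Q * (xD (qX Q ^ t)) = fps_const (of_nat t) * qX Q ^ Suc t"
  unfolding Suc by (simp only: power_Suc mult_ac)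
 also have "fps_const (of_nat t) * qX Q ^ Suc t + qX Q * qX Q ^ t = (fps_const (of_nat t) + 1) * qX Q ^ Suc t"
  by (simp only: distrib_right mult_1 power_Suc)
 also have "fps_const (of_nat t) + 1 = fps_const (of_nat (Suc t) :: complex)"
  by (simp only: fps_const_1_eq_1[symmetric] fps_const_add of_nat_Suc add.commute)
 finally show ?case .
qed simp

lemma gd_deriv: "gd A f ==> gd A (%Q. fps_X * fps_deriv (f Q))"
proof (induction rule: gd.induct)
 case (base \<gamma> t)
 have "pgrow (fps_nth (xD \<gamma>))"
  by (rule pgrow_le[OF base, of _ 1 1]) (auto simp: norm_mult fps_X_mult_nth gr0_conv_Suc intro!: mult_right_mono)
 hence g: "gd A (%Q. qX Q ^ t * (xD \<gamma>))" by (rule gd.base)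
 have "xD (qX Q ^ t * \<gamma>) = fps_const (of_nat t) * (qX Q ^ t * \<gamma>) + qX Q ^ t * (xD \<gamma>)" for Q
 proof -
  have "xD (qX Q ^ t * \<gamma>) = (xD (qX Q ^ t)) * \<gamma> + qX Q ^ t * (xD \<gamma>)"
   unfolding fps_deriv_mult by (simp add: algebra_simps)
  thus ?thesis by (simp only: qX_deriv mult.assoc)
 qed
 thus ?case using gd.plus[OF gd_mult[OF gd_c gd.base[OF base]] g] by (intro gd.cong[OF gd.plus[OF gd_mult[OF gd_c gd.base[OF base]] g]]) blast
next
 case (plus f g)
 thus ?case using gd.plus by (simp add: distrib_left)
next
 case (cong f g)
 thus ?case by (auto intro: gd.cong)
qed

definition geo :: "complex => complex fps" where "geo c = Abs_fps (%n. c ^ n)"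

text \<open>In (Q x)^t \<gamma>(x) / (1 - Q x) the coefficient of x^n is the sum of \<gamma>_j
  Q^(n-j) over j <= n - t: independent of n once j + t <= n, and 0 before.\<close>

lemma gd_coeff:
 "gd A f ==> EX \<beta> k b B e. (ALL Q:A. ALL n. fps_nth (f Q * geo (of_nat Q)) n = (\<Sum>j\<le>n. \<beta> n j * of_nat Q ^ (n - j))) &
  (ALL n j. j + k <= n --> \<beta> n j = b j) & (ALL n j. norm (\<beta> n j) <= B * (real j + 1) ^ e)"
proof (induction rule: gd.induct)
 case (base \<gamma> t)
 then obtain B e where B: "!!j. norm (fps_nth \<gamma> j) <= B * (real j + 1) ^ e" by (auto simp: pgrow_def)
 have B0: "B \<ge> 0" using order_trans[OF norm_ge_zero B[of 0]] by simp
 show ?case proof (intro exI conjI ballI allI impI)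
  fix Q n
  have "fps_nth (qX Q ^ t * \<gamma> * geo (of_nat Q)) n = of_nat Q ^ t * (if n < t then 0 else fps_nth (\<gamma> * geo (of_nat Q)) (n - t))"
   by (simp add: power_mult_distrib fps_const_power mult.assoc fps_X_power_mult_nth)
  also have "... = (\<Sum>j\<le>n. (if j + t <= n then fps_nth \<gamma> j else 0) * of_nat Q ^ (n - j))"
  proof (cases "n < t")
   case True
   thus ?thesis by (simp add: sum.neutral)
  next
   case False
   have "of_nat Q ^ t * fps_nth (\<gamma> * geo (of_nat Q)) (n - t) = (\<Sum>j=0..n - t. fps_nth \<gamma> j * of_nat Q ^ (n - j))"
    unfolding fps_mult_nth sum_distrib_left proof (rule sum.cong[OF refl])
    fix j assume "j \<in> {0..n - t}"
    hence "t + (n - t - j) = n - j" using False by auto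
    thus "of_nat Q ^ t * (fps_nth \<gamma> j * fps_nth (geo (of_nat Q)) (n - t - j)) = fps_nth \<gamma> j * of_nat Q ^ (n - j)"
     by (simp add: geo_def mult.left_commute power_add[symmetric])
   qed
   also have "... = (\<Sum>j\<le>n. (if j + t <= n then fps_nth \<gamma> j else 0) * of_nat Q ^ (n - j))"
    by (rule sum.mono_neutral_cong_left) (use False in auto)
   finally show ?thesis using False by simp
  qed
  finally show "fps_nth (qX Q ^ t * \<gamma> * geo (of_nat Q)) n = (\<Sum>j\<le>n. (if j + t <= n then fps_nth \<gamma> j else 0) * of_nat Q ^ (n - j))" .
 next
  fix n j show "j + t <= n ==> (if j + t <= n then fps_nth \<gamma> j else 0) = fps_nth \<gamma> j" by simp
  show "norm (if j + t <= n then fps_nth \<gamma> j else 0) <= B * (real j + 1) ^ e" using B B0 by simp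
 qed
next
 case (plus f g)
 obtain \<beta> k b B e where
  "(ALL Q:A. ALL n. fps_nth (f Q * geo (of_nat Q)) n = (\<Sum>j\<le>n. \<beta> n j * of_nat Q ^ (n - j))) &
   (ALL n j. j + k <= n --> \<beta> n j = b j) & (ALL n j. norm (\<beta> n j) <= B * (real j + 1) ^ e)" using plus.IH(1) by (elim exE)
 hence 1: "!!Q n. Q \<in> A ==> fps_nth (f Q * geo (of_nat Q)) n = (\<Sum>j\<le>n. \<beta> n j * of_nat Q ^ (n - j))"
   "!!n j. j + k <= n ==> \<beta> n j = b j" "!!n j. norm (\<beta> n j) <= B * (real j + 1) ^ e" by blast+
 obtain \<beta>' k' b' B' e' where
  "(ALL Q:A. ALL n. fps_nth (g Q * geo (of_nat Q)) n = (\<Sum>j\<le>n. \<beta>' n j * of_nat Q ^ (n - j))) &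
   (ALL n j. j + k' <= n --> \<beta>' n j = b' j) & (ALL n j. norm (\<beta>' n j) <= B' * (real j + 1) ^ e')" using plus.IH(2) by (elim exE)
 hence 2: "!!Q n. Q \<in> A ==> fps_nth (g Q * geo (of_nat Q)) n = (\<Sum>j\<le>n. \<beta>' n j * of_nat Q ^ (n - j))"
   "!!n j. j + k' <= n ==> \<beta>' n j = b' j" "!!n j. norm (\<beta>' n j) <= B' * (real j + 1) ^ e'" by blast+
 have B0: "B \<ge> 0" "B' \<ge> 0" using order_trans[OF norm_ge_zero 1(3)[of 0 0]] order_trans[OF norm_ge_zero 2(3)[of 0 0]] by simp_all
 show ?case proof (intro exI conjI ballI allI impI)
  fix Q n assume "Q \<in> A"
  thus "fps_nth ((f Q + g Q) * geo (of_nat Q)) n = (\<Sum>j\<le>n. (\<beta> n j + \<beta>' n j) * of_nat Q ^ (n - j))"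
   using 1(1) 2(1) by (simp add: distrib_right sum.distrib)
 next
  fix n j
  show "j + max k k' <= n ==> \<beta> n j + \<beta>' n j = b j + b' j" using 1(2) 2(2) by simp
  have "norm (\<beta> n j + \<beta>' n j) <= B * (real j + 1) ^ e + B' * (real j + 1) ^ e'"
   by (rule order_trans[OF norm_triangle_ineq add_mono[OF 1(3) 2(3)]])
  also have "... <= B * (real j + 1) ^ (e + e') + B' * (real j + 1) ^ (e + e')"
   using B0 by (intro add_mono mult_left_mono power_increasing) auto
  finally show "norm (\<beta> n j + \<beta>' n j) <= (B + B') * (real j + 1) ^ (e + e')" by (simp add: distrib_right)
 qed
next
 case (cong f g)
 thus ?case by simp
qed

lemma summable_pgrow:
 assumes q: "1 < (q::nat)" shows "summable (%j. B * (real j + 1) ^ e / real q ^ j)"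
proof -
 have "(%j. (1 + inverse (real (Suc j))) ^ e) \<longlonglongrightarrow> 1 ^ e"
  by (intro tendsto_power LIMSEQ_inverse_real_of_nat_add)
 hence "\<forall>\<^sub>F j in sequentially. (1 + inverse (real (Suc j))) ^ e < 3 / 2"
  by (rule order_tendstoD(2)) simp
 then obtain N where N: "!!j. j \<ge> N ==> (1 + inverse (real (Suc j))) ^ e < 3 / 2"
  by (auto simp: eventually_sequentially)
 \<comment> \<open>The growth factor of the numerator is eventually below 3/2 and \<open>q\<close>
   is at least 2, which gives the ratio 3/4.\<close>
 have "summable (%j. (real j + 1) ^ e / real q ^ j)" proof (rule summable_ratio_test[of "3/4" N])
  fix j assume "j \<ge> N"
  have "real (Suc j) + 1 = (1 + inverse (real (Suc j))) * (real j + 1)" by (simp add: field_simps)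
  hence "(real (Suc j) + 1) ^ e = (1 + inverse (real (Suc j))) ^ e * (real j + 1) ^ e" by (simp only: power_mult_distrib)
  also have "... <= 3 / 2 * (real j + 1) ^ e" using N[OF \<open>j \<ge> N\<close>] by (intro mult_right_mono) auto
  finally have "(real (Suc j) + 1) ^ e / real q ^ Suc j <= 3 / 2 * (real j + 1) ^ e / real q ^ Suc j"
   by (rule divide_right_mono) simp
  also have "... = (3 / 2 / real q) * ((real j + 1) ^ e / real q ^ j)" by simp
  also have "... <= 3 / 4 * ((real j + 1) ^ e / real q ^ j)"
   using q by (intro mult_right_mono) (auto simp: field_simps)
  finally show "norm ((real (Suc j) + 1) ^ e / real q ^ Suc j) <= 3 / 4 * norm ((real j + 1) ^ e / real q ^ j)" by simp
 qed simp
 from summable_mult[OF this, of B] show ?thesis by simp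
qed

text \<open>Dominated convergence for series: for fixed j the summand is eventually constant in n,
  and the growth bound is uniform in n.\<close>

lemma limit_coeff:
 assumes q: "1 < (q::nat)" and st: "!!n j. j + k <= n ==> \<beta> n j = b j"
  and bd: "!!n j. norm (\<beta> n j) <= B * (real j + 1) ^ e"
 shows "(%n. (\<Sum>j\<le>n. \<beta> n j * of_nat q ^ (n - j)) / of_nat q ^ n) \<longlonglongrightarrow> suminf (%j. b j / of_nat q ^ j :: complex)"
  "summable (%j. b j / of_nat q ^ j :: complex)"
proof -
 have sm: "summable (%j. B * (real j + 1) ^ e / real q ^ j)" by (rule summable_pgrow[OF q])
 have bb: "norm (b j) <= B * (real j + 1) ^ e" for j using bd[of "j + k" j] st[of j "j + k"] by simp
 show "summable (%j. b j / of_nat q ^ j :: complex)"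
  by (rule summable_comparison_test'[OF sm, of 0]) (use bb in "simp add: norm_divide norm_power divide_right_mono")
 define F where "F j n = (if j <= n then \<beta> n j / of_nat q ^ j else 0 :: complex)" for j n
 have "(%n. suminf (%j. F j n)) \<longlonglongrightarrow> suminf (%j. b j / of_nat q ^ j)"
 proof (rule conjunct2[OF conjunct2[OF tannerys_theorem[OF _ _ sm]]])
  show "(%n. F j n) \<longlonglongrightarrow> b j / of_nat q ^ j" for j
   by (rule tendsto_eventually) (use st in \<open>auto simp: F_def intro!: eventually_sequentiallyI[of "j + k"]\<close>)
  show "\<forall>\<^sub>F (j, n) in at_top \<times>\<^sub>F sequentially. norm (F j n) <= B * (real j + 1) ^ e / real q ^ j"
  proof (rule always_eventually, safe)
   fix j n
   have "0 <= B * (real j + 1) ^ e" by (rule order_trans[OF norm_ge_zero bd])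
   thus "norm (F j n) <= B * (real j + 1) ^ e / real q ^ j"
    using bd[of n j] by (simp add: F_def norm_divide norm_power divide_right_mono)
  qed
 qed simp
 moreover have "suminf (%j. F j n) = (\<Sum>j\<le>n. \<beta> n j * of_nat q ^ (n - j)) / of_nat q ^ n" for n
 proof -
  have "suminf (%j. F j n) = (\<Sum>j\<le>n. F j n)" by (rule suminf_finite) (auto simp: F_def)
  also have "... = (\<Sum>j\<le>n. \<beta> n j * of_nat q ^ (n - j) / of_nat q ^ n)"
   using q by (intro sum.cong refl) (simp add: F_def field_simps power_add[symmetric])
  finally show ?thesis by (simp add: sum_divide_distrib)
 qed
 ultimately show "(%n. (\<Sum>j\<le>n. \<beta> n j * of_nat q ^ (n - j)) / of_nat q ^ n) \<longlonglongrightarrow> suminf (%j. b j / of_nat q ^ j)" by simp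
qed

section \<open>Moments of the number of chosen points of a given type\<close>

definition alt :: "nat => complex fps" where
 "alt i = Abs_fps (%n. if i dvd n then (-1) ^ (n div i) else 0)"

lemma pgrow_alt: "pgrow (fps_nth (alt i))" by (rule pgrow_bound[of _ 1]) (simp add: alt_def norm_power)

lemma alt_inverse:
 assumes "i > 0" shows "(1 + fps_X ^ i) * alt i = 1"
proof (rule fps_ext)
 fix n
 have "fps_nth ((1 + fps_X ^ i) * alt i) n = fps_nth (alt i) n + (if n < i then 0 else fps_nth (alt i) (n - i))"
  by (simp add: distrib_right fps_X_power_mult_nth)
 also have "... = fps_nth 1 n" proof (cases "n < i")
  case True
  thus ?thesis using assms by (cases "n = 0") (auto simp: alt_def dest: dvd_imp_le)
 next
  case False
  then obtain m where n: "n = m + i" using le_Suc_ex by (metis add.commute not_less)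
  thus ?thesis using assms by (simp add: alt_def)
 qed
 finally show "fps_nth ((1 + fps_X ^ i) * alt i) n = fps_nth 1 n" .
qed

lemma X_deriv_X_power: "xD (fps_X ^ i) = fps_const (of_nat i) * (fps_X ^ i :: complex fps)"
proof (induction i)
 case (Suc i)
 have "xD (fps_X ^ Suc i) = fps_X * (xD (fps_X ^ i)) + (fps_X ^ Suc i :: complex fps)"
  by (simp add: algebra_simps)
 also have "... = (fps_const (of_nat i) + 1) * fps_X ^ Suc i" unfolding Suc by (simp add: algebra_simps)
 also have "fps_const (of_nat i) + 1 = fps_const (of_nat (Suc i) :: complex)"
  by (simp only: fps_const_1_eq_1[symmetric] fps_const_add of_nat_Suc add.commute)
 finally show ?case .
qed simp

lemma X_deriv_alt_power:
 assumes "i > 0" shows "xD (alt i ^ N) = - (fps_const (of_nat (N * i)) * fps_X ^ i * alt i * alt i ^ N)"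
proof -
 have V: "xD (alt i) = - (fps_const (of_nat i) * fps_X ^ i * alt i * alt i)" proof -
  have "0 = xD ((1 + fps_X ^ i) * alt i)" by (simp add: alt_inverse[OF assms])
  also have "... = (1 + fps_X ^ i) * (xD (alt i)) + (xD (fps_X ^ i)) * alt i" by (simp add: algebra_simps)
  finally have "0 = alt i * ((1 + fps_X ^ i) * (xD (alt i)) + fps_const (of_nat i) * fps_X ^ i * alt i)"
   unfolding X_deriv_X_power by simp
  also have "... = ((1 + fps_X ^ i) * alt i) * (xD (alt i)) + fps_const (of_nat i) * fps_X ^ i * alt i * alt i"
   by (simp only: distrib_left mult_ac)
  finally show ?thesis unfolding alt_inverse[OF assms] by (simp add: eq_neg_iff_add_eq_0)
 qed
 show ?thesis proof (induction N)
  case (Suc N)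
  have "xD (alt i ^ Suc N) = alt i * (xD (alt i ^ N)) + (xD (alt i)) * alt i ^ N" by (simp add: algebra_simps)
  also have "... = - ((fps_const (of_nat (N * i)) + fps_const (of_nat i)) * fps_X ^ i * alt i * alt i ^ Suc N)"
   unfolding Suc V by (simp add: algebra_simps del: fps_const_add)
  also have "fps_const (of_nat (N * i)) + fps_const (of_nat i) = fps_const (of_nat (Suc N * i) :: complex)"
   by (simp add: algebra_simps)
  finally show ?case .
 qed simp
qed

definition subsets_gf :: "'c set => nat => nat => complex fps" where
 "subsets_gf A i e = (\<Sum>E\<in>Pow A. fps_const (of_nat (card E) ^ e) * fps_X ^ (i * card E))"

text \<open>The moment of order e of the number of points chosen from \<open>A\<close>, all of
  degree i, normalised by the sum for e = 0, which is (1 + x^i)^|A|.\<close>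

definition ratio_gf :: "'c set => nat => nat => complex fps" where
 "ratio_gf A i e = subsets_gf A i e * alt i ^ card A"

lemma sum_Pow_power:
 "finite A ==> (\<Sum>E\<in>Pow A. fps_X ^ (\<Sum>C\<in>E. g C)) = (\<Prod>C\<in>A. 1 + fps_X ^ g C :: complex fps)"
 using prod_add[of A "%C. fps_X ^ g C :: complex fps" "%_. 1"] by (simp add: power_sum add.commute)

lemma ratio_gf_0:
 assumes "finite A" "i > 0" shows "ratio_gf A i 0 = 1"
proof -
 have "subsets_gf A i 0 = (1 + fps_X ^ i) ^ card A"
  using sum_Pow_power[OF assms(1), of "%_. i"] by (simp add: subsets_gf_def mult.commute)
 thus ?thesis by (simp add: ratio_gf_def alt_inverse[OF assms(2)] flip: power_mult_distrib)
qed

text \<open>The operator x d/dx multiplies the term of a subset E by i |E| and so raises the moment;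
  the normalisation yields the second summand. The set enters only as |A| x^i, the combination
  controlled by \<open>gd_npts\<close>.\<close>

lemma ratio_gf_Suc:
 assumes "finite A" "i > 0" shows "ratio_gf A i (Suc e) = fps_const (1 / of_nat i) * (xD (ratio_gf A i e))
  + (fps_const (of_nat (card A)) * fps_X ^ i) * alt i * ratio_gf A i e"
proof -
 let ?H = "subsets_gf A i" and ?V = "alt i ^ card A"
 have H: "xD (?H e) = fps_const (of_nat i) * ?H (Suc e)" proof -
  have "xD (?H e) = (\<Sum>E\<in>Pow A. fps_const (of_nat (card E) ^ e) * (xD (fps_X ^ (i * card E))))"
   unfolding subsets_gf_def fps_deriv_sum sum_distrib_left by (simp only: fps_deriv_mult_const_left mult.left_commute)
  also have "... = (\<Sum>E\<in>Pow A. fps_const (of_nat i) * (fps_const (of_nat (card E) ^ Suc e) * fps_X ^ (i * card E)))"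
   unfolding X_deriv_X_power of_nat_mult power_Suc fps_const_mult[symmetric] by (simp only: mult_ac)
  finally show ?thesis by (simp only: subsets_gf_def sum_distrib_left)
 qed
 have "xD (ratio_gf A i e) = (xD (?H e)) * ?V + ?H e * (xD ?V)"
  unfolding ratio_gf_def fps_deriv_mult by (simp only: distrib_left mult_ac add.commute)
 also have "... = fps_const (of_nat i) * ratio_gf A i (Suc e) - fps_const (of_nat i) * ((fps_const (of_nat (card A)) * fps_X ^ i) * alt i * ratio_gf A i e)"
  unfolding H X_deriv_alt_power[OF assms(2)] ratio_gf_def of_nat_mult fps_const_mult[symmetric]
  by (simp add: algebra_simps del: fps_const_mult)
 finally have E: "xD (ratio_gf A i e) = fps_const (of_nat i) * (ratio_gf A i (Suc e) - (fps_const (of_nat (card A)) * fps_X ^ i) * alt i * ratio_gf A i e)"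
  by (simp only: right_diff_distrib)
 have "fps_const (1 / of_nat i) * (xD (ratio_gf A i e)) =
  (fps_const (1 / of_nat i) * fps_const (of_nat i)) * (ratio_gf A i (Suc e) - (fps_const (of_nat (card A)) * fps_X ^ i) * alt i * ratio_gf A i e)"
  unfolding E by (simp only: mult.assoc)
 also have "fps_const (1 / of_nat i) * fps_const (of_nat i) = (1 :: complex fps)" using assms(2) by simp
 finally show ?thesis by simp
qed

lemma sum_Pow_Un:
 assumes "A \<inter> B = {}"
 shows "(\<Sum>E\<in>Pow (A \<union> B). f (E \<inter> A) * g (E \<inter> B)) = (\<Sum>E\<in>Pow A. f E) * (\<Sum>E\<in>Pow B. g E :: 'r::comm_semiring_0)"
proof -
 have "bij_betw (%E. (E \<inter> A, E \<inter> B)) (Pow (A \<union> B)) (Pow A \<times> Pow B)"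
  by (rule bij_betw_byWitness[where f' = "%(E, E'). E \<union> E'"]) (use assms in auto)
 hence "(\<Sum>E\<in>Pow (A \<union> B). f (E \<inter> A) * g (E \<inter> B)) = (\<Sum>(E, E')\<in>Pow A \<times> Pow B. f E * g E')"
  by (subst sum.reindex_bij_betw[symmetric]) auto
 thus ?thesis by (simp only: sum.cartesian_product[symmetric] sum_product)
qed

text \<open>Points of different types are chosen independently, so one type after the other can be
  split off. Points of no type in \<open>T\<close> contribute only to the product over
  \<open>\<Omega>\<close>.\<close>

lemma typed_subsets_gf:
 assumes "finite T" "finite \<Omega>" "!!v v' C. v \<in> T ==> v' \<in> T ==> C \<in> \<Omega> ==> \<tau> v C ==> \<tau> v' C ==> v = v'"
  "!!v C. v \<in> T ==> \<tau> v C ==> g C = i v" "!!v. v \<in> T ==> 0 < i v"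
 shows "(\<Sum>E\<in>Pow \<Omega>. fps_const (\<Prod>v\<in>T. of_nat (card {C\<in>E. \<tau> v C}) ^ f v) * fps_X ^ (\<Sum>C\<in>E. g C)) =
  (\<Prod>C\<in>\<Omega>. 1 + fps_X ^ g C) * (\<Prod>v\<in>T. ratio_gf {C\<in>\<Omega>. \<tau> v C} (i v) (f v))"
 using assms
proof (induction T arbitrary: \<Omega> rule: finite_induct)
 case empty
 thus ?case using sum_Pow_power by simp
next
 case (insert v T)
 let ?A = "{C\<in>\<Omega>. \<tau> v C}" and ?B = "{C\<in>\<Omega>. \<not> \<tau> v C}"
 let ?h = "%T E. \<Prod>v\<in>T. of_nat (card {C\<in>E. \<tau> v C}) ^ f v :: complex"
 have AB: "?A \<union> ?B = \<Omega>" "?A \<inter> ?B = {}" by auto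
 have fin: "finite ?A" "finite ?B" using insert.prems(1) by auto
 have notv: "\<not> \<tau> u C" if "u \<in> T" "C \<in> \<Omega>" "\<tau> v C" for u C
  using insert.prems(2)[of u v C] that insert.hyps(2) by auto
 have "(\<Sum>E\<in>Pow \<Omega>. fps_const (?h (insert v T) E) * fps_X ^ (\<Sum>C\<in>E. g C)) =
  (\<Sum>E\<in>Pow (?A \<union> ?B). (fps_const (of_nat (card (E \<inter> ?A)) ^ f v) * fps_X ^ (i v * card (E \<inter> ?A))) *
   (fps_const (?h T (E \<inter> ?B)) * fps_X ^ (\<Sum>C\<in>E \<inter> ?B. g C)))" unfolding AB(1)
 proof (rule sum.cong[OF refl])
  fix E assume E: "E \<in> Pow \<Omega>"
  have "finite E" using E insert.prems(1) finite_subset by auto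
  have "{C\<in>E. \<tau> v C} = E \<inter> ?A" "!!u. u \<in> T ==> {C\<in>E. \<tau> u C} = {C\<in>E \<inter> ?B. \<tau> u C}" using E notv by auto
  hence h: "?h (insert v T) E = of_nat (card (E \<inter> ?A)) ^ f v * ?h T (E \<inter> ?B)"
   using insert.hyps by simp
  have "(\<Sum>C\<in>E. g C) = (\<Sum>C\<in>E \<inter> ?A. g C) + (\<Sum>C\<in>E \<inter> ?B. g C)"
   using \<open>finite E\<close> by (subst sum.union_disjoint[symmetric]) (use E in "auto intro!: sum.cong")
  also have "(\<Sum>C\<in>E \<inter> ?A. g C) = (\<Sum>C\<in>E \<inter> ?A. i v)" by (rule sum.cong[OF refl]) (use insert.prems(3) in auto)
  finally have g: "(\<Sum>C\<in>E. g C) = i v * card (E \<inter> ?A) + (\<Sum>C\<in>E \<inter> ?B. g C)" by (simp add: mult.commute)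
  show "fps_const (?h (insert v T) E) * fps_X ^ (\<Sum>C\<in>E. g C) =
   (fps_const (of_nat (card (E \<inter> ?A)) ^ f v) * fps_X ^ (i v * card (E \<inter> ?A))) * (fps_const (?h T (E \<inter> ?B)) * fps_X ^ (\<Sum>C\<in>E \<inter> ?B. g C))"
   unfolding h g fps_const_mult[symmetric] power_add by (simp only: mult_ac)
 qed
 also have "... = subsets_gf ?A (i v) (f v) * (\<Sum>E\<in>Pow ?B. fps_const (?h T E) * fps_X ^ (\<Sum>C\<in>E. g C))"
  unfolding subsets_gf_def by (rule sum_Pow_Un[OF AB(2)])
 also have "(\<Sum>E\<in>Pow ?B. fps_const (?h T E) * fps_X ^ (\<Sum>C\<in>E. g C)) =
  (\<Prod>C\<in>?B. 1 + fps_X ^ g C) * (\<Prod>u\<in>T. ratio_gf {C\<in>?B. \<tau> u C} (i u) (f u))"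
  by (rule insert.IH) (use insert.prems fin in auto)
 also have "(\<Prod>u\<in>T. ratio_gf {C\<in>?B. \<tau> u C} (i u) (f u)) = (\<Prod>u\<in>T. ratio_gf {C\<in>\<Omega>. \<tau> u C} (i u) (f u))"
  by (intro prod.cong refl arg_cong[where f = "%S. ratio_gf S _ _"]) (use notv in auto)
 also have "subsets_gf ?A (i v) (f v) = (\<Prod>C\<in>?A. 1 + fps_X ^ g C) * ratio_gf ?A (i v) (f v)" proof -
  have "(\<Prod>C\<in>?A. 1 + fps_X ^ g C) = (\<Prod>C\<in>?A. 1 + fps_X ^ i v :: complex fps)"
   by (rule prod.cong[OF refl]) (use insert.prems(3) in simp)
  hence "(\<Prod>C\<in>?A. 1 + fps_X ^ g C) * ratio_gf ?A (i v) (f v) = subsets_gf ?A (i v) (f v) * (((1 + fps_X ^ i v) * alt (i v)) ^ card ?A)"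
   by (simp add: ratio_gf_def power_mult_distrib mult_ac)
  thus ?thesis using insert.prems(4)[of v] by (simp add: alt_inverse)
 qed
 also have "(\<Prod>C\<in>?A. 1 + fps_X ^ g C) * ratio_gf ?A (i v) (f v) * ((\<Prod>C\<in>?B. 1 + fps_X ^ g C) * (\<Prod>u\<in>T. ratio_gf {C\<in>\<Omega>. \<tau> u C} (i u) (f u))) =
  ((\<Prod>C\<in>?A. 1 + fps_X ^ g C) * (\<Prod>C\<in>?B. 1 + fps_X ^ g C)) * (\<Prod>u\<in>insert v T. ratio_gf {C\<in>\<Omega>. \<tau> u C} (i u) (f u))"
  using insert.hyps by (simp add: mult_ac)
 also have "(\<Prod>C\<in>?A. 1 + fps_X ^ g C) * (\<Prod>C\<in>?B. 1 + fps_X ^ g C) = (\<Prod>C\<in>\<Omega>. 1 + fps_X ^ g C :: complex fps)"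
  using prod.union_disjoint[OF fin AB(2), of "%C. 1 + fps_X ^ g C :: complex fps"] unfolding AB(1) by simp
 finally show ?case .
qed

section \<open>Logarithmic derivatives and the square-free zeta quotient\<close>

lemma X_deriv_prod:
 assumes "finite \<Omega>" "!!C. C \<in> \<Omega> ==> 0 < g C"
 shows "xD (\<Prod>C\<in>\<Omega>. 1 + fps_X ^ g C) =
  (\<Prod>C\<in>\<Omega>. 1 + fps_X ^ g C) * (\<Sum>C\<in>\<Omega>. fps_const (of_nat (g C)) * (fps_X ^ g C * alt (g C)))"
 using assms
proof (induction \<Omega> rule: finite_induct)
 case (insert C \<Omega>)
 let ?P = "\<Prod>C\<in>\<Omega>. 1 + fps_X ^ g C :: complex fps" and ?S = "\<Sum>C\<in>\<Omega>. fps_const (of_nat (g C)) * (fps_X ^ g C * alt (g C))"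
 have inv: "(1 + fps_X ^ g C) * alt (g C) = 1" using alt_inverse insert.prems[of C] by simp
 have "xD (\<Prod>C\<in>insert C \<Omega>. 1 + fps_X ^ g C) =
  (1 + fps_X ^ g C) * (xD ?P) + (xD (fps_X ^ g C)) * ?P" using insert.hyps by (simp add: algebra_simps)
 also have "... = (1 + fps_X ^ g C) * (?P * ?S) + fps_const (of_nat (g C)) * fps_X ^ g C * ((1 + fps_X ^ g C) * alt (g C)) * ?P"
  using insert unfolding X_deriv_X_power inv by simp
 also have "... = (\<Prod>C\<in>insert C \<Omega>. 1 + fps_X ^ g C) * (\<Sum>C\<in>insert C \<Omega>. fps_const (of_nat (g C)) * (fps_X ^ g C * alt (g C)))"
  using insert.hyps by (simp add: algebra_simps)
 finally show ?case .
qed simp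

text \<open>Coefficient n times n is a convolution of earlier coefficients with the logarithmic
  derivative. Agreement up to degree N suffices, which allows comparison with a truncated
  product.\<close>

lemma fps_log_deriv_unique:
 fixes f g a b :: "complex fps"
 assumes "xD f = f * a" "xD g = g * b" "fps_nth f 0 = fps_nth g 0"
  "fps_nth a 0 = 0" "fps_nth b 0 = 0" "!!m. 0 < m ==> m <= N ==> fps_nth a m = fps_nth b m" "n <= N"
 shows "fps_nth f n = fps_nth g n" using assms(7)
proof (induction n rule: less_induct)
 case (less n)
 have X: "fps_nth (xD h) n = of_nat n * fps_nth h n" for h :: "complex fps" by (cases n) simp_all
 show ?case proof (cases "n = 0")
  case False
  have "of_nat n * fps_nth f n = (\<Sum>k=0..n. fps_nth f k * fps_nth a (n - k))"
   using X[of f] assms(1) by (simp add: fps_mult_nth)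
  also have "... = (\<Sum>k=0..n. fps_nth g k * fps_nth b (n - k))" proof (rule sum.cong[OF refl])
   fix k assume k: "k \<in> {0..n}"
   show "fps_nth f k * fps_nth a (n - k) = fps_nth g k * fps_nth b (n - k)" proof (cases "k = n")
    case False
    thus ?thesis using k less assms(6)[of "n - k"] by auto
   qed (simp add: assms(4,5))
  qed
  also have "... = of_nat n * fps_nth g n" using X[of g] assms(2) by (simp add: fps_mult_nth)
  finally show ?thesis using False by simp
 qed (simp add: assms(3))
qed

text \<open>The zeta series of the punctured line is (1 - x) / (1 - Q x). Divided by the same series
  in x^2 it counts square-free divisors and equals (1 - Q x^2) / ((1 + x) (1 - Q x)); the factor 1 /
  (1 - Q x) is kept apart as \<open>geo\<close>.\<close>

definition main_gf :: "nat => complex fps" where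
 "main_gf Q = (1 - fps_const (of_nat Q) * fps_X ^ 2) * geo (-1)"

lemma geo_inverse: "(1 - fps_const c * fps_X) * geo c = 1"
proof (rule fps_ext)
 fix n show "fps_nth ((1 - fps_const c * fps_X) * geo c) n = fps_nth 1 n"
  by (cases n) (simp_all add: left_diff_distrib geo_def mult.assoc)
qed

lemma X_deriv_geo: "xD (geo c) = geo c * (fps_const c * fps_X * geo c)"
proof -
 have "0 = xD ((1 - fps_const c * fps_X) * geo c)" by (simp add: geo_inverse)
 also have "... = (1 - fps_const c * fps_X) * (xD (geo c)) - fps_const c * fps_X * geo c"
  by (simp add: algebra_simps)
 finally have "0 = geo c * ((1 - fps_const c * fps_X) * (xD (geo c)) - fps_const c * fps_X * geo c)" by simp
 also have "... = ((1 - fps_const c * fps_X) * geo c) * (xD (geo c)) - geo c * (fps_const c * fps_X * geo c)"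
  by (simp only: right_diff_distrib mult_ac)
 finally show ?thesis by (simp add: geo_inverse)
qed

definition geo2 :: "complex => complex fps" where
 "geo2 c = Abs_fps (%n. if even n then c ^ (n div 2) else 0)"

lemma geo2_inverse: "(1 - fps_const c * fps_X ^ 2) * geo2 c = 1"
proof (rule fps_ext)
 fix n
 have "fps_nth ((1 - fps_const c * fps_X ^ 2) * geo2 c) n = fps_nth (geo2 c) n - c * (if n < 2 then 0 else fps_nth (geo2 c) (n - 2))"
  by (simp add: left_diff_distrib mult.assoc fps_X_power_mult_nth)
 also have "... = fps_nth 1 n" proof (cases "n < 2")
  case True
  hence "n = 0 | n = 1" by auto
  thus ?thesis by (auto simp: geo2_def)
 next
  case False
  then obtain m where n: "n = Suc (Suc m)" by (metis Suc_1 not_less_eq less_Suc0 old.nat.exhaust less_2_cases_iff)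
  thus ?thesis by (auto simp: geo2_def)
 qed
 finally show "fps_nth ((1 - fps_const c * fps_X ^ 2) * geo2 c) n = fps_nth 1 n" .
qed

text \<open>The logarithmic derivative under x d/dx of the three factors 1 / (1 - Q x), 1 / (1 + x)
  and 1 - Q x^2.\<close>

definition log_gf :: "nat => complex fps" where
 "log_gf Q = fps_const (of_nat Q) * fps_X * geo (of_nat Q) - fps_X * geo (-1) - fps_const (2 * of_nat Q) * (fps_X ^ 2 * geo2 (of_nat Q))"

lemma X_deriv_main_gf:
 "xD (main_gf Q * geo (of_nat Q)) = (main_gf Q * geo (of_nat Q)) * log_gf Q"
proof -
 let ?c = "of_nat Q :: complex"
 let ?A = "1 - fps_const ?c * fps_X ^ 2 :: complex fps" and ?B = "geo (-1)" and ?C = "geo ?c"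
 have A: "xD ?A = ?A * (- (fps_const (2 * ?c) * (fps_X ^ 2 * geo2 ?c)))" proof -
  have "xD ?A = - (fps_const ?c * (xD (fps_X ^ 2)))" by (simp add: algebra_simps)
  also have "... = - (fps_const (2 * ?c) * fps_X ^ 2) * (?A * geo2 ?c)"
   unfolding X_deriv_X_power geo2_inverse by (simp add: mult.assoc[symmetric] mult.commute)
  finally show ?thesis by (simp add: mult_ac)
 qed
 have B: "xD ?B = ?B * (- (fps_X * ?B))" unfolding X_deriv_geo by (simp flip: fps_const_neg)
 have "xD (main_gf Q * ?C) = (xD ?A) * ?B * ?C + ?A * (xD ?B) * ?C + ?A * ?B * (xD ?C)"
  unfolding main_gf_def fps_deriv_mult by (simp only: distrib_left distrib_right mult_ac add_ac)
 also have "... = (main_gf Q * ?C) * log_gf Q" proof -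
  have gen: "(A * a) * B * C + A * (B * b) * C + A * B * (C * c) = (A * B * C) * (c + b + a)" for A B C a b c :: "complex fps"
   by (simp add: algebra_simps)
  have L: "log_gf Q = fps_const ?c * fps_X * ?C + - (fps_X * ?B) + - (fps_const (2 * ?c) * (fps_X ^ 2 * geo2 ?c))"
   by (simp add: log_gf_def)
  show ?thesis unfolding A B unfolding X_deriv_geo main_gf_def L by (rule gen)
 qed
 finally show ?thesis .
qed

context fpts
begin

lemma finite_CP_le: "finite {C\<in>CP. card C <= N}"
proof (rule finite_subset[OF _ finite_CP_dvd[of "fact N"]])
 show "{C\<in>CP. card C <= N} <= {C\<in>CP. card C dvd fact N}"
  using CP_D(2) by (auto intro!: dvd_fact simp: Suc_le_eq)
qed simp

text \<open>A point of degree c contributes to degree m the amount c if c divides m, less 2 c if 2 c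
  divides m as well. Summation by \<open>count_points\<close> gives Q^m - 1, less 2 (Q^(m/2) - 1)
  for even m.\<close>

lemma log_gf_nth:
 assumes m: "0 < m" "m <= N"
 shows "fps_nth (\<Sum>C | C \<in> CP & card C <= N. fps_const (of_nat (card C)) * (fps_X ^ card C * alt (card C))) m = fps_nth (log_gf Q) m"
proof -
 have fin: "finite {C\<in>CP. card C dvd k}" if "0 < k" for k by (rule finite_CP_dvd[OF that])
 have finN: "finite {C\<in>CP. card C <= N}" by (rule finite_CP_le)
 have tm: "fps_nth (fps_const (of_nat c) * (fps_X ^ c * alt c)) m =
  (if c dvd m then of_nat c - 2 * (if 2 * c dvd m then of_nat c else 0) else 0)" if c: "0 < c" for c
 proof (cases "c dvd m")
  case True
  then obtain k where k: "m = c * k" by blast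
  hence k0: "k > 0" using m by auto
  then obtain l where l: "k = Suc l" by (cases k) auto
  have "2 * c dvd m \<longleftrightarrow> even k" unfolding k using c by (simp add: mult.commute)
  thus ?thesis using c l k by (auto simp: fps_X_power_mult_nth alt_def algebra_simps)
 next
  case False
  hence "\<not> c dvd m - c" if "c <= m" using that by (simp add: dvd_minus_self)
  thus ?thesis using False by (auto simp: fps_X_power_mult_nth alt_def)
 qed
 have cnt: "(\<Sum>C | C \<in> CP & card C dvd k. of_nat (card C) :: complex) = of_nat Q ^ k - 1" if "0 < k" for k
 proof -
  have "(\<Sum>C | C \<in> CP & card C dvd k. of_nat (card C) :: complex) = of_nat (Q ^ k - 1)"
   unfolding count_points[OF that, symmetric] by simp
  thus ?thesis using Q1 by (simp add: of_nat_diff)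
 qed
 have "fps_nth (\<Sum>C | C \<in> CP & card C <= N. fps_const (of_nat (card C)) * (fps_X ^ card C * alt (card C))) m =
  (\<Sum>C | C \<in> CP & card C <= N. if card C dvd m then of_nat (card C) - 2 * (if 2 * card C dvd m then of_nat (card C) else 0) else 0)"
  unfolding fps_sum_nth by (rule sum.cong[OF refl]) (use tm CP_D(2) in blast)
 also have "... = (\<Sum>C | C \<in> CP & card C dvd m. of_nat (card C) - 2 * (if 2 * card C dvd m then of_nat (card C) else 0))"
  by (rule sum.mono_neutral_cong_right[OF finN]) (use m in "auto dest: dvd_imp_le")
 also have "... = (of_nat Q ^ m - 1) - 2 * (\<Sum>C | C \<in> CP & card C dvd m. if 2 * card C dvd m then of_nat (card C) else 0)"
  using cnt[OF m(1)] by (simp add: sum_subtractf sum_distrib_left)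
 also have "(\<Sum>C | C \<in> CP & card C dvd m. if 2 * card C dvd m then of_nat (card C) else 0) = (if even m then of_nat Q ^ (m div 2) - 1 else (0::complex))"
 proof (cases "even m")
  case True
  then obtain k where k: "m = 2 * k" by blast
  have "(\<Sum>C | C \<in> CP & card C dvd m. if 2 * card C dvd m then of_nat (card C) else 0) = (\<Sum>C | C \<in> CP & card C dvd k. of_nat (card C) :: complex)"
   by (rule sum.mono_neutral_cong_right[OF fin[OF m(1)]]) (auto simp: k)
  thus ?thesis using cnt[of k] k m by simp
 next
  case False
  hence "\<not> 2 * c dvd m" for c by (meson dvd_mult_left)
  thus ?thesis using False by simp
 qed
 also have "of_nat Q ^ m - 1 - 2 * (if even m then of_nat Q ^ (m div 2) - 1 else (0::complex)) = fps_nth (log_gf Q) m"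
 proof -
  obtain l where l: "m = Suc l" using m by (cases m) auto
  show ?thesis proof (cases "even m")
   case True
   then obtain j where j: "l = Suc (2 * j)" using l by (metis even_Suc oddE add.commute plus_1_eq_Suc)
   show ?thesis unfolding log_gf_def l j
    by (simp add: geo_def geo2_def mult.assoc fps_X_power_mult_nth algebra_simps)
  next
   case False
   hence "even l" "odd (m - 2) | m < 2" using l by auto
   thus ?thesis using False unfolding log_gf_def l
    by (auto simp: geo_def geo2_def mult.assoc fps_X_power_mult_nth)
  qed
 qed
 finally show ?thesis .
qed

text \<open>A stable set is a finite set of closed points, so the sum is a coefficient of the
  square-free product with one moment factor for each type.\<close>

theorem stable_gf:
 fixes T :: "(nat \<times> int) set"
 assumes T: "finite T" "!!v. v \<in> T ==> 0 < fst v & 0 <= snd v & snd v < int d"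
 shows "(\<Sum>D\<in>stable n. \<Prod>v\<in>T. of_nat (card {C \<in> orbit frob ` D. ctype v C}) ^ f v) =
  fps_nth (main_gf Q * geo (of_nat Q) * (\<Prod>v\<in>T. ratio_gf {C\<in>CP. ctype v C} (fst v) (f v))) n"
proof -
 \<comment> \<open>Points of degree above \<open>n\<close> cannot occur in a set of total degree
   \<open>n\<close>; adding the degrees in \<open>T\<close> keeps every moment factor complete after
   truncation.\<close>
 define N where "N = n + (\<Sum>v\<in>T. fst v)"
 have vN: "fst v <= N" if "v \<in> T" for v using member_le_sum[of v T fst] that T(1) by (simp add: N_def)
 define \<Omega> where "\<Omega> = {C\<in>CP. card C <= N}"
 have fin: "finite \<Omega>" unfolding \<Omega>_def by (rule finite_CP_le)
 let ?h = "%E. \<Prod>v\<in>T. of_nat (card {C\<in>E. ctype v C}) ^ f v :: complex"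
 let ?G = "\<Prod>C\<in>\<Omega>. 1 + fps_X ^ card C :: complex fps"
 let ?R = "\<Prod>v\<in>T. ratio_gf {C\<in>CP. ctype v C} (fst v) (f v)"
 have G: "fps_nth ?G k = fps_nth (main_gf Q * geo (of_nat Q)) k" if "k <= N" for k
 proof (rule fps_log_deriv_unique[OF X_deriv_prod[OF fin] X_deriv_main_gf])
  have c0: "0 < card C" if "C \<in> \<Omega>" for C using that CP_D(2) by (simp add: \<Omega>_def)
  thus "!!C. C \<in> \<Omega> ==> 0 < card C" .
  have p0: "fps_nth (\<Prod>C\<in>S. 1 + fps_X ^ card C :: complex fps) 0 = 1" if "S <= \<Omega>" "finite S" for S
   using that(2,1) by (induction S rule: finite_induct) (use c0 in "auto simp: fps_X_power_nth")
  show "fps_nth ?G 0 = fps_nth (main_gf Q * geo (of_nat Q)) 0" using p0[OF order_refl fin] by (simp add: main_gf_def geo_def)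
  show "fps_nth (\<Sum>C\<in>\<Omega>. fps_const (of_nat (card C)) * (fps_X ^ card C * alt (card C))) 0 = 0"
   unfolding fps_sum_nth by (rule sum.neutral) (use c0 in "auto simp: fps_X_power_mult_nth")
  show "fps_nth (log_gf Q) 0 = 0" by (simp add: log_gf_def)
  show "fps_nth (\<Sum>C\<in>\<Omega>. fps_const (of_nat (card C)) * (fps_X ^ card C * alt (card C))) m = fps_nth (log_gf Q) m"
   if "0 < m" "m <= N" for m using log_gf_nth[OF that] by (simp add: \<Omega>_def)
 qed (rule that)
 have "(\<Sum>D\<in>stable n. \<Prod>v\<in>T. of_nat (card {C \<in> orbit frob ` D. ctype v C}) ^ f v) =
  (\<Sum>E | finite E & E <= CP & (\<Sum>C\<in>E. card C) = n. ?h E)" by (rule sum_stable)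
 also have "{E. finite E & E <= CP & (\<Sum>C\<in>E. card C) = n} = {E\<in>Pow \<Omega>. (\<Sum>C\<in>E. card C) = n}"
 proof (intro subset_antisym subsetI)
  fix E assume E: "E \<in> {E. finite E & E <= CP & (\<Sum>C\<in>E. card C) = n}"
  have "card C <= N" if "C \<in> E" for C using member_le_sum[of C E card] that E by (simp add: N_def)
  thus "E \<in> {E\<in>Pow \<Omega>. (\<Sum>C\<in>E. card C) = n}" using E by (auto simp: \<Omega>_def)
 next
  fix E assume "E \<in> {E\<in>Pow \<Omega>. (\<Sum>C\<in>E. card C) = n}"
  thus "E \<in> {E. finite E & E <= CP & (\<Sum>C\<in>E. card C) = n}" using fin finite_subset by (auto simp: \<Omega>_def)
 qed
 also have "(\<Sum>E\<in>{E\<in>Pow \<Omega>. (\<Sum>C\<in>E. card C) = n}. ?h E) = fps_nth (\<Sum>E\<in>Pow \<Omega>. fps_const (?h E) * fps_X ^ (\<Sum>C\<in>E. card C)) n"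
  unfolding fps_sum_nth by (rule sum.mono_neutral_cong_left) (use fin in "auto simp: fps_X_power_nth")
 also have "(\<Sum>E\<in>Pow \<Omega>. fps_const (?h E) * fps_X ^ (\<Sum>C\<in>E. card C)) = ?G * (\<Prod>v\<in>T. ratio_gf {C\<in>\<Omega>. ctype v C} (fst v) (f v))"
 proof (rule typed_subsets_gf[OF T(1) fin])
  fix v v' C assume v: "v \<in> T" "v' \<in> T" "C \<in> \<Omega>" "ctype v C" "ctype v' C"
  hence e: "fst v = card C" "fst v' = card C" by (simp_all add: ctype_def)
  have i: "v = (card C, int (nat (snd v)))" "v' = (card C, int (nat (snd v')))" using e T(2)[OF v(1)] T(2)[OF v(2)] by (simp_all add: prod_eq_iff)
  have "nat (snd v) = nat (snd v')"
   by (rule ctype_unique[of C]) (use v i T(2)[OF v(1)] T(2)[OF v(2)] in "auto simp: \<Omega>_def")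
  thus "v = v'" using i by metis
 qed (use T in "auto simp: ctype_def")
 also have "(\<Prod>v\<in>T. ratio_gf {C\<in>\<Omega>. ctype v C} (fst v) (f v)) = ?R"
  by (intro prod.cong refl arg_cong[where f = "%S. ratio_gf S _ _"]) (use vN in "auto simp: \<Omega>_def ctype_def")
 also have "fps_nth (?G * ?R) n = fps_nth (main_gf Q * geo (of_nat Q) * ?R) n"
  unfolding fps_mult_nth[of ?G] fps_mult_nth[of "main_gf Q * geo (of_nat Q)"]
  by (rule sum.cong[OF refl]) (use G in "simp add: N_def")
 finally show ?thesis .
qed

end

subsection \<open>Dependence on the size of the field\<close>

lemma pgrow_geo: "pgrow (fps_nth (geo (-1)))" by (rule pgrow_bound[of _ 1]) (simp add: geo_def norm_power)

lemma gd_main_gf: "gd A main_gf"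
proof -
 have "gd A (%Q. (1 - qX Q * fps_X) * geo (-1))" by (intro gd_mult gd_diff gd_1 gd_qX gd_X gd_const pgrow_geo)
 thus ?thesis by (rule gd.cong) (simp add: main_gf_def power2_eq_square mult.assoc)
qed

lemma gd_X_power: "gd A (%Q. fps_X ^ i)" by (intro gd_power gd_X)

context
 fixes d :: nat and z :: "'f::alg_closed_field" and A :: "nat set"
 assumes d: "d > 0" and A: "!!Q. Q \<in> A ==> fpts d z Q"
begin

text \<open>In \<open>count_typed_points\<close> the term e = i involves only the type
  \<open>a\<close>. Solving for it expresses the number through Q^i - 1 and smaller degrees, and
  after multiplication by x^i the power Q^i turns into (Q x)^i.\<close>

lemma gd_npts:
 "0 < i ==> a < d ==> gd A (%Q. fps_const (of_nat (fpts.npts d z Q i a)) * fps_X ^ i)"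
proof (induction i arbitrary: a rule: less_induct)
 case (less i)
 let ?N = "%Q e b. fpts.npts d z Q e b"
 let ?B = "%e. {b. b < d & b * (i div e) mod d = a}"
 let ?E = "{e. e dvd i} - {i}"
 have finE: "finite {e. e dvd i}" using less.prems by simp
 have H: "gd A (%Q. \<Sum>b\<in>?B e. fps_const (of_nat (d * e)) * ((fps_const (of_nat (?N Q e b)) * fps_X ^ e) * fps_X ^ (i - e)))"
  if e: "e \<in> ?E" for e proof (rule gd_sum)
  fix b assume b: "b \<in> ?B e"
  have "0 < e" "e < i" using e less.prems by (auto dest: dvd_imp_le dvd_pos_nat intro: le_neq_implies_less)
  thus "gd A (%Q. fps_const (of_nat (d * e)) * ((fps_const (of_nat (?N Q e b)) * fps_X ^ e) * fps_X ^ (i - e)))"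
   using b by (intro gd_mult[OF gd_c gd_mult[OF less.IH gd_X_power]]) auto
 qed simp
 have S: "gd A (%Q. \<Sum>e\<in>?E. \<Sum>b\<in>?B e. fps_const (of_nat (d * e)) * ((fps_const (of_nat (?N Q e b)) * fps_X ^ e) * fps_X ^ (i - e)))"
  by (rule gd_sum[OF _ H]) (use finE in simp)
 have "gd A (%Q. fps_const (1 / of_nat (d * i)) * ((qX Q ^ i - fps_X ^ i) -
  (\<Sum>e\<in>?E. \<Sum>b\<in>?B e. fps_const (of_nat (d * e)) * ((fps_const (of_nat (?N Q e b)) * fps_X ^ e) * fps_X ^ (i - e)))))"
  by (intro gd_mult gd_c gd_diff gd_power gd_qX gd_X S)
 thus ?case proof (rule gd.cong)
  fix Q assume "Q \<in> A"
  then interpret fpts d z Q by (rule A)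
  define s where "s = (\<Sum>e\<in>?E. \<Sum>b\<in>?B e. of_nat (d * e) * of_nat (?N Q e b) :: complex)"
  have Ba: "?B i = {a}" using less.prems by auto
  have "of_nat (Q ^ i - 1) = (of_nat (\<Sum>e | e dvd i. \<Sum>b\<in>?B e. d * e * ?N Q e b) :: complex)"
   using count_typed_points[OF less.prems] by simp
  also have "... = (\<Sum>e | e dvd i. \<Sum>b\<in>?B e. of_nat (d * e) * of_nat (?N Q e b))" by simp
  also have "... = (\<Sum>b\<in>?B i. of_nat (d * i) * of_nat (?N Q i b)) + s"
   unfolding s_def by (rule sum.remove[OF finE]) simp
  finally have "of_nat (Q ^ i - 1) = of_nat (d * i) * of_nat (?N Q i a) + s" unfolding Ba by simp
  hence N: "of_nat (?N Q i a) = (1 / of_nat (d * i)) * (of_nat Q ^ i - 1 - s)"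
   using d less.prems Q1 by (simp add: of_nat_diff field_simps)
  have "(\<Sum>e\<in>?E. \<Sum>b\<in>?B e. fps_const (of_nat (d * e)) * ((fps_const (of_nat (?N Q e b)) * fps_X ^ e) * fps_X ^ (i - e))) = fps_const s * fps_X ^ i"
  proof -
   have "(\<Sum>e\<in>?E. \<Sum>b\<in>?B e. fps_const (of_nat (d * e)) * ((fps_const (of_nat (?N Q e b)) * fps_X ^ e) * fps_X ^ (i - e))) =
    (\<Sum>e\<in>?E. \<Sum>b\<in>?B e. fps_const (of_nat (d * e) * of_nat (?N Q e b)) * (fps_X ^ i :: complex fps))"
   proof (rule sum.cong[OF refl], rule sum.cong[OF refl])
    fix e b assume "e \<in> ?E" and "b \<in> ?B e"
    hence "e <= i" using less.prems by (auto dest: dvd_imp_le)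
    hence "fps_X ^ e * fps_X ^ (i - e) = (fps_X ^ i :: complex fps)" by (simp flip: power_add)
    thus "fps_const (of_nat (d * e)) * ((fps_const (of_nat (?N Q e b)) * fps_X ^ e) * fps_X ^ (i - e)) =
     fps_const (of_nat (d * e) * of_nat (?N Q e b)) * (fps_X ^ i :: complex fps)"
     by (simp only: mult.assoc fps_const_mult[symmetric])
   qed
   also have "... = fps_const s * fps_X ^ i" proof -
    have "fps_const s = (\<Sum>e\<in>?E. \<Sum>b\<in>?B e. fps_const (of_nat (d * e) * of_nat (?N Q e b)))"
     unfolding s_def by (rule fps_ext) (simp add: fps_const_def fps_sum_nth)
    thus ?thesis by (simp only: sum_distrib_right)
   qed
   finally show ?thesis .
  qed
  moreover have "(qX Q ^ i - fps_X ^ i) - fps_const s * fps_X ^ i = fps_const (of_nat Q ^ i - 1 - s) * fps_X ^ i"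
   by (simp only: power_mult_distrib fps_const_power left_diff_distrib mult_1 fps_const_sub[symmetric] fps_const_1_eq_1)
  ultimately show "fps_const (of_nat (?N Q i a)) * fps_X ^ i = fps_const (1 / of_nat (d * i)) * ((qX Q ^ i - fps_X ^ i) -
   (\<Sum>e\<in>?E. \<Sum>b\<in>?B e. fps_const (of_nat (d * e)) * ((fps_const (of_nat (?N Q e b)) * fps_X ^ e) * fps_X ^ (i - e))))"
   unfolding N by (simp only: mult.assoc[symmetric] fps_const_mult)
 qed
qed

lemma gd_ratio:
 assumes "0 < i" "0 <= a" "a < int d"
 shows "gd A (%Q. ratio_gf {C\<in>fpts.CP Q. fpts.ctype d z Q (i, a) C} i e)"
proof (induction e)
 case 0
 have "ratio_gf {C\<in>fpts.CP Q. fpts.ctype d z Q (i, a) C} i 0 = 1" if "Q \<in> A" for Q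
  using ratio_gf_0[OF fpts.finite_ctype[OF A[OF that] assms(1)] assms(1)] .
 thus ?case by (intro gd.cong[OF gd_1])
next
 case (Suc e)
 let ?R = "%Q. ratio_gf {C\<in>fpts.CP Q. fpts.ctype d z Q (i, a) C} i"
 have "gd A (%Q. fps_const (1 / of_nat i) * (xD (?R Q e)) +
  (fps_const (of_nat (fpts.npts d z Q i (nat a))) * fps_X ^ i) * alt i * ?R Q e)"
  using assms by (intro gd.plus gd_mult gd_c gd_deriv gd_npts gd_const pgrow_alt Suc) auto
 thus ?case proof (rule gd.cong)
  fix Q assume Q: "Q \<in> A"
  show "?R Q (Suc e) = fps_const (1 / of_nat i) * (xD (?R Q e)) +
   (fps_const (of_nat (fpts.npts d z Q i (nat a))) * fps_X ^ i) * alt i * ?R Q e"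
   using ratio_gf_Suc[OF fpts.finite_ctype[OF A[OF Q] assms(1)] assms(1)] assms(2)
   by (simp add: fpts.npts_def[OF A[OF Q]])
 qed
qed

definition set_value :: "char_poly => nat => 'f set => complex" where
 "set_value P Q D = (\<Sum>m\<in>pkeys P. plook P m *
  (\<Prod>v\<in>pkeys m. of_nat (card {C \<in> orbit (fpts.frob Q) ` D. fpts.ctype d z Q v C}) ^ plook m v))"

lemma char_polyD:
 assumes "is_char_poly d P" "m \<in> pkeys P" "v \<in> pkeys m" shows "0 < fst v & 0 <= snd v & snd v < int d"
proof -
 have "v \<in> {1..} \<times> carrier (integer_mod_group d)" using assms by (auto simp: is_char_poly_def)
 thus ?thesis using d by (cases v) (auto simp: carrier_integer_mod_group)
qed

lemma stable_sum_gd: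
 assumes P: "is_char_poly d P"
 shows "EX T. gd A T & (ALL Q:A. ALL n. (\<Sum>D\<in>fpts.stable Q n. set_value P Q D) = fps_nth (T Q * geo (of_nat Q)) n)"
proof -
 let ?R = "%Q m. \<Prod>v\<in>pkeys m. ratio_gf {C\<in>fpts.CP Q. fpts.ctype d z Q v C} (fst v) (plook m v)"
 define T where "T Q = (\<Sum>m\<in>pkeys P. fps_const (plook P m) * (main_gf Q * ?R Q m))" for Q
 have "gd A T" unfolding T_def proof (intro gd_sum gd_mult gd_c gd_main_gf gd_prod finite_keys)
  fix m v assume "m \<in> pkeys P" "v \<in> pkeys m"
  from char_polyD[OF P this] show "gd A (%Q. ratio_gf {C\<in>fpts.CP Q. fpts.ctype d z Q v C} (fst v) (plook m v))"
   using gd_ratio[of "fst v" "snd v"] by simp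
 qed
 moreover have "(\<Sum>D\<in>fpts.stable Q n. set_value P Q D) = fps_nth (T Q * geo (of_nat Q)) n" if "Q \<in> A" for Q n
 proof -
  have "(\<Sum>D\<in>fpts.stable Q n. set_value P Q D) = (\<Sum>m\<in>pkeys P. plook P m *
   (\<Sum>D\<in>fpts.stable Q n. \<Prod>v\<in>pkeys m. of_nat (card {C \<in> orbit (fpts.frob Q) ` D. fpts.ctype d z Q v C}) ^ plook m v))"
   unfolding set_value_def sum_distrib_left by (rule sum.swap)
  also have "... = (\<Sum>m\<in>pkeys P. plook P m * fps_nth (main_gf Q * geo (of_nat Q) * ?R Q m) n)"
  proof (rule sum.cong[OF refl])
   fix m assume m: "m \<in> pkeys P"
   show "plook P m * (\<Sum>D\<in>fpts.stable Q n. \<Prod>v\<in>pkeys m.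
     of_nat (card {C \<in> orbit (fpts.frob Q) ` D. fpts.ctype d z Q v C}) ^ plook m v) =
    plook P m * fps_nth (main_gf Q * geo (of_nat Q) * ?R Q m) n"
    by (subst fpts.stable_gf[OF A[OF that] finite_keys char_polyD[OF P m]]) simp_all
  qed
  also have "... = fps_nth (\<Sum>m\<in>pkeys P. fps_const (plook P m) * (main_gf Q * geo (of_nat Q) * ?R Q m)) n"
   by (simp add: fps_sum_nth)
  also have "(\<Sum>m\<in>pkeys P. fps_const (plook P m) * (main_gf Q * geo (of_nat Q) * ?R Q m)) = T Q * geo (of_nat Q)"
   unfolding T_def sum_distrib_right by (simp only: mult_ac)
  finally show ?thesis .
 qed
 ultimately show ?thesis by blast
qed

lemma char_poly_fun_frobs:
 assumes P: "is_char_poly d P" and Q: "Q \<in> A" and w: "w \<in> wcar d n" "y \<in> fpts.frobs d z Q n w"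
 shows "char_poly_fun d P n w = set_value P Q ((%j. y j ^ d) ` {..<n})"
proof -
 interpret fpts d z Q by (rule A[OF Q])
 show ?thesis unfolding char_poly_fun_def set_value_def
 proof (intro sum.cong refl arg_cong[where f = "%x. _ * x"] prod.cong)
  fix m v assume mv: "m \<in> pkeys P" "v \<in> pkeys m"
  obtain i a where v: "v = (i, a)" by (cases v)
  have "cycle_count d n v w = card {C \<in> orbit frob ` (%j. y j ^ d) ` {..<n}. ctype v C}"
   using cycle_count_frobs[OF w, of a i] char_polyD[OF P mv] by (simp add: v)
  thus "of_nat (cycle_count d n v w) ^ plook m v =
   of_nat (card {C \<in> orbit frob ` (%j. y j ^ d) ` {..<n}. ctype v C}) ^ plook m v" by simp
 qed
qed

lemma conf_inner_stable:
 assumes P: "is_char_poly d P" and Q: "Q \<in> A"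
 shows "(\<Sum>p\<le>n. (-1) ^ p * (of_nat Q ^ (n - p) * conf_inner d P p n)) = (\<Sum>D\<in>fpts.stable Q n. set_value P Q D)"
proof -
 interpret fpts d z Q by (rule A[OF Q])
 let ?W = "wcar d n"
 from sum_frobs(1)[of n "char_poly_fun d P n" "set_value P Q", OF char_poly_fun_frobs[OF P Q]] have "(\<Sum>w\<in>?W. char_poly_fun d P n w * of_nat (card (frobs n w))) =
  of_nat (card ?W) * (\<Sum>D\<in>stable n. set_value P Q D)" by blast
 moreover have "card ?W ~= 0" proof -
  have "((\<lambda>i\<in>{..<n}. 0), id) \<in> ?W" using d by (auto simp: carrier_wreath permutes_id)
  thus ?thesis using wreath_finite by (auto simp: card_eq_0_iff)
 qed
 ultimately show ?thesis unfolding conf_inner_frobs by simp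
qed

text \<open>For each n both expressions of the sum over stable sets are polynomials in Q that agree
  on an infinite set, so the inner products are, up to sign, the coefficients from
  \<open>gd_coeff\<close>. These are stable in n and uniformly of polynomial growth.\<close>

theorem inner_limit:
 assumes P: "is_char_poly d P" and inf: "infinite A" and q: "q \<in> A"
 shows "(ALL i. convergent (%n. conf_inner d P i n)) &
  (EX L::complex. (%n. (\<Sum>D\<in>fpts.stable q n. set_value P q D) / of_nat q ^ n) \<longlonglongrightarrow> L &
   (%i. (-1) ^ i * lim (%n. conf_inner d P i n) / of_nat q ^ i) sums L)"
proof -
 obtain T where T: "gd A T"
  "!!Q n. Q \<in> A ==> (\<Sum>D\<in>fpts.stable Q n. set_value P Q D) = fps_nth (T Q * geo (of_nat Q)) n"
  using stable_sum_gd[OF P] by blast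
 obtain \<beta> k b B e where "(ALL Q:A. ALL n. fps_nth (T Q * geo (of_nat Q)) n = (\<Sum>j\<le>n. \<beta> n j * of_nat Q ^ (n - j))) &
  (ALL n j. j + k <= n --> \<beta> n j = b j) & (ALL n j. norm (\<beta> n j) <= B * (real j + 1) ^ e)"
  using gd_coeff[OF T(1)] by (elim exE)
 hence \<beta>: "!!Q n. Q \<in> A ==> fps_nth (T Q * geo (of_nat Q)) n = (\<Sum>j\<le>n. \<beta> n j * of_nat Q ^ (n - j))"
  and st: "!!n j. j + k <= n ==> \<beta> n j = b j" and bd: "!!n j. norm (\<beta> n j) <= B * (real j + 1) ^ e" by blast+
 have eq: "(-1) ^ p * conf_inner d P p n = \<beta> n p" if p: "p <= n" for p n proof -
  \<comment> \<open>Indexed by the exponent of Q rather than by the cohomological degree, hence the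
    reversal \<open>n - i\<close>.\<close>
  define c where "c i = (-1) ^ (n - i) * conf_inner d P (n - i) n - \<beta> n (n - i)" for i
  have "(\<Sum>i\<le>n. c i * of_nat Q ^ i) = 0" if Q: "Q \<in> A" for Q proof -
   have "(\<Sum>i\<le>n. c i * of_nat Q ^ i) = (\<Sum>j\<le>n. c (n - j) * of_nat Q ^ (n - j))"
    by (rule sum.reindex_bij_witness[of _ "%j. n - j" "%j. n - j"]) auto
   also have "... = (\<Sum>j\<le>n. (-1) ^ j * (of_nat Q ^ (n - j) * conf_inner d P j n)) - (\<Sum>j\<le>n. \<beta> n j * of_nat Q ^ (n - j))"
    unfolding sum_subtractf[symmetric] by (rule sum.cong) (auto simp: c_def algebra_simps)
   also have "... = 0" using conf_inner_stable[OF P Q, of n] T(2)[OF Q, of n] \<beta>[OF Q, of n] by simp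
   finally show ?thesis .
  qed
  hence "of_nat ` A <= {x::complex. (\<Sum>i\<le>n. c i * x ^ i) = 0}" by blast
  moreover have "infinite (of_nat ` A :: complex set)" using inf by (simp add: finite_image_iff inj_on_def)
  ultimately have "\<not> finite {x::complex. (\<Sum>i\<le>n. c i * x ^ i) = 0}" using finite_subset by blast
  hence "c (n - p) = 0" using polyfun_finite_roots[of c n] by auto
  thus ?thesis using p by (simp add: c_def)
 qed
 have ci: "conf_inner d P p n = (-1) ^ p * b p" if "p + k <= n" for p n proof -
  have "conf_inner d P p n = (-1) ^ p * ((-1) ^ p * conf_inner d P p n)" by (simp flip: mult.assoc power_add)
  thus ?thesis using eq[of p n] st[OF that] that by simp
 qed
 have lim: "(%n. conf_inner d P p n) \<longlonglongrightarrow> (-1) ^ p * b p" for p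
  by (rule tendsto_eventually) (use ci in \<open>auto intro!: eventually_sequentiallyI[of "p + k"]\<close>)
 have q1: "1 < q" using A[OF q] by (simp add: fpts_def fpts_axioms_def)
 note L = limit_coeff[OF q1 st bd]
 have "(%n. (\<Sum>D\<in>fpts.stable q n. set_value P q D) / of_nat q ^ n) \<longlonglongrightarrow> suminf (%j. b j / of_nat q ^ j)"
  unfolding T(2)[OF q] \<beta>[OF q] by (rule L(1))
 moreover have "(%i. (-1) ^ i * lim (%n. conf_inner d P i n) / of_nat q ^ i) sums suminf (%j. b j / of_nat q ^ j)"
 proof -
  have "(-1) ^ i * lim (%n. conf_inner d P i n) = b i" for i
   unfolding limI[OF lim] by (simp flip: mult.assoc power_add)
  thus ?thesis using summable_sums[OF L(2)] by simp
 qed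
 ultimately show ?thesis using lim by (auto simp: convergent_def)
qed

end

section \<open>Square-free polynomials over a finite field\<close>

lemma card_field_ge_2: "CARD('k::{field,finite}) > 1"
proof -
 have "card {0, 1 :: 'k} <= CARD('k)" by (rule card_mono) auto
 thus ?thesis by simp
qed

lemma prime_CHAR: "prime CHAR('k::{field,finite})"
proof -
 have "CHAR('k) > 0" by (rule finite_imp_CHAR_pos) simp
 thus ?thesis by (rule prime_CHAR_semidom)
qed

text \<open>If a prime r divides the order of the field, Sylow gives an additive subgroup of order
  r, and a nonzero x in it satisfies r x = 0; so r is the characteristic.\<close>

lemma card_field_prime_power: "EX n. CARD('k::{field,finite}) = CHAR('k) ^ n"
proof -
 let ?p = "CHAR('k)" and ?q = "CARD('k)"
 define G where "G = \<lparr>carrier = (UNIV :: 'k set), monoid.mult = ((+) :: 'k => 'k => 'k), one = 0\<rparr>"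
 have grp: "group G" proof (rule groupI)
  fix x assume "x \<in> carrier G"
  show "EX y:carrier G. y \<otimes>\<^bsub>G\<^esub> x = \<one>\<^bsub>G\<^esub>" by (intro bexI[of _ "-x"]) (auto simp: G_def)
 qed (auto simp: G_def add_ac)
 have pow: "x [^]\<^bsub>G\<^esub> (k::nat) = of_nat k * x" for x k
  by (induction k) (simp_all add: nat_pow_def G_def algebra_simps)
 have "r = ?p" if r: "prime r" "r dvd ?q" for r proof -
  obtain m where m: "?q = r ^ 1 * m" using r(2) by auto
  have "EX H. subgroup H G & card H = r ^ 1"
   by (rule sylow_thm[OF r(1) grp, of 1 m]) (use m in "simp_all add: G_def Coset.order_def")
  then obtain H where H: "subgroup H G" "card H = r" by auto
  have r1: "r > 1" using r(1) by (rule prime_gt_1_nat)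
  obtain x where x: "x \<in> H" "x ~= 0" proof -
   have "\<not> H <= {0}" using H(2) r1 card_mono[of "{0}" H] by auto
   thus ?thesis using that by blast
  qed
  interpret S: group "G\<lparr>carrier := H\<rparr>" by (rule subgroup.subgroup_is_group[OF H(1) grp])
  have "x [^]\<^bsub>G\<lparr>carrier := H\<rparr>\<^esub> Coset.order (G\<lparr>carrier := H\<rparr>) = \<one>\<^bsub>G\<lparr>carrier := H\<rparr>\<^esub>"
   using x by (intro S.pow_order_eq_1) simp
  hence "x [^]\<^bsub>G\<^esub> r = 0" using H(2) by (simp add: nat_pow_def Coset.order_def G_def)
  hence "of_nat r = (0::'k)" using x(2) by (simp add: pow)
  hence "?p dvd r" by (simp add: of_nat_eq_0_iff_char_dvd)
  from primes_dvd_imp_eq[OF prime_CHAR r(1) this] show ?thesis ..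
 qed
 hence "prime_factors ?q <= {?p}" by (auto simp: in_prime_factors_iff)
 moreover have "?q ~= 0" by simp
 ultimately have "?q = ?p ^ multiplicity ?p ?q"
  using prime_factorization_nat[of ?q] by (cases "prime_factors ?q = {}") (auto simp: subset_singleton_iff)
 thus ?thesis by blast
qed

lemma finite_field_power_card: "(a::'k::{field,finite}) ^ CARD('k) = a"
proof (cases "a = 0")
 case False
 let ?U = "UNIV - {0::'k}"
 have "bij_betw (%x. a * x) ?U ?U" by (rule bij_betw_byWitness[where f' = "%x. x / a"]) (use False in auto)
 hence "(\<Prod>x\<in>?U. a * x) = \<Prod>?U" by (rule prod.reindex_bij_betw)
 hence "a ^ card ?U * \<Prod>?U = \<Prod>?U" by (simp add: prod.distrib)
 moreover have "\<Prod>?U ~= 0" by simp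
 ultimately have "a ^ card ?U = 1" by simp
 moreover have c: "CARD('k) = Suc (card ?U)" by (simp add: card_Diff_singleton card_gt_0_iff)
 ultimately show ?thesis unfolding c power_Suc by (simp only: mult_1_right)
qed (simp add: power_0_left)

lemma frob_add: "(x + y :: 'k::{field,finite} alg_closure) ^ CARD('k) = x ^ CARD('k) + y ^ CARD('k)"
proof -
 obtain n where "CARD('k) = CHAR('k alg_closure) ^ n" using card_field_prime_power[where 'k = 'k] by auto
 thus ?thesis by (intro freshmans_dream') (simp_all add: prime_CHAR)
qed

lemma frob_sum: "finite I ==> (\<Sum>i\<in>I. f i :: 'k::{field,finite} alg_closure) ^ CARD('k) = (\<Sum>i\<in>I. f i ^ CARD('k))"
 by (induction I rule: finite_induct) (simp_all add: frob_add power_0_left)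

lemma frob_inj: "(x :: 'k::{field,finite} alg_closure) ^ CARD('k) = y ^ CARD('k) \<longleftrightarrow> x = y"
proof
 assume e: "x ^ CARD('k) = y ^ CARD('k)"
 have "(x - y) ^ CARD('k) + y ^ CARD('k) = x ^ CARD('k)" unfolding frob_add[symmetric] by simp
 thus "x = y" using e by simp
qed simp

lemma of_nat_card_0: "of_nat CARD('k) = (0 :: 'k::{field,finite} alg_closure)"
 using CHAR_dvd_CARD[where 'a = 'k] by (simp add: of_nat_eq_0_iff_char_dvd)

text \<open>The embedded field consists of fixed points of Frobenius and has as many elements as
  there are fixed points.\<close>

lemma range_to_ac: "x ^ CARD('k) = x \<longleftrightarrow> x \<in> range (to_ac :: 'k::{field,finite} => _)"
proof -
 have "card {x :: 'k alg_closure. x ^ CARD('k) = x} = CARD('k)"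
  using card_twisted_power[OF of_nat_card_0 card_field_ge_2, of 1] by simp
 moreover have "card (range (to_ac :: 'k => _)) = CARD('k)" by (simp add: card_image inj_to_ac)
 moreover have "range (to_ac :: 'k => _) <= {x. x ^ CARD('k) = x}"
  using finite_field_power_card by (auto simp flip: to_ac_power)
 moreover have "finite {x :: 'k alg_closure. x ^ CARD('k) = x}"
  using calculation(1) by (intro card_ge_0_finite) simp
 ultimately have "range (to_ac :: 'k => _) = {x. x ^ CARD('k) = x}" by (intro card_subset_eq) simp_all
 thus ?thesis by blast
qed

section \<open>Polynomials over the finite field and Frobenius-stable sets of roots\<close>

abbreviation acp :: "'k::{field,finite} poly => 'k alg_closure poly" where "acp \<equiv> map_poly to_ac"

definition acr :: "'k::{field,finite} poly => 'k alg_closure set" where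
 "acr f = {\<alpha>. poly (acp f) \<alpha> = 0}"

lemma coeff_acp: "poly.coeff (acp p) i = to_ac (poly.coeff p i)" by (simp add: coeff_map_poly)

lemma acp_mult: "acp (p * q) = acp p * acp q" by (rule poly_eqI) (simp add: coeff_acp coeff_mult to_ac_sum)

lemma acp_add: "acp (p + q) = acp p + acp q" by (rule poly_eqI) (simp add: coeff_acp)

lemma degree_acp: "Polynomial.degree (acp p) = Polynomial.degree p" by (rule degree_map_poly) simp

lemma acp_eq_iff: "acp p = acp q \<longleftrightarrow> p = q" by (auto simp: poly_eq_iff coeff_acp)

lemma acp_0_iff: "acp p = 0 \<longleftrightarrow> p = 0" using acp_eq_iff[of p 0] by simp

lemma acr_mult: "acr (p * q) = acr p \<union> acr q" by (auto simp: acr_def acp_mult)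

lemma finite_acr: "p ~= 0 ==> finite (acr p)"
 unfolding acr_def by (rule poly_roots_finite) (simp add: acp_0_iff)

lemma card_acr_le: "p ~= 0 ==> card (acr p) <= Polynomial.degree p"
 unfolding acr_def using card_poly_roots_bound[of "acp p"] by (simp add: acp_0_iff degree_acp)

lemma acr_nonempty: "0 < Polynomial.degree p ==> acr p ~= {}"
 unfolding acr_def using alg_closed_imp_poly_has_root[of "acp p"] by (auto simp: degree_acp)

lemma poly_acp_frob: "poly (acp f) (x ^ CARD('k)) = poly (acp (f :: 'k::{field,finite} poly)) x ^ CARD('k)"
proof -
 have "poly (acp f) x ^ CARD('k) = (\<Sum>i\<le>Polynomial.degree (acp f). (poly.coeff (acp f) i * x ^ i) ^ CARD('k))"
  unfolding poly_altdef by (rule frob_sum) simp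
 also have "... = (\<Sum>i\<le>Polynomial.degree (acp f). poly.coeff (acp f) i * (x ^ CARD('k)) ^ i)"
 proof (rule sum.cong[OF refl])
  fix i
  have "poly.coeff (acp f) i ^ CARD('k) = poly.coeff (acp f) i" unfolding range_to_ac coeff_acp by simp
  thus "(poly.coeff (acp f) i * x ^ i) ^ CARD('k) = poly.coeff (acp f) i * (x ^ CARD('k)) ^ i"
   by (simp add: power_mult_distrib power_mult[symmetric] mult.commute)
 qed
 finally show ?thesis by (simp add: poly_altdef)
qed

lemma acr_stable:
 assumes "f ~= (0 :: 'k::{field,finite} poly)" shows "(%x. x ^ CARD('k)) ` acr f = acr f"
proof (rule endo_inj_surj[OF finite_acr[OF assms]])
 show "(%x. x ^ CARD('k)) ` acr f <= acr f" by (auto simp: acr_def poly_acp_frob power_0_left)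
 show "inj_on (%x. x ^ CARD('k)) (acr f)" by (rule inj_onI) (simp add: frob_inj)
qed

lemma monic_eqI:
 fixes g h :: "'a::field poly"
 assumes "Polynomial.degree g = n" "Polynomial.degree h = n" "lead_coeff g = lead_coeff h" "card D \<ge> n"
  "!!a. a \<in> D ==> poly g a = poly h a" "finite D" shows "g = h"
proof (rule ccontr)
 assume ne: "g ~= h"
 have "poly.coeff (g - h) n = 0" using assms(1-3) by simp
 have dn: "Polynomial.degree (g - h) < n" proof (rule ccontr)
  assume "\<not> Polynomial.degree (g - h) < n"
  moreover have "Polynomial.degree (g - h) <= n" using degree_diff_le[of g n h] assms(1,2) by simp
  ultimately have "Polynomial.degree (g - h) = n" by simp
  thus False using \<open>poly.coeff (g - h) n = 0\<close> ne by (metis leading_coeff_0_iff right_minus_eq)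
 qed
 have "D <= {a. poly (g - h) a = 0}" using assms(5) by auto
 hence "card D <= card {a. poly (g - h) a = 0}" using ne by (intro card_mono poly_roots_finite) auto
 also have "... <= Polynomial.degree (g - h)" using ne by (intro card_poly_roots_bound) auto
 finally show False using dn assms(4) by simp
qed

text \<open>Applying Frobenius to the coefficients of the monic product over \<open>D\<close> gives
  a monic polynomial of the same degree that vanishes on the image of \<open>D\<close>, which is
  \<open>D\<close>. Hence the coefficients are fixed and the product descends to the finite
  field.\<close>

lemma monic_of_stable:
 fixes D :: "'k::{field,finite} alg_closure set"
 assumes D: "finite D" "(%x. x ^ CARD('k)) ` D = D"
 shows "EX f :: 'k poly. acp f = (\<Prod>\<alpha>\<in>D. [:- \<alpha>, 1:]) & Polynomial.degree f = card D & lead_coeff f = 1 & acr f = D"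
proof -
 define u where "u = (\<Prod>\<alpha>\<in>D. [:- \<alpha>, 1:])"
 have du: "Polynomial.degree u = card D" unfolding u_def by (subst degree_prod_eq_sum_degree) auto
 have lu: "lead_coeff u = 1" unfolding u_def lead_coeff_prod by simp
 have ru: "poly u a = 0 \<longleftrightarrow> a \<in> D" for a using D(1) by (simp add: u_def poly_prod)
 let ?v = "map_poly (%x. x ^ CARD('k)) u"
 have c0: "(0 :: 'k alg_closure) ^ CARD('k) = 0" by (simp add: power_0_left)
 have dv: "Polynomial.degree ?v = card D" using degree_map_poly[of "%x. x ^ CARD('k)" u] du by simp
 have lv: "lead_coeff ?v = 1" using lu du dv by (simp add: coeff_map_poly c0)
 have pv: "poly ?v (x ^ CARD('k)) = poly u x ^ CARD('k)" for x proof -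
  have "poly u x ^ CARD('k) = (\<Sum>i\<le>card D. (poly.coeff u i * x ^ i) ^ CARD('k))"
   unfolding poly_altdef du by (rule frob_sum) simp
  thus ?thesis unfolding poly_altdef dv
   by (simp add: coeff_map_poly c0 power_mult_distrib power_mult[symmetric] mult.commute)
 qed
 have "?v = u" proof (rule monic_eqI[OF dv du _ order_refl _ D(1)])
  fix a assume "a \<in> D"
  then obtain b where b: "b \<in> D" "a = b ^ CARD('k)" using D(2) by blast
  hence "poly ?v a = 0" using ru by (simp add: pv c0)
  thus "poly ?v a = poly u a" using ru \<open>a \<in> D\<close> by simp
 qed (simp_all add: lu lv)
 hence "poly.coeff u i ^ CARD('k) = poly.coeff u i" for i by (metis coeff_map_poly c0)
 hence co: "poly.coeff u i \<in> range to_ac" for i unfolding range_to_ac .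
 define f where "f = map_poly of_ac u"
 have au: "acp f = u" by (rule poly_eqI) (simp add: coeff_acp f_def coeff_map_poly to_ac_of_ac[OF co])
 have df: "Polynomial.degree f = card D" using degree_acp[of f] au du by simp
 moreover have "to_ac (lead_coeff f) = 1" using lu du df au coeff_acp[of f "card D"] by simp
 hence "lead_coeff f = 1" by (metis to_ac_1 to_ac_eq_iff)
 moreover have "acr f = D" using ru by (auto simp: acr_def au)
 ultimately show ?thesis using au u_def by blast
qed

text \<open>A nonzero remainder would vanish on at least as many points as the degree of
  \<open>h\<close>.\<close>

lemma dvd_of_roots:
 fixes g h :: "'k::{field,finite} poly"
 assumes h: "Polynomial.degree h = card (acr h)" "h ~= 0" and g: "acr h <= acr g" shows "h dvd g"
proof (rule ccontr)
 assume "\<not> h dvd g"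
 hence r0: "g mod h ~= 0" by (simp add: dvd_eq_mod_eq_0)
 have "acr h <= acr (g mod h)" proof
  fix a assume a: "a \<in> acr h"
  hence "poly (acp g) a = 0" "poly (acp h) a = 0" using g by (auto simp: acr_def)
  moreover have "acp g = acp h * acp (g div h) + acp (g mod h)" by (simp flip: acp_mult acp_add)
  ultimately show "a \<in> acr (g mod h)" by (simp add: acr_def)
 qed
 hence "card (acr h) <= card (acr (g mod h))" by (rule card_mono[OF finite_acr[OF r0]])
 also have "... <= Polynomial.degree (g mod h)" by (rule card_acr_le[OF r0])
 finally show False using degree_mod_less'[OF h(2) r0] h(1) by simp
qed

text \<open>\<open>h\<close> is the radical of \<open>f\<close>, defined over the finite field. If
  the cofactor \<open>s\<close> had a root, the radical of \<open>s\<close> would divide both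
  \<open>h\<close> and \<open>s\<close>, so its square would divide \<open>f\<close>.\<close>

lemma card_acr_squarefree:
 assumes f: "squarefree (f :: 'k::{field,finite} poly)" "f ~= 0" shows "card (acr f) = Polynomial.degree f"
proof -
 obtain h where h: "Polynomial.degree h = card (acr f)" "acr h = acr f" "lead_coeff h = 1"
  using monic_of_stable[OF finite_acr[OF f(2)] acr_stable[OF f(2)]] by blast
 hence h0: "h ~= 0" by auto
 have "h dvd f" by (rule dvd_of_roots) (use h h0 in auto)
 then obtain s where s: "f = h * s" by blast
 have s0: "s ~= 0" using s f(2) by auto
 have "Polynomial.degree s = 0" proof (rule ccontr)
  assume "Polynomial.degree s ~= 0"
  hence ne: "acr s ~= {}" using acr_nonempty by blast
  obtain u where u: "Polynomial.degree u = card (acr s)" "acr u = acr s" "lead_coeff u = 1"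
   using monic_of_stable[OF finite_acr[OF s0] acr_stable[OF s0]] by blast
  hence u0: "u ~= 0" by auto
  have "acr s <= acr f" unfolding s acr_mult by blast
  hence "u dvd h" by (intro dvd_of_roots) (simp_all add: u(1,2) u0 h(2))
  moreover have "u dvd s" by (rule dvd_of_roots) (simp_all add: u(1,2) u0)
  ultimately have "u ^ 2 dvd f" unfolding s power2_eq_square by (rule mult_dvd_mono)
  hence "is_unit u" using f(1) by (simp add: squarefree_def)
  hence "Polynomial.degree u = 0" using u0 by (simp add: is_unit_iff_degree)
  thus False using u(1) ne finite_acr[OF s0] by simp
 qed
 thus ?thesis using s h h0 s0 by (simp add: degree_mult_eq)
qed

lemma squarefree_of_card:
 assumes "f ~= (0 :: 'k::{field,finite} poly)" "card (acr f) = Polynomial.degree f" shows "squarefree f"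
 unfolding squarefree_def
proof (intro allI impI)
 fix y assume "y ^ 2 dvd f"
 then obtain t where t: "f = y ^ 2 * t" by blast
 have nz: "y ~= 0" "t ~= 0" using t assms(1) by auto
 have "acr f = acr y \<union> acr t" unfolding t power2_eq_square acr_mult by blast
 hence "card (acr f) <= card (acr y) + card (acr t)" by (simp add: card_Un_le)
 also have "... <= Polynomial.degree y + Polynomial.degree t" using nz by (intro add_mono card_acr_le)
 finally have "Polynomial.degree y = 0" using assms(2) nz by (simp add: t power2_eq_square degree_mult_eq)
 thus "is_unit y" using nz by (simp add: is_unit_iff_degree)
qed

text \<open>Monic polynomials of degree n with n common roots are equal, and every stable set is the
  root set of a monic polynomial by descent; its distinct roots make that polynomial
  square-free.\<close>

lemma sqfree_polys_bij:
 fixes q d :: nat and z :: "'k::{field,finite} alg_closure"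
 assumes q: "q = CARD('k)" and fr: "fpts d z q"
 shows "bij_betw acr (sqfree_polys n :: 'k poly set) (fpts.stable q n)"
proof -
 interpret fpts d z q by (rule fr)
 have frob_eq: "frob = (%x. x ^ CARD('k))" by (rule ext, subst frob_def, subst q, rule refl)
 have f0: "f ~= 0" if "f \<in> sqfree_polys n" for f :: "'k poly" using that by (auto simp: sqfree_polys_def)
 have card: "card (acr f) = n" if "f \<in> sqfree_polys n" for f :: "'k poly"
  using card_acr_squarefree[OF _ f0[OF that]] that by (simp add: sqfree_polys_def)
 have zero: "0 \<in> acr f \<longleftrightarrow> poly f 0 = 0" for f :: "'k poly"
  by (simp add: acr_def poly_0_coeff_0 coeff_acp)
 have "inj_on acr (sqfree_polys n :: 'k poly set)" proof (rule inj_onI)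
  fix f g :: "'k poly" assume f: "f \<in> sqfree_polys n" and g: "g \<in> sqfree_polys n" and e: "acr f = acr g"
  have l: "Polynomial.degree f = n" "Polynomial.degree g = n" "lead_coeff f = 1" "lead_coeff g = 1"
   using f g unfolding sqfree_polys_def by blast+
  have "acp f = acp g" proof (rule monic_eqI[of _ n _ "acr f"])
   show "lead_coeff (acp f) = lead_coeff (acp g)" using l(3,4) by (simp add: degree_acp coeff_acp)
   show "poly (acp f) a = poly (acp g) a" if "a \<in> acr f" for a using that e by (auto simp: acr_def)
  qed (simp_all add: degree_acp l card[OF f] finite_acr[OF f0[OF f]])
  thus "f = g" by (simp add: acp_eq_iff)
 qed
 moreover have "acr ` (sqfree_polys n :: 'k poly set) = stable n"
 proof (intro subset_antisym image_subsetI subsetI)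
  fix f :: "'k poly" assume f: "f \<in> sqfree_polys n"
  thus "acr f \<in> stable n" using finite_acr[OF f0[OF f]] card[OF f] acr_stable[OF f0[OF f]] zero
   by (simp add: stable_def frob_eq sqfree_polys_def)
 next
  fix D assume D: "D \<in> stable n"
  then obtain f :: "'k poly" where f: "Polynomial.degree f = card D" "lead_coeff f = 1" "acr f = D"
   using monic_of_stable[of D] by (auto simp: stable_def frob_eq)
  have f0: "f ~= 0" using f(2) by auto
  have "squarefree f" by (rule squarefree_of_card[OF f0]) (simp add: f)
  moreover have "poly f 0 ~= 0" using zero[of f] D f(3) by (simp add: stable_def)
  ultimately show "D \<in> acr ` (sqfree_polys n :: 'k poly set)"
   using f D by (auto simp: sqfree_polys_def stable_def)
 qed
 ultimately show ?thesis by (simp add: bij_betw_def)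
qed

text \<open>Root sets translate square-free polynomials into stable sets, and any Frobenius element
  of a polynomial comes from a tuple over its roots; this identifies the value at \<open>f\<close>
  with \<open>set_value\<close>, and \<open>inner_limit\<close> applies.\<close>

theorem theorem1p5:
  fixes q d :: nat and \<zeta> :: "'k::{field,finite}" and P :: char_poly
  assumes "q = CARD('k)"
    and "d > 0" and "d dvd q - 1"
    and "\<zeta> ^ d = 1" and "\<forall>k. 0 < k \<and> k < d \<longrightarrow> \<zeta> ^ k \<noteq> 1"
    and "is_char_poly d P"
  shows "(\<forall>i. convergent (\<lambda>n. conf_inner d P i n)) \<and>
    (\<exists>L::complex.
      (\<lambda>n. (\<Sum>f\<in>(sqfree_polys n :: 'k poly set). char_poly_at d \<zeta> P f) / of_nat q ^ n)
        \<longlonglongrightarrow> L \<and>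
      (\<lambda>i. (-1) ^ i * lim (\<lambda>n. conf_inner d P i n) / of_nat q ^ i) sums L)"
proof -
 note q = assms(1) and d = assms(2)
 define z where "z = to_ac \<zeta>"
 have q1: "q > 1" unfolding q by (rule card_field_ge_2)
 have z_inj: "a = b" if ab: "a < d" "b < d" "z ^ a = z ^ b" for a b proof -
  have *: "a = b" if ab: "a <= b" "b < d" "z ^ a = z ^ b" for a b proof -
   have "\<zeta> ^ a = \<zeta> ^ b" using ab(3) by (simp add: z_def flip: to_ac_power)
   moreover have "\<zeta> ^ a * \<zeta> ^ (b - a) = \<zeta> ^ b" using ab(1) by (simp flip: power_add)
   moreover have "\<zeta> ~= 0" using assms(4) d by (auto simp: zero_power)
   ultimately have "\<zeta> ^ (b - a) = 1" by simp
   thus ?thesis using assms(5)[rule_format, of "b - a"] ab by linarith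
  qed
  show ?thesis using *[of a b] *[of b a] ab by (cases "a <= b") auto
 qed
 have fr: "fpts d z (q ^ Suc m)" for m proof
  show "d > 0" by (rule d)
  show "z ^ d = 1" using assms(4) by (simp add: z_def flip: to_ac_power)
  show "of_nat (q ^ Suc m) = (0 :: 'k alg_closure)" unfolding q of_nat_power of_nat_card_0 by simp
  show "q ^ Suc m > 1" using q1 by (rule one_less_power) simp
  have "q - 1 dvd q ^ Suc m - 1" proof (induction m)
   case (Suc m)
   have "q ^ Suc (Suc m) - 1 = q * (q ^ Suc m - 1) + (q - 1)" using q1 by (simp add: diff_mult_distrib2)
   thus ?case using Suc by (simp only: dvd_add dvd_mult dvd_refl)
  qed simp
  thus "d dvd q ^ Suc m - 1" using assms(3) by (rule dvd_trans[rotated])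
 qed (rule z_inj)
 \<comment> \<open>All positive powers of q. One root of unity serves for all of them, as q - 1
   divides q^m - 1, and there are infinitely many, as the comparison of coefficients
   demands.\<close>
 define A where "A = range (%m. q ^ Suc m)"
 have A: "!!Q. Q \<in> A ==> fpts d z Q" using fr by (auto simp: A_def)
 have qA: "q \<in> A" unfolding A_def by (rule image_eqI[of _ _ 0]) simp_all
 have "inj (%m. q ^ Suc m)" using q1 by (auto intro!: injI)
 hence "infinite A" unfolding A_def by (rule range_inj_infinite)
 note L = inner_limit[OF d A assms(6) this qA]
 interpret fpts d z q by (rule A[OF qA])
 have "char_poly_at d \<zeta> P f = set_value d z P q (acr f)" if f: "f \<in> sqfree_polys n" for f :: "'k poly" and n
 proof -
  have n: "Polynomial.degree f = n" using f by (simp add: sqfree_polys_def)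
  have D: "acr f \<in> stable n" using sqfree_polys_bij[OF q A[OF qA], of n] f by (auto simp: bij_betw_def)
  have elem: "frobenius_elem d \<zeta> f w \<longleftrightarrow> w \<in> wcar d n & (EX y:tuples n (acr f). y \<in> frobs n w)" for w
  proof
   assume "frobenius_elem d \<zeta> f w"
   then obtain y where w: "w \<in> wcar d n" and y: "bij_betw (%j. y j ^ d) {..<n} (acr f)"
    "ALL j<n. y j ^ q = z ^ nat (fst w (snd w j)) * y (snd w j)"
    by (cases w) (auto simp: frobenius_elem_def n acr_def z_def q)
   \<comment> \<open>\<open>frobenius_elem\<close> leaves \<open>y\<close> free outside the index
     range; the restriction is a member of \<open>tuples\<close>.\<close>
   let ?y = "restrict y {..<n}"
   have "bij_betw (%j. ?y j ^ d) {..<n} (acr f)" by (rule iffD1[OF bij_betw_cong y(1)]) simp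
   hence t: "?y \<in> tuples n (acr f)" by (simp add: tuples_def)
   have "snd w j < n" if "j < n" for j using permutes_in_image[OF wreath_snd_permutes[OF d w], of j] that by simp
   hence "?y \<in> frobs n w"
    using y t tuples_nz[OF t] D by (auto simp: frobs_def tuples_def bij_betw_def stable_def)
   with w t show "w \<in> wcar d n & (EX y:tuples n (acr f). y \<in> frobs n w)" by blast
  next
   assume "w \<in> wcar d n & (EX y:tuples n (acr f). y \<in> frobs n w)"
   then obtain y where y: "w \<in> wcar d n" "y \<in> tuples n (acr f)" "y \<in> frobs n w" by blast
   have "bij_betw (%j. y j ^ d) {..<n} (acr f)" "ALL j<n. y j ^ q = z ^ nat (fst w (snd w j)) * y (snd w j)"
    using y by (simp_all add: tuples_def frobs_def)
   thus "frobenius_elem d \<zeta> f w" using y(1) by (cases w) (auto simp: frobenius_elem_def n acr_def z_def q)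
  qed
  obtain y where y: "y \<in> tuples n (acr f)" using tuples_nonempty[of "acr f" n] D by (auto simp: stable_def)
  hence "EX w. frobenius_elem d \<zeta> f w" unfolding elem using tuples_frobs[OF D y] by blast
  hence "frobenius_elem d \<zeta> f (SOME w. frobenius_elem d \<zeta> f w)" by (rule someI_ex)
  then obtain y where w: "(SOME w. frobenius_elem d \<zeta> f w) \<in> wcar d n"
   and y: "y \<in> tuples n (acr f)" "y \<in> frobs n (SOME w. frobenius_elem d \<zeta> f w)" unfolding elem by blast
  have "(%j. y j ^ d) ` {..<n} = acr f" using y(1) by (simp add: tuples_def bij_betw_def)
  thus ?thesis using char_poly_fun_frobs[OF d A assms(6) qA w y(2)] by (simp add: char_poly_at_def n)
 qed
 hence "(\<Sum>f\<in>(sqfree_polys n :: 'k poly set). char_poly_at d \<zeta> P f) = (\<Sum>D\<in>stable n. set_value d z P q D)" for n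
  using sum.reindex_bij_betw[OF sqfree_polys_bij[OF q A[OF qA], of n], of "set_value d z P q"] by simp
 with L show ?thesis by simp
qed

end
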